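(* Assume $I^{\sigma,\alpha}:=\int_{\mathbb{R}} \sigma(x)^{-\alpha}|x|^{\alpha-1}\,dx<\infty$, and let $p_t^0(x,y)=\frac{dP_t^0(x,\cdot)}{d\mu}(y)$ be the transition density of $Y^0$ with respect to $\mu$. Let $\nu(A)=\int_A\psi_0\,d\mu\big/\int_{\mathbb{R}^0}\psi_0\,d\mu$, $A\in\mathscr{B}(\mathbb{R}^0)$. If for every $r_0>0$ one has $\sup_{x\in[-r_0,r_0]\setminus\{0\}}p_2^0(x,x)<+\infty$, then $\nu$ attracts all probability measures on $\mathbb{R}^0$, that is, for every probability measure $\eta$ on $\mathbb{R}^0$ and every $A\in\mathscr{B}(\mathbb{R}^0)$, $$\lim_{t\to\infty}\mathbb{P}_\eta[Y_t\in A\mid t<T_0]=\nu(A).$$ Furthermore, if $\sup_{x\in\mathbb{R}^0}p_2^0(x,x)<+\infty$, then there is a constant $C$, independent of $\eta$ and $t$, such that for every probability measure $\eta$ on $\mathbb{R}^0$ and every $t\ge 0$, $$\big\|\mathbb{P}_\eta[Y_t\in\cdot\mid t<T_0]-\nu(\cdot)\big\|_{TV}\le\frac{C\,e^{-(\lambda_1-\lambda_0)t}\,\|\eta-\nu\|_{TV}}{\eta(\psi_0)}.$$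
   Context: Let $\alpha\in(1,2)$ and let $X=(X_t)_{t\ge 0}$ be a symmetric $\alpha$-stable process on $\mathbb{R}$ with generator $-(-\Delta)^{\alpha/2}$ (fractional Laplacian). Let $\sigma$ be a strictly positive continuous function on $\mathbb{R}$ such that $\mu(dx):=\sigma(x)^{-\alpha}dx$ is a probability measure on $\mathbb{R}$. Let $Y=(Y_t)_{t\ge 0}$ be the time-changed process $Y_t:=X_{\zeta_t}$, where $\zeta_t:=\inf\{s>0:\int_0^s\sigma(X_u)^{-\alpha}\,du>t\}$; it is the unique weak solution of the SDE $dY_t=\sigma(Y_{t-})\,dX_t$. $\mathbb{P}_x$ is the law with $Y_0=x$. Put $\mathbb{R}^0:=\mathbb{R}\setminus\{0\}$ with Borel $\sigma$-algebra $\mathscr{B}(\mathbb{R}^0)$, and $T_0:=\inf\{t>0:Y_t=0\}$. The process $Y^0$, i.e. $Y$ killed upon hitting $0$, has transition function $P_t^0(x,A)=\mathbb{P}_x[Y_t\in A,\ t<T_0]$ for $x\in\mathbb{R}^0$, $A\in\mathscr{B}(\mathbb{R}^0)$; it is symmetric with respect to $\mu$ and acts as a semigroup on $L^2(\mathbb{R}^0;\mu)$. For every $t>0$ and $x\in\mathbb{R}^0$, $P_t^0(x,dy)$ has a density $p_t^0(x,y)$ with respect to $\mu$; the version used satisfies $p_t^0(x,y)=p_t^0(y,x)$ and the Chapman–Kolmogorov equation for all $x,y\neq 0$, so that $p_2^0(x,x)=\int_{\mathbb{R}^0}p_1^0(x,y)^2\mu(dy)$. For a probability measure $\eta$ on $\mathbb{R}^0$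 write $\mathbb{P}_\eta(\cdot)=\int_{\mathbb{R}^0}\mathbb{P}_x(\cdot)\,\eta(dx)$ and $\eta(f)=\int_{\mathbb{R}^0} f\,d\eta$. When $I^{\sigma,\alpha}<\infty$, each $P_t^0$ ($t>0$) is compact on $L^2(\mathbb{R}^0;\mu)$, and there is a complete orthonormal set $\{\psi_n\}_{n\ge 0}$ of $L^2(\mathbb{R}^0;\mu)$ with $P_t^0\psi_n=e^{-\lambda_n t}\psi_n$ for all $n\geq 0$, $t\ge 0$, where $0<\lambda_0<\lambda_1\le\lambda_2\le\cdots\to+\infty$ are the eigenvalues, counted with multiplicity, of minus the $L^2$-generator of $(P^0_t)_{t\ge0}$. The function $\psi_0$ is called the ground state; it can be, and is, chosen strictly positive and continuous on $\mathbb{R}^0$. The total variation norm of a signed measure $\eta$ is $\|\eta\|_{TV}:=\sup_{|f|\le 1}|\eta(f)|$. *)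

theory Defs
  imports "HOL-Probability.Probability"
begin

definition cadlag :: "(real \<Rightarrow> real) \<Rightarrow> bool" where
  "cadlag w \<longleftrightarrow>
     (\<forall>t\<ge>0. continuous (at_right t) w) \<and> (\<forall>t>0. \<exists>l. (w \<longlongrightarrow> l) (at_left t))"

text \<open>The generator of this Levy process is minus the fractional Laplacian of order
  \<open>\<alpha>/2\<close>, whose Fourier symbol is \<open>- \<bar>\<theta>\<bar> powr \<alpha>\<close>; this fixes the time scale.\<close>

definition symmetric_stable_process ::
    "real \<Rightarrow> real \<Rightarrow> 'w measure \<Rightarrow> (real \<Rightarrow> 'w \<Rightarrow> real) \<Rightarrow> bool" where
  "symmetric_stable_process \<alpha> x M X \<longleftrightarrow>
     prob_space M \<and>
     (\<forall>t\<ge>0. X t \<in> borel_measurable M) \<and>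
     (AE \<omega> in M. X 0 \<omega> = x) \<and>
     (AE \<omega> in M. cadlag (\<lambda>t. X t \<omega>)) \<and>
     (\<forall>(s :: nat \<Rightarrow> real) n. 0 \<le> s 0 \<longrightarrow> strict_mono s \<longrightarrow>
        prob_space.indep_vars M (\<lambda>_. borel) (\<lambda>i \<omega>. X (s (Suc i)) \<omega> - X (s i) \<omega>) {..<n}) \<and>
     (\<forall>s t \<theta>. 0 \<le> s \<longrightarrow> s \<le> t \<longrightarrow>
        char (distr M borel (\<lambda>\<omega>. X t \<omega> - X s \<omega>)) \<theta>
          = complex_of_real (exp (- (t - s) * \<bar>\<theta>\<bar> powr \<alpha>)))"

definition speed_measure :: "(real \<Rightarrow> real) \<Rightarrow> real \<Rightarrow> real measure" where
  "speed_measure \<sigma> \<alpha> = density lborel (\<lambda>x. ennreal (\<sigma> x powr (- \<alpha>)))"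

definition clock ::
    "(real \<Rightarrow> real) \<Rightarrow> real \<Rightarrow> (real \<Rightarrow> 'w \<Rightarrow> real) \<Rightarrow> real \<Rightarrow> 'w \<Rightarrow> ennreal" where
  "clock \<sigma> \<alpha> X s \<omega> = (\<integral>\<^sup>+ u\<in>{0..s}. ennreal (\<sigma> (X u \<omega>) powr (- \<alpha>)) \<partial>lborel)"

text \<open>For \<open>\<alpha> > 1\<close> the process \<open>X\<close> is recurrent and the clock diverges almost surely, so the
  infimum below is almost surely taken over a nonempty set and is finite.\<close>

definition inverse_clock ::
    "(real \<Rightarrow> real) \<Rightarrow> real \<Rightarrow> (real \<Rightarrow> 'w \<Rightarrow> real) \<Rightarrow> real \<Rightarrow> 'w \<Rightarrow> real" where
  "inverse_clock \<sigma> \<alpha> X t \<omega> = Inf {s. s > 0 \<and> clock \<sigma> \<alpha> X s \<omega> > ennreal t}"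

definition time_changed ::
    "(real \<Rightarrow> real) \<Rightarrow> real \<Rightarrow> (real \<Rightarrow> 'w \<Rightarrow> real) \<Rightarrow> real \<Rightarrow> 'w \<Rightarrow> real" where
  "time_changed \<sigma> \<alpha> X t \<omega> = X (inverse_clock \<sigma> \<alpha> X t \<omega>) \<omega>"

definition hitting_time_0 :: "(real \<Rightarrow> 'w \<Rightarrow> real) \<Rightarrow> 'w \<Rightarrow> ereal" where
  "hitting_time_0 Y \<omega> = Inf {ereal t | t. t > 0 \<and> Y t \<omega> = 0}"

text \<open>\<open>M[Y\<^sub>t \<in> A, t < T\<^sub>0]\<close>. The hitting time \<open>T\<^sub>0\<close> is only measurable with
  respect to the completion of \<open>M\<close>; on completion-measurable events the outer measure is the
  completed probability, so no completeness of \<open>M\<close> has to be required.\<close>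

definition killed_prob ::
    "'w measure \<Rightarrow> (real \<Rightarrow> 'w \<Rightarrow> real) \<Rightarrow> real \<Rightarrow> real set \<Rightarrow> ennreal" where
  "killed_prob M Y t A =
     outer_measure_of M {\<omega> \<in> space M. Y t \<omega> \<in> A \<and> ereal t < hitting_time_0 Y \<omega>}"

definition borel_R0 :: "real measure" where
  "borel_R0 = restrict_space borel (- {0})"

definition killed_transition ::
    "'w measure \<Rightarrow> (real \<Rightarrow> 'w \<Rightarrow> real) \<Rightarrow> real \<Rightarrow> real measure" where
  "killed_transition M Y t = measure_of (- {0}) (sets borel_R0) (killed_prob M Y t)"

text \<open>\<open>\<P>\<^sub>\<eta>[Y\<^sub>t \<in> A | t < T\<^sub>0]\<close> for the family \<open>P x\<close> of laws with
  \<open>Y\<^sub>0 = x\<close>; the denominator is \<open>\<P>\<^sub>\<eta>[t < T\<^sub>0]\<close>.\<close>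

definition cond_prob_survival ::
    "(real \<Rightarrow> 'w measure) \<Rightarrow> (real \<Rightarrow> 'w \<Rightarrow> real) \<Rightarrow> real measure \<Rightarrow> real \<Rightarrow> real set \<Rightarrow> ennreal" where
  "cond_prob_survival P Y \<eta> t A =
     (\<integral>\<^sup>+ x. killed_prob (P x) Y t A \<partial>\<eta>) / (\<integral>\<^sup>+ x. killed_prob (P x) Y t UNIV \<partial>\<eta>)"

definition cond_law_survival ::
    "(real \<Rightarrow> 'w measure) \<Rightarrow> (real \<Rightarrow> 'w \<Rightarrow> real) \<Rightarrow> real measure \<Rightarrow> real \<Rightarrow> real measure" where
  "cond_law_survival P Y \<eta> t =
     measure_of (- {0}) (sets borel_R0) (cond_prob_survival P Y \<eta> t)"

definition prob_measure_R0 :: "real measure \<Rightarrow> bool" where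
  "prob_measure_R0 \<eta> \<longleftrightarrow> prob_space \<eta> \<and> sets \<eta> = sets borel_R0"

definition L2_fun :: "'a measure \<Rightarrow> ('a \<Rightarrow> real) set" where
  "L2_fun M = {f \<in> borel_measurable M. integrable M (\<lambda>x. (f x)\<^sup>2)}"

definition complete_orthonormal :: "'a measure \<Rightarrow> (nat \<Rightarrow> 'a \<Rightarrow> real) \<Rightarrow> bool" where
  "complete_orthonormal M \<psi> \<longleftrightarrow>
     (\<forall>n. \<psi> n \<in> L2_fun M) \<and>
     (\<forall>m n. (\<integral>x. \<psi> m x * \<psi> n x \<partial>M) = (if m = n then 1 else 0)) \<and>
     (\<forall>f \<in> L2_fun M. \<forall>\<epsilon>>0. \<exists>(c :: nat \<Rightarrow> real) N.
        (\<integral>x. (f x - (\<Sum>n<N. c n * \<psi> n x))\<^sup>2 \<partial>M) < \<epsilon>)"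

text \<open>The norm of the signed measure \<open>\<eta>\<^sub>1 - \<eta>\<^sub>2\<close>, for finite measures on
  \<open>\<real> - {0}\<close>; with this normalisation it is at most 2 for probability measures.\<close>

definition tv_norm_diff :: "real measure \<Rightarrow> real measure \<Rightarrow> real" where
  "tv_norm_diff \<eta>1 \<eta>2 =
     (SUP f \<in> {f \<in> borel_measurable borel_R0. \<forall>x\<in>- {0}. \<bar>f x\<bar> \<le> 1}.
        \<bar>(\<integral>x. f x \<partial>\<eta>1) - (\<integral>x. f x \<partial>\<eta>2)\<bar>)"

definition normalized_density :: "'a measure \<Rightarrow> ('a \<Rightarrow> real) \<Rightarrow> 'a measure" where
  "normalized_density M f = density M (\<lambda>x. ennreal (f x / (\<integral>y. f y \<partial>M)))"

end

theory Submission
  imports Defs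
begin

text \<open>Since \<open>p 1 x\<close> has squared \<open>L\<^sup>2\<close> norm \<open>p 2 x x\<close>, the spectral gap turns \<open>L\<^sup>2\<close> decay into
  pointwise decay: \<open>exp (lam 0 * t) * P\<^sub>t f x\<close> tends to \<open>\<psi> 0 x\<close> times the coefficient of \<open>f\<close> along
  \<open>\<psi> 0\<close>, with an error of order \<open>sqrt (p 2 x x) * exp (- (lam 1 - lam 0) * t)\<close>. If \<open>p 2 x x\<close> is
  bounded, integrating against \<open>\<eta>\<close> gives the exponential rate. If it is only bounded on bounded
  sets, dominated convergence needs a uniform bound on \<open>exp (lam 0 * t) * P\<^sub>t 1 x\<close>. That follows
  once some \<open>r\<close> is such that from every starting point the process is, at some time before 1,
  outside \<open>[- r, r]\<close> with small probability: the remaining mass restarts in the bounded set.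

  For this coming down from infinity, \<open>\<bar>x - y\<bar> powr (\<alpha> - 1)\<close> is, up to a constant, the potential
  kernel of the recurrent process \<open>X\<close>. With it one builds a bounded superharmonic barrier for \<open>X\<close>
  killed at a small rate near the origin, so the occupation measure of the killed process,
  integrated against \<open>\<sigma> powr (- \<alpha>)\<close> restricted to \<open>\<bar>y\<bar> > r\<close>, is at most a constant times the tail of
  \<open>I\<close>, whatever the starting point. Up to time 1 of the clock of \<open>Y\<close> the killing costs only a
  bounded factor, and the expected time that \<open>Y\<close> spends outside \<open>[- r, r]\<close> before time 1 is small.\<close>

section \<open>Expansions in an orthonormal basis of the square-integrable functions\<close>

text \<open>A starting law \<open>\<eta>\<close> may charge single points, so statements that hold
  \<open>\<mu>0\<close>-almost everywhere are too weak. Hence \<open>ground\<close>, defined at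
  every point, replaces \<open>\<psi> 0\<close> in the limits; its positivity everywhere comes from
  the paths near time 0 and the continuity of \<open>\<psi> 0\<close>. The Markov property of the
  killed process enters through the Chapman-Kolmogorov equation for \<open>p\<close>; from the paths
  only bounds on one-time laws are taken. The obstacle in the tail bound is that a recurrent process
  has infinite occupation measures. In the barrier the potential of \<open>f\<close> is balanced by
  that of a tent function of the same mass, which cancels the growth at infinity, and killing near
  the origin pays for the tent. The generator of \<open>X\<close> is used in integrated form over
  short time steps, with weights \<open>1 - \<gamma> * occupation\<close>. The estimate
  \<open>exp (- 2 * y) \<le> 1 - y\<close> bounds their product below by about
  \<open>exp (- 2 * \<gamma> * hat_clock)\<close>, and
  \<open>2 * \<gamma> * hat \<le> \<sigma> powr (- \<alpha>)\<close> keeps this above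
  \<open>exp (- 1)\<close> until the clock of \<open>Y\<close> reads 1.\<close>

definition inner_L2 :: "'a measure \<Rightarrow> ('a \<Rightarrow> real) \<Rightarrow> ('a \<Rightarrow> real) \<Rightarrow> real" where
  "inner_L2 M f g = (\<integral>x. f x * g x \<partial>M)"

lemma L2_fun_measurable: "f \<in> L2_fun M \<Longrightarrow> f \<in> borel_measurable M"
  by (simp add: L2_fun_def)

lemma L2_fun_mult_integrable:
  assumes "f \<in> L2_fun M" "g \<in> L2_fun M"
  shows "integrable M (\<lambda>x. f x * g x)"
proof (rule Bochner_Integration.integrable_bound)
  show "integrable M (\<lambda>x. (f x)\<^sup>2 + (g x)\<^sup>2)"
    using assms by (simp add: L2_fun_def)
  show "AE x in M. norm (f x * g x) \<le> norm ((f x)\<^sup>2 + (g x)\<^sup>2)"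
  proof (rule AE_I2)
    fix x
    have "2 * \<bar>f x * g x\<bar> \<le> (f x)\<^sup>2 + (g x)\<^sup>2"
      using sum_squares_bound[of "\<bar>f x\<bar>" "\<bar>g x\<bar>"] by (simp add: abs_mult)
    then show "norm (f x * g x) \<le> norm ((f x)\<^sup>2 + (g x)\<^sup>2)"
      by simp
  qed
qed (use assms in \<open>auto simp: L2_fun_def intro!: borel_measurable_times\<close>)

lemma L2_fun_scale: "f \<in> L2_fun M \<Longrightarrow> (\<lambda>x. c * f x) \<in> L2_fun M"
  by (auto simp: L2_fun_def power_mult_distrib intro!: borel_measurable_times)

lemma L2_fun_add:
  assumes "f \<in> L2_fun M" "g \<in> L2_fun M"
  shows "(\<lambda>x. f x + g x) \<in> L2_fun M"
  using assms L2_fun_mult_integrable[OF assms]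
  by (auto simp: L2_fun_def power2_sum mult.assoc intro!: borel_measurable_add)

lemma L2_fun_diff:
  assumes "f \<in> L2_fun M" "g \<in> L2_fun M"
  shows "(\<lambda>x. f x - g x) \<in> L2_fun M"
  using L2_fun_add[OF assms(1) L2_fun_scale[OF assms(2), of "-1"]] by simp

lemma L2_fun_sum:
  assumes "\<And>i. i \<in> I \<Longrightarrow> f i \<in> L2_fun M"
  shows "(\<lambda>x. \<Sum>i\<in>I. f i x) \<in> L2_fun M"
  using assms
proof (induction I rule: infinite_finite_induct)
  case (insert i I)
  then show ?case by (simp add: L2_fun_add)
qed (auto simp: L2_fun_def)

lemma L2_fun_bounded:
  assumes "finite_measure M" "f \<in> borel_measurable M" "\<And>x. x \<in> space M \<Longrightarrow> \<bar>f x\<bar> \<le> B"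
  shows "f \<in> L2_fun M"
proof -
  interpret finite_measure M by fact
  have "integrable M (\<lambda>x. (f x)\<^sup>2)"
  proof (rule integrable_const_bound[where B="B\<^sup>2"])
    show "AE x in M. norm ((f x)\<^sup>2) \<le> B\<^sup>2"
    proof (rule AE_I2)
      fix x assume "x \<in> space M"
      then have "\<bar>f x\<bar>^2 \<le> B^2" using assms(3) by (intro power_mono) auto
      then show "norm ((f x)\<^sup>2) \<le> B\<^sup>2" by simp
    qed
  qed (use assms in measurable)
  then show ?thesis using assms by (simp add: L2_fun_def)
qed

lemma L2_fun_integrable:
  assumes "finite_measure M" "f \<in> L2_fun M"
  shows "integrable M f"
  using L2_fun_mult_integrable[OF assms(2) L2_fun_bounded[OF assms(1), of "\<lambda>_. 1" 1]] by simp

lemma inner_L2_commute: "inner_L2 M f g = inner_L2 M g f"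
  by (simp add: inner_L2_def mult.commute)

lemma inner_L2_self: "inner_L2 M f f = (\<integral>x. (f x)\<^sup>2 \<partial>M)"
  by (simp add: inner_L2_def power2_eq_square)

lemma inner_L2_nonneg: "0 \<le> inner_L2 M f f"
  by (simp add: inner_L2_self)

lemma inner_L2_add_left:
  assumes "f \<in> L2_fun M" "g \<in> L2_fun M" "h \<in> L2_fun M"
  shows "inner_L2 M (\<lambda>x. f x + g x) h = inner_L2 M f h + inner_L2 M g h"
  using assms by (simp add: inner_L2_def distrib_right L2_fun_mult_integrable)

lemma inner_L2_diff_left:
  assumes "f \<in> L2_fun M" "g \<in> L2_fun M" "h \<in> L2_fun M"
  shows "inner_L2 M (\<lambda>x. f x - g x) h = inner_L2 M f h - inner_L2 M g h"
  using assms by (simp add: inner_L2_def left_diff_distrib L2_fun_mult_integrable)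

lemma inner_L2_scale_left: "inner_L2 M (\<lambda>x. c * f x) h = c * inner_L2 M f h"
  by (simp add: inner_L2_def mult.assoc)

lemma inner_L2_sum_left:
  assumes "\<And>i. i \<in> I \<Longrightarrow> f i \<in> L2_fun M" "h \<in> L2_fun M"
  shows "inner_L2 M (\<lambda>x. \<Sum>i\<in>I. f i x) h = (\<Sum>i\<in>I. inner_L2 M (f i) h)"
  using assms by (simp add: inner_L2_def sum_distrib_right L2_fun_mult_integrable)

lemma inner_L2_add_right:
  assumes "f \<in> L2_fun M" "g \<in> L2_fun M" "h \<in> L2_fun M"
  shows "inner_L2 M h (\<lambda>x. f x + g x) = inner_L2 M h f + inner_L2 M h g"
  using inner_L2_add_left[OF assms] by (simp only: inner_L2_commute[of M h])

lemma inner_L2_diff_right: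
  assumes "f \<in> L2_fun M" "g \<in> L2_fun M" "h \<in> L2_fun M"
  shows "inner_L2 M h (\<lambda>x. f x - g x) = inner_L2 M h f - inner_L2 M h g"
  using inner_L2_diff_left[OF assms] by (simp only: inner_L2_commute[of M h])

lemma inner_L2_scale_right: "inner_L2 M h (\<lambda>x. c * f x) = c * inner_L2 M h f"
  using inner_L2_scale_left[of M c f h] by (simp only: inner_L2_commute[of M h])

lemma inner_L2_sum_right:
  assumes "\<And>i. i \<in> I \<Longrightarrow> f i \<in> L2_fun M" "h \<in> L2_fun M"
  shows "inner_L2 M h (\<lambda>x. \<Sum>i\<in>I. f i x) = (\<Sum>i\<in>I. inner_L2 M h (f i))"
  using inner_L2_sum_left[OF assms] by (simp only: inner_L2_commute[of M h])

lemma inner_L2_diff_self: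
  assumes "f \<in> L2_fun M" "g \<in> L2_fun M"
  shows "inner_L2 M (\<lambda>x. f x - g x) (\<lambda>x. f x - g x)
    = inner_L2 M f f - 2 * inner_L2 M f g + inner_L2 M g g"
  using assms by (simp add: inner_L2_diff_left inner_L2_diff_right L2_fun_diff inner_L2_commute[of M g f])

lemma inner_L2_add_self:
  assumes "f \<in> L2_fun M" "g \<in> L2_fun M"
  shows "inner_L2 M (\<lambda>x. f x + g x) (\<lambda>x. f x + g x)
    = inner_L2 M f f + 2 * inner_L2 M f g + inner_L2 M g g"
  using assms by (simp add: inner_L2_add_left inner_L2_add_right L2_fun_add inner_L2_commute[of M g f])

text \<open>Discriminant criterion. It serves twice: for Cauchy-Schwarz and for the minimising
  sequence in \<open>L2_weak_approx\<close>.\<close>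

lemma quadratic_nonneg_imp:
  fixes a b c :: real
  assumes "\<And>t. 0 \<le> a - 2 * t * b + t\<^sup>2 * c" "0 \<le> c"
  shows "b\<^sup>2 \<le> a * c"
proof (cases "c = 0")
  case True
  have "b = 0"
  proof (rule ccontr)
    assume "b \<noteq> 0"
    \<comment> \<open>With \<open>c = 0\<close> this choice of \<open>t\<close> gives the value
      \<open>a - (a + 1) = -1\<close>.\<close>
    then show False
      using assms(1)[of "(a + 1) / (2 * b)"] True by (simp add: field_simps)
  qed
  then show ?thesis using True by simp
next
  case False
  then have "c > 0" using assms by simp
  then show ?thesis using assms(1)[of "b / c"]
    by (simp add: field_simps power2_eq_square)
qed

lemma inner_L2_Cauchy_Schwarz:
  assumes "f \<in> L2_fun M" "g \<in> L2_fun M"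
  shows "(inner_L2 M f g)\<^sup>2 \<le> inner_L2 M f f * inner_L2 M g g"
proof (rule quadratic_nonneg_imp)
  fix t
  show "0 \<le> inner_L2 M f f - 2 * t * inner_L2 M f g + t\<^sup>2 * inner_L2 M g g"
    using inner_L2_nonneg[of M "\<lambda>x. f x - t * g x"]
      inner_L2_diff_self[OF assms(1) L2_fun_scale[OF assms(2), of t]]
    by (simp add: inner_L2_scale_left inner_L2_scale_right power2_eq_square)
qed (rule inner_L2_nonneg)

lemma inner_L2_abs_le:
  assumes "f \<in> L2_fun M" "g \<in> L2_fun M"
  shows "\<bar>inner_L2 M f g\<bar> \<le> sqrt (inner_L2 M f f) * sqrt (inner_L2 M g g)"
  using real_sqrt_le_mono[OF inner_L2_Cauchy_Schwarz[OF assms]]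
  by (simp add: real_sqrt_mult)

text \<open>A minimising sequence for the distance to the subspace replaces the orthogonal projection,
  so that completeness of \<open>L\<^sup>2\<close> is not needed.\<close>

lemma L2_weak_approx:
  assumes f: "f \<in> L2_fun M" and V: "V \<subseteq> L2_fun M" "V \<noteq> {}"
    and add: "\<And>u v. u \<in> V \<Longrightarrow> v \<in> V \<Longrightarrow> (\<lambda>x. u x + v x) \<in> V"
    and scale: "\<And>c v. v \<in> V \<Longrightarrow> (\<lambda>x. c * v x) \<in> V"
  shows "\<exists>g. (\<forall>k::nat. g k \<in> V) \<and> (\<forall>v\<in>V. (\<lambda>k. inner_L2 M v (g k)) \<longlonglongrightarrow> inner_L2 M v f)"
proof -
  define D where "D g = inner_L2 M (\<lambda>x. f x - g x) (\<lambda>x. f x - g x)" for g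
  define d where "d = (INF g\<in>V. D g)"
  have D0: "0 \<le> D g" for g by (simp add: D_def inner_L2_nonneg)
  have bdd: "bdd_below (D ` V)" by (rule bdd_belowI[of _ 0]) (auto simp: D0)
  have dle: "d \<le> D g" if "g \<in> V" for g
    unfolding d_def by (rule cINF_lower[OF bdd that])
  have "\<exists>g\<in>V. D g < d + 1 / (real k + 1)" for k :: nat
  proof -
    have "d < d + 1 / (real k + 1)" by simp
    then show ?thesis
      using cINF_less_iff[OF V(2) bdd] unfolding d_def by blast
  qed
  then obtain g where g: "g k \<in> V" "D (g k) < d + 1 / (real k + 1)" for k :: nat by metis
  have "(\<lambda>k. inner_L2 M v (g k)) \<longlonglongrightarrow> inner_L2 M v f" if v: "v \<in> V" for v
  proof -
    have vL: "v \<in> L2_fun M" using v V by auto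
    have gL: "g k \<in> L2_fun M" for k using g(1) V by auto
    define n where "n = inner_L2 M v v"
    define a where "a k = inner_L2 M v f - inner_L2 M v (g k)" for k
    \<comment> \<open>Moving from \<open>g k\<close> by \<open>t * v\<close> stays in
      \<open>V\<close>, so the squared distance to \<open>f\<close> cannot fall below
      \<open>d\<close>, while at \<open>g k\<close> it exceeds \<open>d\<close> by less than
      \<open>1 / (k + 1)\<close>. The discriminant criterion in \<open>t\<close> then bounds the
      defect \<open>a k\<close>.\<close>
    have bound: "(a k)\<^sup>2 \<le> 1 / (real k + 1) * n" for k
    proof (rule quadratic_nonneg_imp)
      fix t
      have "(\<lambda>x. g k x + t * v x) \<in> V" using add g(1) scale v by blast
      from dle[OF this] have "d \<le> D (\<lambda>x. g k x + t * v x)" .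
      also have "D (\<lambda>x. g k x + t * v x)
          = inner_L2 M (\<lambda>x. (f x - g k x) - t * v x) (\<lambda>x. (f x - g k x) - t * v x)"
        unfolding D_def by (simp add: algebra_simps)
      also have "\<dots> = D (g k) - 2 * t * a k + t\<^sup>2 * n"
        by (subst inner_L2_diff_self[OF L2_fun_diff[OF f gL] L2_fun_scale[OF vL]])
          (simp add: D_def a_def n_def inner_L2_scale_left inner_L2_scale_right
            inner_L2_diff_left f gL vL power2_eq_square
            inner_L2_commute[of M f v] inner_L2_commute[of M "g k" v])
      finally show "0 \<le> 1 / (real k + 1) - 2 * t * a k + t\<^sup>2 * n" using g(2)[of k] by simp
    qed (simp add: n_def inner_L2_nonneg)
    have "(\<lambda>k. n * inverse (real (Suc k))) \<longlonglongrightarrow> n * 0"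
      by (intro tendsto_mult tendsto_const LIMSEQ_inverse_real_of_nat)
    then have lim: "(\<lambda>k. n * inverse (real (Suc k))) \<longlonglongrightarrow> 0" by simp
    have "(\<lambda>k. (a k)\<^sup>2) \<longlonglongrightarrow> 0"
    proof (rule tendsto_sandwich[OF _ _ tendsto_const lim])
      show "\<forall>\<^sub>F k in sequentially. (a k)\<^sup>2 \<le> n * inverse (real (Suc k))"
        using bound by (simp add: divide_inverse add.commute mult.commute)
    qed simp
    then have "(\<lambda>k. sqrt ((a k)\<^sup>2)) \<longlonglongrightarrow> sqrt 0" by (rule tendsto_real_sqrt)
    then have "(\<lambda>k. \<bar>a k\<bar>) \<longlonglongrightarrow> 0" by simp
    then have "a \<longlonglongrightarrow> 0" by (rule tendsto_rabs_zero_cancel)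
    from tendsto_diff[OF tendsto_const[of "inner_L2 M v f"] this]
    show ?thesis by (simp add: a_def)
  qed
  with g(1) show ?thesis by blast
qed

section \<open>Parseval identities for a complete orthonormal system\<close>

lemma complete_orthonormal_L2: "complete_orthonormal M \<psi> \<Longrightarrow> \<psi> n \<in> L2_fun M"
  by (simp add: complete_orthonormal_def)

lemma complete_orthonormal_inner:
  "complete_orthonormal M \<psi> \<Longrightarrow> inner_L2 M (\<psi> m) (\<psi> n) = (if m = n then 1 else 0)"
  by (simp add: complete_orthonormal_def inner_L2_def)

lemma orthonormal_dist:
  assumes M: "complete_orthonormal M \<psi>" and f: "f \<in> L2_fun M"
  shows "inner_L2 M (\<lambda>x. f x - (\<Sum>n<N. c n * \<psi> n x)) (\<lambda>x. f x - (\<Sum>n<N. c n * \<psi> n x))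
    = inner_L2 M f f - 2 * (\<Sum>n<N. c n * inner_L2 M f (\<psi> n)) + (\<Sum>n<N. (c n)\<^sup>2)"
proof -
  let ?s = "\<lambda>x. \<Sum>n<N. c n * \<psi> n x"
  have p: "(\<lambda>x. c n * \<psi> n x) \<in> L2_fun M" for n
    by (intro L2_fun_scale complete_orthonormal_L2[OF M])
  have s: "?s \<in> L2_fun M" by (intro L2_fun_sum p)
  have 1: "inner_L2 M g ?s = (\<Sum>n<N. c n * inner_L2 M g (\<psi> n))" if "g \<in> L2_fun M" for g
    using that by (simp add: inner_L2_sum_right[OF p] inner_L2_scale_right)
  have 2: "inner_L2 M ?s (\<psi> m) = c m" if "m < N" for m
    using that by (simp add: inner_L2_sum_left[OF p complete_orthonormal_L2[OF M]] inner_L2_scale_left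
        complete_orthonormal_inner[OF M] if_distrib[of "\<lambda>x. _ * x"] cong: if_cong)
  have 3: "inner_L2 M ?s ?s = (\<Sum>n<N. (c n)\<^sup>2)"
    by (simp add: 1[OF s] 2 power2_eq_square)
  show ?thesis
    by (simp add: inner_L2_diff_self[OF f s] 1[OF f] 3)
qed

text \<open>Completing the square shows that the coefficients \<open>inner_L2 M f (\<psi> n)\<close>
  minimise the distance from \<open>f\<close> among combinations of the first \<open>N\<close> basis
  functions. The approximation in \<open>complete_orthonormal\<close> has arbitrary coefficients, so
  the optimal ones do at least as well, and their defect decreases with \<open>N\<close>.\<close>

lemma Parseval_norm:
  assumes M: "complete_orthonormal M \<psi>" and f: "f \<in> L2_fun M"
  shows "(\<lambda>N. inner_L2 M f f - (\<Sum>n<N. (inner_L2 M f (\<psi> n))\<^sup>2)) \<longlonglongrightarrow> 0"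
    and "(\<Sum>n<N. (inner_L2 M f (\<psi> n))\<^sup>2) \<le> inner_L2 M f f"
proof -
  define a where "a n = inner_L2 M f (\<psi> n)" for n
  have opt: "inner_L2 M (\<lambda>x. f x - (\<Sum>n<N. c n * \<psi> n x)) (\<lambda>x. f x - (\<Sum>n<N. c n * \<psi> n x))
    = inner_L2 M f f - (\<Sum>n<N. (a n)\<^sup>2) + (\<Sum>n<N. (c n - a n)\<^sup>2)" for c N
  proof -
    have "(\<Sum>n<N. (c n - a n)\<^sup>2) = (\<Sum>n<N. (c n)\<^sup>2) + (\<Sum>n<N. (a n)\<^sup>2) - 2 * (\<Sum>n<N. c n * a n)"
      by (simp add: power2_diff sum.distrib sum_subtractf sum_distrib_left mult.assoc)
    then show ?thesis unfolding orthonormal_dist[OF assms] a_def by simp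
  qed
  have le: "0 \<le> inner_L2 M f f - (\<Sum>n<N. (a n)\<^sup>2)" for N
    using opt[where c=a and N=N] inner_L2_nonneg[of M "\<lambda>x. f x - (\<Sum>n<N. a n * \<psi> n x)"] by simp
  then show "(\<Sum>n<N. (inner_L2 M f (\<psi> n))\<^sup>2) \<le> inner_L2 M f f" unfolding a_def by simp
  show "(\<lambda>N. inner_L2 M f f - (\<Sum>n<N. (inner_L2 M f (\<psi> n))\<^sup>2)) \<longlonglongrightarrow> 0"
  proof (rule LIMSEQ_I)
    fix r :: real assume "0 < r"
    with M f obtain c N where cN: "(\<integral>x. (f x - (\<Sum>n<N. c n * \<psi> n x))\<^sup>2 \<partial>M) < r"
      unfolding complete_orthonormal_def by blast
    have "inner_L2 M f f - (\<Sum>n<N. (a n)\<^sup>2) < r"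
      using cN opt[where c=c and N=N] sum_nonneg[of "{..<N}" "\<lambda>n. (c n - a n)\<^sup>2"]
      by (simp add: inner_L2_self)
    moreover have "(\<Sum>n<N. (a n)\<^sup>2) \<le> (\<Sum>n<N'. (a n)\<^sup>2)" if "N \<le> N'" for N'
      using that by (intro sum_mono2) auto
    ultimately show "\<exists>no. \<forall>n\<ge>no. norm (inner_L2 M f f - (\<Sum>n<n. (inner_L2 M f (\<psi> n))\<^sup>2) - 0) < r"
      using le unfolding a_def by (intro exI[of _ N]) (auto, smt (verit, best))
  qed
qed

text \<open>Polarisation: \<open>4 * inner_L2 M f g\<close> is the difference of the squared norms
  of the sum and of the difference, and \<open>Parseval_norm\<close> applies to both.\<close>

lemma Parseval:
  assumes M: "complete_orthonormal M \<psi>" and f: "f \<in> L2_fun M" and g: "g \<in> L2_fun M"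
  shows "(\<lambda>N. \<Sum>n<N. inner_L2 M f (\<psi> n) * inner_L2 M g (\<psi> n)) \<longlonglongrightarrow> inner_L2 M f g"
proof -
  let ?p = "\<lambda>n. inner_L2 M f (\<psi> n)" and ?q = "\<lambda>n. inner_L2 M g (\<psi> n)"
  note L = complete_orthonormal_L2[OF M]
  have "(\<lambda>N. inner_L2 M f g - (\<Sum>n<N. ?p n * ?q n)) \<longlonglongrightarrow> (0 - 0) / 4"
  proof (rule Lim_transform_eventually[OF tendsto_divide[OF tendsto_diff[OF
          Parseval_norm(1)[OF M L2_fun_add[OF f g]] Parseval_norm(1)[OF M L2_fun_diff[OF f g]]]
          tendsto_const]])
    show "\<forall>\<^sub>F N in sequentially.
      (inner_L2 M (\<lambda>x. f x + g x) (\<lambda>x. f x + g x) - (\<Sum>n<N. (inner_L2 M (\<lambda>x. f x + g x) (\<psi> n))\<^sup>2) -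
        (inner_L2 M (\<lambda>x. f x - g x) (\<lambda>x. f x - g x) - (\<Sum>n<N. (inner_L2 M (\<lambda>x. f x - g x) (\<psi> n))\<^sup>2))) / 4
      = inner_L2 M f g - (\<Sum>n<N. ?p n * ?q n)"
      by (rule always_eventually)
        (simp add: inner_L2_add_self[OF f g] inner_L2_diff_self[OF f g] inner_L2_add_left[OF f g L]
          inner_L2_diff_left[OF f g L] power2_sum power2_diff sum.distrib sum_subtractf
          sum_distrib_left[symmetric] mult.assoc)
  qed simp
  from tendsto_diff[OF tendsto_const[of "inner_L2 M f g"] this] show ?thesis by simp
qed

section \<open>Symmetric Markovian kernels with a spectral gap\<close>

text \<open>Symmetry and Chapman-Kolmogorov hold at every point, so evaluation at a single
  \<open>x\<close> is meaningful; the eigenvalue equation, an identity in \<open>L\<^sup>2\<close>,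
  holds almost everywhere. Measurability is prescribed in one variable, and joint measurability is
  derived from the basis.\<close>

locale symmetric_kernel = prob_space M for M :: "'a measure" +
  fixes p :: "real \<Rightarrow> 'a \<Rightarrow> 'a \<Rightarrow> real"
    and \<psi> :: "nat \<Rightarrow> 'a \<Rightarrow> real"
    and lam :: "nat \<Rightarrow> real"
  assumes p_nonneg: "\<And>t x y. t > 0 \<Longrightarrow> x \<in> space M \<Longrightarrow> y \<in> space M \<Longrightarrow> 0 \<le> p t x y"
    and p_measurable: "\<And>t x. t > 0 \<Longrightarrow> x \<in> space M \<Longrightarrow> p t x \<in> borel_measurable M"
    and p_symmetric: "\<And>t x y. t > 0 \<Longrightarrow> x \<in> space M \<Longrightarrow> y \<in> space M \<Longrightarrow> p t x y = p t y x"
    and p_Chapman_Kolmogorov: "\<And>s t x y. s > 0 \<Longrightarrow> t > 0 \<Longrightarrow> x \<in> space M \<Longrightarrow> y \<in> space M \<Longrightarrow>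
          ennreal (p (s + t) x y) = (\<integral>\<^sup>+ z. ennreal (p s x z * p t z y) \<partial>M)"
    and p_submarkov: "\<And>t x. t > 0 \<Longrightarrow> x \<in> space M \<Longrightarrow> (\<integral>\<^sup>+ y. ennreal (p t x y) \<partial>M) \<le> 1"
    and basis: "complete_orthonormal M \<psi>"
    and eigen: "\<And>n t. t > 0 \<Longrightarrow>
          AE x in M. (\<integral>y. p t x y * \<psi> n y \<partial>M) = exp (- lam n * t) * \<psi> n x"
    and lam_mono: "mono lam" and lam_pos: "0 < lam 0"
begin

section \<open>Transition operators and joint measurability of the kernel\<close>

definition Pt :: "real \<Rightarrow> ('a \<Rightarrow> real) \<Rightarrow> 'a \<Rightarrow> real" where
  "Pt t f x = (\<integral>y. p t x y * f y \<partial>M)"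

lemma Pt_inner: "Pt t f x = inner_L2 M (p t x) f"
  by (simp add: Pt_def inner_L2_def)

lemmas psi_L2 = complete_orthonormal_L2[OF basis]

lemma nn_integral_kernel:
  assumes "s > 0" "t > 0" "x \<in> space M" "y \<in> space M"
  shows "(\<integral>\<^sup>+ z. ennreal (p s x z * p t y z) \<partial>M) = ennreal (p (s + t) x y)"
  using assms by (subst p_Chapman_Kolmogorov) (auto intro!: nn_integral_cong simp: p_symmetric)

text \<open>By symmetry, Chapman-Kolmogorov is an inner product of two sections of the kernel; the
  squared norm of \<open>p t x\<close> is the finite number \<open>p (t + t) x x\<close>.\<close>

lemma kernel_L2:
  assumes "t > 0" "x \<in> space M"
  shows "p t x \<in> L2_fun M"
proof -
  note [measurable] = p_measurable[OF assms]
  have "integrable M (\<lambda>z. p t x z * p t x z)"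
    using assms by (intro integrableI_nn_integral_finite[OF _ _ nn_integral_kernel]) auto
  then show ?thesis by (simp add: L2_fun_def power2_eq_square)
qed

lemma inner_kernel:
  assumes "s > 0" "t > 0" "x \<in> space M" "y \<in> space M"
  shows "inner_L2 M (p s x) (p t y) = p (s + t) x y"
proof -
  have "ennreal (inner_L2 M (p s x) (p t y)) = (\<integral>\<^sup>+ z. ennreal (p s x z * p t y z) \<partial>M)"
    unfolding inner_L2_def using assms
    by (intro nn_integral_eq_integral[symmetric] L2_fun_mult_integrable kernel_L2)
      (auto intro!: mult_nonneg_nonneg p_nonneg)
  also have "\<dots> = ennreal (p (s + t) x y)" by (rule nn_integral_kernel[OF assms])
  finally show ?thesis
    using assms by (subst (asm) ennreal_inj)
      (auto simp: inner_L2_def intro!: integral_nonneg_AE mult_nonneg_nonneg p_nonneg)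
qed

text \<open>The functions with measurable image form a subspace \<open>?V\<close> that contains
  every section \<open>p t x\<close>. \<open>L2_weak_approx\<close> gives \<open>g k\<close> in
  \<open>?V\<close> with convergence of inner products against all members of \<open>?V\<close>;
  tested against the sections, this is pointwise convergence of \<open>Pt t (g k)\<close> to
  \<open>Pt t f\<close>.\<close>

lemma Pt_measurable:
  assumes t: "t > 0" and f: "f \<in> L2_fun M"
  shows "Pt t f \<in> borel_measurable M"
proof -
  let ?V = "{g \<in> L2_fun M. Pt t g \<in> borel_measurable M}"
  have Pt_add: "Pt t (\<lambda>x. u x + v x) x = Pt t u x + Pt t v x"
    if "x \<in> space M" "u \<in> L2_fun M" "v \<in> L2_fun M" for u v x
    unfolding Pt_inner using that t by (intro inner_L2_add_right kernel_L2)
  have Pt_scale: "Pt t (\<lambda>x. c * v x) x = c * Pt t v x" for c v x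
    unfolding Pt_inner by (rule inner_L2_scale_right)
  \<comment> \<open>The image of the section \<open>p t x\<close> is again a section, namely
    \<open>p (t + t) x\<close>, whose measurability is assumed.\<close>
  have kernel_in: "p t x \<in> ?V" if x: "x \<in> space M" for x
  proof -
    have "p (t + t) x \<in> borel_measurable M" using t x by (intro p_measurable) auto
    moreover have "p (t + t) x y = Pt t (p t x) y" if "y \<in> space M" for y
      unfolding Pt_inner using inner_kernel[OF t t that x] t x that p_symmetric[of "t + t" x y] by simp
    ultimately have "Pt t (p t x) \<in> borel_measurable M" by (simp cong: measurable_cong)
    then show ?thesis using kernel_L2[OF t x] by simp
  qed
  have "\<exists>g. (\<forall>k::nat. g k \<in> ?V) \<and> (\<forall>v\<in>?V. (\<lambda>k. inner_L2 M v (g k)) \<longlonglongrightarrow> inner_L2 M v f)"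
  proof (rule L2_weak_approx[OF f])
    have "(\<lambda>_. 0) \<in> ?V" by (simp add: L2_fun_def Pt_def[abs_def])
    then show "?V \<noteq> {}" by blast
    show "(\<lambda>x. u x + v x) \<in> ?V" if "u \<in> ?V" "v \<in> ?V" for u v
    proof -
      have "(\<lambda>x. Pt t u x + Pt t v x) \<in> borel_measurable M" using that by auto
      then have "Pt t (\<lambda>x. u x + v x) \<in> borel_measurable M"
        using that by (subst measurable_cong[OF Pt_add]) auto
      then show ?thesis using that L2_fun_add by auto
    qed
    show "(\<lambda>x. c * v x) \<in> ?V" if "v \<in> ?V" for c v
    proof -
      have "(\<lambda>x. c * Pt t v x) \<in> borel_measurable M" using that by auto
      then have "Pt t (\<lambda>x. c * v x) \<in> borel_measurable M"
        by (subst measurable_cong[OF Pt_scale])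
      then show ?thesis using that L2_fun_scale by auto
    qed
  qed auto
  then obtain g where g: "\<And>k::nat. g k \<in> ?V"
    "\<And>v. v \<in> ?V \<Longrightarrow> (\<lambda>k. inner_L2 M v (g k)) \<longlonglongrightarrow> inner_L2 M v f" by blast
  show ?thesis
  proof (rule borel_measurable_LIMSEQ_real)
    show "Pt t (g k) \<in> borel_measurable M" for k using g(1) by auto
    show "(\<lambda>k. Pt t (g k) x) \<longlonglongrightarrow> Pt t f x" if "x \<in> space M" for x
      unfolding Pt_inner by (rule g(2)[OF kernel_in[OF that]])
  qed
qed

text \<open>Splitting the time in half gives \<open>p t x y\<close> as the inner product of
  \<open>p (t/2) x\<close> and \<open>p (t/2) y\<close>. Parseval expands it as a limit of finite
  sums of products of a function of \<open>x\<close> and a function of \<open>y\<close>.\<close>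

lemma kernel_joint_measurable:
  assumes t: "t > 0"
  shows "(\<lambda>(x, y). p t x y) \<in> borel_measurable (M \<Otimes>\<^sub>M M)"
proof (rule borel_measurable_LIMSEQ_real)
  have [measurable]: "Pt (t/2) (\<psi> n) \<in> borel_measurable M" for n
    using t by (intro Pt_measurable psi_L2) auto
  show "(\<lambda>z. \<Sum>n<N. Pt (t/2) (\<psi> n) (fst z) * Pt (t/2) (\<psi> n) (snd z))
      \<in> borel_measurable (M \<Otimes>\<^sub>M M)" for N
    by measurable
  fix z assume "z \<in> space (M \<Otimes>\<^sub>M M)"
  then obtain x y where z: "z = (x, y)" "x \<in> space M" "y \<in> space M"
    by (auto simp: space_pair_measure)
  have "(\<lambda>N. \<Sum>n<N. inner_L2 M (p (t/2) x) (\<psi> n) * inner_L2 M (p (t/2) y) (\<psi> n))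
      \<longlonglongrightarrow> inner_L2 M (p (t/2) x) (p (t/2) y)"
    using t z by (intro Parseval[OF basis] kernel_L2) auto
  also have "inner_L2 M (p (t/2) x) (p (t/2) y) = p t x y"
    using t z inner_kernel[of "t/2" "t/2" x y] by simp
  finally show "(\<lambda>N. \<Sum>n<N. Pt (t/2) (\<psi> n) (fst z) * Pt (t/2) (\<psi> n) (snd z))
      \<longlonglongrightarrow> (case z of (x, y) \<Rightarrow> p t x y)"
    by (simp add: z Pt_inner)
qed

lemma nn_semigroup:
  assumes s: "s > 0" and t: "t > 0" and x: "x \<in> space M" and [measurable]: "f \<in> borel_measurable M"
  shows "(\<integral>\<^sup>+ z. ennreal (p s x z) * (\<integral>\<^sup>+ y. ennreal (p t z y) * f y \<partial>M) \<partial>M)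
    = (\<integral>\<^sup>+ y. ennreal (p (s + t) x y) * f y \<partial>M)"
proof -
  interpret MM: pair_sigma_finite M M ..
  note [measurable] = p_measurable[OF s x] kernel_joint_measurable[OF t]
  have [measurable]: "(\<lambda>w. p t (fst w) (snd w)) \<in> borel_measurable (M \<Otimes>\<^sub>M M)"
    using kernel_joint_measurable[OF t] by (simp add: case_prod_beta')
  have "(\<integral>\<^sup>+ z. ennreal (p s x z) * (\<integral>\<^sup>+ y. ennreal (p t z y) * f y \<partial>M) \<partial>M)
      = (\<integral>\<^sup>+ z. (\<integral>\<^sup>+ y. ennreal (p s x z) * (ennreal (p t z y) * f y) \<partial>M) \<partial>M)"
    by (intro nn_integral_cong nn_integral_cmult[symmetric]) measurable
  also have "\<dots> = (\<integral>\<^sup>+ y. (\<integral>\<^sup>+ z. ennreal (p s x z) * (ennreal (p t z y) * f y) \<partial>M) \<partial>M)"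
    by (rule MM.Fubini'[symmetric]) (simp add: case_prod_beta')
  also have "\<dots> = (\<integral>\<^sup>+ y. (\<integral>\<^sup>+ z. ennreal (p s x z * p t z y) \<partial>M) * f y \<partial>M)"
  proof (rule nn_integral_cong)
    fix y assume y: "y \<in> space M"
    have [measurable]: "(\<lambda>z. p t z y) \<in> borel_measurable M"
      using p_measurable[OF t y] by (subst measurable_cong[of M _ "p t y"]) (auto simp: p_symmetric t y)
    show "(\<integral>\<^sup>+ z. ennreal (p s x z) * (ennreal (p t z y) * f y) \<partial>M)
        = (\<integral>\<^sup>+ z. ennreal (p s x z * p t z y) \<partial>M) * f y"
      by (subst nn_integral_multc[symmetric])
        (auto intro!: nn_integral_cong simp: ennreal_mult p_nonneg s t x y mult.assoc)
  qed
  also have "\<dots> = (\<integral>\<^sup>+ y. ennreal (p (s + t) x y) * f y \<partial>M)"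
    by (intro nn_integral_cong) (simp add: p_Chapman_Kolmogorov s t x)
  finally show ?thesis .
qed

text \<open>\<open>nn_semigroup\<close> for the absolute value of \<open>f\<close> supplies the
  integrability that the interchange of the two integrals requires.\<close>

lemma Pt_semigroup:
  assumes s: "s > 0" and t: "t > 0" and x: "x \<in> space M" and f: "f \<in> L2_fun M"
  shows "Pt s (Pt t f) x = Pt (s + t) f x"
proof -
  interpret MM: pair_sigma_finite M M ..
  note [measurable] = p_measurable[OF s x] L2_fun_measurable[OF f]
  have [measurable]: "(\<lambda>w. p t (fst w) (snd w)) \<in> borel_measurable (M \<Otimes>\<^sub>M M)"
    using kernel_joint_measurable[OF t] by (simp add: case_prod_beta')
  let ?h = "\<lambda>z y. p s x z * (p t z y * f y)"
  have fin: "(\<integral>\<^sup>+ y. ennreal (p (s + t) x y) * ennreal \<bar>f y\<bar> \<partial>M) < \<infinity>"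
  proof -
    have "integrable M (\<lambda>y. p (s + t) x y * f y)"
      using s t x f by (intro L2_fun_mult_integrable kernel_L2) auto
    then have "(\<integral>\<^sup>+ y. ennreal (norm (p (s + t) x y * f y)) \<partial>M) < \<infinity>"
      by (simp add: integrable_iff_bounded)
    also have "(\<integral>\<^sup>+ y. ennreal (norm (p (s + t) x y * f y)) \<partial>M)
        = (\<integral>\<^sup>+ y. ennreal (p (s + t) x y) * ennreal \<bar>f y\<bar> \<partial>M)"
      using s t x by (intro nn_integral_cong) (simp add: abs_mult ennreal_mult p_nonneg)
    finally show ?thesis .
  qed
  have int: "integrable (M \<Otimes>\<^sub>M M) (\<lambda>(z, y). ?h z y)"
  proof (rule integrableI_bounded)
    show "(\<lambda>(z, y). ?h z y) \<in> borel_measurable (M \<Otimes>\<^sub>M M)"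
      by (simp add: case_prod_beta')
    have "(\<integral>\<^sup>+ w. ennreal (norm (case w of (z, y) \<Rightarrow> ?h z y)) \<partial>(M \<Otimes>\<^sub>M M))
        = (\<integral>\<^sup>+ z. \<integral>\<^sup>+ y. ennreal (norm (?h z y)) \<partial>M \<partial>M)"
    proof -
      have "(\<lambda>w. ennreal (norm (case w of (z, y) \<Rightarrow> ?h z y))) \<in> borel_measurable (M \<Otimes>\<^sub>M M)"
        by (simp add: case_prod_beta')
      from nn_integral_fst[OF this] show ?thesis by simp
    qed
    also have "\<dots> = (\<integral>\<^sup>+ z. ennreal (p s x z) * (\<integral>\<^sup>+ y. ennreal (p t z y) * ennreal \<bar>f y\<bar> \<partial>M) \<partial>M)"
    proof (intro nn_integral_cong)
      fix z assume z: "z \<in> space M"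
      have [measurable]: "p t z \<in> borel_measurable M" using t z by (rule p_measurable)
      show "(\<integral>\<^sup>+ y. ennreal (norm (?h z y)) \<partial>M)
          = ennreal (p s x z) * (\<integral>\<^sup>+ y. ennreal (p t z y) * ennreal \<bar>f y\<bar> \<partial>M)"
        by (subst nn_integral_cmult[symmetric])
          (auto intro!: nn_integral_cong simp: abs_mult ennreal_mult p_nonneg s t x z)
    qed
    also have "\<dots> < \<infinity>" using fin by (subst nn_semigroup[OF s t x]) auto
    finally show "(\<integral>\<^sup>+ w. ennreal (norm (case w of (z, y) \<Rightarrow> ?h z y)) \<partial>(M \<Otimes>\<^sub>M M)) < \<infinity>" .
  qed
  have "Pt s (Pt t f) x = (\<integral>z. (\<integral>y. ?h z y \<partial>M) \<partial>M)"
    by (simp add: Pt_def)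
  also have "\<dots> = (\<integral>y. (\<integral>z. ?h z y \<partial>M) \<partial>M)"
    by (rule MM.Fubini_integral[symmetric, OF int])
  also have "\<dots> = Pt (s + t) f x"
    unfolding Pt_def
  proof (intro Bochner_Integration.integral_cong refl)
    fix y assume y: "y \<in> space M"
    have "(\<integral>z. ?h z y \<partial>M) = (\<integral>z. p s x z * p t y z * f y \<partial>M)"
      by (intro Bochner_Integration.integral_cong) (simp_all add: p_symmetric t y)
    also have "\<dots> = p (s + t) x y * f y"
      using inner_kernel[OF s t x y] by (simp add: inner_L2_def)
    finally show "(\<integral>z. ?h z y \<partial>M) = p (s + t) x y * f y" .
  qed
  finally show ?thesis .
qed

text \<open>Parseval at the fixed point \<open>x\<close>, for \<open>p t x\<close> against
  \<open>f\<close>, together with the eigenvalue equations shows that the damped partial sums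
  \<open>h N\<close> converge to \<open>Pt t f\<close> almost everywhere. Their norms obey the bound
  because the coefficients below \<open>k\<close> vanish and the later eigenvalues are at least
  \<open>lam k\<close>; Fatou passes it to the limit. The case \<open>k = 0\<close> is plain
  stability of \<open>L\<^sup>2\<close>.\<close>

lemma Pt_contraction:
  assumes t: "t > 0" and f: "f \<in> L2_fun M" and orth: "\<And>n. n < k \<Longrightarrow> inner_L2 M f (\<psi> n) = 0"
  shows "Pt t f \<in> L2_fun M"
    and "inner_L2 M (Pt t f) (Pt t f) \<le> (exp (- lam k * t))\<^sup>2 * inner_L2 M f f"
proof -
  define a where "a n = inner_L2 M f (\<psi> n)" for n
  define h where "h N x = (\<Sum>n<N. (exp (- lam n * t) * a n) * \<psi> n x)" for N x
  let ?B = "(exp (- lam k * t))\<^sup>2 * inner_L2 M f f"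
  have [measurable]: "\<psi> n \<in> borel_measurable M" for n by (rule L2_fun_measurable[OF psi_L2])
  have hL: "h N \<in> L2_fun M" for N
    unfolding h_def by (intro L2_fun_sum L2_fun_scale psi_L2)
  have h_norm: "inner_L2 M (h N) (h N) \<le> ?B" for N
  proof -
    have z: "(\<lambda>_. 0) \<in> L2_fun M" by (simp add: L2_fun_def)
    have "inner_L2 M (h N) (h N) = (\<Sum>n<N. (exp (- lam n * t) * a n)\<^sup>2)"
      using orthonormal_dist[OF basis z, where N=N and c="\<lambda>n. exp (- lam n * t) * a n"]
      by (simp add: h_def[abs_def] inner_L2_def)
    also have "\<dots> \<le> (\<Sum>n<N. (exp (- lam k * t))\<^sup>2 * (a n)\<^sup>2)"
    proof (rule sum_mono)
      fix n
      show "(exp (- lam n * t) * a n)\<^sup>2 \<le> (exp (- lam k * t))\<^sup>2 * (a n)\<^sup>2"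
      proof (cases "n < k")
        case True then show ?thesis by (simp add: a_def orth)
      next
        case False
        then have "lam k \<le> lam n" using lam_mono by (auto simp: mono_def)
        then show ?thesis unfolding power_mult_distrib using t
          by (intro mult_right_mono power_mono) auto
      qed
    qed
    also have "\<dots> = (exp (- lam k * t))\<^sup>2 * (\<Sum>n<N. (a n)\<^sup>2)" by (simp add: sum_distrib_left)
    also have "\<dots> \<le> ?B" unfolding a_def by (intro mult_left_mono Parseval_norm(2)[OF basis f]) auto
    finally show ?thesis .
  qed
  have [measurable]: "Pt t f \<in> borel_measurable M" by (rule Pt_measurable[OF t f])
  have [measurable]: "h N \<in> borel_measurable M" for N by (rule L2_fun_measurable[OF hL])
  have "AE x in M. \<forall>n. (\<integral>y. p t x y * \<psi> n y \<partial>M) = exp (- lam n * t) * \<psi> n x"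
    using eigen[OF t] by (simp add: AE_all_countable)
  then have lim: "AE x in M. (\<lambda>N. h N x) \<longlonglongrightarrow> Pt t f x"
  proof (rule AE_mp, intro AE_I2 impI)
    fix x assume x: "x \<in> space M"
      and e: "\<forall>n. (\<integral>y. p t x y * \<psi> n y \<partial>M) = exp (- lam n * t) * \<psi> n x"
    show "(\<lambda>N. h N x) \<longlonglongrightarrow> Pt t f x"
      using Parseval[OF basis kernel_L2[OF t x] f] e
      by (simp add: Pt_inner h_def a_def inner_L2_def mult_ac)
  qed
  have "(\<integral>\<^sup>+ x. ennreal ((Pt t f x)\<^sup>2) \<partial>M) = (\<integral>\<^sup>+ x. liminf (\<lambda>N. ennreal ((h N x)\<^sup>2)) \<partial>M)"
  proof (rule nn_integral_cong_AE, use lim in eventually_elim)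
    fix x assume "(\<lambda>N. h N x) \<longlonglongrightarrow> Pt t f x"
    then have "(\<lambda>N. ennreal ((h N x)\<^sup>2)) \<longlonglongrightarrow> ennreal ((Pt t f x)\<^sup>2)"
      by (intro tendsto_ennrealI tendsto_power)
    then show "ennreal ((Pt t f x)\<^sup>2) = liminf (\<lambda>N. ennreal ((h N x)\<^sup>2))"
      by (intro lim_imp_Liminf[symmetric]) auto
  qed
  also have "\<dots> \<le> liminf (\<lambda>N. \<integral>\<^sup>+ x. ennreal ((h N x)\<^sup>2) \<partial>M)"
    by (rule nn_integral_liminf) auto
  also have "\<dots> \<le> liminf (\<lambda>N::nat. ennreal ?B)"
  proof (rule Liminf_mono, intro always_eventually allI)
    fix N
    have "(\<integral>\<^sup>+ x. ennreal ((h N x)\<^sup>2) \<partial>M) = ennreal (\<integral>x. (h N x)\<^sup>2 \<partial>M)"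
      using hL[of N] by (intro nn_integral_eq_integral) (auto simp: L2_fun_def)
    then show "(\<integral>\<^sup>+ x. ennreal ((h N x)\<^sup>2) \<partial>M) \<le> ennreal ?B"
      using h_norm[of N] by (simp add: inner_L2_self ennreal_leI)
  qed
  also have "\<dots> = ennreal ?B" by (simp add: Liminf_const)
  finally have *: "(\<integral>\<^sup>+ x. ennreal ((Pt t f x)\<^sup>2) \<partial>M) \<le> ennreal ?B" .
  then have i: "integrable M (\<lambda>x. (Pt t f x)\<^sup>2)"
    by (intro integrableI_bounded) (auto intro: le_less_trans)
  then show "Pt t f \<in> L2_fun M" by (simp add: L2_fun_def)
  have "ennreal (\<integral>x. (Pt t f x)\<^sup>2 \<partial>M) \<le> ennreal ?B"
    using * by (subst (asm) nn_integral_eq_integral[OF i]) auto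
  then show "inner_L2 M (Pt t f) (Pt t f) \<le> ?B"
    unfolding inner_L2_self by (subst (asm) ennreal_le_iff) (auto simp: inner_L2_def)
qed

lemma Pt_decay:
  assumes t: "1 \<le> t" and x: "x \<in> space M" and f: "f \<in> L2_fun M"
    and orth: "\<And>n. n < k \<Longrightarrow> inner_L2 M f (\<psi> n) = 0"
  shows "\<bar>Pt t f x\<bar> \<le> sqrt (p 2 x x) * exp (- lam k * (t - 1)) * sqrt (inner_L2 M f f)"
proof -
  have p2: "inner_L2 M (p 1 x) (p 1 x) = p 2 x x"
    using inner_kernel[of 1 1 x x] x by simp
  show ?thesis
  \<comment> \<open>\<open>Pt_semigroup\<close> splits off positive times only; at the boundary the
    claim is Cauchy-Schwarz for \<open>p 1 x\<close> and \<open>f\<close>.\<close>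
  proof (cases "t = 1")
    case True
    then show ?thesis
      using inner_L2_abs_le[OF kernel_L2[of 1 x] f] x by (simp add: Pt_inner p2)
  next
    case False
    then have t': "t - 1 > 0" using t by simp
    have "\<bar>Pt t f x\<bar> = \<bar>inner_L2 M (p 1 x) (Pt (t - 1) f)\<bar>"
      using Pt_semigroup[of 1 "t - 1" x f] t' x f by (simp add: Pt_inner)
    also have "\<dots> \<le> sqrt (p 2 x x) * sqrt (inner_L2 M (Pt (t - 1) f) (Pt (t - 1) f))"
      using inner_L2_abs_le[OF kernel_L2[of 1 x] Pt_contraction(1)[OF t' f orth]] x by (simp add: p2)
    also have "\<dots> \<le> sqrt (p 2 x x) * sqrt ((exp (- lam k * (t - 1)))\<^sup>2 * inner_L2 M f f)"
      using p_nonneg[of 2 x x] x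
      by (intro mult_left_mono real_sqrt_le_mono Pt_contraction(2)[OF t' f orth]) auto
    also have "\<dots> = sqrt (p 2 x x) * exp (- lam k * (t - 1)) * sqrt (inner_L2 M f f)"
      by (simp add: real_sqrt_mult)
    finally show ?thesis .
  qed
qed

text \<open>The eigenvalue equation for \<open>\<psi> 0\<close> itself is only known almost everywhere.\<close>

definition ground :: "'a \<Rightarrow> real" where
  "ground x = exp (lam 0) * Pt 1 (\<psi> 0) x"

lemma Pt_cong_AE:
  assumes "t > 0" "x \<in> space M" "AE y in M. f y = g y" "f \<in> borel_measurable M" "g \<in> borel_measurable M"
  shows "Pt t f x = Pt t g x"
  unfolding Pt_def
  using assms(3) by (intro integral_cong_AE borel_measurable_times p_measurable assms) auto

text \<open>An almost everywhere identity becomes pointwise after one more application of the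
  kernel. Splitting \<open>1 + t\<close> in both orders then compares the values at time
  \<open>t\<close> and at time 1.\<close>

lemma Pt_psi0:
  assumes t: "t > 0" and x: "x \<in> space M"
  shows "Pt t (\<psi> 0) x = exp (- lam 0 * t) * ground x"
proof -
  have step: "Pt (s + r) (\<psi> 0) x = exp (- lam 0 * r) * Pt s (\<psi> 0) x" if "s > 0" "r > 0" for s r
  proof -
    have "Pt (s + r) (\<psi> 0) x = Pt s (Pt r (\<psi> 0)) x"
      using that x by (intro Pt_semigroup[symmetric] psi_L2)
    also have "\<dots> = Pt s (\<lambda>y. exp (- lam 0 * r) * \<psi> 0 y) x"
      using eigen[OF that(2), of 0] that x
      by (intro Pt_cong_AE Pt_measurable psi_L2 borel_measurable_times L2_fun_measurable borel_measurable_const)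
        (simp_all add: Pt_def[symmetric])
    also have "\<dots> = exp (- lam 0 * r) * Pt s (\<psi> 0) x"
      unfolding Pt_inner by (rule inner_L2_scale_right)
    finally show ?thesis .
  qed
  have "exp (- lam 0 * 1) * Pt t (\<psi> 0) x = exp (- lam 0 * t) * Pt 1 (\<psi> 0) x"
    using step[of 1 t] step[of t 1] t by (simp add: add.commute)
  then have "exp (lam 0) * (exp (- lam 0 * 1) * Pt t (\<psi> 0) x)
      = exp (lam 0) * (exp (- lam 0 * t) * Pt 1 (\<psi> 0) x)" by simp
  then show ?thesis by (simp add: ground_def mult.assoc[symmetric] exp_add[symmetric] mult.left_commute)
qed

lemma ground_measurable: "ground \<in> borel_measurable M"
  unfolding ground_def[abs_def]
  by (intro borel_measurable_times borel_measurable_const Pt_measurable psi_L2) simp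

end

section \<open>Survival probabilities and conditioning on survival\<close>

lemma (in prob_space) integral_pos:
  fixes f :: "'a \<Rightarrow> real"
  assumes f: "integrable M f" and pos: "\<And>x. x \<in> space M \<Longrightarrow> 0 < f x"
  shows "0 < (\<integral>x. f x \<partial>M)"
proof -
  have nn: "AE x in M. 0 \<le> f x" using pos by (intro AE_I2) (simp add: less_imp_le)
  have "(\<integral>x. f x \<partial>M) \<noteq> 0"
  proof
    assume "(\<integral>x. f x \<partial>M) = 0"
    then have "AE x in M. f x = 0" using integral_nonneg_eq_0_iff_AE[OF f nn] by simp
    with AE_space have "AE x in M. False"
    proof eventually_elim
      case (elim x)
      then show ?case using pos[of x] by simp
    qed
    then show False by simp
  qed
  moreover have "0 \<le> (\<integral>x. f x \<partial>M)" by (rule integral_nonneg_AE[OF nn])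
  ultimately show ?thesis by simp
qed

context symmetric_kernel
begin

lemma kernel_integral_le_1:
  assumes "t > 0" "x \<in> space M"
  shows "integrable M (p t x)" "(\<integral>y. p t x y \<partial>M) \<le> 1"
proof -
  show i: "integrable M (p t x)"
    using L2_fun_integrable[OF finite_measure_axioms kernel_L2[OF assms]] .
  have "ennreal (\<integral>y. p t x y \<partial>M) = (\<integral>\<^sup>+ y. ennreal (p t x y) \<partial>M)"
    using assms by (intro nn_integral_eq_integral[symmetric] i AE_I2 p_nonneg)
  also have "\<dots> \<le> ennreal 1" using p_submarkov[OF assms] by simp
  finally show "(\<integral>y. p t x y \<partial>M) \<le> 1" by (subst (asm) ennreal_le_iff) auto
qed

lemma Pt_mono:
  assumes "t > 0" "x \<in> space M" "f \<in> L2_fun M" "g \<in> L2_fun M"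
    "\<And>y. y \<in> space M \<Longrightarrow> f y \<le> g y"
  shows "Pt t f x \<le> Pt t g x"
  unfolding Pt_def using assms
  by (intro integral_mono L2_fun_mult_integrable kernel_L2 mult_left_mono p_nonneg)

lemma Pt_const: "Pt t (\<lambda>_. c) x = c * Pt t (\<lambda>_. 1) x"
  by (simp add: Pt_def)

lemma Pt_one_le_1: "t > 0 \<Longrightarrow> x \<in> space M \<Longrightarrow> Pt t (\<lambda>_. 1) x \<le> 1"
  using kernel_integral_le_1 by (simp add: Pt_def)

lemma const_L2: "(\<lambda>_. c) \<in> L2_fun M"
  by (simp add: L2_fun_def)

lemma Pt_nonneg:
  assumes "t > 0" "x \<in> space M" "\<And>y. y \<in> space M \<Longrightarrow> 0 \<le> f y"
  shows "0 \<le> Pt t f x"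
  unfolding Pt_def using assms by (intro integral_nonneg_AE AE_I2 mult_nonneg_nonneg p_nonneg)

lemma Pt_bounded:
  assumes t: "t > 0" "x \<in> space M" and f: "f \<in> borel_measurable M"
    and c: "\<And>y. y \<in> space M \<Longrightarrow> \<bar>f y\<bar> \<le> c"
  shows "\<bar>Pt t f x\<bar> \<le> c"
proof -
  have fL: "f \<in> L2_fun M" using L2_fun_bounded[OF finite_measure_axioms f c] .
  have c0: "0 \<le> c" using c[OF t(2)] by simp
  have "Pt t f x \<le> Pt t (\<lambda>_. c) x"
    by (intro Pt_mono t fL const_L2) (use c in \<open>auto simp: abs_le_iff\<close>)
  moreover have "Pt t (\<lambda>_. - c) x \<le> Pt t f x"
    by (intro Pt_mono t fL const_L2) (use c in \<open>fastforce simp: abs_le_iff\<close>)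
  moreover have "c * Pt t (\<lambda>_. 1) x \<le> c"
    using mult_left_mono[OF Pt_one_le_1[OF t] c0] by simp
  ultimately show ?thesis
    using Pt_const[of t c x] Pt_const[of t "- c" x] by (simp add: abs_le_iff)
qed

lemma Pt_add:
  assumes "t > 0" "x \<in> space M" "f \<in> L2_fun M" "g \<in> L2_fun M"
  shows "Pt t (\<lambda>y. f y + g y) x = Pt t f x + Pt t g x"
  unfolding Pt_inner using assms by (intro inner_L2_add_right kernel_L2)

lemma Pt_scale: "Pt t (\<lambda>y. c * f y) x = c * Pt t f x"
  unfolding Pt_inner by (rule inner_L2_scale_right)

lemma Pt_one_antimono:
  assumes "s > 0" "s \<le> t" "x \<in> space M"
  shows "Pt t (\<lambda>_. 1) x \<le> Pt s (\<lambda>_. 1) x"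
proof (cases "s = t")
  case False
  then have st: "t - s > 0" using assms by simp
  have "Pt t (\<lambda>_. 1) x = Pt s (Pt (t - s) (\<lambda>_. 1)) x"
    using Pt_semigroup[OF assms(1) st assms(3) const_L2, of 1] by simp
  also have "\<dots> \<le> Pt s (\<lambda>_. 1) x"
    using st by (intro Pt_mono assms const_L2 Pt_contraction(1)[where k=0] Pt_one_le_1) auto
  finally show ?thesis .
qed simp

text \<open>Renewal argument. At a suitable time \<open>s < 1\<close> the mass inside
  \<open>K\<close> has the survival bound from \<open>Pt_decay\<close>, and the mass outside is at
  most \<open>\<epsilon>\<close>. The time \<open>s\<close> depends on the starting point, so
  monotonicity of survival in time replaces \<open>t - s\<close> by \<open>t - 1\<close>. Since
  \<open>exp (lam 0) * \<epsilon> = 1 / 2\<close>, a bound with constant \<open>C\<close> at time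
  \<open>t - 1\<close> reproduces itself at time \<open>t\<close> as
  \<open>D * exp (lam 0) + C / 2 \<le> C\<close>.\<close>

lemma survival_bound:
  assumes tail: "\<And>\<epsilon>. \<epsilon> > 0 \<Longrightarrow> \<exists>K B. K \<in> sets M \<and> (\<forall>x\<in>K. p 2 x x \<le> B) \<and>
      (\<forall>x\<in>space M. \<exists>s. 0 < s \<and> s < 1 \<and> Pt s (indicator (space M - K)) x \<le> \<epsilon>)"
  shows "\<exists>C. \<forall>t\<ge>1. \<forall>x\<in>space M. Pt t (\<lambda>_. 1) x \<le> C * exp (- lam 0 * t)"
proof -
  define \<epsilon> where "\<epsilon> = exp (- lam 0) / 2"
  obtain K B where K: "K \<in> sets M" and B: "\<And>x. x \<in> K \<Longrightarrow> p 2 x x \<le> B"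
    and short: "\<And>x. x \<in> space M \<Longrightarrow> \<exists>s. 0 < s \<and> s < 1 \<and> Pt s (indicator (space M - K)) x \<le> \<epsilon>"
    using tail[of \<epsilon>] by (auto simp: \<epsilon>_def)
  define D where "D = sqrt \<bar>B\<bar> * exp (lam 0)"
  have D0: "0 \<le> D" by (simp add: D_def)
  have on_K: "Pt t (\<lambda>_. 1) x \<le> D * exp (- lam 0 * t)" if "1 \<le> t" "x \<in> K" for t x
  proof -
    have x: "x \<in> space M" using that K sets.sets_into_space by auto
    have "\<bar>Pt t (\<lambda>_. 1) x\<bar> \<le> sqrt (p 2 x x) * exp (- lam 0 * (t - 1)) * sqrt (inner_L2 M (\<lambda>_. 1) (\<lambda>_. 1))"
      by (rule Pt_decay[OF that(1) x const_L2]) simp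
    also have "\<dots> \<le> sqrt \<bar>B\<bar> * exp (- lam 0 * (t - 1)) * 1"
      using B[OF that(2)] by (intro mult_mono) (auto simp: inner_L2_def prob_space)
    also have "\<dots> = D * exp (- lam 0 * t)"
      by (simp add: D_def mult.assoc exp_add[symmetric] algebra_simps)
    finally show ?thesis by simp
  qed
  \<comment> \<open>The first entry covers the times up to 2, where survival is bounded by 1; the
    second absorbs the contribution of \<open>K\<close> in the induction step.\<close>
  define C where "C = max (exp (2 * lam 0)) (2 * D * exp (lam 0))"
  have C0: "0 \<le> C" by (simp add: C_def le_max_iff_disj)
  \<comment> \<open>The induction advances the upper end of the time range by 1. In the step
    \<open>t > 2\<close>, so \<open>t - 1\<close> is still at least 1 and lies in the previous
    range.\<close>
  have main: "1 \<le> t \<Longrightarrow> t \<le> real n + 2 \<Longrightarrow> x \<in> space M \<Longrightarrow> Pt t (\<lambda>_. 1) x \<le> C * exp (- lam 0 * t)" for n t x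
  proof (induction n arbitrary: t x)
    case 0
    have "Pt t (\<lambda>_. 1) x \<le> 1" using 0 by (intro Pt_one_le_1) auto
    also have "1 \<le> exp (2 * lam 0) * exp (- lam 0 * t)"
      using 0 lam_pos mult_left_mono[of t 2 "lam 0"] by (simp add: exp_add[symmetric])
    also have "\<dots> \<le> C * exp (- lam 0 * t)" by (intro mult_right_mono) (auto simp: C_def)
    finally show ?case .
  next
    case (Suc n)
    show ?case
    proof (cases "t \<le> 2")
      case True
      then show ?thesis using Suc.IH[of t x] Suc.prems by simp
    next
      case False
      then have t: "t > 2" by simp
      obtain s where s: "0 < s" "s < 1" "Pt s (indicator (space M - K)) x \<le> \<epsilon>"
        using short[OF Suc.prems(3)] by blast
      let ?H = "C * exp (- lam 0 * (t - 1))" and ?G = "D * exp (- lam 0 * (t - 1))"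
      have i: "(\<lambda>y. ?H * indicator (space M - K) y :: real) \<in> L2_fun M"
      proof (rule L2_fun_scale)
        show "indicator (space M - K) \<in> L2_fun M"
          using K by (intro L2_fun_bounded[OF finite_measure_axioms, where B=1]) (auto simp: indicator_def)
      qed
      have "Pt t (\<lambda>_. 1) x = Pt s (Pt (t - s) (\<lambda>_. 1)) x"
        using Pt_semigroup[of s "t - s" x "\<lambda>_. 1"] s t Suc.prems const_L2 by simp
      also have "\<dots> \<le> Pt s (\<lambda>y. ?G + ?H * indicator (space M - K) y) x"
      proof (rule Pt_mono[OF s(1) Suc.prems(3)])
        show "Pt (t - s) (\<lambda>_. 1) \<in> L2_fun M"
          using s t by (intro Pt_contraction(1)[where k=0] const_L2) auto
        show "(\<lambda>y. ?G + ?H * indicator (space M - K) y) \<in> L2_fun M"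
          by (intro L2_fun_add const_L2 i)
        fix y assume y: "y \<in> space M"
        show "Pt (t - s) (\<lambda>_. 1) y \<le> ?G + ?H * indicator (space M - K) y"
        proof (cases "y \<in> K")
          case True
          have "Pt (t - s) (\<lambda>_. 1) y \<le> D * exp (- lam 0 * (t - s))"
            using s t True by (intro on_K) auto
          also have "\<dots> \<le> ?G" using D0 s lam_pos by (intro mult_left_mono) auto
          finally show ?thesis using True by simp
        next
          case False
          have "Pt (t - s) (\<lambda>_. 1) y \<le> Pt (t - 1) (\<lambda>_. 1) y"
            using s t y by (intro Pt_one_antimono) auto
          also have "\<dots> \<le> ?H" using t Suc.prems y by (intro Suc.IH) auto
          finally show ?thesis using False y D0 by (simp add: add_increasing)
        qed
      qed
      also have "\<dots> = ?G * Pt s (\<lambda>_. 1) x + ?H * Pt s (indicator (space M - K)) x"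
        unfolding Pt_add[OF s(1) Suc.prems(3) const_L2 i] using Pt_scale[of s ?H "indicator (space M - K)" x]
        by (subst Pt_const[of s ?G]) simp
      also have "\<dots> \<le> ?G * 1 + ?H * \<epsilon>"
        using s D0 C0 Suc.prems by (intro add_mono mult_left_mono Pt_one_le_1) auto
      also have "\<dots> = (D * exp (lam 0) + C / 2) * exp (- lam 0 * t)"
      proof -
        have "exp (- lam 0 * (t - 1)) = exp (lam 0) * exp (- lam 0 * t)"
          by (simp add: exp_add[symmetric] algebra_simps)
        moreover have "exp (lam 0) * \<epsilon> = 1 / 2" by (simp add: \<epsilon>_def exp_minus)
        ultimately show ?thesis by (simp add: algebra_simps)
      qed
      also have "\<dots> \<le> C * exp (- lam 0 * t)"
        by (intro mult_right_mono) (auto simp: C_def max_def)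
      finally show ?thesis .
    qed
  qed
  have "Pt t (\<lambda>_. 1) x \<le> C * exp (- lam 0 * t)" if "1 \<le> t" "x \<in> space M" for t x
  proof -
    obtain n :: nat where "t \<le> real n" using real_arch_simple by blast
    then show ?thesis using main[of t n x] that by simp
  qed
  then show ?thesis by blast
qed

text \<open>Removing the component along \<open>\<psi> 0\<close> leaves a function to which
  \<open>Pt_decay\<close> applies with \<open>k = 1\<close>; the removed component evolves exactly,
  by \<open>Pt_psi0\<close>.\<close>

lemma orthogonal_part:
  assumes f: "f \<in> L2_fun M"
  defines "g \<equiv> (\<lambda>y. f y - inner_L2 M f (\<psi> 0) * \<psi> 0 y)"
  shows "g \<in> L2_fun M" "n < 1 \<Longrightarrow> inner_L2 M g (\<psi> n) = 0"
    "t > 0 \<Longrightarrow> x \<in> space M \<Longrightarrow>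
      Pt t f x = Pt t g x + inner_L2 M f (\<psi> 0) * (exp (- lam 0 * t) * ground x)"
proof -
  note s = L2_fun_scale[OF psi_L2, of "inner_L2 M f (\<psi> 0)" 0]
  show g: "g \<in> L2_fun M" unfolding g_def by (intro L2_fun_diff f s)
  show "inner_L2 M g (\<psi> n) = 0" if "n < 1"
    using that complete_orthonormal_inner[OF basis, of 0 0] unfolding g_def
    by (simp add: inner_L2_diff_left[OF f s psi_L2] inner_L2_scale_left)
  assume "t > 0" "x \<in> space M"
  then show "Pt t f x = Pt t g x + inner_L2 M f (\<psi> 0) * (exp (- lam 0 * t) * ground x)"
    using Pt_add[OF _ _ g s, of t x] Pt_psi0[of t x] by (simp add: g_def Pt_scale)
qed

lemma Pt_limit:
  assumes f: "f \<in> L2_fun M" and x: "x \<in> space M" and gap: "lam 0 < lam 1"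
  shows "((\<lambda>t. exp (lam 0 * t) * Pt t f x) \<longlongrightarrow> inner_L2 M f (\<psi> 0) * ground x) at_top"
proof -
  define g where "g = (\<lambda>y. f y - inner_L2 M f (\<psi> 0) * \<psi> 0 y)"
  note g = orthogonal_part[OF f, folded g_def]
  define c where "c = sqrt (p 2 x x) * exp (lam 1) * sqrt (inner_L2 M g g)"
  have "((\<lambda>t. exp (lam 0 * t) * Pt t f x - inner_L2 M f (\<psi> 0) * ground x) \<longlongrightarrow> 0) at_top"
  proof (rule Lim_null_comparison)
    show "\<forall>\<^sub>F t in at_top. norm (exp (lam 0 * t) * Pt t f x - inner_L2 M f (\<psi> 0) * ground x)
        \<le> c * exp (- (lam 1 - lam 0) * t)"
      using eventually_ge_at_top[of 1]
    proof eventually_elim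
      case (elim t)
      have "exp (lam 0 * t) * Pt t f x - inner_L2 M f (\<psi> 0) * ground x = exp (lam 0 * t) * Pt t g x"
        using elim x by (simp add: g(3) algebra_simps exp_minus field_simps)
      then have "norm (exp (lam 0 * t) * Pt t f x - inner_L2 M f (\<psi> 0) * ground x)
          = exp (lam 0 * t) * \<bar>Pt t g x\<bar>" by (simp add: abs_mult)
      also have "\<dots> \<le> exp (lam 0 * t) * (sqrt (p 2 x x) * exp (- lam 1 * (t - 1)) * sqrt (inner_L2 M g g))"
        using elim by (intro mult_left_mono Pt_decay x g(1,2)) auto
      also have "\<dots> = c * (exp (lam 0 * t) * exp (- lam 1 * (t - 1)) * exp (- lam 1))"
        by (simp add: c_def exp_minus)
      also have "\<dots> = c * exp (- (lam 1 - lam 0) * t)"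
        by (simp add: exp_add[symmetric] algebra_simps)
      finally show ?case .
    qed
    show "((\<lambda>t. c * exp (- (lam 1 - lam 0) * t)) \<longlongrightarrow> 0) at_top"
    proof -
      have "filterlim (\<lambda>t. - ((lam 1 - lam 0) * t)) at_bot at_top"
        using gap by (simp add: filterlim_uminus_at_bot filterlim_tendsto_pos_mult_at_top[OF tendsto_const _ filterlim_ident])
      from filterlim_compose[OF exp_at_bot this] show ?thesis
        by (intro tendsto_mult_right_zero) (simp add: algebra_simps)
    qed
  qed
  from tendsto_add[OF this tendsto_const[of "inner_L2 M f (\<psi> 0) * ground x"]]
  show ?thesis by simp
qed

lemma psi0_integral_pos:
  assumes "\<And>x. x \<in> space M \<Longrightarrow> 0 < \<psi> 0 x"
  shows "0 < (\<integral>x. \<psi> 0 x \<partial>M)"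
  using assms by (intro integral_pos L2_fun_integrable[OF finite_measure_axioms psi_L2])

text \<open>Numerator and denominator are both multiplied by \<open>exp (lam 0 * t)\<close>.
  \<open>survival_bound\<close> is the constant majorant for dominated convergence under
  \<open>\<eta>\<close>; in the limit the integral of \<open>ground\<close> is a common factor and
  cancels. It is positive since \<open>ground\<close> dominates \<open>\<psi> 0\<close> at every
  point.\<close>

theorem conditional_limit:
  assumes tail: "\<And>\<epsilon>. \<epsilon> > 0 \<Longrightarrow> \<exists>K B. K \<in> sets M \<and> (\<forall>x\<in>K. p 2 x x \<le> B) \<and>
      (\<forall>x\<in>space M. \<exists>s. 0 < s \<and> s < 1 \<and> Pt s (indicator (space M - K)) x \<le> \<epsilon>)"
    and pos: "\<And>x. x \<in> space M \<Longrightarrow> 0 < \<psi> 0 x"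
    and ground: "\<And>x. x \<in> space M \<Longrightarrow> \<psi> 0 x \<le> ground x"
    and gap: "lam 0 < lam 1"
    and \<eta>: "prob_space \<eta>" "sets \<eta> = sets M"
    and f: "f \<in> borel_measurable M" "\<And>x. x \<in> space M \<Longrightarrow> \<bar>f x\<bar> \<le> 1"
  shows "((\<lambda>t. (\<integral>x. Pt t f x \<partial>\<eta>) / (\<integral>x. Pt t (\<lambda>_. 1) x \<partial>\<eta>))
    \<longlongrightarrow> inner_L2 M f (\<psi> 0) / (\<integral>x. \<psi> 0 x \<partial>M)) at_top"
    and "\<forall>\<^sub>F t in at_top. 0 < (\<integral>x. Pt t (\<lambda>_. 1) x \<partial>\<eta>)"
proof -
  interpret \<eta>: prob_space \<eta> by fact
  have sp: "space \<eta> = space M" by (rule sets_eq_imp_space_eq[OF \<eta>(2)])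
  obtain C where C: "\<And>t x. 1 \<le> t \<Longrightarrow> x \<in> space M \<Longrightarrow> Pt t (\<lambda>_. 1) x \<le> C * exp (- lam 0 * t)"
    using survival_bound[OF tail] by blast
  note ms = measurable_cong_sets[OF \<eta>(2) refl]
  have lim: "((\<lambda>t. \<integral>x. exp (lam 0 * t) * Pt t g x \<partial>\<eta>) \<longlongrightarrow> (\<integral>x. inner_L2 M g (\<psi> 0) * ground x \<partial>\<eta>)) at_top"
    and int: "integrable \<eta> (\<lambda>x. inner_L2 M g (\<psi> 0) * ground x)"
    if g: "g \<in> borel_measurable M" "\<And>x. x \<in> space M \<Longrightarrow> \<bar>g x\<bar> \<le> 1" for g
  proof -
    have gL: "g \<in> L2_fun M" by (rule L2_fun_bounded[OF finite_measure_axioms g])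
    have bd: "\<forall>\<^sub>F t in at_top. AE x in \<eta>. norm (exp (lam 0 * t) * Pt t g x) \<le> C"
      using eventually_ge_at_top[of 1]
    proof eventually_elim
      case (elim t)
      show ?case
      proof (rule AE_I2)
        fix x assume "x \<in> space \<eta>"
        then have x: "x \<in> space M" by (simp add: sp)
        have t: "t > 0" using elim by simp
        have "Pt t g x \<le> Pt t (\<lambda>_. 1) x"
          using g(2) by (intro Pt_mono t x gL const_L2) (auto simp: abs_le_iff)
        moreover have "Pt t (\<lambda>_. -1) x \<le> Pt t g x"
          using g(2) by (intro Pt_mono t x gL const_L2) (fastforce simp: abs_le_iff)
        ultimately have "\<bar>Pt t g x\<bar> \<le> C * exp (- lam 0 * t)"
          using C[OF elim x] Pt_const[of t "-1" x] by (simp add: abs_le_iff)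
        then have "exp (lam 0 * t) * \<bar>Pt t g x\<bar> \<le> exp (lam 0 * t) * (C * exp (- lam 0 * t))"
          by (intro mult_left_mono) auto
        also have "\<dots> = C" by (simp add: exp_minus field_simps)
        finally show "norm (exp (lam 0 * t) * Pt t g x) \<le> C" by (simp add: abs_mult)
      qed
    qed
    have m1: "(\<lambda>x. inner_L2 M g (\<psi> 0) * ground x) \<in> borel_measurable \<eta>"
      using ground_measurable by (simp add: ms)
    \<comment> \<open>Times below 1 are replaced by 1: dominated convergence asks for measurability
      at every real \<open>t\<close>, whereas \<open>Pt_measurable\<close> covers positive times.
      The limit is unaffected.\<close>
    have m2: "(\<lambda>x. exp (lam 0 * (if 1 \<le> t then t else 1)) * Pt (if 1 \<le> t then t else 1) g x) \<in> borel_measurable \<eta>" for t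
      unfolding ms by (intro borel_measurable_times borel_measurable_const Pt_measurable gL) auto
    have bd': "\<forall>\<^sub>F t in at_top. AE x in \<eta>. norm (exp (lam 0 * (if 1 \<le> t then t else 1)) * Pt (if 1 \<le> t then t else 1) g x) \<le> C"
      using bd eventually_ge_at_top[of 1] by eventually_elim simp
    have l': "AE x in \<eta>. ((\<lambda>t. exp (lam 0 * (if 1 \<le> t then t else 1)) * Pt (if 1 \<le> t then t else 1) g x)
        \<longlongrightarrow> inner_L2 M g (\<psi> 0) * ground x) at_top"
    proof (rule AE_I2)
      fix x assume "x \<in> space \<eta>"
      then have x: "x \<in> space M" by (simp add: sp)
      show "((\<lambda>t. exp (lam 0 * (if 1 \<le> t then t else 1)) * Pt (if 1 \<le> t then t else 1) g x)
        \<longlongrightarrow> inner_L2 M g (\<psi> 0) * ground x) at_top"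
        by (rule Lim_transform_eventually[OF Pt_limit[OF gL x gap]],
          use eventually_ge_at_top[of 1] in eventually_elim) simp
    qed
    have ic: "integrable \<eta> (\<lambda>_. C)" by simp
    show "integrable \<eta> (\<lambda>x. inner_L2 M g (\<psi> 0) * ground x)"
      by (rule integrable_dominated_convergence_at_top[OF m1 m2 ic l' bd'])
    have "((\<lambda>t. \<integral>x. exp (lam 0 * (if 1 \<le> t then t else 1)) * Pt (if 1 \<le> t then t else 1) g x \<partial>\<eta>)
        \<longlongrightarrow> (\<integral>x. inner_L2 M g (\<psi> 0) * ground x \<partial>\<eta>)) at_top"
      by (rule integral_dominated_convergence_at_top[OF m1 m2 ic l' bd'])
    then show "((\<lambda>t. \<integral>x. exp (lam 0 * t) * Pt t g x \<partial>\<eta>) \<longlongrightarrow> (\<integral>x. inner_L2 M g (\<psi> 0) * ground x \<partial>\<eta>)) at_top"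
      by (rule Lim_transform_eventually, use eventually_ge_at_top[of 1] in eventually_elim) simp
  qed
  define c0 where "c0 = (\<integral>x. \<psi> 0 x \<partial>M)"
  have c0: "c0 > 0" unfolding c0_def by (rule psi0_integral_pos[OF pos])
  have one: "inner_L2 M (\<lambda>_. 1) (\<psi> 0) = c0" by (simp add: inner_L2_def c0_def)
  have i: "integrable \<eta> ground" using int[of "\<lambda>_. 1"] c0 by (simp add: one)
  have "0 < ground x" if "x \<in> space \<eta>" for x
    using pos[of x] ground[of x] that by (simp add: sp)
  then have gpos0: "0 < (\<integral>x. ground x \<partial>\<eta>)" by (rule \<eta>.integral_pos[OF i])
  then have gpos: "(\<integral>x. ground x \<partial>\<eta>) \<noteq> 0" by simp
  have "((\<lambda>t. (\<integral>x. exp (lam 0 * t) * Pt t f x \<partial>\<eta>) / (\<integral>x. exp (lam 0 * t) * Pt t (\<lambda>_. 1) x \<partial>\<eta>))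
      \<longlongrightarrow> (\<integral>x. inner_L2 M f (\<psi> 0) * ground x \<partial>\<eta>) / (\<integral>x. inner_L2 M (\<lambda>_. 1) (\<psi> 0) * ground x \<partial>\<eta>)) at_top"
    using c0 gpos by (intro tendsto_divide lim f) (auto simp: one)
  then show "((\<lambda>t. (\<integral>x. Pt t f x \<partial>\<eta>) / (\<integral>x. Pt t (\<lambda>_. 1) x \<partial>\<eta>))
    \<longlongrightarrow> inner_L2 M f (\<psi> 0) / (\<integral>x. \<psi> 0 x \<partial>M)) at_top"
    using c0 gpos by (simp add: one c0_def[symmetric])
  have "\<forall>\<^sub>F t in at_top. 0 < (\<integral>x. exp (lam 0 * t) * Pt t (\<lambda>_. 1) x \<partial>\<eta>)"
    by (rule order_tendstoD(1)[OF lim]) (use c0 gpos0 in \<open>simp_all add: one\<close>)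
  then show "\<forall>\<^sub>F t in at_top. 0 < (\<integral>x. Pt t (\<lambda>_. 1) x \<partial>\<eta>)"
    by (auto elim!: eventually_mono simp: zero_less_mult_iff)
qed

text \<open>\<open>T\<close> plays the part of the total variation distance between
  \<open>\<eta>\<close> and the normalised ground state, expressed by test functions. After
  subtracting its mean under that state, \<open>f\<close> becomes orthogonal to
  \<open>\<psi> 0\<close>; so its image decays at rate \<open>lam 1\<close>, while survival decays
  no faster than at rate \<open>lam 0\<close>. The bound \<open>L\<close> is exported because time 0
  is treated separately later.\<close>

theorem conditional_rate:
  assumes B: "\<And>x. x \<in> space M \<Longrightarrow> p 2 x x \<le> B"
    and pos: "\<And>x. x \<in> space M \<Longrightarrow> 0 < \<psi> 0 x"
    and ground: "\<And>x. x \<in> space M \<Longrightarrow> \<psi> 0 x \<le> ground x"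
    and gap: "lam 0 < lam 1"
  shows "\<exists>L C. 0 \<le> C \<and> (\<forall>x\<in>space M. \<psi> 0 x \<le> L) \<and>
    (\<forall>\<eta> T t f. prob_space \<eta> \<longrightarrow> sets \<eta> = sets M \<longrightarrow>
      (\<forall>g\<in>borel_measurable M. (\<forall>x\<in>space M. \<bar>g x\<bar> \<le> 1) \<longrightarrow>
        \<bar>(\<integral>x. g x \<partial>\<eta>) - inner_L2 M g (\<psi> 0) / (\<integral>x. \<psi> 0 x \<partial>M)\<bar> \<le> T) \<longrightarrow>
      0 < t \<longrightarrow> f \<in> borel_measurable M \<longrightarrow> (\<forall>x\<in>space M. \<bar>f x\<bar> \<le> 1) \<longrightarrow>
      0 < (\<integral>x. Pt t (\<lambda>_. 1) x \<partial>\<eta>) \<and>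
      \<bar>(\<integral>x. Pt t f x \<partial>\<eta>) / (\<integral>x. Pt t (\<lambda>_. 1) x \<partial>\<eta>) - inner_L2 M f (\<psi> 0) / (\<integral>x. \<psi> 0 x \<partial>M)\<bar>
        \<le> C * exp (- (lam 1 - lam 0) * t) * T / (\<integral>x. \<psi> 0 x \<partial>\<eta>))"
proof -
  define c0 where "c0 = (\<integral>x. \<psi> 0 x \<partial>M)"
  have c0: "c0 > 0" unfolding c0_def by (rule psi0_integral_pos[OF pos])
  have one: "inner_L2 M (\<lambda>_. 1) (\<psi> 0) = c0" by (simp add: inner_L2_def c0_def)
  obtain x0 where x0: "x0 \<in> space M" using not_empty by blast
  have B0: "0 \<le> B" using p_nonneg[of 2 x0 x0] B[OF x0] x0 by simp
  \<comment> \<open>At time 1, \<open>Pt_decay\<close> with \<open>k = 0\<close> bounds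
    \<open>ground\<close>, since \<open>\<psi> 0\<close> has norm 1.\<close>
  define L where "L = exp (lam 0) * sqrt B"
  have L: "\<psi> 0 x \<le> L" if x: "x \<in> space M" for x
  proof -
    have "\<psi> 0 x \<le> exp (lam 0) * Pt 1 (\<psi> 0) x" using ground[OF x] by (simp add: ground_def)
    also have "\<dots> \<le> exp (lam 0) * (sqrt (p 2 x x) * exp (- lam 0 * (1 - 1)) * sqrt (inner_L2 M (\<psi> 0) (\<psi> 0)))"
      using Pt_decay[of 1 x "\<psi> 0" 0] x psi_L2 by (intro mult_left_mono) auto
    also have "\<dots> \<le> L"
      using B[OF x] complete_orthonormal_inner[OF basis, of 0 0] by (simp add: L_def)
    finally show ?thesis .
  qed
  have L0: "0 < L" using L[OF x0] pos[OF x0] by simp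
  \<comment> \<open>\<open>2 * sqrt B\<close> comes from \<open>Pt_decay\<close> for
    \<open>t \<ge> 1\<close>, where a function bounded by 2 has norm at most 2. The summand 2 is the
    trivial bound for \<open>t < 1\<close>, and \<open>exp (lam 1)\<close> compensates the shift of
    time by 1.\<close>
  define C1 where "C1 = (2 * sqrt B + 2) * exp (lam 1)"
  have lam1: "0 < lam 1" using gap lam_pos by simp
  have C1: "0 \<le> C1" using B0 by (simp add: C1_def)
  have sup_bound: "\<bar>Pt t g x\<bar> \<le> C1 * exp (- lam 1 * t)"
    if t: "0 < t" and x: "x \<in> space M" and g: "g \<in> borel_measurable M" "\<And>y. y \<in> space M \<Longrightarrow> \<bar>g y\<bar> \<le> 2"
      and orth: "inner_L2 M g (\<psi> 0) = 0" for t x g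
  proof (cases "1 \<le> t")
    case True
    have gL: "g \<in> L2_fun M" by (rule L2_fun_bounded[OF finite_measure_axioms g])
    have "inner_L2 M g g \<le> (\<integral>x. 4 \<partial>M)"
      unfolding inner_L2_def using gL
    proof (intro integral_mono L2_fun_mult_integrable)
      fix y assume "y \<in> space M"
      then have "\<bar>g y\<bar> * \<bar>g y\<bar> \<le> 2 * 2" using g(2) by (intro mult_mono) auto
      then show "g y * g y \<le> 4" by (simp add: abs_mult[symmetric])
    qed auto
    then have g4: "sqrt (inner_L2 M g g) \<le> 2" by (intro real_le_lsqrt) (auto simp: prob_space)
    have "\<bar>Pt t g x\<bar> \<le> sqrt (p 2 x x) * exp (- lam 1 * (t - 1)) * sqrt (inner_L2 M g g)"
      by (rule Pt_decay[OF True x gL]) (simp add: orth)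
    also have "\<dots> \<le> sqrt B * exp (- lam 1 * (t - 1)) * 2"
      using B[OF x] B0 g4 by (intro mult_mono) (auto simp: inner_L2_nonneg)
    also have "\<dots> = 2 * sqrt B * exp (lam 1) * exp (- lam 1 * t)"
      by (simp add: algebra_simps exp_add[symmetric])
    also have "\<dots> \<le> C1 * exp (- lam 1 * t)" by (simp add: C1_def algebra_simps)
    finally show ?thesis .
  next
    case False
    have "\<bar>Pt t g x\<bar> \<le> 2" by (rule Pt_bounded[OF t x g])
    also have "2 \<le> 2 * exp (lam 1) * exp (- lam 1 * t)"
      using False lam1 by (simp add: exp_add[symmetric])
    also have "\<dots> \<le> C1 * exp (- lam 1 * t)" using B0 by (simp add: C1_def algebra_simps)
    finally show ?thesis .
  qed
  \<comment> \<open>Self-adjointness of the operator moves it onto \<open>\<psi> 0\<close>; in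
    particular orthogonality to \<open>\<psi> 0\<close> is preserved in time.\<close>
  have ortho_Pt: "inner_L2 M (Pt t g) (\<psi> 0) = exp (- lam 0 * t) * inner_L2 M g (\<psi> 0)"
    if t: "0 < t" and g: "g \<in> L2_fun M" for t g
  proof -
    interpret MM: pair_sigma_finite M M ..
    have [measurable]: "(\<lambda>w. p t (fst w) (snd w)) \<in> borel_measurable (M \<Otimes>\<^sub>M M)"
      using kernel_joint_measurable[OF t] by (simp add: case_prod_beta')
    note [measurable] = L2_fun_measurable[OF g] L2_fun_measurable[OF psi_L2]
    let ?h = "\<lambda>x y. p t x y * g y * \<psi> 0 x"
    have absg: "(\<lambda>y. \<bar>g y\<bar>) \<in> L2_fun M" using g by (simp add: L2_fun_def)
    have int: "integrable (M \<Otimes>\<^sub>M M) (\<lambda>(x, y). ?h x y)"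
    proof (rule integrableI_bounded)
      show "(\<lambda>(x, y). ?h x y) \<in> borel_measurable (M \<Otimes>\<^sub>M M)" by (simp add: case_prod_beta')
      have m: "(\<lambda>w. ennreal (norm (case w of (x, y) \<Rightarrow> ?h x y))) \<in> borel_measurable (M \<Otimes>\<^sub>M M)"
        by (simp add: case_prod_beta')
      have "(\<integral>\<^sup>+ w. ennreal (norm (case w of (x, y) \<Rightarrow> ?h x y)) \<partial>(M \<Otimes>\<^sub>M M))
          = (\<integral>\<^sup>+ x. \<integral>\<^sup>+ y. ennreal (norm (?h x y)) \<partial>M \<partial>M)"
        using nn_integral_fst[OF m] by simp
      also have "\<dots> = (\<integral>\<^sup>+ x. ennreal (Pt t (\<lambda>y. \<bar>g y\<bar>) x * \<psi> 0 x) \<partial>M)"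
      proof (rule nn_integral_cong)
        fix x assume x: "x \<in> space M"
        have "(\<integral>\<^sup>+ y. ennreal (norm (?h x y)) \<partial>M) = (\<integral>\<^sup>+ y. ennreal (p t x y * \<bar>g y\<bar> * \<psi> 0 x) \<partial>M)"
          using t x pos[OF x] by (intro nn_integral_cong) (simp add: abs_mult p_nonneg)
        also have "\<dots> = ennreal (\<integral>y. p t x y * \<bar>g y\<bar> * \<psi> 0 x \<partial>M)"
          using t x pos[OF x]
          by (intro nn_integral_eq_integral integrable_mult_left L2_fun_mult_integrable kernel_L2 absg)
            (auto intro!: AE_I2 mult_nonneg_nonneg p_nonneg simp: less_imp_le)
        finally show "(\<integral>\<^sup>+ y. ennreal (norm (?h x y)) \<partial>M) = ennreal (Pt t (\<lambda>y. \<bar>g y\<bar>) x * \<psi> 0 x)"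
          by (simp add: Pt_def)
      qed
      also have "\<dots> < \<infinity>"
      proof -
        have "integrable M (\<lambda>x. Pt t (\<lambda>y. \<bar>g y\<bar>) x * \<psi> 0 x)"
          by (intro L2_fun_mult_integrable psi_L2 Pt_contraction(1)[where k=0] t absg) simp
        then have "(\<integral>\<^sup>+ x. ennreal (norm (Pt t (\<lambda>y. \<bar>g y\<bar>) x * \<psi> 0 x)) \<partial>M) < \<infinity>"
          by (simp add: integrable_iff_bounded)
        moreover have "(\<integral>\<^sup>+ x. ennreal (Pt t (\<lambda>y. \<bar>g y\<bar>) x * \<psi> 0 x) \<partial>M)
            \<le> (\<integral>\<^sup>+ x. ennreal (norm (Pt t (\<lambda>y. \<bar>g y\<bar>) x * \<psi> 0 x)) \<partial>M)"
          by (intro nn_integral_mono ennreal_leI) simp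
        ultimately show ?thesis by (rule le_less_trans[rotated])
      qed
      finally show "(\<integral>\<^sup>+ w. ennreal (norm (case w of (x, y) \<Rightarrow> ?h x y)) \<partial>(M \<Otimes>\<^sub>M M)) < \<infinity>" .
    qed
    have "inner_L2 M (Pt t g) (\<psi> 0) = (\<integral>x. (\<integral>y. ?h x y \<partial>M) \<partial>M)"
      by (simp add: inner_L2_def Pt_def)
    also have "\<dots> = (\<integral>y. (\<integral>x. ?h x y \<partial>M) \<partial>M)"
      by (rule MM.Fubini_integral[symmetric, OF int])
    also have "\<dots> = (\<integral>y. g y * Pt t (\<psi> 0) y \<partial>M)"
    proof (intro Bochner_Integration.integral_cong refl)
      fix y assume y: "y \<in> space M"
      have "(\<integral>x. ?h x y \<partial>M) = (\<integral>x. g y * (p t y x * \<psi> 0 x) \<partial>M)"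
        by (intro Bochner_Integration.integral_cong) (simp_all add: p_symmetric t y)
      then show "(\<integral>x. ?h x y \<partial>M) = g y * Pt t (\<psi> 0) y" by (simp add: Pt_def)
    qed
    also have "\<dots> = (\<integral>y. exp (- lam 0 * t) * (g y * \<psi> 0 y) \<partial>M)"
    proof (rule integral_cong_AE)
      have [measurable]: "Pt t (\<psi> 0) \<in> borel_measurable M" by (intro Pt_measurable t psi_L2)
      show "(\<lambda>y. g y * Pt t (\<psi> 0) y) \<in> borel_measurable M" by measurable
      show "(\<lambda>y. exp (- lam 0 * t) * (g y * \<psi> 0 y)) \<in> borel_measurable M" by measurable
      show "AE y in M. g y * Pt t (\<psi> 0) y = exp (- lam 0 * t) * (g y * \<psi> 0 y)"
        using eigen[OF t, of 0] by eventually_elim (simp add: Pt_def)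
    qed
    finally show ?thesis by (simp add: inner_L2_def)
  qed
  define C where "C = C1 * L"
  have main: "0 < (\<integral>x. Pt t (\<lambda>_. 1) x \<partial>\<eta>) \<and>
      \<bar>(\<integral>x. Pt t f x \<partial>\<eta>) / (\<integral>x. Pt t (\<lambda>_. 1) x \<partial>\<eta>) - inner_L2 M f (\<psi> 0) / c0\<bar>
        \<le> C * exp (- (lam 1 - lam 0) * t) * T / (\<integral>x. \<psi> 0 x \<partial>\<eta>)"
    if \<eta>: "prob_space \<eta>" "sets \<eta> = sets M"
      and T: "\<And>g. g \<in> borel_measurable M \<Longrightarrow> (\<And>x. x \<in> space M \<Longrightarrow> \<bar>g x\<bar> \<le> 1) \<Longrightarrow>
        \<bar>(\<integral>x. g x \<partial>\<eta>) - inner_L2 M g (\<psi> 0) / c0\<bar> \<le> T"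
      and t: "0 < t" and f: "f \<in> borel_measurable M" "\<And>x. x \<in> space M \<Longrightarrow> \<bar>f x\<bar> \<le> 1"
    for \<eta> T t f
  proof -
    interpret \<eta>: prob_space \<eta> by fact
    have sp: "space \<eta> = space M" by (rule sets_eq_imp_space_eq[OF \<eta>(2)])
    note ms = measurable_cong_sets[OF \<eta>(2) refl]
    have T0: "0 \<le> T" using order_trans[OF abs_ge_zero T[of "\<lambda>_. 0"]] by simp
    have fL: "f \<in> L2_fun M" by (rule L2_fun_bounded[OF finite_measure_axioms f])
    have int: "integrable \<eta> (Pt t g)"
      if g: "g \<in> borel_measurable M" "\<And>x. x \<in> space M \<Longrightarrow> \<bar>g x\<bar> \<le> b" for g b
    proof (rule \<eta>.integrable_const_bound[where B=b])
      show "AE x in \<eta>. norm (Pt t g x) \<le> b"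
        using Pt_bounded[OF t _ g] by (auto simp: sp)
      show "Pt t g \<in> borel_measurable \<eta>"
        unfolding ms by (intro Pt_measurable t L2_fun_bounded[OF finite_measure_axioms g])
    qed
    have psi_int: "integrable \<eta> (\<psi> 0)"
      using L pos by (intro \<eta>.integrable_const_bound[where B=L])
        (auto simp: sp ms L2_fun_measurable psi_L2 abs_of_pos)
    define D where "D = (\<integral>x. Pt t (\<lambda>_. 1) x \<partial>\<eta>)"
    define e where "e = (\<integral>x. \<psi> 0 x \<partial>\<eta>)"
    have e0: "0 < e" unfolding e_def using pos by (intro \<eta>.integral_pos psi_int) (simp add: sp)
    \<comment> \<open>Since \<open>\<psi> 0 \<le> L\<close>, survival is at least
      \<open>Pt t (\<psi> 0) x / L\<close>, that is \<open>exp (- lam 0 * t) * ground x / L\<close>,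
      and \<open>ground\<close> dominates \<open>\<psi> 0\<close>. This is the origin of the
      denominator in the final estimate.\<close>
    have De: "exp (- lam 0 * t) * e / L \<le> D"
    proof -
      have "exp (- lam 0 * t) * e / L = (\<integral>x. exp (- lam 0 * t) / L * \<psi> 0 x \<partial>\<eta>)"
        by (simp add: e_def)
      also have "\<dots> \<le> D"
        unfolding D_def
      proof (rule integral_mono)
        show "integrable \<eta> (\<lambda>x. exp (- lam 0 * t) / L * \<psi> 0 x)" using psi_int by simp
        show "integrable \<eta> (Pt t (\<lambda>_. 1))" using int[of "\<lambda>_. 1" 1] by simp
        fix x assume "x \<in> space \<eta>"
        then have x: "x \<in> space M" by (simp add: sp)
        have "exp (- lam 0 * t) * \<psi> 0 x \<le> exp (- lam 0 * t) * ground x"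
          using ground[OF x] by simp
        also have "\<dots> = Pt t (\<psi> 0) x" using Pt_psi0[OF t x] by simp
        also have "\<dots> \<le> Pt t (\<lambda>_. L) x" using L by (intro Pt_mono t x psi_L2 const_L2)
        also have "\<dots> = L * Pt t (\<lambda>_. 1) x" by (rule Pt_const)
        finally show "exp (- lam 0 * t) / L * \<psi> 0 x \<le> Pt t (\<lambda>_. 1) x"
          using L0 by (simp add: field_simps)
      qed
      finally show ?thesis .
    qed
    have D0: "0 < D" using De e0 L0 by (intro less_le_trans[OF _ De]) auto
    define n where "n = inner_L2 M f (\<psi> 0) / c0"
    have n1: "\<bar>n\<bar> \<le> 1"
    proof -
      have "\<bar>inner_L2 M f (\<psi> 0)\<bar> \<le> (\<integral>x. \<bar>f x * \<psi> 0 x\<bar> \<partial>M)" unfolding inner_L2_def by simp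
      also have "\<dots> \<le> c0" unfolding c0_def
      proof (rule integral_mono)
        show "integrable M (\<lambda>x. \<bar>f x * \<psi> 0 x\<bar>)"
          by (intro integrable_abs L2_fun_mult_integrable fL psi_L2)
        show "integrable M (\<psi> 0)" by (rule L2_fun_integrable[OF finite_measure_axioms psi_L2])
        show "\<bar>f x * \<psi> 0 x\<bar> \<le> \<psi> 0 x" if "x \<in> space M" for x
          using f(2)[OF that] pos[OF that] mult_right_mono[of "\<bar>f x\<bar>" 1 "\<psi> 0 x"] by (simp add: abs_mult)
      qed
      finally show ?thesis using c0 by (simp add: n_def)
    qed
    define g where "g = (\<lambda>x. f x - n)"
    have gm: "g \<in> borel_measurable M" unfolding g_def using f by measurable
    have g2: "\<bar>g x\<bar> \<le> 2" if "x \<in> space M" for x using f(2)[OF that] n1 by (simp add: g_def abs_le_iff)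
    have gL: "g \<in> L2_fun M" by (rule L2_fun_bounded[OF finite_measure_axioms gm g2])
    have g_orth: "inner_L2 M g (\<psi> 0) = 0"
      unfolding g_def using c0 inner_L2_scale_left[of M n "\<lambda>_. 1" "\<psi> 0"]
      by (subst inner_L2_diff_left[OF fL const_L2 psi_L2]) (simp add: one n_def)
    have num: "(\<integral>x. Pt t g x \<partial>\<eta>) = (\<integral>x. Pt t f x \<partial>\<eta>) - n * D"
    proof -
      have "(\<integral>x. Pt t g x \<partial>\<eta>) = (\<integral>x. Pt t f x + (- n) * Pt t (\<lambda>_. 1) x \<partial>\<eta>)"
      proof (intro Bochner_Integration.integral_cong refl)
        fix x assume "x \<in> space \<eta>"
        then show "Pt t g x = Pt t f x + (- n) * Pt t (\<lambda>_. 1) x"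
          using Pt_add[OF t _ fL const_L2, of x "- n"] Pt_const[of t "- n" x] by (simp add: sp g_def)
      qed
      also have "\<dots> = (\<integral>x. Pt t f x \<partial>\<eta>) + (- n) * D"
        unfolding D_def using int[OF f] int[of "\<lambda>_. 1" 1] by (subst Bochner_Integration.integral_add) auto
      finally show ?thesis by simp
    qed
    define b where "b = C1 * exp (- lam 1 * t)"
    have b0: "0 \<le> b" by (simp add: b_def C1)
    \<comment> \<open>The factor \<open>T\<close> is gained here: \<open>Pt t g / b\<close> is an
      admissible test function, and being orthogonal to \<open>\<psi> 0\<close> it has mean 0 under
      the normalised ground state.\<close>
    have numb: "\<bar>\<integral>x. Pt t g x \<partial>\<eta>\<bar> \<le> b * T"
    proof -
      have gb: "\<bar>Pt t g x\<bar> \<le> b" if "x \<in> space M" for x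
        unfolding b_def by (rule sup_bound[OF t that gm g2 g_orth])
      show ?thesis
      proof (cases "b = 0")
        case True
        then have "(\<integral>x. Pt t g x \<partial>\<eta>) = (\<integral>x. 0 \<partial>\<eta>)"
          using gb by (intro Bochner_Integration.integral_cong) (auto simp: sp)
        then show ?thesis using True by simp
      next
        case False
        then have bp: "b > 0" using b0 by simp
        have m: "(\<lambda>x. Pt t g x / b) \<in> borel_measurable M"
          by (intro borel_measurable_divide borel_measurable_const Pt_measurable t gL)
        have "\<bar>(\<integral>x. Pt t g x / b \<partial>\<eta>) - inner_L2 M (\<lambda>x. Pt t g x / b) (\<psi> 0) / c0\<bar> \<le> T"
          using gb bp by (intro T m) (simp add: abs_divide)
        moreover have "inner_L2 M (\<lambda>x. Pt t g x / b) (\<psi> 0) = 0"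
          using inner_L2_scale_left[of M "1 / b" "Pt t g" "\<psi> 0"] ortho_Pt[OF t gL] g_orth by simp
        ultimately show ?thesis using bp by (simp add: abs_divide field_simps)
      qed
    qed
    have "\<bar>(\<integral>x. Pt t f x \<partial>\<eta>) / D - n\<bar> = \<bar>\<integral>x. Pt t g x \<partial>\<eta>\<bar> / D"
    proof -
      have "(\<integral>x. Pt t f x \<partial>\<eta>) / D - n = (\<integral>x. Pt t g x \<partial>\<eta>) / D"
        using D0 by (simp add: num diff_divide_distrib)
      then show ?thesis using D0 by (simp add: abs_divide)
    qed
    also have "\<dots> \<le> b * T / D" using numb D0 by (intro divide_right_mono) auto
    also have "\<dots> \<le> b * T / (exp (- lam 0 * t) * e / L)"
      using De b0 T0 e0 L0 D0 by (intro divide_left_mono) (auto intro!: mult_pos_pos divide_pos_pos)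
    also have "\<dots> = C * (exp (- lam 1 * t) / exp (- lam 0 * t)) * T / e"
      using L0 e0 by (simp add: b_def C_def field_simps)
    also have "exp (- lam 1 * t) / exp (- lam 0 * t) = exp (- (lam 1 - lam 0) * t)"
      by (simp add: exp_diff[symmetric] algebra_simps)
    finally show ?thesis using D0 by (simp add: D_def n_def e_def)
  qed
  have "0 \<le> C" using C1 L0 by (simp add: C_def)
  moreover have "\<forall>x\<in>space M. \<psi> 0 x \<le> L" using L by blast
  moreover have "\<forall>\<eta> T t f. prob_space \<eta> \<longrightarrow> sets \<eta> = sets M \<longrightarrow>
      (\<forall>g\<in>borel_measurable M. (\<forall>x\<in>space M. \<bar>g x\<bar> \<le> 1) \<longrightarrow>
        \<bar>(\<integral>x. g x \<partial>\<eta>) - inner_L2 M g (\<psi> 0) / c0\<bar> \<le> T) \<longrightarrow>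
      0 < t \<longrightarrow> f \<in> borel_measurable M \<longrightarrow> (\<forall>x\<in>space M. \<bar>f x\<bar> \<le> 1) \<longrightarrow>
      0 < (\<integral>x. Pt t (\<lambda>_. 1) x \<partial>\<eta>) \<and>
      \<bar>(\<integral>x. Pt t f x \<partial>\<eta>) / (\<integral>x. Pt t (\<lambda>_. 1) x \<partial>\<eta>) - inner_L2 M f (\<psi> 0) / c0\<bar>
        \<le> C * exp (- (lam 1 - lam 0) * t) * T / (\<integral>x. \<psi> 0 x \<partial>\<eta>)"
    by (intro allI impI, rule main) simp_all
  ultimately show ?thesis unfolding c0_def by (intro exI[of _ L] exI[of _ C] conjI)
qed

end

section \<open>The symmetric stable law and its potential kernel\<close>

text \<open>One integrable majorant, up to constants, for the Fourier integrands below: bounded near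
  0 and of order \<open>\<bar>\<theta>\<bar> powr (- \<alpha>)\<close> at infinity, where
  \<open>1 < \<alpha>\<close> enters.\<close>

definition tail_majorant :: "real \<Rightarrow> real \<Rightarrow> real" where
  "tail_majorant \<alpha> \<theta> = (if \<bar>\<theta>\<bar> \<le> 1 then 1 else \<bar>\<theta>\<bar> powr (- \<alpha>))"

lemma tail_majorant_measurable [measurable]: "tail_majorant \<alpha> \<in> borel_measurable borel"
  unfolding tail_majorant_def[abs_def] by measurable

lemma tail_majorant_nonneg: "0 \<le> tail_majorant \<alpha> \<theta>"
  by (simp add: tail_majorant_def)

lemma integrable_tail_majorant:
  assumes "1 < \<alpha>"
  shows "integrable lborel (tail_majorant \<alpha>)"
proof -
  define h where "h \<theta> = indicator {1..} \<theta> * \<theta> powr (- \<alpha>)" for \<theta> :: real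
  have [measurable]: "h \<in> borel_measurable borel" unfolding h_def[abs_def] by measurable
  have "(\<integral>\<^sup>+ \<theta>. ennreal (\<theta> powr (- \<alpha>)) * indicator {1..} \<theta> \<partial>lborel)
      = ennreal (0 - - (1 powr (1 - \<alpha>) / (\<alpha> - 1)))"
  proof (rule nn_integral_FTC_atLeast[where F="\<lambda>x. - (x powr (1 - \<alpha>) / (\<alpha> - 1))"])
    show "((\<lambda>x. - (x powr (1 - \<alpha>) / (\<alpha> - 1))) has_real_derivative x powr (- \<alpha>)) (at x)" if "1 \<le> x" for x
    proof -
      have "((\<lambda>x. - (x powr (1 - \<alpha>) / (\<alpha> - 1))) has_real_derivative
          - (((1 - \<alpha>) * x powr (1 - \<alpha> - 1)) / (\<alpha> - 1))) (at x)"
        using that by (intro DERIV_minus DERIV_cdivide has_real_derivative_powr) auto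
      moreover have "- (((1 - \<alpha>) * x powr (1 - \<alpha> - 1)) / (\<alpha> - 1)) = x powr (- \<alpha>)"
        using assms by (simp add: field_simps)
      ultimately show ?thesis by simp
    qed
    have "((\<lambda>x. x powr (1 - \<alpha>)) \<longlongrightarrow> 0) at_top"
      using assms by (intro tendsto_neg_powr filterlim_ident) auto
    then show "((\<lambda>x. - (x powr (1 - \<alpha>) / (\<alpha> - 1))) \<longlongrightarrow> 0) at_top"
      using assms tendsto_minus[OF tendsto_divide[OF _ tendsto_const, of "\<lambda>x. x powr (1 - \<alpha>)" 0 at_top "\<alpha> - 1"]] by simp
  qed auto
  then have "(\<integral>\<^sup>+ \<theta>. ennreal (norm (h \<theta>)) \<partial>lborel) < \<infinity>"
    by (simp add: h_def indicator_mult_ennreal abs_mult mult.commute)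
  then have h: "integrable lborel h" by (intro integrableI_bounded) auto
  have h': "integrable lborel (\<lambda>\<theta>. h (0 + (- 1) * \<theta>))"
    by (rule lborel_integrable_real_affine[OF h]) simp
  have "integrable lborel (\<lambda>\<theta>. indicator {-1..1} \<theta> + h \<theta> + h (0 + (- 1) * \<theta>))"
    by (intro Bochner_Integration.integrable_add h h') auto
  then show ?thesis
    by (rule Bochner_Integration.integrable_bound)
      (auto simp: tail_majorant_def h_def indicator_def abs_if)
qed

lemma one_minus_cos_bounds: "0 \<le> 1 - cos x" "1 - cos x \<le> 2" "1 - cos x \<le> x\<^sup>2 / (2::real)"
proof -
  show "0 \<le> 1 - cos x" "1 - cos x \<le> 2" using cos_le_one[of x] cos_ge_minus_one[of x] by auto
  have "1 - cos x = 2 * (sin (x / 2))\<^sup>2" using cos_double_sin[of "x/2"] by simp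
  also have "(sin (x / 2))\<^sup>2 \<le> (x / 2)\<^sup>2"
    using abs_sin_x_le_abs_x[of "x/2"] by (simp only: abs_le_square_iff)
  finally show "1 - cos x \<le> x\<^sup>2 / 2" by (simp add: power2_eq_square)
qed

text \<open>Near the origin \<open>1 - cos \<theta> \<le> \<theta>\<^sup>2 / 2\<close> beats the
  singularity because \<open>\<alpha> < 2\<close>; away from it the cosine factor is at most
  2.\<close>

lemma cos_kernel_bound:
  assumes "1 < \<alpha>" "\<alpha> < 2"
  shows "(1 - cos \<theta>) * \<bar>\<theta>\<bar> powr (- \<alpha>) \<le> 2 * tail_majorant \<alpha> \<theta>"
proof (cases "\<bar>\<theta>\<bar> \<le> 1")
  case True
  show ?thesis
  proof (cases "\<theta> = 0")
    case False
    have "(1 - cos \<theta>) * \<bar>\<theta>\<bar> powr (- \<alpha>) \<le> (\<theta>\<^sup>2 / 2) * \<bar>\<theta>\<bar> powr (- \<alpha>)"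
      by (intro mult_right_mono one_minus_cos_bounds) auto
    also have "\<theta>\<^sup>2 = \<bar>\<theta>\<bar> powr 2" using False by (simp add: powr_numeral)
    also have "\<bar>\<theta>\<bar> powr 2 / 2 * \<bar>\<theta>\<bar> powr (- \<alpha>) = \<bar>\<theta>\<bar> powr (2 - \<alpha>) / 2"
      using powr_add[of "\<bar>\<theta>\<bar>" 2 "- \<alpha>"] by simp
    also have "\<dots> \<le> 1" using powr_mono'[of 0 "2 - \<alpha>" "\<bar>\<theta>\<bar>"] True False assms by simp
    finally show ?thesis using True by (simp add: tail_majorant_def)
  qed (simp add: tail_majorant_nonneg)
next
  case False
  then show ?thesis using mult_right_mono[OF one_minus_cos_bounds(2), of "\<bar>\<theta>\<bar> powr (- \<alpha>)" \<theta>]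
    by (simp add: tail_majorant_def)
qed

lemma exp_majorant_bound:
  assumes "0 < s" "0 < \<alpha>"
  shows "exp (- s * \<bar>\<theta>\<bar> powr \<alpha>) \<le> max 1 (1 / s) * tail_majorant \<alpha> \<theta>"
proof (cases "\<bar>\<theta>\<bar> \<le> 1")
  case True
  have "exp (- s * \<bar>\<theta>\<bar> powr \<alpha>) \<le> 1" using assms by simp
  also have "1 \<le> max 1 (1 / s)" by simp
  finally show ?thesis using True by (simp add: tail_majorant_def)
next
  case False
  define y where "y = s * \<bar>\<theta>\<bar> powr \<alpha>"
  have y: "0 < y" using False assms by (simp add: y_def)
  have "y \<le> exp y" using exp_ge_add_one_self[of y] by linarith
  then have "exp (- y) \<le> 1 / y" using y by (simp add: exp_minus field_simps)
  also have "\<dots> = 1 / s * \<bar>\<theta>\<bar> powr (- \<alpha>)" by (simp add: y_def powr_minus field_simps)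
  also have "\<dots> \<le> max 1 (1 / s) * \<bar>\<theta>\<bar> powr (- \<alpha>)" by (intro mult_right_mono) auto
  finally show ?thesis using False by (simp add: tail_majorant_def y_def)
qed

text \<open>The expression is the integral of
  \<open>exp (- s * \<bar>\<theta>\<bar> powr \<alpha>)\<close> over \<open>s\<close> in
  \<open>{0..t}\<close> when \<open>\<theta> \<noteq> 0\<close>: at most \<open>t\<close> for small
  \<open>\<theta>\<close> and at most \<open>\<bar>\<theta>\<bar> powr (- \<alpha>)\<close> for
  large \<open>\<theta>\<close>.\<close>

lemma integrated_exp_bound:
  assumes "0 \<le> t" "0 < \<alpha>"
  shows "0 \<le> (1 - exp (- t * \<bar>\<theta>\<bar> powr \<alpha>)) * \<bar>\<theta>\<bar> powr (- \<alpha>)"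
    and "(1 - exp (- t * \<bar>\<theta>\<bar> powr \<alpha>)) * \<bar>\<theta>\<bar> powr (- \<alpha>) \<le> max 1 t * tail_majorant \<alpha> \<theta>"
proof -
  show "0 \<le> (1 - exp (- t * \<bar>\<theta>\<bar> powr \<alpha>)) * \<bar>\<theta>\<bar> powr (- \<alpha>)"
    using assms by (intro mult_nonneg_nonneg) auto
  show "(1 - exp (- t * \<bar>\<theta>\<bar> powr \<alpha>)) * \<bar>\<theta>\<bar> powr (- \<alpha>) \<le> max 1 t * tail_majorant \<alpha> \<theta>"
  proof (cases "\<bar>\<theta>\<bar> \<le> 1")
    case True
    show ?thesis
    proof (cases "\<theta> = 0")
      case False
      have "1 - exp (- t * \<bar>\<theta>\<bar> powr \<alpha>) \<le> t * \<bar>\<theta>\<bar> powr \<alpha>"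
        using exp_ge_add_one_self[of "- t * \<bar>\<theta>\<bar> powr \<alpha>"] by simp
      then have "(1 - exp (- t * \<bar>\<theta>\<bar> powr \<alpha>)) * \<bar>\<theta>\<bar> powr (- \<alpha>) \<le> t * \<bar>\<theta>\<bar> powr \<alpha> * \<bar>\<theta>\<bar> powr (- \<alpha>)"
        by (intro mult_right_mono) auto
      also have "\<dots> = t" using False by (simp add: powr_add[symmetric] mult.assoc)
      finally show ?thesis using True by (auto simp: tail_majorant_def)
    qed (use assms in \<open>simp add: tail_majorant_nonneg\<close>)
  next
    case False
    have "(1 - exp (- t * \<bar>\<theta>\<bar> powr \<alpha>)) * \<bar>\<theta>\<bar> powr (- \<alpha>) \<le> max 1 t * \<bar>\<theta>\<bar> powr (- \<alpha>)"
      by (intro mult_right_mono) (auto simp: le_max_iff_disj)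
    then show ?thesis using False by (simp add: tail_majorant_def)
  qed
qed

section \<open>Fourier representation of the potential kernel\<close>

definition cos_const :: "real \<Rightarrow> real" where
  "cos_const \<alpha> = (\<integral>\<theta>. (1 - cos \<theta>) * \<bar>\<theta>\<bar> powr (- \<alpha>) \<partial>lborel)"

lemma integrable_cos_kernel:
  fixes \<alpha> :: real
  assumes "1 < \<alpha>" "\<alpha> < 2"
  shows "integrable lborel (\<lambda>\<theta>::real. (1 - cos \<theta>) * \<bar>\<theta>\<bar> powr (- \<alpha>))"
proof (rule Bochner_Integration.integrable_bound)
  show "integrable lborel (\<lambda>\<theta>. 2 * tail_majorant \<alpha> \<theta>)"
    using integrable_tail_majorant[OF assms(1)] by simp
  show "AE \<theta> in lborel. norm ((1 - cos \<theta>) * \<bar>\<theta>\<bar> powr (- \<alpha>)) \<le> norm (2 * tail_majorant \<alpha> \<theta>)"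
    using cos_kernel_bound[OF assms] one_minus_cos_bounds(1) by (simp add: tail_majorant_nonneg abs_mult)
qed simp

lemma cos_const_pos:
  assumes "1 < \<alpha>" "\<alpha> < 2"
  shows "0 < cos_const \<alpha>"
proof -
  let ?f = "\<lambda>\<theta>::real. (1 - cos \<theta>) * \<bar>\<theta>\<bar> powr (- \<alpha>)"
  have nn: "0 \<le> ?f \<theta>" for \<theta> using one_minus_cos_bounds(1) by simp
  have "cos_const \<alpha> \<noteq> 0"
  proof
    assume "cos_const \<alpha> = 0"
    then have "AE \<theta> in lborel. ?f \<theta> = 0"
      using integral_nonneg_eq_0_iff_AE[OF integrable_cos_kernel[OF assms]] nn
      unfolding cos_const_def by auto
    then have "AE \<theta>::real in lborel. \<theta> \<notin> {1..2}"
    proof eventually_elim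
      case (elim \<theta>)
      have "cos \<theta> < 1" if "\<theta> \<in> {1..2}"
        using cos_monotone_0_pi[of 0 \<theta>] that pi_gt3 by simp
      with elim show ?case by auto
    qed
    then have "emeasure lborel {1..2::real} = 0"
      by (subst (asm) AE_iff_measurable[where N="{1..2}"]) auto
    then show False by simp
  qed
  moreover have "0 \<le> cos_const \<alpha>" unfolding cos_const_def using nn by simp
  ultimately show ?thesis by simp
qed

text \<open>Substituting \<open>\<theta> * x\<close> for the integration variable extracts the power
  of \<open>x\<close>. The kernel becomes a superposition of cosines, and on cosines the stable
  semigroup acts by multiplication.\<close>

lemma abs_powr_cos:
  assumes "1 < \<alpha>" "\<alpha> < 2"
  shows "integrable lborel (\<lambda>\<theta>. (1 - cos (\<theta> * x)) * \<bar>\<theta>\<bar> powr (- \<alpha>))"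
    and "(\<integral>\<theta>. (1 - cos (\<theta> * x)) * \<bar>\<theta>\<bar> powr (- \<alpha>) \<partial>lborel) = cos_const \<alpha> * \<bar>x\<bar> powr (\<alpha> - 1)"
proof -
  have "integrable lborel (\<lambda>\<theta>. (1 - cos (\<theta> * x)) * \<bar>\<theta>\<bar> powr (- \<alpha>)) \<and>
    (\<integral>\<theta>. (1 - cos (\<theta> * x)) * \<bar>\<theta>\<bar> powr (- \<alpha>) \<partial>lborel) = cos_const \<alpha> * \<bar>x\<bar> powr (\<alpha> - 1)"
  proof (cases "x = 0")
    case False
    define f where "f = (\<lambda>\<theta>::real. (1 - cos \<theta>) * \<bar>\<theta>\<bar> powr (- \<alpha>))"
    have eq: "(1 - cos (\<theta> * x)) * \<bar>\<theta>\<bar> powr (- \<alpha>) = \<bar>x\<bar> powr \<alpha> * f (0 + x * \<theta>)" for \<theta>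
      using False by (simp add: f_def abs_mult powr_mult powr_minus mult.commute)
    have i: "integrable lborel f" unfolding f_def by (rule integrable_cos_kernel[OF assms])
    have "cos_const \<alpha> = \<bar>x\<bar> *\<^sub>R (\<integral>\<theta>. f (0 + x * \<theta>) \<partial>lborel)"
      unfolding cos_const_def f_def[symmetric] by (rule lborel_integral_real_affine[OF False])
    then have "(\<integral>\<theta>. f (0 + x * \<theta>) \<partial>lborel) = cos_const \<alpha> / \<bar>x\<bar>" using False by simp
    then have "(\<integral>\<theta>. \<bar>x\<bar> powr \<alpha> * f (0 + x * \<theta>) \<partial>lborel) = cos_const \<alpha> * \<bar>x\<bar> powr (\<alpha> - 1)"
      using False by (simp add: powr_diff)
    then show ?thesis unfolding eq
      using lborel_integrable_real_affine[OF i False, of 0] by simp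
  qed (simp add: cos_const_def)
  then show "integrable lborel (\<lambda>\<theta>. (1 - cos (\<theta> * x)) * \<bar>\<theta>\<bar> powr (- \<alpha>))"
    "(\<integral>\<theta>. (1 - cos (\<theta> * x)) * \<bar>\<theta>\<bar> powr (- \<alpha>) \<partial>lborel) = cos_const \<alpha> * \<bar>x\<bar> powr (\<alpha> - 1)" by auto
qed

section \<open>Stable densities by Fourier inversion\<close>

definition stable_density :: "real \<Rightarrow> real \<Rightarrow> real \<Rightarrow> real" where
  "stable_density \<alpha> s x = 1 / (2 * pi) * (\<integral>\<theta>. cos (\<theta> * x) * exp (- s * \<bar>\<theta>\<bar> powr \<alpha>) \<partial>lborel)"

lemma integrable_exp_powr:
  fixes s \<alpha> :: real
  assumes "0 < s" "1 < \<alpha>"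
  shows "integrable lborel (\<lambda>\<theta>::real. exp (- s * \<bar>\<theta>\<bar> powr \<alpha>))"
  using assms exp_majorant_bound[of s \<alpha>]
  by (intro Bochner_Integration.integrable_bound[OF integrable_mult_right[OF integrable_tail_majorant[OF assms(2)], of "max 1 (1 / s)"]])
    (auto simp: tail_majorant_nonneg intro!: AE_I2)

lemma stable_density_measurable [measurable]:
  "(\<lambda>w. stable_density \<alpha> (fst w) (snd w)) \<in> borel_measurable (borel \<Otimes>\<^sub>M borel)"
  unfolding stable_density_def by measurable

lemma stable_density_even: "stable_density \<alpha> s (- x) = stable_density \<alpha> s x"
  by (simp add: stable_density_def)

lemma continuous_stable_density:
  assumes "0 < s" "1 < \<alpha>"
  shows "isCont (stable_density \<alpha> s) x"
proof -
  have "isCont (\<lambda>x. \<integral>\<theta>. cos (\<theta> * x) * exp (- s * \<bar>\<theta>\<bar> powr \<alpha>) \<partial>lborel) x"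
  proof (rule continuous_within_sequentially[THEN iffD2, rule_format])
    fix u :: "nat \<Rightarrow> real" assume u: "(\<forall>n. u n \<in> UNIV) \<and> u \<longlonglongrightarrow> x"
    show "((\<lambda>x. \<integral>\<theta>. cos (\<theta> * x) * exp (- s * \<bar>\<theta>\<bar> powr \<alpha>) \<partial>lborel) \<circ> u)
        \<longlonglongrightarrow> (\<integral>\<theta>. cos (\<theta> * x) * exp (- s * \<bar>\<theta>\<bar> powr \<alpha>) \<partial>lborel)"
      unfolding o_def
    proof (rule integral_dominated_convergence[OF _ _ integrable_exp_powr[OF assms]])
      show "AE \<theta> in lborel. (\<lambda>n. cos (\<theta> * u n) * exp (- s * \<bar>\<theta>\<bar> powr \<alpha>)) \<longlonglongrightarrow> cos (\<theta> * x) * exp (- s * \<bar>\<theta>\<bar> powr \<alpha>)"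
        using u by (intro AE_I2 tendsto_intros) auto
      show "AE \<theta> in lborel. norm (cos (\<theta> * u n) * exp (- s * \<bar>\<theta>\<bar> powr \<alpha>)) \<le> exp (- s * \<bar>\<theta>\<bar> powr \<alpha>)" for n
        by (intro AE_I2) (simp add: abs_mult mult_left_le_one_le)
    qed auto
  qed
  then show ?thesis unfolding stable_density_def[abs_def] by (intro continuous_intros)
qed

context
  fixes N :: "real measure" and \<alpha> s :: real
  assumes N: "real_distribution N"
    and char_N: "\<And>\<theta>. char N \<theta> = complex_of_real (exp (- s * \<bar>\<theta>\<bar> powr \<alpha>))"
    and s: "0 < s" and \<alpha>: "1 < \<alpha>"
begin

interpretation N: real_distribution N by (rule N)

text \<open>Levy inversion yields the mass of an interval as a limit of truncated Fourier integrals.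
  The characteristic function is integrable, so the truncation can be removed by dominated
  convergence, and Fubini exchanges the frequency integral with the integral over the
  interval.\<close>

lemma stable_measure_Ioc:
  assumes ab: "a \<le> b" and atoms: "measure N {a} = 0" "measure N {b} = 0"
  shows "integrable lborel (\<lambda>x. indicator {a<..b} x * stable_density \<alpha> s x)"
    and "measure N {a<..b} = (\<integral>x. indicator {a<..b} x * stable_density \<alpha> s x \<partial>lborel)"
proof -
  define e where "e \<theta> = exp (- s * \<bar>\<theta>\<bar> powr \<alpha>)" for \<theta>
  define R where "R \<theta> = (\<integral>x. indicator {a<..b} x * cos (\<theta> * x) \<partial>lborel)" for \<theta>
  define F where "F \<theta> = (iexp (-(\<theta> * a)) - iexp (-(\<theta> * b))) / (\<i> * complex_of_real \<theta>)" for \<theta> :: real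
  have [measurable]: "e \<in> borel_measurable borel" unfolding e_def by measurable
  have e_int: "integrable lborel e" unfolding e_def[abs_def] by (rule integrable_exp_powr[OF s \<alpha>])
  have e0: "0 \<le> e \<theta>" for \<theta> by (simp add: e_def)
  have [measurable]: "R \<in> borel_measurable borel" unfolding R_def[abs_def] by measurable
  have [measurable]: "F \<in> borel_measurable borel" unfolding F_def[abs_def] by measurable
  have F_bound: "cmod (F \<theta>) \<le> b - a" if "\<theta> \<noteq> 0" for \<theta>
    using Levy_Inversion_aux2[of "- b" "- a" \<theta>] ab that by (simp add: F_def)
  \<comment> \<open>The inversion kernel is the integral of \<open>exp (- i * \<theta> * x)\<close>
    over the interval; the mass is real and the characteristic function is real, so the cosine
    integral \<open>R\<close> carries all the information.\<close>
  have Re_F: "Re (F \<theta>) = R \<theta>" if "\<theta> \<noteq> 0" for \<theta>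
  proof -
    have "R \<theta> = sin (\<theta> * b) / \<theta> - sin (\<theta> * a) / \<theta>"
    proof -
      have "((\<lambda>x. cos (\<theta> * x)) has_integral (sin (\<theta> * b) / \<theta> - sin (\<theta> * a) / \<theta>)) {a..b}"
        using that by (intro fundamental_theorem_of_calculus ab)
          (auto intro!: derivative_eq_intros simp: has_real_derivative_iff_has_vector_derivative[symmetric])
      moreover have "set_integrable lborel {a..b} (\<lambda>x. cos (\<theta> * x))"
        by (intro borel_integrable_atLeastAtMost') (auto intro!: continuous_intros)
      ultimately have "(LBINT x:{a..b}. cos (\<theta> * x)) = sin (\<theta> * b) / \<theta> - sin (\<theta> * a) / \<theta>"
        by (metis set_borel_integral_eq_integral(2) integral_unique)
      moreover have "(LBINT x:{a..b}. cos (\<theta> * x)) = R \<theta>"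
        unfolding R_def set_lebesgue_integral_def
        by (intro integral_cong_AE) (use AE_lborel_singleton[of a] in \<open>auto simp: indicator_def\<close>)
      ultimately show ?thesis by simp
    qed
    moreover have "Re (F \<theta>) = (sin (\<theta> * b) - sin (\<theta> * a)) / \<theta>"
      using that by (simp add: F_def Re_divide Im_exp power2_eq_square field_simps)
    ultimately show ?thesis by (simp add: diff_divide_distrib)
  qed
  have "(\<lambda>T. Re (1 / (2 * pi) * (CLBINT \<theta>=-real T..real T. F \<theta> * char N \<theta>))) \<longlonglongrightarrow> Re (measure N {a<..b})"
    using N.Levy_Inversion[OF ab atoms] unfolding F_def by (intro tendsto_Re) simp
  moreover have "Re (1 / (2 * pi) * (CLBINT \<theta>=-real T..real T. F \<theta> * char N \<theta>))
      = 1 / (2 * pi) * (\<integral>\<theta>. indicator {- real T<..<real T} \<theta> * (R \<theta> * e \<theta>) \<partial>lborel)" for T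
  proof -
    let ?I = "\<lambda>\<theta>. indicator {- real T<..<real T} \<theta> *\<^sub>R (F \<theta> * complex_of_real (e \<theta>))"
    have i: "integrable lborel ?I"
    proof (rule Bochner_Integration.integrable_bound)
      show "integrable lborel (\<lambda>\<theta>. (b - a) * e \<theta>)" using e_int by simp
      show "AE \<theta> in lborel. norm (?I \<theta>) \<le> norm ((b - a) * e \<theta>)"
        using AE_lborel_singleton[of 0]
      proof eventually_elim
        case (elim \<theta>)
        then show ?case using F_bound[of \<theta>] e0[of \<theta>] ab
          by (auto simp: indicator_def norm_mult abs_mult intro!: mult_right_mono)
      qed
    qed measurable
    have "(CLBINT \<theta>=-real T..real T. F \<theta> * char N \<theta>) = (\<integral>\<theta>. ?I \<theta> \<partial>lborel)"
      by (simp add: interval_lebesgue_integral_def set_lebesgue_integral_def char_N e_def)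
    then have "Re (CLBINT \<theta>=-real T..real T. F \<theta> * char N \<theta>) = (\<integral>\<theta>. Re (?I \<theta>) \<partial>lborel)"
      by (simp only: integral_Re[OF i])
    also have "\<dots> = (\<integral>\<theta>. indicator {- real T<..<real T} \<theta> * (R \<theta> * e \<theta>) \<partial>lborel)"
    proof (rule integral_cong_AE)
      show "AE \<theta> in lborel. Re (?I \<theta>) = indicator {- real T<..<real T} \<theta> * (R \<theta> * e \<theta>)"
        using AE_lborel_singleton[of 0] by eventually_elim (simp add: Re_F)
    qed measurable
    finally show ?thesis by (simp add: Re_divide_of_real)
  qed
  ultimately have lim1: "(\<lambda>T. 1 / (2 * pi) * (\<integral>\<theta>. indicator {- real T<..<real T} \<theta> * (R \<theta> * e \<theta>) \<partial>lborel))
      \<longlonglongrightarrow> measure N {a<..b}" by simp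
  have prod_int: "integrable (lborel \<Otimes>\<^sub>M lborel) (\<lambda>(\<theta>, x). e \<theta> * (indicator {a<..b} x * cos (\<theta> * x)))"
  proof (rule Bochner_Integration.integrable_bound)
    have "integrable (lborel \<Otimes>\<^sub>M lborel) (\<lambda>(\<theta>, x). e \<theta> * indicator {a<..b} x)"
      using e_int e0 ab by (intro lborel_pair.Fubini_integrable) (auto simp: abs_mult case_prod_beta')
    then show "integrable (lborel \<Otimes>\<^sub>M lborel) (\<lambda>(\<theta>, x). e \<theta> * indicator {a<..b} x)" .
    show "AE w in lborel \<Otimes>\<^sub>M lborel. norm (case w of (\<theta>, x) \<Rightarrow> e \<theta> * (indicator {a<..b} x * cos (\<theta> * x)))
        \<le> norm (case w of (\<theta>, x) \<Rightarrow> e \<theta> * indicator {a<..b} x)"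
      by (intro AE_I2) (auto simp: e0 abs_mult indicator_def mult_left_le)
  qed measurable
  have R_bound: "\<bar>R \<theta>\<bar> \<le> b - a" for \<theta>
  proof -
    have ind: "integrable lborel (indicator {a<..b} :: real \<Rightarrow> real)"
      using ab by (intro integrable_real_indicator) auto
    have "integrable lborel (\<lambda>x. indicator {a<..b} x * cos (\<theta> * x))"
      by (rule Bochner_Integration.integrable_bound[OF ind]) (auto simp: indicator_def)
    then have "integrable lborel (\<lambda>x. \<bar>indicator {a<..b} x * cos (\<theta> * x)\<bar>)"
      by (rule integrable_abs)
    then have "(\<integral>x. \<bar>indicator {a<..b} x * cos (\<theta> * x)\<bar> \<partial>lborel) \<le> (\<integral>x. indicator {a<..b} x \<partial>lborel)"
      by (rule integral_mono[OF _ ind]) (auto simp: indicator_def)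
    then have "\<bar>R \<theta>\<bar> \<le> (\<integral>x. indicator {a<..b} x \<partial>lborel)"
      unfolding R_def by (rule order_trans[OF integral_abs_bound])
    then show ?thesis using ab by simp
  qed
  have "(\<lambda>T. \<integral>\<theta>. indicator {- real T<..<real T} \<theta> * (R \<theta> * e \<theta>) \<partial>lborel) \<longlonglongrightarrow> (\<integral>\<theta>. R \<theta> * e \<theta> \<partial>lborel)"
  proof (rule integral_dominated_convergence)
    show "integrable lborel (\<lambda>\<theta>. (b - a) * e \<theta>)" using e_int by simp
    show "AE \<theta> in lborel. norm (indicator {- real T<..<real T} \<theta> * (R \<theta> * e \<theta>)) \<le> (b - a) * e \<theta>" for T
      using R_bound e0 ab by (intro AE_I2) (auto simp: indicator_def abs_mult intro!: mult_right_mono)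
    show "AE \<theta> in lborel. (\<lambda>T. indicator {- real T<..<real T} \<theta> * (R \<theta> * e \<theta>)) \<longlonglongrightarrow> R \<theta> * e \<theta>"
    proof (intro AE_I2 tendsto_eventually)
      fix \<theta> :: real
      obtain n :: nat where n: "\<bar>\<theta>\<bar> < real n" using reals_Archimedean2 by blast
      show "\<forall>\<^sub>F T in sequentially. indicator {- real T<..<real T} \<theta> * (R \<theta> * e \<theta>) = R \<theta> * e \<theta>"
        using eventually_ge_at_top[of n]
      proof eventually_elim
        case (elim T)
        then have "\<theta> \<in> {- real T<..<real T}" using n by auto
        then show ?case by simp
      qed
    qed
  qed measurable
  from tendsto_mult[OF tendsto_const[of "1 / (2 * pi)"] this]
  have "measure N {a<..b} = 1 / (2 * pi) * (\<integral>\<theta>. R \<theta> * e \<theta> \<partial>lborel)"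
    by (rule LIMSEQ_unique[OF lim1])
  also have "(\<integral>\<theta>. R \<theta> * e \<theta> \<partial>lborel) = (\<integral>\<theta>. (\<integral>x. e \<theta> * (indicator {a<..b} x * cos (\<theta> * x)) \<partial>lborel) \<partial>lborel)"
    by (simp add: R_def mult.commute)
  also have "\<dots> = (\<integral>x. (\<integral>\<theta>. e \<theta> * (indicator {a<..b} x * cos (\<theta> * x)) \<partial>lborel) \<partial>lborel)"
    by (rule lborel_pair.Fubini_integral[symmetric, OF prod_int])
  also have "1 / (2 * pi) * \<dots> = (\<integral>x. indicator {a<..b} x * stable_density \<alpha> s x \<partial>lborel)"
    by (simp add: stable_density_def e_def mult_ac flip: integral_mult_right_zero)
  finally show "measure N {a<..b} = (\<integral>x. indicator {a<..b} x * stable_density \<alpha> s x \<partial>lborel)" .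
  have "integrable lborel (\<lambda>x. 1 / (2 * pi) * (\<integral>\<theta>. e \<theta> * (indicator {a<..b} x * cos (\<theta> * x)) \<partial>lborel))"
    using lborel_pair.integrable_snd[OF prod_int] by simp
  then show "integrable lborel (\<lambda>x. indicator {a<..b} x * stable_density \<alpha> s x)"
    by (simp add: stable_density_def e_def mult_ac flip: integral_mult_right_zero)
qed

lemma ex_non_atom:
  assumes "u < v"
  shows "\<exists>a. u < a \<and> a < v \<and> measure N {a} = 0"
proof -
  have "uncountable ({u<..<v} - {x. measure N {x} \<noteq> 0})"
    using N.countable_support assms by (intro uncountable_minus_countable) (auto simp: uncountable_open_interval)
  then have "{u<..<v} - {x. measure N {x} \<noteq> 0} \<noteq> {}" by force
  then show ?thesis by auto
qed

text \<open>By continuity a negative value would persist on a small interval to the right of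
  \<open>x\<close>. Choosing its endpoints off the atoms, Levy inversion would give that interval a
  negative mass.\<close>

lemma stable_density_nonneg: "0 \<le> stable_density \<alpha> s x"
proof (rule ccontr)
  assume "\<not> 0 \<le> stable_density \<alpha> s x"
  then have neg: "stable_density \<alpha> s x < 0" by simp
  let ?c = "stable_density \<alpha> s x / 2"
  have "(stable_density \<alpha> s \<longlongrightarrow> stable_density \<alpha> s x) (at x)"
    using continuous_stable_density[OF s \<alpha>, of x] by (simp add: isCont_def)
  then have "\<forall>\<^sub>F y in at x. stable_density \<alpha> s y < ?c"
    using neg by (intro order_tendstoD) auto
  then obtain d where d: "d > 0" "\<And>y. y \<noteq> x \<Longrightarrow> dist y x < d \<Longrightarrow> stable_density \<alpha> s y < ?c"
    unfolding eventually_at by auto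
  obtain a where a: "x < a" "a < x + d / 2" "measure N {a} = 0"
    using ex_non_atom[of x "x + d / 2"] d(1) by auto
  obtain b where b: "x + d / 2 < b" "b < x + d" "measure N {b} = 0"
    using ex_non_atom[of "x + d / 2" "x + d"] d(1) by auto
  have ab: "a \<le> b" using a b by simp
  have "measure N {a<..b} = (\<integral>y. indicator {a<..b} y * stable_density \<alpha> s y \<partial>lborel)"
    by (rule stable_measure_Ioc[OF ab a(3) b(3)])
  also have "\<dots> \<le> (\<integral>y. indicator {a<..b} y * ?c \<partial>lborel)"
  proof (rule integral_mono[OF stable_measure_Ioc(1)[OF ab a(3) b(3)]])
    show "integrable lborel (\<lambda>y. indicator {a<..b} y * ?c)"
      using ab by (intro integrable_mult_left integrable_real_indicator) auto
    show "indicator {a<..b} y * stable_density \<alpha> s y \<le> indicator {a<..b} y * ?c" for y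
      using d(2)[of y] a b by (auto simp: indicator_def dist_real_def)
  qed
  also have "\<dots> = (b - a) * ?c" using ab by simp
  also have "\<dots> < 0" using a b neg by (intro mult_pos_neg) auto
  finally show False using measure_nonneg[of N "{a<..b}"] by simp
qed

text \<open>The interval formula requires endpoints without mass, so each ray is exhausted by
  intervals with such endpoints; atoms are countable and leave enough room.\<close>

lemma stable_law_eq_density: "N = density lborel (\<lambda>x. ennreal (stable_density \<alpha> s x))"
proof (rule measure_eqI_lessThan)
  show "sets N = sets borel" by simp
  show "sets (density lborel (\<lambda>x. ennreal (stable_density \<alpha> s x))) = sets borel" by simp
  show "emeasure N {x<..} < \<infinity>" for x by (simp add: N.emeasure_eq_measure)
  fix x :: real
  have [measurable]: "stable_density \<alpha> s \<in> borel_measurable borel"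
    unfolding stable_density_def[abs_def] by measurable
  \<comment> \<open>The windows for consecutive indices are adjacent and disjoint, which makes
    \<open>a\<close> decreasing to \<open>x\<close> whatever the choices are; \<open>b\<close>
    increases to infinity for the same reason.\<close>
  define a where "a n = (SOME a. x + 1 / (real n + 2) < a \<and> a < x + 1 / (real n + 1) \<and> measure N {a} = 0)" for n :: nat
  have a: "x + 1 / (real n + 2) < a n" "a n < x + 1 / (real n + 1)" "measure N {a n} = 0" for n
  proof -
    have "1 / (real n + 2) < 1 / (real n + 1)" by (intro divide_strict_left_mono) auto
    then show "x + 1 / (real n + 2) < a n" "a n < x + 1 / (real n + 1)" "measure N {a n} = 0"
      using someI_ex[OF ex_non_atom[of "x + 1 / (real n + 2)" "x + 1 / (real n + 1)"]]
      by (auto simp: a_def)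
  qed
  define b where "b n = (SOME b. x + 1 + real n < b \<and> b < x + 2 + real n \<and> measure N {b} = 0)" for n :: nat
  have b: "x + 1 + real n < b n" "b n < x + 2 + real n" "measure N {b n} = 0" for n
    using someI_ex[OF ex_non_atom[of "x + 1 + real n" "x + 2 + real n"]] by (auto simp: b_def)
  have ab: "a n \<le> b n" for n
  proof -
    have "1 / (real n + 1) \<le> 1" by simp
    then show ?thesis using a(2)[of n] b(1)[of n] by linarith
  qed
  have inc: "incseq (\<lambda>n. {a n<..b n})"
  proof (rule incseq_SucI)
    fix n
    have "a (Suc n) \<le> a n" using a(2)[of "Suc n"] a(1)[of n] by (simp add: algebra_simps)
    moreover have "b n \<le> b (Suc n)" using b(2)[of n] b(1)[of "Suc n"] by simp
    ultimately show "{a n<..b n} \<subseteq> {a (Suc n)<..b (Suc n)}" by auto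
  qed
  have Un: "(\<Union>n. {a n<..b n}) = {x<..}"
  proof (intro equalityI subsetI)
    fix y assume "y \<in> (\<Union>n. {a n<..b n})"
    then obtain n where "a n < y" by auto
    moreover have "0 < 1 / (real n + 2)" by simp
    ultimately show "y \<in> {x<..}" using a(1)[of n] unfolding greaterThan_iff by linarith
  next
    fix y assume y: "y \<in> {x<..}"
    obtain m :: nat where m: "1 / (real m + 1) < y - x"
      using y reals_Archimedean[of "y - x"] by (auto simp: inverse_eq_divide add.commute)
    obtain k :: nat where k: "y - x < real k" using reals_Archimedean2 by blast
    have "a m < y" using a(2)[of m] m by simp
    moreover have "a (max m k) \<le> a m" "b k \<le> b (max m k)"
    proof -
      have "antimono a"
        by (rule antimonoI, rule lift_Suc_antimono_le)
          (use a(1) a(2)[of "Suc _"] in \<open>auto simp: algebra_simps intro: less_imp_le less_trans\<close>)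
      then show "a (max m k) \<le> a m" by (auto simp: antimono_def)
      have "mono b"
        by (rule monoI, rule lift_Suc_mono_le)
          (use b(2) b(1)[of "Suc _"] in \<open>auto simp: algebra_simps intro: less_imp_le less_trans\<close>)
      then show "b k \<le> b (max m k)" by (auto simp: mono_def)
    qed
    ultimately have "y \<in> {a (max m k)<..b (max m k)}" using b(1)[of k] k by auto
    then show "y \<in> (\<Union>n. {a n<..b n})" by blast
  qed
  let ?D = "density lborel (\<lambda>x. ennreal (stable_density \<alpha> s x))"
  have eq: "emeasure N {a n<..b n} = emeasure ?D {a n<..b n}" for n
  proof -
    note I = stable_measure_Ioc[OF ab a(3) b(3), of n]
    have "emeasure ?D {a n<..b n} = (\<integral>\<^sup>+ y. ennreal (indicator {a n<..b n} y * stable_density \<alpha> s y) \<partial>lborel)"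
      by (subst emeasure_density) (auto intro!: nn_integral_cong simp: indicator_def)
    also have "\<dots> = ennreal (measure N {a n<..b n})"
      unfolding I(2) by (rule nn_integral_eq_integral[OF I(1)]) (auto simp: stable_density_nonneg)
    finally show ?thesis by (simp add: N.emeasure_eq_measure)
  qed
  have "emeasure N {x<..} = (SUP n. emeasure N {a n<..b n})"
    unfolding Un[symmetric] by (rule SUP_emeasure_incseq[symmetric]) (auto intro: inc)
  also have "\<dots> = (SUP n. emeasure ?D {a n<..b n})" by (simp add: eq)
  also have "\<dots> = emeasure ?D {x<..}"
    unfolding Un[symmetric] by (rule SUP_emeasure_incseq) (auto intro: inc)
  finally show "emeasure N {x<..} = emeasure ?D {x<..}" .
qed

end

section \<open>Dynkin formula for the potential kernel\<close>

lemma measurable_stable_density [measurable]: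
  assumes [measurable]: "f \<in> borel_measurable M" "g \<in> borel_measurable M"
  shows "(\<lambda>w. stable_density \<alpha> (f w) (g w)) \<in> borel_measurable M"
  using measurable_compose[OF measurable_Pair[OF assms] stable_density_measurable] by simp

text \<open>The laws of the increments are separated from any particular process, so that one
  family, and the constants derived from it, serve every starting point.\<close>

locale stable_family =
  fixes \<alpha> :: real and N :: "real \<Rightarrow> real measure"
  assumes alpha: "1 < \<alpha>" "\<alpha> < 2"
    and N_dist: "\<And>t. 0 \<le> t \<Longrightarrow> real_distribution (N t)"
    and N_char: "\<And>t \<theta>. 0 \<le> t \<Longrightarrow> char (N t) \<theta> = complex_of_real (exp (- t * \<bar>\<theta>\<bar> powr \<alpha>))"
begin

lemma N_prob: "0 \<le> t \<Longrightarrow> prob_space (N t)"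
  using N_dist by (simp add: real_distribution_def)

lemma sets_N: "0 \<le> t \<Longrightarrow> sets (N t) = sets borel"
  using N_dist[of t] by (simp add: real_distribution_def real_distribution_axioms_def)

lemma density_nonneg: "0 < s \<Longrightarrow> 0 \<le> stable_density \<alpha> s x"
  using stable_density_nonneg[OF N_dist N_char] alpha by simp

lemma nn_integral_N:
  assumes s: "0 < s" and [measurable]: "f \<in> borel_measurable borel"
  shows "(\<integral>\<^sup>+ z. f (x + z) \<partial>N s) = (\<integral>\<^sup>+ y. f y * ennreal (stable_density \<alpha> s (y - x)) \<partial>lborel)"
proof -
  have "N s = density lborel (\<lambda>x. ennreal (stable_density \<alpha> s x))"
    using stable_law_eq_density[OF N_dist N_char] alpha s by simp
  then have "(\<integral>\<^sup>+ z. f (x + z) \<partial>N s) = (\<integral>\<^sup>+ z. ennreal (stable_density \<alpha> s z) * f (x + z) \<partial>lborel)"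
    by (simp add: nn_integral_density)
  also have "\<dots> = (\<integral>\<^sup>+ y. f y * ennreal (stable_density \<alpha> s (y - x)) \<partial>lborel)"
    by (subst nn_integral_real_affine[where c=1 and t="- x"]) (auto simp: mult.commute)
  finally show ?thesis .
qed

lemma integral_cos_N:
  assumes t: "0 \<le> t"
  shows "(\<integral>z. cos (\<theta> * (x + z)) \<partial>N t) = cos (\<theta> * x) * exp (- t * \<bar>\<theta>\<bar> powr \<alpha>)"
proof -
  interpret real_distribution "N t" by (rule N_dist[OF t])
  have "(\<integral>z. cos (\<theta> * (x + z)) \<partial>N t) = (\<integral>z. Re (iexp (\<theta> * x) * iexp (\<theta> * z)) \<partial>N t)"
    by (intro Bochner_Integration.integral_cong)
      (simp_all add: exp_add[symmetric] Re_exp distrib_left[symmetric] flip: of_real_add of_real_mult)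
  also have "\<dots> = Re (\<integral>z. iexp (\<theta> * x) * iexp (\<theta> * z) \<partial>N t)"
    by (rule integral_Re) (intro integrable_mult_right integrable_iexp, auto)
  also have "\<dots> = Re (iexp (\<theta> * x) * char (N t) \<theta>)" by (simp add: char_def)
  also have "\<dots> = cos (\<theta> * x) * exp (- t * \<bar>\<theta>\<bar> powr \<alpha>)"
    unfolding N_char[OF t] by (simp add: Re_exp)
  finally show ?thesis .
qed

text \<open>In the sense of \<open>nn_integral_abs_powr\<close> the generator sends
  \<open>\<bar>x\<bar> powr (\<alpha> - 1)\<close> to \<open>pot_const\<close> times the unit mass
  at 0. The numerator is the Fourier normalisation, the denominator the constant of
  \<open>abs_powr_cos\<close>.\<close>

definition pot_const :: real where "pot_const = 2 * pi / cos_const \<alpha>"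

lemma pot_const_pos: "0 < pot_const"
  using cos_const_pos alpha by (simp add: pot_const_def)

lemma integrable_integrated_exp:
  assumes t: "0 \<le> t"
  shows "integrable lborel (\<lambda>\<theta>::real. (1 - exp (- t * \<bar>\<theta>\<bar> powr \<alpha>)) * \<bar>\<theta>\<bar> powr (- \<alpha>))"
  using integrated_exp_bound[OF t, of \<alpha>] alpha
  by (intro Bochner_Integration.integrable_bound[OF integrable_mult_right[OF integrable_tail_majorant[OF alpha(1)], of "max 1 t"]])
    (auto intro!: AE_I2 simp: tail_majorant_nonneg)

text \<open>The Fourier formula for the density is integrated over time under the frequency
  integral, using the elementary integral of the exponential for \<open>\<theta> \<noteq> 0\<close>.
  Nonnegativity of the result is inherited from the density.\<close>

lemma occupation_density:
  assumes t: "0 \<le> t"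
  shows "0 \<le> (\<integral>\<theta>. cos (\<theta> * x) * ((1 - exp (- t * \<bar>\<theta>\<bar> powr \<alpha>)) * \<bar>\<theta>\<bar> powr (- \<alpha>)) \<partial>lborel)"
    and "(\<integral>\<^sup>+ s. ennreal (stable_density \<alpha> s x) * indicator {0..t} s \<partial>lborel)
    = ennreal (1 / (2 * pi) * (\<integral>\<theta>. cos (\<theta> * x) * ((1 - exp (- t * \<bar>\<theta>\<bar> powr \<alpha>)) * \<bar>\<theta>\<bar> powr (- \<alpha>)) \<partial>lborel))"
proof -
  let ?h = "\<lambda>\<theta> s. indicator {0..t} s * (cos (\<theta> * x) * exp (- s * \<bar>\<theta>\<bar> powr \<alpha>))"
  let ?E = "\<lambda>\<theta>. (1 - exp (- t * \<bar>\<theta>\<bar> powr \<alpha>)) * \<bar>\<theta>\<bar> powr (- \<alpha>)"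
  have E_int: "integrable lborel ?E" by (rule integrable_integrated_exp[OF t])
  have inner: "integrable lborel (\<lambda>s. indicator {0..t} s * exp (- s * \<bar>\<theta>\<bar> powr \<alpha>)) \<and>
      (\<integral>s. indicator {0..t} s * exp (- s * \<bar>\<theta>\<bar> powr \<alpha>) \<partial>lborel) = ?E \<theta>" if "\<theta> \<noteq> 0" for \<theta>
  proof -
    define c where "c = \<bar>\<theta>\<bar> powr \<alpha>"
    have c: "0 < c" using that by (simp add: c_def)
    have "((\<lambda>s. exp (- s * c)) has_integral (- exp (- t * c) / c - (- exp (- 0 * c) / c))) {0..t}"
      using c by (intro fundamental_theorem_of_calculus t)
        (auto intro!: derivative_eq_intros simp: has_real_derivative_iff_has_vector_derivative[symmetric])
    then have I: "((\<lambda>s. exp (- s * c)) has_integral ((1 - exp (- t * c)) / c)) {0..t}"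
      using c by (simp add: field_simps)
    have S: "set_integrable lborel {0..t} (\<lambda>s. exp (- s * c))"
      by (intro borel_integrable_atLeastAtMost') (auto intro!: continuous_intros)
    have "(LBINT s:{0..t}. exp (- s * c)) = (1 - exp (- t * c)) / c"
      using set_borel_integral_eq_integral(2)[OF S] integral_unique[OF I] by simp
    then show ?thesis using S
      by (simp add: set_lebesgue_integral_def set_integrable_def c_def powr_minus divide_inverse)
  qed
  have prod: "integrable (lborel \<Otimes>\<^sub>M lborel) (\<lambda>(\<theta>, s). ?h \<theta> s)"
  proof (rule lborel_pair.Fubini_integrable)
    show "(\<lambda>(\<theta>, s). ?h \<theta> s) \<in> borel_measurable (lborel \<Otimes>\<^sub>M lborel)" by measurable
    show "AE \<theta> in lborel. integrable lborel (\<lambda>s. case (\<theta>, s) of (\<theta>, s) \<Rightarrow> ?h \<theta> s)"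
      using AE_lborel_singleton[of 0]
    proof eventually_elim
      case (elim \<theta>)
      then have "integrable lborel (\<lambda>s. cos (\<theta> * x) * (indicator {0..t} s * exp (- s * \<bar>\<theta>\<bar> powr \<alpha>)))"
        using inner by (intro integrable_mult_right) auto
      then show ?case by (simp add: mult_ac)
    qed
    show "integrable lborel (\<lambda>\<theta>. \<integral>s. norm (case (\<theta>, s) of (\<theta>, s) \<Rightarrow> ?h \<theta> s) \<partial>lborel)"
    proof (rule Bochner_Integration.integrable_bound[OF E_int])
      show "AE \<theta> in lborel. norm (\<integral>s. norm (case (\<theta>, s) of (\<theta>, s) \<Rightarrow> ?h \<theta> s) \<partial>lborel) \<le> norm (?E \<theta>)"
        using AE_lborel_singleton[of 0]
      proof eventually_elim
        case (elim \<theta>)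
        have "(\<integral>s. norm (case (\<theta>, s) of (\<theta>, s) \<Rightarrow> ?h \<theta> s) \<partial>lborel)
            = (\<integral>s. \<bar>cos (\<theta> * x)\<bar> * (indicator {0..t} s * exp (- s * \<bar>\<theta>\<bar> powr \<alpha>)) \<partial>lborel)"
          by (intro Bochner_Integration.integral_cong) (auto simp: abs_mult)
        also have "\<dots> = \<bar>cos (\<theta> * x)\<bar> * ?E \<theta>" using inner[OF elim] by simp
        also have "\<dots> \<le> ?E \<theta>"
          using integrated_exp_bound(1)[OF t, of \<alpha> \<theta>] alpha by (intro mult_left_le_one_le) auto
        finally show ?case using integrated_exp_bound(1)[OF t, of \<alpha> \<theta>] alpha
          by simp
      qed
    qed measurable
  qed
  have AEs: "AE s in lborel. (\<integral>\<theta>. ?h \<theta> s \<partial>lborel) = 2 * pi * (stable_density \<alpha> s x * indicator {0..t} s)"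
    by (intro AE_I2) (simp add: stable_density_def)
  have K_int: "integrable lborel (\<lambda>s. stable_density \<alpha> s x * indicator {0..t} s)"
  proof -
    have "integrable lborel (\<lambda>s. \<integral>\<theta>. ?h \<theta> s \<partial>lborel)" using lborel_pair.integrable_snd[OF prod] by simp
    then have "integrable lborel (\<lambda>s. 2 * pi * (stable_density \<alpha> s x * indicator {0..t} s))"
      by (rule integrable_cong_AE_imp) (use AEs in \<open>auto elim: eventually_mono\<close>)
    then show ?thesis by simp
  qed
  have "2 * pi * (\<integral>s. stable_density \<alpha> s x * indicator {0..t} s \<partial>lborel)
      = (\<integral>s. (\<integral>\<theta>. ?h \<theta> s \<partial>lborel) \<partial>lborel)"
    by (simp add: stable_density_def mult.commute[of _ "indicator _ _"])
  also have "\<dots> = (\<integral>\<theta>. (\<integral>s. ?h \<theta> s \<partial>lborel) \<partial>lborel)"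
    by (rule lborel_pair.Fubini_integral[OF prod])
  also have "\<dots> = (\<integral>\<theta>. cos (\<theta> * x) * ?E \<theta> \<partial>lborel)"
  proof (rule integral_cong_AE)
    show "AE \<theta> in lborel. (\<integral>s. ?h \<theta> s \<partial>lborel) = cos (\<theta> * x) * ?E \<theta>"
      using AE_lborel_singleton[of 0]
    proof eventually_elim
      case (elim \<theta>)
      have "(\<integral>s. ?h \<theta> s \<partial>lborel) = (\<integral>s. cos (\<theta> * x) * (indicator {0..t} s * exp (- s * \<bar>\<theta>\<bar> powr \<alpha>)) \<partial>lborel)"
        by (simp add: mult_ac)
      then show ?case using inner[OF elim] by simp
    qed
  qed measurable
  finally have eq: "(\<integral>s. stable_density \<alpha> s x * indicator {0..t} s \<partial>lborel)
      = 1 / (2 * pi) * (\<integral>\<theta>. cos (\<theta> * x) * ?E \<theta> \<partial>lborel)" by (simp add: field_simps)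
  have nn: "AE s in lborel. 0 \<le> stable_density \<alpha> s x * indicator {0..t} s"
    using AE_lborel_singleton[of 0] by eventually_elim (auto simp: indicator_def density_nonneg)
  show "0 \<le> (\<integral>\<theta>. cos (\<theta> * x) * ?E \<theta> \<partial>lborel)"
    using integral_nonneg_AE[OF nn] unfolding eq using pi_gt_zero
    by (auto simp: zero_le_divide_iff zero_le_mult_iff simp del: pi_gt_zero)
  from nn_integral_eq_integral[OF K_int nn]
  have "(\<integral>\<^sup>+ s. ennreal (stable_density \<alpha> s x * indicator {0..t} s) \<partial>lborel)
      = ennreal (1 / (2 * pi) * (\<integral>\<theta>. cos (\<theta> * x) * ?E \<theta> \<partial>lborel))" by (simp only: eq)
  moreover have "(\<integral>\<^sup>+ s. ennreal (stable_density \<alpha> s x * indicator {0..t} s) \<partial>lborel)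
      = (\<integral>\<^sup>+ s. ennreal (stable_density \<alpha> s x) * indicator {0..t} s \<partial>lborel)"
    by (intro nn_integral_cong) (auto simp: indicator_def)
  ultimately show "(\<integral>\<^sup>+ s. ennreal (stable_density \<alpha> s x) * indicator {0..t} s \<partial>lborel)
      = ennreal (1 / (2 * pi) * (\<integral>\<theta>. cos (\<theta> * x) * ?E \<theta> \<partial>lborel))" by simp
qed

text \<open>Under \<open>N t\<close> the cosine of frequency \<open>\<theta>\<close> is multiplied
  by \<open>exp (- t * \<bar>\<theta>\<bar> powr \<alpha>)\<close>. Inserting this in the cosine
  representation, the increase over time \<open>t\<close> is the Fourier integral of
  \<open>occupation_density\<close>. Both sides carry the factor \<open>cos_const \<alpha>\<close>,
  cancelled at the end.\<close>

lemma nn_integral_abs_powr: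
  assumes t: "0 \<le> t"
  shows "(\<integral>\<^sup>+ z. ennreal (\<bar>x + z\<bar> powr (\<alpha> - 1)) \<partial>N t) = ennreal (\<bar>x\<bar> powr (\<alpha> - 1))
    + ennreal pot_const * (\<integral>\<^sup>+ s. ennreal (stable_density \<alpha> s x) * indicator {0..t} s \<partial>lborel)"
proof -
  interpret real_distribution "N t" by (rule N_dist[OF t])
  interpret P: pair_sigma_finite "N t" lborel ..
  let ?J = "cos_const \<alpha>"
  let ?E = "\<lambda>\<theta>. (1 - exp (- t * \<bar>\<theta>\<bar> powr \<alpha>)) * \<bar>\<theta>\<bar> powr (- \<alpha>)"
  define \<kappa> where "\<kappa> = (\<integral>\<theta>. cos (\<theta> * x) * ?E \<theta> \<partial>lborel)"
  have J: "0 < ?J" by (rule cos_const_pos[OF alpha])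
  have nn: "0 \<le> (1 - cos y) * \<bar>\<theta>\<bar> powr (- \<alpha>)" for y \<theta> :: real
    using one_minus_cos_bounds(1) by simp
  have rep: "ennreal ?J * ennreal (\<bar>y\<bar> powr (\<alpha> - 1))
      = (\<integral>\<^sup>+ \<theta>. ennreal ((1 - cos (\<theta> * y)) * \<bar>\<theta>\<bar> powr (- \<alpha>)) \<partial>lborel)" for y
    using nn_integral_eq_integral[OF abs_powr_cos(1)[OF alpha, of y]] abs_powr_cos(2)[OF alpha, of y] J nn
    by (simp add: ennreal_mult)
  have "ennreal ?J * (\<integral>\<^sup>+ z. ennreal (\<bar>x + z\<bar> powr (\<alpha> - 1)) \<partial>N t)
      = (\<integral>\<^sup>+ z. ennreal ?J * ennreal (\<bar>x + z\<bar> powr (\<alpha> - 1)) \<partial>N t)"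
    by (intro nn_integral_cmult[symmetric]) measurable
  also have "\<dots> = (\<integral>\<^sup>+ z. \<integral>\<^sup>+ \<theta>. ennreal ((1 - cos (\<theta> * (x + z))) * \<bar>\<theta>\<bar> powr (- \<alpha>)) \<partial>lborel \<partial>N t)"
    by (simp only: rep)
  also have "\<dots> = (\<integral>\<^sup>+ \<theta>. \<integral>\<^sup>+ z. ennreal ((1 - cos (\<theta> * (x + z))) * \<bar>\<theta>\<bar> powr (- \<alpha>)) \<partial>N t \<partial>lborel)"
    by (rule P.Fubini'[symmetric]) measurable
  also have "\<dots> = (\<integral>\<^sup>+ \<theta>. ennreal ((1 - cos (\<theta> * x)) * \<bar>\<theta>\<bar> powr (- \<alpha>) + cos (\<theta> * x) * ?E \<theta>) \<partial>lborel)"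
  proof (intro nn_integral_cong)
    fix \<theta> :: real
    have ic: "integrable (N t) (\<lambda>z. cos (\<theta> * (x + z)))"
      by (intro integrable_const_bound[where B=1]) auto
    have i: "integrable (N t) (\<lambda>z. (1 - cos (\<theta> * (x + z))) * \<bar>\<theta>\<bar> powr (- \<alpha>))"
      by (intro integrable_mult_left Bochner_Integration.integrable_diff ic) auto
    have "(\<integral>\<^sup>+ z. ennreal ((1 - cos (\<theta> * (x + z))) * \<bar>\<theta>\<bar> powr (- \<alpha>)) \<partial>N t)
        = ennreal (\<integral>z. (1 - cos (\<theta> * (x + z))) * \<bar>\<theta>\<bar> powr (- \<alpha>) \<partial>N t)"
      by (rule nn_integral_eq_integral[OF i]) (simp add: nn)
    also have "(\<integral>z. (1 - cos (\<theta> * (x + z))) * \<bar>\<theta>\<bar> powr (- \<alpha>) \<partial>N t)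
        = (1 - cos (\<theta> * x) * exp (- t * \<bar>\<theta>\<bar> powr \<alpha>)) * \<bar>\<theta>\<bar> powr (- \<alpha>)"
      using ic prob_space by (simp add: integral_cos_N[OF t])
    also have "\<dots> = (1 - cos (\<theta> * x)) * \<bar>\<theta>\<bar> powr (- \<alpha>) + cos (\<theta> * x) * ?E \<theta>"
      by (simp add: algebra_simps)
    finally show "(\<integral>\<^sup>+ z. ennreal ((1 - cos (\<theta> * (x + z))) * \<bar>\<theta>\<bar> powr (- \<alpha>)) \<partial>N t)
        = ennreal ((1 - cos (\<theta> * x)) * \<bar>\<theta>\<bar> powr (- \<alpha>) + cos (\<theta> * x) * ?E \<theta>)" .
  qed
  also have "\<dots> = ennreal (?J * \<bar>x\<bar> powr (\<alpha> - 1) + \<kappa>)"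
  proof -
    have E_int: "integrable lborel (\<lambda>\<theta>. cos (\<theta> * x) * ?E \<theta>)"
    proof (rule Bochner_Integration.integrable_bound[OF integrable_integrated_exp[OF t]])
      show "AE \<theta> in lborel. norm (cos (\<theta> * x) * ?E \<theta>) \<le> norm (?E \<theta>)"
        unfolding norm_mult[of "cos _"] by (intro AE_I2 mult_left_le_one_le) auto
    qed measurable
    have nonneg: "0 \<le> (1 - cos (\<theta> * x)) * \<bar>\<theta>\<bar> powr (- \<alpha>) + cos (\<theta> * x) * ?E \<theta>" for \<theta>
    proof -
      have "(1 - cos (\<theta> * x)) * \<bar>\<theta>\<bar> powr (- \<alpha>) + cos (\<theta> * x) * ?E \<theta>
          = (1 - cos (\<theta> * x) * exp (- t * \<bar>\<theta>\<bar> powr \<alpha>)) * \<bar>\<theta>\<bar> powr (- \<alpha>)"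
        by (simp add: algebra_simps)
      moreover have "cos (\<theta> * x) * exp (- t * \<bar>\<theta>\<bar> powr \<alpha>) \<le> 1"
      proof -
        have "cos (\<theta> * x) * exp (- t * \<bar>\<theta>\<bar> powr \<alpha>) \<le> 1 * exp (- t * \<bar>\<theta>\<bar> powr \<alpha>)"
          by (rule mult_right_mono) auto
        also have "\<dots> \<le> 1" using t by simp
        finally show ?thesis .
      qed
      ultimately show ?thesis by simp
    qed
    show ?thesis
      using nn_integral_eq_integral[OF Bochner_Integration.integrable_add[OF abs_powr_cos(1)[OF alpha, of x] E_int]]
        abs_powr_cos[OF alpha, of x] E_int nonneg by (simp add: \<kappa>_def)
  qed
  also have "\<dots> = ennreal ?J * (ennreal (\<bar>x\<bar> powr (\<alpha> - 1))
    + ennreal pot_const * (\<integral>\<^sup>+ s. ennreal (stable_density \<alpha> s x) * indicator {0..t} s \<partial>lborel))"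
  proof -
    have k: "ennreal (1 / (2 * pi) * \<kappa>) = (\<integral>\<^sup>+ s. ennreal (stable_density \<alpha> s x) * indicator {0..t} s \<partial>lborel)"
      unfolding \<kappa>_def by (rule occupation_density(2)[OF t, symmetric])
    have "0 \<le> \<kappa>" unfolding \<kappa>_def by (rule occupation_density(1)[OF t])
    then show ?thesis unfolding k[symmetric] using J
      by (simp add: pot_const_def ennreal_mult[symmetric] distrib_left flip: ennreal_plus)
  qed
  finally have *: "ennreal ?J * (\<integral>\<^sup>+ z. ennreal (\<bar>x + z\<bar> powr (\<alpha> - 1)) \<partial>N t) = \<dots>" .
  then show ?thesis using J
    by (subst (asm) ennreal_mult_cancel_left) auto
qed

text \<open>The kernel vanishes on the diagonal and grows at infinity, so \<open>potential f\<close>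
  increases in mean along the process. A superharmonic function must therefore contain it with a
  minus sign.\<close>

definition potential :: "(real \<Rightarrow> ennreal) \<Rightarrow> real \<Rightarrow> ennreal" where
  "potential f x = (\<integral>\<^sup>+ y. f y * ennreal (\<bar>x - y\<bar> powr (\<alpha> - 1)) \<partial>lborel)"

text \<open>Expected integral of \<open>f\<close> along the process started at \<open>x\<close>, up
  to time \<open>t\<close>. At \<open>s = 0\<close> the inversion integral defines no density of the
  unit mass; this single instant has Lebesgue measure 0, which is why 0 is excluded before pointwise
  estimates in \<open>s\<close>.\<close>

definition occupation :: "real \<Rightarrow> (real \<Rightarrow> ennreal) \<Rightarrow> real \<Rightarrow> ennreal" where
  "occupation t f x =
    (\<integral>\<^sup>+ s. (\<integral>\<^sup>+ y. f y * ennreal (stable_density \<alpha> s (y - x)) \<partial>lborel) * indicator {0..t} s \<partial>lborel)"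

lemma potential_measurable [measurable]:
  assumes [measurable]: "f \<in> borel_measurable borel"
  shows "potential f \<in> borel_measurable borel"
  unfolding potential_def[abs_def] by measurable

lemma occupation_measurable [measurable]:
  assumes [measurable]: "f \<in> borel_measurable borel"
  shows "occupation t f \<in> borel_measurable borel"
  unfolding occupation_def[abs_def] by measurable

text \<open>\<open>nn_integral_abs_powr\<close> is integrated against \<open>f\<close> over the
  position of the pole; evenness of the density puts the result in the form of an expected
  occupation.\<close>

lemma potential_step:
  assumes t: "0 \<le> t" and [measurable]: "f \<in> borel_measurable borel"
  shows "(\<integral>\<^sup>+ z. potential f (x + z) \<partial>N t) = potential f x + ennreal pot_const * occupation t f x"
proof -
  interpret real_distribution "N t" by (rule N_dist[OF t])
  interpret P: pair_sigma_finite "N t" lborel ..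
  let ?k = "\<lambda>y. \<integral>\<^sup>+ s. ennreal (stable_density \<alpha> s (x - y)) * indicator {0..t} s \<partial>lborel"
  have [measurable]: "?k \<in> borel_measurable borel" by measurable
  have "(\<integral>\<^sup>+ z. potential f (x + z) \<partial>N t)
      = (\<integral>\<^sup>+ z. \<integral>\<^sup>+ y. f y * ennreal (\<bar>x + z - y\<bar> powr (\<alpha> - 1)) \<partial>lborel \<partial>N t)"
    by (simp add: potential_def)
  also have "\<dots> = (\<integral>\<^sup>+ y. \<integral>\<^sup>+ z. f y * ennreal (\<bar>x + z - y\<bar> powr (\<alpha> - 1)) \<partial>N t \<partial>lborel)"
    by (rule P.Fubini'[symmetric]) measurable
  also have "\<dots> = (\<integral>\<^sup>+ y. f y * ennreal (\<bar>x - y\<bar> powr (\<alpha> - 1)) + ennreal pot_const * (f y * ?k y) \<partial>lborel)"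
  proof (intro nn_integral_cong)
    fix y
    have "(\<integral>\<^sup>+ z. f y * ennreal (\<bar>x + z - y\<bar> powr (\<alpha> - 1)) \<partial>N t)
        = f y * (\<integral>\<^sup>+ z. ennreal (\<bar>(x - y) + z\<bar> powr (\<alpha> - 1)) \<partial>N t)"
      by (subst nn_integral_cmult) (auto simp: algebra_simps)
    then show "(\<integral>\<^sup>+ z. f y * ennreal (\<bar>x + z - y\<bar> powr (\<alpha> - 1)) \<partial>N t)
        = f y * ennreal (\<bar>x - y\<bar> powr (\<alpha> - 1)) + ennreal pot_const * (f y * ?k y)"
      by (simp add: nn_integral_abs_powr[OF t] distrib_left mult_ac)
  qed
  also have "\<dots> = potential f x + ennreal pot_const * (\<integral>\<^sup>+ y. f y * ?k y \<partial>lborel)"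
    by (simp add: nn_integral_add nn_integral_cmult potential_def)
  also have "(\<integral>\<^sup>+ y. f y * ?k y \<partial>lborel)
      = (\<integral>\<^sup>+ y. \<integral>\<^sup>+ s. f y * ennreal (stable_density \<alpha> s (y - x)) * indicator {0..t} s \<partial>lborel \<partial>lborel)"
  proof (intro nn_integral_cong)
    fix y
    have "stable_density \<alpha> s (x - y) = stable_density \<alpha> s (y - x)" for s
      using stable_density_even[of \<alpha> s "y - x"] by simp
    then show "f y * ?k y = (\<integral>\<^sup>+ s. f y * ennreal (stable_density \<alpha> s (y - x)) * indicator {0..t} s \<partial>lborel)"
      by (subst nn_integral_cmult[symmetric]) (auto simp: mult.assoc)
  qed
  also have "\<dots> = (\<integral>\<^sup>+ s. \<integral>\<^sup>+ y. f y * ennreal (stable_density \<alpha> s (y - x)) * indicator {0..t} s \<partial>lborel \<partial>lborel)"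
    by (rule lborel_pair.Fubini') measurable
  also have "\<dots> = occupation t f x"
    unfolding occupation_def by (intro nn_integral_cong nn_integral_multc) measurable
  finally show ?thesis .
qed

lemma occupation_le:
  assumes t: "0 \<le> t" and [measurable]: "f \<in> borel_measurable borel" and f: "\<And>y. f y \<le> C"
  shows "occupation t f x \<le> ennreal t * C"
proof -
  have "occupation t f x \<le> (\<integral>\<^sup>+ s. C * indicator {0..t} s \<partial>lborel)"
    unfolding occupation_def
  proof (rule nn_integral_mono_AE)
    show "AE s in lborel. (\<integral>\<^sup>+ y. f y * ennreal (stable_density \<alpha> s (y - x)) \<partial>lborel) * indicator {0..t} s
        \<le> C * indicator {0..t} s"
      using AE_lborel_singleton[of 0]
    proof eventually_elim
      case (elim s)
      show ?case
      proof (cases "s \<in> {0..t}")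
        case True
        then have s: "0 < s" using elim by auto
        interpret prob_space "N s" using s by (intro N_prob) simp
        have "(\<integral>\<^sup>+ z. f (x + z) \<partial>N s) \<le> (\<integral>\<^sup>+ z. C \<partial>N s)" by (intro nn_integral_mono f)
        then show ?thesis by (simp add: nn_integral_N[OF s] emeasure_space_1 mult_right_mono)
      qed simp
    qed
  qed
  also have "\<dots> = ennreal t * C" using t by (simp add: nn_integral_cmult mult.commute)
  finally show ?thesis .
qed

end

section \<open>Barriers for the stable semigroup\<close>

text \<open>With \<open>s\<close> the sum of the absolute values, each fraction \<open>y / s\<close>
  lies in the unit interval and is at most its own power with exponent
  \<open>\<beta> \<le> 1\<close>; the two fractions add up to 1.\<close>

lemma abs_add_powr_le:
  fixes a b \<beta> :: real
  assumes "0 < \<beta>" "\<beta> \<le> 1"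
  shows "\<bar>a + b\<bar> powr \<beta> \<le> \<bar>a\<bar> powr \<beta> + \<bar>b\<bar> powr \<beta>"
proof -
  define s where "s = \<bar>a\<bar> + \<bar>b\<bar>"
  have "\<bar>a + b\<bar> powr \<beta> \<le> s powr \<beta>"
    using assms by (intro powr_mono2) (auto simp: s_def)
  also have "s powr \<beta> \<le> \<bar>a\<bar> powr \<beta> + \<bar>b\<bar> powr \<beta>"
  proof (cases "s = 0")
    case False
    then have s: "s > 0" by (auto simp: s_def)
    have *: "y / s * s powr \<beta> \<le> y powr \<beta>" if "0 \<le> y" "y \<le> s" for y
    proof -
      have "(y / s) powr 1 \<le> (y / s) powr \<beta>"
        using assms that s by (intro powr_mono') (auto simp: divide_le_eq_1)
      then have "y / s * s powr \<beta> \<le> (y / s) powr \<beta> * s powr \<beta>"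
        using that s by (intro mult_right_mono) auto
      also have "\<dots> = y powr \<beta>" using that s by (simp add: powr_divide)
      finally show ?thesis .
    qed
    have "s powr \<beta> = \<bar>a\<bar> / s * s powr \<beta> + \<bar>b\<bar> / s * s powr \<beta>"
      using s by (simp add: s_def add_divide_distrib[symmetric] distrib_right[symmetric])
    also have "\<dots> \<le> \<bar>a\<bar> powr \<beta> + \<bar>b\<bar> powr \<beta>"
      by (intro add_mono *) (auto simp: s_def)
    finally show ?thesis .
  qed (use assms in simp)
  finally show ?thesis .
qed

lemma ennreal_right_cancel_le:
  fixes a b c :: ennreal
  assumes "a + c \<le> b + c" "c < \<infinity>"
  shows "a \<le> b"
  using assms ennreal_add_left_cancel_le[of c a b] by (simp add: add.commute less_top[symmetric])

text \<open>A tent of mass 1: a multiple of it can match the mass of any \<open>f\<close>, and its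
  continuity lets sums over time grids converge to the path integral.\<close>

definition hat :: "real \<Rightarrow> real" where
  "hat z = max 0 (1 - \<bar>z\<bar>)"

lemma hat_measurable [measurable]: "hat \<in> borel_measurable borel"
  unfolding hat_def[abs_def] by measurable

lemma hat_nonneg: "0 \<le> hat z" and hat_le_1: "hat z \<le> 1"
  and hat_lipschitz: "\<bar>hat y - hat z\<bar> \<le> \<bar>y - z\<bar>"
  and hat_support: "hat z \<noteq> 0 \<Longrightarrow> \<bar>z\<bar> \<le> 1"
  by (auto simp: hat_def max_def abs_if split: if_splits)

lemma nn_integral_hat: "(\<integral>\<^sup>+ z. ennreal (hat z) \<partial>lborel) = 1"
proof -
  have l: "((\<lambda>x. 1 + x) has_integral ((0 + 0\<^sup>2 / 2) - (- 1 + (- 1)\<^sup>2 / 2))) {- 1..0::real}"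
    by (intro fundamental_theorem_of_calculus)
      (auto intro!: derivative_eq_intros simp: has_real_derivative_iff_has_vector_derivative[symmetric])
  have r: "((\<lambda>x. 1 - x) has_integral ((1 - 1\<^sup>2 / 2) - (0 - 0\<^sup>2 / 2))) {0..1::real}"
    by (intro fundamental_theorem_of_calculus)
      (auto intro!: derivative_eq_intros simp: has_real_derivative_iff_has_vector_derivative[symmetric])
  have l': "(hat has_integral 1 / 2) {- 1..0}"
    using has_integral_eq[OF _ l, of hat] by (simp add: hat_def)
  have r': "(hat has_integral 1 / 2) {0..1}"
    using has_integral_eq[OF _ r, of hat] by (simp add: hat_def)
  have "(hat has_integral 1) {- 1..1}"
    using has_integral_combine[OF _ _ l' r'] by simp
  then have "(\<integral>\<^sup>+ z. ennreal (hat z) * indicator {- 1..1} z \<partial>lborel) = ennreal 1"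
    by (intro nn_integral_has_integral_lebesgue'[rotated]) (auto simp: hat_nonneg)
  moreover have "(\<integral>\<^sup>+ z. ennreal (hat z) * indicator {- 1..1} z \<partial>lborel) = (\<integral>\<^sup>+ z. ennreal (hat z) \<partial>lborel)"
    using hat_support by (intro nn_integral_cong) (force simp: indicator_def abs_le_iff)
  ultimately show ?thesis by simp
qed

context stable_family
begin

abbreviation hatE :: "real \<Rightarrow> ennreal" where "hatE z \<equiv> ennreal (hat z)"

text \<open>For the speed density this is the mass of the speed measure plus the integral
  \<open>I\<close>, so its finiteness is the hypothesis of the theorem.\<close>

definition weight :: "(real \<Rightarrow> ennreal) \<Rightarrow> ennreal" where
  "weight f = (\<integral>\<^sup>+ y. f y * ennreal (1 + \<bar>y\<bar> powr (\<alpha> - 1)) \<partial>lborel)"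

lemma mass_le_weight: "(\<integral>\<^sup>+ y. f y \<partial>lborel) \<le> weight f"
  unfolding weight_def
proof (rule nn_integral_mono)
  fix y
  have "f y * 1 \<le> f y * ennreal (1 + \<bar>y\<bar> powr (\<alpha> - 1))"
    by (intro mult_left_mono) (auto simp: ennreal_1[symmetric] simp del: ennreal_1)
  then show "f y \<le> f y * ennreal (1 + \<bar>y\<bar> powr (\<alpha> - 1))" by simp
qed

text \<open>Moving the pole between \<open>y\<close> and a point \<open>z\<close> of the unit
  interval around 0 changes the kernel by at most
  \<open>\<bar>y - z\<bar> powr (\<alpha> - 1)\<close>, by subadditivity, uniformly in
  \<open>x\<close>.\<close>

lemma powr_shift:
  assumes "\<bar>z\<bar> \<le> 1"
  shows "\<bar>x - z\<bar> powr (\<alpha> - 1) \<le> \<bar>x - y\<bar> powr (\<alpha> - 1) + (1 + \<bar>y\<bar> powr (\<alpha> - 1))"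
    and "\<bar>x - y\<bar> powr (\<alpha> - 1) \<le> \<bar>x - z\<bar> powr (\<alpha> - 1) + (1 + \<bar>y\<bar> powr (\<alpha> - 1))"
proof -
  have \<beta>: "0 < \<alpha> - 1" "\<alpha> - 1 \<le> 1" using alpha by auto
  have "\<bar>y - z\<bar> powr (\<alpha> - 1) \<le> \<bar>y\<bar> powr (\<alpha> - 1) + \<bar>z\<bar> powr (\<alpha> - 1)"
    using abs_add_powr_le[OF \<beta>, of y "- z"] by simp
  also have "\<bar>z\<bar> powr (\<alpha> - 1) \<le> 1" using powr_mono2[of "\<alpha> - 1" "\<bar>z\<bar>" 1] assms \<beta> by simp
  finally have yz: "\<bar>y - z\<bar> powr (\<alpha> - 1) \<le> 1 + \<bar>y\<bar> powr (\<alpha> - 1)" by simp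
  then show "\<bar>x - z\<bar> powr (\<alpha> - 1) \<le> \<bar>x - y\<bar> powr (\<alpha> - 1) + (1 + \<bar>y\<bar> powr (\<alpha> - 1))"
    using abs_add_powr_le[OF \<beta>, of "x - y" "y - z"] by simp
  show "\<bar>x - y\<bar> powr (\<alpha> - 1) \<le> \<bar>x - z\<bar> powr (\<alpha> - 1) + (1 + \<bar>y\<bar> powr (\<alpha> - 1))"
    using abs_add_powr_le[OF \<beta>, of "x - z" "z - y"] yz by (simp add: abs_minus_commute)
qed

lemma potential_double:
  assumes [measurable]: "f \<in> borel_measurable borel"
  shows "(\<integral>\<^sup>+ y. f y \<partial>lborel) * potential hatE x
      = (\<integral>\<^sup>+ y. \<integral>\<^sup>+ z. f y * hatE z * ennreal (\<bar>x - z\<bar> powr (\<alpha> - 1)) \<partial>lborel \<partial>lborel)"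
    and "potential f x
      = (\<integral>\<^sup>+ y. \<integral>\<^sup>+ z. f y * hatE z * ennreal (\<bar>x - y\<bar> powr (\<alpha> - 1)) \<partial>lborel \<partial>lborel)"
    and "weight f
      = (\<integral>\<^sup>+ y. \<integral>\<^sup>+ z. f y * hatE z * ennreal (1 + \<bar>y\<bar> powr (\<alpha> - 1)) \<partial>lborel \<partial>lborel)"
proof -
  show "(\<integral>\<^sup>+ y. f y \<partial>lborel) * potential hatE x
      = (\<integral>\<^sup>+ y. \<integral>\<^sup>+ z. f y * hatE z * ennreal (\<bar>x - z\<bar> powr (\<alpha> - 1)) \<partial>lborel \<partial>lborel)"
  proof (subst nn_integral_multc[symmetric])
    show "(\<integral>\<^sup>+ y. f y * potential hatE x \<partial>lborel)
      = (\<integral>\<^sup>+ y. \<integral>\<^sup>+ z. f y * hatE z * ennreal (\<bar>x - z\<bar> powr (\<alpha> - 1)) \<partial>lborel \<partial>lborel)"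
      by (simp add: potential_def nn_integral_cmult mult.assoc)
  qed simp
  have *: "(\<integral>\<^sup>+ z. f y * hatE z * a \<partial>lborel) = f y * a" for a y
  proof -
    have "(\<integral>\<^sup>+ z. f y * hatE z * a \<partial>lborel) = (\<integral>\<^sup>+ z. (f y * a) * hatE z \<partial>lborel)"
      by (intro nn_integral_cong) (simp add: mult_ac)
    also have "\<dots> = f y * a" by (subst nn_integral_cmult) (simp_all add: nn_integral_hat)
    finally show ?thesis .
  qed
  show "potential f x
      = (\<integral>\<^sup>+ y. \<integral>\<^sup>+ z. f y * hatE z * ennreal (\<bar>x - y\<bar> powr (\<alpha> - 1)) \<partial>lborel \<partial>lborel)"
    by (simp add: * potential_def)
  show "weight f
      = (\<integral>\<^sup>+ y. \<integral>\<^sup>+ z. f y * hatE z * ennreal (1 + \<bar>y\<bar> powr (\<alpha> - 1)) \<partial>lborel \<partial>lborel)"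
    by (simp add: * weight_def)
qed

text \<open>Both potentials are written as double integrals against \<open>f y * hat z\<close>,
  where \<open>powr_shift\<close> compares the integrands. Potentials of equal mass thus differ by a
  quantity independent of \<open>x\<close>, although each grows at infinity.\<close>

lemma potential_compare:
  assumes [measurable]: "f \<in> borel_measurable borel"
  shows "(\<integral>\<^sup>+ y. f y \<partial>lborel) * potential hatE x \<le> potential f x + weight f"
    and "potential f x \<le> (\<integral>\<^sup>+ y. f y \<partial>lborel) * potential hatE x + weight f"
proof -
  have le: "f y * hatE z * ennreal a \<le> f y * hatE z * ennreal b + f y * hatE z * ennreal c"
    if "hat z \<noteq> 0 \<Longrightarrow> a \<le> b + c" "0 \<le> b" "0 \<le> c" for y z a b c
  proof (cases "hat z = 0")
    case False
    then have "ennreal a \<le> ennreal b + ennreal c"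
      using that by (simp add: ennreal_plus[symmetric] ennreal_leI del: ennreal_plus)
    then have "f y * hatE z * ennreal a \<le> f y * hatE z * (ennreal b + ennreal c)"
      by (intro mult_left_mono) auto
    then show ?thesis by (simp add: distrib_left)
  qed simp
  show "(\<integral>\<^sup>+ y. f y \<partial>lborel) * potential hatE x \<le> potential f x + weight f"
    unfolding potential_double[OF assms]
    by (simp add: nn_integral_add[symmetric] del: ennreal_plus)
      (intro nn_integral_mono le powr_shift hat_support, auto)
  show "potential f x \<le> (\<integral>\<^sup>+ y. f y \<partial>lborel) * potential hatE x + weight f"
    unfolding potential_double[OF assms]
    by (simp add: nn_integral_add[symmetric] del: ennreal_plus)
      (intro nn_integral_mono le powr_shift hat_support, auto)
qed

lemma potential_hat_finite: "potential hatE x < \<infinity>"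
proof -
  have "potential hatE x \<le> (\<integral>\<^sup>+ z. hatE z * ennreal (\<bar>x\<bar> powr (\<alpha> - 1) + 1) \<partial>lborel)"
    unfolding potential_def
  proof (rule nn_integral_mono)
    fix z
    show "hatE z * ennreal (\<bar>x - z\<bar> powr (\<alpha> - 1)) \<le> hatE z * ennreal (\<bar>x\<bar> powr (\<alpha> - 1) + 1)"
    proof (cases "hat z = 0")
      case False
      then show ?thesis using powr_shift(1)[OF hat_support, of z x 0]
        by (intro mult_left_mono ennreal_leI) auto
    qed simp
  qed
  also have "\<dots> = ennreal (\<bar>x\<bar> powr (\<alpha> - 1) + 1)"
    by (subst nn_integral_multc) (simp_all add: nn_integral_hat)
  finally show ?thesis by (simp add: le_less_trans)
qed

lemma occupation_hat_le: "0 \<le> h \<Longrightarrow> occupation h hatE x \<le> ennreal h"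
  using occupation_le[of h hatE 1 x] hat_le_1 by simp

text \<open>The generator of \<open>X\<close> maps \<open>potential f\<close> to \<open>pot_const * f\<close>, hence \<open>barrier \<gamma> f\<close> to
  \<open>pot_const * (m * hat - f)\<close> with \<open>m\<close> the mass of \<open>f\<close>; killing at rate \<open>\<gamma> * hat\<close> absorbs the
  positive part, because \<open>barrier \<gamma> f \<ge> (pot_const / \<gamma>) * m\<close>. The truncated subtraction is exact.\<close>

definition barrier :: "real \<Rightarrow> (real \<Rightarrow> ennreal) \<Rightarrow> real \<Rightarrow> ennreal" where
  "barrier \<gamma> f x = (weight f + ennreal (pot_const / \<gamma>) * (\<integral>\<^sup>+ y. f y \<partial>lborel)
      + (\<integral>\<^sup>+ y. f y \<partial>lborel) * potential hatE x) - potential f x"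

lemma barrier_measurable [measurable]:
  assumes [measurable]: "f \<in> borel_measurable borel"
  shows "barrier \<gamma> f \<in> borel_measurable borel"
  unfolding barrier_def[abs_def] by measurable

text \<open>One step of length \<open>h\<close> of the killed supermartingale property. The
  potentials of \<open>f\<close> and of the tent are advanced by \<open>potential_step\<close>; the
  tent produces an excess \<open>m * pot_const * occupation h hat\<close>, and the killed fraction
  of the barrier, which is at least \<open>(pot_const / \<gamma>) * m\<close> everywhere, pays for
  it. The condition \<open>\<gamma> * h \<le> 1\<close> keeps the weight from being
  truncated.\<close>

lemma barrier:
  assumes \<gamma>: "0 < \<gamma>" and h: "0 \<le> h" "\<gamma> * h \<le> 1"
    and f[measurable]: "f \<in> borel_measurable borel" and fin: "weight f < \<infinity>"
    and bdd: "\<And>y. f y \<le> C" "C < \<infinity>"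
  shows "ennreal pot_const * occupation h f x
      + (1 - ennreal \<gamma> * occupation h hatE x) * (\<integral>\<^sup>+ z. barrier \<gamma> f (x + z) \<partial>N h) \<le> barrier \<gamma> f x"
    and "barrier \<gamma> f x \<le> ennreal (2 + pot_const / \<gamma>) * weight f"
proof -
  interpret prob_space "N h" by (rule N_prob[OF h(1)])
  note [measurable_cong] = sets_N[OF h(1)]
  let ?c = "ennreal pot_const" and ?S = "barrier \<gamma> f"
  define m where "m = (\<integral>\<^sup>+ y. f y \<partial>lborel)"
  define a where "a x = weight f + ennreal (pot_const / \<gamma>) * m + m * potential hatE x" for x
  have [measurable]: "a \<in> borel_measurable borel" unfolding a_def by measurable
  have m_fin: "m < \<infinity>" using mass_le_weight[of f] fin by (auto simp: m_def intro: le_less_trans)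
  have pf_fin: "potential f x < \<infinity>" for x
    using potential_compare(2)[OF f, of x] m_fin fin potential_hat_finite[of x]
    by (auto simp: m_def[symmetric] ennreal_mult_less_top intro: le_less_trans)
  have le_a: "potential f x \<le> a x" for x
    using potential_compare(2)[OF f, of x]
    unfolding a_def m_def by (rule order_trans) (auto simp: add_ac intro: add_mono)
  \<comment> \<open>Sums replace the truncated difference from here on; the finite potential is
    cancelled only after integration.\<close>
  have S_eq: "?S x + potential f x = a x" for x
    unfolding barrier_def m_def[symmetric] a_def[symmetric]
    using le_a[of x] by (simp add: diff_add_cancel_ennreal)
  have upper: "?S x \<le> ennreal (2 + pot_const / \<gamma>) * weight f" for x
  proof -
    have "a x \<le> weight f + ennreal (pot_const / \<gamma>) * weight f + (potential f x + weight f)"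
      unfolding a_def m_def
      by (intro add_mono mult_left_mono mass_le_weight potential_compare(1)[OF f]) auto
    also have "\<dots> = ennreal (2 + pot_const / \<gamma>) * weight f + potential f x"
    proof -
      have "ennreal (2 + pot_const / \<gamma>) = 1 + 1 + ennreal (pot_const / \<gamma>)"
        using \<gamma> pot_const_pos by (simp add: one_add_one)
      then show ?thesis by (simp only: distrib_right mult_1 add_ac)
    qed
    finally have "?S x + potential f x \<le> ennreal (2 + pot_const / \<gamma>) * weight f + potential f x"
      by (simp add: S_eq)
    then show ?thesis by (rule ennreal_right_cancel_le[OF _ pf_fin])
  qed
  then show "barrier \<gamma> f x \<le> ennreal (2 + pot_const / \<gamma>) * weight f" .
  have lower: "ennreal (pot_const / \<gamma>) * m \<le> ?S x" for x
  proof -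
    have "ennreal (pot_const / \<gamma>) * m + potential f x
        \<le> ennreal (pot_const / \<gamma>) * m + (m * potential hatE x + weight f)"
      using potential_compare(2)[OF f, of x] by (intro add_mono) (auto simp: m_def)
    also have "\<dots> = a x" by (simp add: a_def add_ac)
    also have "a x = ?S x + potential f x" by (simp only: S_eq)
    finally show ?thesis by (rule ennreal_right_cancel_le[OF _ pf_fin])
  qed
  define QS where "QS = (\<integral>\<^sup>+ z. ?S (x + z) \<partial>N h)"
  let ?Kf = "occupation h f x" and ?Kw = "occupation h hatE x"
  have QS_le: "QS \<le> ennreal (2 + pot_const / \<gamma>) * weight f"
  proof -
    have "QS \<le> (\<integral>\<^sup>+ z. ennreal (2 + pot_const / \<gamma>) * weight f \<partial>N h)"
      unfolding QS_def by (intro nn_integral_mono upper)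
    then show ?thesis by (simp add: emeasure_space_1)
  qed
  then have QS_fin: "QS < \<infinity>" using fin by (auto simp: ennreal_mult_less_top intro: le_less_trans)
  have QS_ge: "ennreal (pot_const / \<gamma>) * m \<le> QS"
  proof -
    have "(\<integral>\<^sup>+ z. ennreal (pot_const / \<gamma>) * m \<partial>N h) \<le> QS"
      unfolding QS_def by (intro nn_integral_mono lower)
    then show ?thesis by (simp add: emeasure_space_1)
  qed
  have "QS + (potential f x + ?c * ?Kf) = (\<integral>\<^sup>+ z. ?S (x + z) + potential f (x + z) \<partial>N h)"
    unfolding QS_def potential_step[OF h(1) f, symmetric] by (rule nn_integral_add[symmetric]) measurable
  also have "\<dots> = (\<integral>\<^sup>+ z. a (x + z) \<partial>N h)" by (simp add: S_eq)
  also have "\<dots> = weight f + ennreal (pot_const / \<gamma>) * m + m * (\<integral>\<^sup>+ z. potential hatE (x + z) \<partial>N h)"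
    unfolding a_def by (simp add: nn_integral_add nn_integral_cmult emeasure_space_1)
  also have "\<dots> = a x + m * (?c * ?Kw)"
    by (simp add: potential_step[OF h(1)] a_def distrib_left)
  also have "\<dots> = ?S x + m * (?c * ?Kw) + potential f x" by (simp add: S_eq[symmetric] add_ac)
  finally have "(QS + ?c * ?Kf) + potential f x = (?S x + m * (?c * ?Kw)) + potential f x"
    by (simp add: add_ac)
  \<comment> \<open>Exact balance over one step: the expected barrier plus the occupation of
    \<open>f\<close> equals the old barrier plus the excess from the tent.\<close>
  then have key: "QS + ?c * ?Kf = ?S x + m * (?c * ?Kw)"
    by (metis antisym ennreal_right_cancel_le order_refl pf_fin)
  have gK: "ennreal \<gamma> * ?Kw \<le> 1"
  proof -
    have "ennreal \<gamma> * ?Kw \<le> ennreal \<gamma> * ennreal h"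
      using occupation_hat_le[OF h(1), of x] by (intro mult_left_mono) auto
    also have "\<dots> \<le> 1" using \<gamma> h by (simp add: ennreal_mult[symmetric] ennreal_le_1)
    finally show ?thesis .
  qed
  \<comment> \<open>The excess is \<open>\<gamma> * ?Kw\<close> times the uniform lower bound of the
    barrier, hence at most the part of \<open>QS\<close> removed by killing.\<close>
  have "m * (?c * ?Kw) = ennreal \<gamma> * ?Kw * (ennreal (pot_const / \<gamma>) * m)"
  proof -
    have "ennreal \<gamma> * ennreal (pot_const / \<gamma>) = ?c"
      using \<gamma> pot_const_pos by (simp add: ennreal_mult[symmetric])
    then have "m * (?c * ?Kw) = m * ((ennreal \<gamma> * ennreal (pot_const / \<gamma>)) * ?Kw)" by simp
    then show ?thesis by (simp only: mult_ac)
  qed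
  also have "\<dots> \<le> ennreal \<gamma> * ?Kw * QS" by (intro mult_left_mono QS_ge) auto
  finally have e1: "QS + ?c * ?Kf \<le> ?S x + ennreal \<gamma> * ?Kw * QS"
    unfolding key by (intro add_mono) auto
  have e2: "(1 - ennreal \<gamma> * ?Kw) * QS + ennreal \<gamma> * ?Kw * QS = QS"
    unfolding distrib_right[symmetric] diff_add_cancel_ennreal[OF gK] by simp
  have e3: "(?c * ?Kf + (1 - ennreal \<gamma> * ?Kw) * QS) + ennreal \<gamma> * ?Kw * QS
      = ((1 - ennreal \<gamma> * ?Kw) * QS + ennreal \<gamma> * ?Kw * QS) + ?c * ?Kf" by (simp only: add_ac)
  have "(?c * ?Kf + (1 - ennreal \<gamma> * ?Kw) * QS) + ennreal \<gamma> * ?Kw * QS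
      \<le> ?S x + ennreal \<gamma> * ?Kw * QS"
    unfolding e3 e2 by (rule e1)
  moreover have "ennreal \<gamma> * ?Kw * QS < \<infinity>"
    using mult_right_mono[OF gK, of QS] QS_fin by (simp add: le_less_trans)
  ultimately show "?c * ?Kf + (1 - ennreal \<gamma> * ?Kw) * (\<integral>\<^sup>+ z. ?S (x + z) \<partial>N h) \<le> ?S x"
    unfolding QS_def by (rule ennreal_right_cancel_le)
qed

text \<open>An unbounded companion of the barrier, growing like
  \<open>\<bar>x\<bar> powr (\<alpha> - 1)\<close>. Its mean increase comes from the tent and is
  compensated by killing because \<open>v \<ge> pot_const / \<gamma>\<close>. It serves to show that
  the clock diverges.\<close>

lemma lyapunov:
  assumes \<gamma>: "0 < \<gamma>" and h: "0 \<le> h" "\<gamma> * h \<le> 1"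
  defines "v \<equiv> \<lambda>x. potential hatE x + ennreal (pot_const / \<gamma>)"
  shows "(1 - ennreal \<gamma> * occupation h hatE x) * (\<integral>\<^sup>+ z. v (x + z) \<partial>N h) \<le> v x"
proof -
  interpret prob_space "N h" by (rule N_prob[OF h(1)])
  note [measurable_cong] = sets_N[OF h(1)]
  let ?Kw = "occupation h hatE x" and ?c = "ennreal pot_const"
  define g where "g = 1 - ennreal \<gamma> * ?Kw"
  have gK: "ennreal \<gamma> * ?Kw \<le> 1"
  proof -
    have "ennreal \<gamma> * ?Kw \<le> ennreal \<gamma> * ennreal h"
      using occupation_hat_le[OF h(1), of x] by (intro mult_left_mono) auto
    also have "\<dots> \<le> 1" using \<gamma> h by (simp add: ennreal_mult[symmetric] ennreal_le_1)
    finally show ?thesis .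
  qed
  have g: "g + ennreal \<gamma> * ?Kw = 1" unfolding g_def by (rule diff_add_cancel_ennreal[OF gK])
  have g1: "g \<le> 1" using g by (metis le_iff_add)
  have "(\<integral>\<^sup>+ z. v (x + z) \<partial>N h) = v x + ?c * ?Kw"
    unfolding v_def
    by (simp add: nn_integral_add emeasure_space_1 potential_step[OF h(1)])
  then have "g * (\<integral>\<^sup>+ z. v (x + z) \<partial>N h) = g * v x + g * (?c * ?Kw)" by (simp add: distrib_left)
  also have "\<dots> \<le> g * v x + 1 * (?c * ?Kw)" by (intro add_mono mult_right_mono g1) auto
  also have "1 * (?c * ?Kw) = ennreal \<gamma> * ?Kw * ennreal (pot_const / \<gamma>)"
  proof -
    have "ennreal \<gamma> * ennreal (pot_const / \<gamma>) = ?c"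
      using \<gamma> pot_const_pos by (simp add: ennreal_mult[symmetric])
    then have "1 * (?c * ?Kw) = (ennreal \<gamma> * ennreal (pot_const / \<gamma>)) * ?Kw" by simp
    then show ?thesis by (simp only: mult_ac)
  qed
  also have "\<dots> \<le> ennreal \<gamma> * ?Kw * v x" by (intro mult_left_mono) (auto simp: v_def)
  also have "g * v x + \<dots> = v x" unfolding distrib_right[symmetric] g by simp
  finally show ?thesis by (simp add: g_def add_left_mono)
qed

end

section \<open>Supermartingale inequalities for random walks\<close>

lemma measurable_sum_component:
  "J \<subseteq> I \<Longrightarrow> (\<lambda>a. \<Sum>i\<in>J. a i :: real) \<in> borel_measurable (PiM I (\<lambda>_. borel))"
  by (rule borel_measurable_sum[where f="\<lambda>i a. a i"]) (auto intro: measurable_component_singleton)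

context prob_space
begin

text \<open>The last increment is independent of the earlier ones, on which \<open>F\<close> and the
  current position depend; the product form of the joint law lets it be integrated out
  first.\<close>

lemma walk_step:
  fixes \<xi> :: "nat \<Rightarrow> 'a \<Rightarrow> real" and x :: real
  assumes ind: "indep_vars (\<lambda>_. borel) \<xi> {..<Suc n}"
    and law: "distr M borel (\<xi> n) = L"
    and [measurable]: "F \<in> borel_measurable (PiM {..<n} (\<lambda>_. borel))" "S \<in> borel_measurable borel"
  shows "(\<integral>\<^sup>+ \<omega>. F (\<lambda>i\<in>{..<n}. \<xi> i \<omega>) * S (x + (\<Sum>i<Suc n. \<xi> i \<omega>)) \<partial>M)
    = (\<integral>\<^sup>+ \<omega>. F (\<lambda>i\<in>{..<n}. \<xi> i \<omega>) * (\<integral>\<^sup>+ z. S (x + (\<Sum>i<n. \<xi> i \<omega>) + z) \<partial>L) \<partial>M)"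
proof -
  have [measurable]: "\<xi> i \<in> borel_measurable M" if "i < Suc n" for i
    using ind that by (auto simp: indep_vars_def2)
  then have [measurable]: "\<xi> n \<in> borel_measurable M" by simp
  define A where "A \<omega> = (\<lambda>i\<in>{..<n}. \<xi> i \<omega>)" for \<omega>
  have A[measurable]: "A \<in> measurable M (PiM {..<n} (\<lambda>_. borel))"
    unfolding A_def by (intro measurable_restrict) (auto simp: \<open>\<And>i. i < Suc n \<Longrightarrow> \<xi> i \<in> borel_measurable M\<close>)
  define B where "B \<omega> = (\<lambda>i\<in>{n}. \<xi> i \<omega>)" for \<omega>
  have "indep_var (PiM {..<n} (\<lambda>_. borel)) A (PiM {n} (\<lambda>_. borel)) B"
    unfolding A_def B_def by (rule indep_var_restrict[OF ind]) auto
  from this[unfolded indep_var_distribution_eq]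
  have prod: "distr M (PiM {..<n} (\<lambda>_. borel) \<Otimes>\<^sub>M PiM {n} (\<lambda>_. borel)) (\<lambda>\<omega>. (A \<omega>, B \<omega>))
      = distr M (PiM {..<n} (\<lambda>_. borel)) A \<Otimes>\<^sub>M distr M (PiM {n} (\<lambda>_. borel)) B"
    by (simp add: B_def)
  have B[measurable]: "B \<in> measurable M (PiM {n} (\<lambda>_. borel))"
    unfolding B_def by (intro measurable_restrict) simp
  have [measurable_cong]: "sets L = sets borel" unfolding law[symmetric] by simp
  interpret B: prob_space "distr M (PiM {n} (\<lambda>_. borel)) B" by (intro prob_space_distr B)
  let ?G = "\<lambda>a b. F a * S (x + (\<Sum>i<n. a i) + b n)"
  have [measurable]: "(\<lambda>w. snd w n :: real) \<in> borel_measurable (PiM {..<n} (\<lambda>_. borel) \<Otimes>\<^sub>M PiM {n} (\<lambda>_. borel))"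
    by (rule measurable_compose[OF measurable_snd measurable_component_singleton]) simp
  have [measurable]: "(\<lambda>w. \<Sum>i<n. fst w i :: real) \<in> borel_measurable (PiM {..<n} (\<lambda>_. borel) \<Otimes>\<^sub>M PiM {n} (\<lambda>_. borel))"
    by (rule measurable_compose[OF measurable_fst measurable_sum_component]) simp
  have [measurable]: "(\<lambda>a. \<Sum>i<n. a i :: real) \<in> borel_measurable (PiM {..<n} (\<lambda>_. borel))"
    by (rule measurable_sum_component) simp
  have [measurable]: "(\<lambda>b. b n :: real) \<in> borel_measurable (PiM {n} (\<lambda>_. borel))"
    by (rule measurable_component_singleton) simp
  have sumA: "(\<Sum>i<n. A \<omega> i) = (\<Sum>i<n. \<xi> i \<omega>)" for \<omega> by (simp add: A_def)
  have Gm: "(\<lambda>w. ?G (fst w) (snd w)) \<in> borel_measurable (PiM {..<n} (\<lambda>_. borel) \<Otimes>\<^sub>M PiM {n} (\<lambda>_. borel))"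
    by measurable
  have "(\<integral>\<^sup>+ \<omega>. F (A \<omega>) * S (x + (\<Sum>i<Suc n. \<xi> i \<omega>)) \<partial>M)
      = (\<integral>\<^sup>+ \<omega>. ?G (fst (A \<omega>, B \<omega>)) (snd (A \<omega>, B \<omega>)) \<partial>M)"
    by (simp add: sumA B_def add.assoc)
  also have "\<dots> = (\<integral>\<^sup>+ w. ?G (fst w) (snd w) \<partial>(distr M (PiM {..<n} (\<lambda>_. borel)) A \<Otimes>\<^sub>M distr M (PiM {n} (\<lambda>_. borel)) B))"
    unfolding prod[symmetric] by (rule nn_integral_distr[symmetric]) (simp_all add: Gm)
  also have "\<dots> = (\<integral>\<^sup>+ a. \<integral>\<^sup>+ b. ?G a b \<partial>distr M (PiM {n} (\<lambda>_. borel)) B \<partial>distr M (PiM {..<n} (\<lambda>_. borel)) A)"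
    using B.nn_integral_fst[of "\<lambda>w. ?G (fst w) (snd w)" "distr M (PiM {..<n} (\<lambda>_. borel)) A"] Gm by simp
  also have "\<dots> = (\<integral>\<^sup>+ \<omega>. \<integral>\<^sup>+ b. ?G (A \<omega>) b \<partial>distr M (PiM {n} (\<lambda>_. borel)) B \<partial>M)"
    by (rule nn_integral_distr[OF A]) (use B.borel_measurable_nn_integral_fst[of "\<lambda>w. ?G (fst w) (snd w)"] Gm in simp)
  also have "\<dots> = (\<integral>\<^sup>+ \<omega>. F (A \<omega>) * (\<integral>\<^sup>+ z. S (x + (\<Sum>i<n. \<xi> i \<omega>) + z) \<partial>L) \<partial>M)"
    unfolding law[symmetric]
    by (intro nn_integral_cong) (simp add: sumA nn_integral_cmult nn_integral_distr B_def)
  finally show ?thesis by (simp add: A_def)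
qed

text \<open>Induction on the number of steps: \<open>walk_step\<close> together with the one-step
  inequality exchanges the terminal term at time \<open>n\<close> for a running term plus the
  terminal term at time \<open>n + 1\<close>.\<close>

lemma walk_supermartingale:
  fixes S \<phi> g :: "real \<Rightarrow> ennreal" and x :: real and \<xi> :: "nat \<Rightarrow> 'a \<Rightarrow> real" and n :: nat
  assumes ind: "\<And>n. indep_vars (\<lambda>_. borel) \<xi> {..<n}"
    and law: "\<And>n. distr M borel (\<xi> n) = L"
    and [measurable]: "S \<in> borel_measurable borel" "\<phi> \<in> borel_measurable borel" "g \<in> borel_measurable borel"
    and step: "\<And>y. \<phi> y + g y * (\<integral>\<^sup>+ z. S (y + z) \<partial>L) \<le> S y"
  defines "W \<equiv> \<lambda>k \<omega>. x + (\<Sum>i<k. \<xi> i \<omega>)"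
  shows "(\<Sum>k<n. \<integral>\<^sup>+ \<omega>. (\<Prod>j<k. g (W j \<omega>)) * \<phi> (W k \<omega>) \<partial>M)
      + (\<integral>\<^sup>+ \<omega>. (\<Prod>j<n. g (W j \<omega>)) * S (W n \<omega>) \<partial>M) \<le> S x"
proof (induction n)
  case 0
  then show ?case by (simp add: W_def emeasure_space_1)
next
  case (Suc n)
  have [measurable]: "\<xi> i \<in> borel_measurable M" for i
    using ind[of "Suc i"] by (auto simp: indep_vars_def2)
  have [measurable]: "W k \<in> borel_measurable M" for k unfolding W_def by measurable
  have [measurable_cong]: "sets L = sets borel" unfolding law[of 0, symmetric] by simp
  interpret L: prob_space L unfolding law[of 0, symmetric] by (intro prob_space_distr) simp
  let ?F = "\<lambda>a. \<Prod>j<Suc n. g (x + (\<Sum>i<j. a i))"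
  have F[measurable]: "?F \<in> borel_measurable (PiM {..<n} (\<lambda>_. borel))"
  proof (intro borel_measurable_prod_ennreal)
    fix j assume "j \<in> {..<Suc n}"
    then have "(\<lambda>a. \<Sum>i<j. a i :: real) \<in> borel_measurable (PiM {..<n} (\<lambda>_. borel))"
      by (intro measurable_sum_component) auto
    then show "(\<lambda>a. g (x + (\<Sum>i<j. a i))) \<in> borel_measurable (PiM {..<n} (\<lambda>_. borel))"
      by measurable
  qed
  have FW: "?F (\<lambda>i\<in>{..<n}. \<xi> i \<omega>) = (\<Prod>j<Suc n. g (W j \<omega>))" for \<omega>
  proof (rule prod.cong)
    fix j assume "j \<in> {..<Suc n}"
    then have "(\<Sum>i<j. (\<lambda>i\<in>{..<n}. \<xi> i \<omega>) i) = (\<Sum>i<j. \<xi> i \<omega>)" by (intro sum.cong) auto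
    then show "g (x + (\<Sum>i<j. (\<lambda>i\<in>{..<n}. \<xi> i \<omega>) i)) = g (W j \<omega>)" by (simp add: W_def)
  qed simp
  have "(\<integral>\<^sup>+ \<omega>. (\<Prod>j<Suc n. g (W j \<omega>)) * S (W (Suc n) \<omega>) \<partial>M)
      = (\<integral>\<^sup>+ \<omega>. (\<Prod>j<Suc n. g (W j \<omega>)) * (\<integral>\<^sup>+ z. S (W n \<omega> + z) \<partial>L) \<partial>M)"
    using walk_step[OF ind law F, of S x] unfolding FW W_def by simp
  then have "(\<integral>\<^sup>+ \<omega>. (\<Prod>j<n. g (W j \<omega>)) * \<phi> (W n \<omega>) \<partial>M)
      + (\<integral>\<^sup>+ \<omega>. (\<Prod>j<Suc n. g (W j \<omega>)) * S (W (Suc n) \<omega>) \<partial>M)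
      = (\<integral>\<^sup>+ \<omega>. (\<Prod>j<n. g (W j \<omega>)) * (\<phi> (W n \<omega>) + g (W n \<omega>) * (\<integral>\<^sup>+ z. S (W n \<omega> + z) \<partial>L)) \<partial>M)"
    by (simp add: nn_integral_add[symmetric] distrib_left mult.assoc)
  also have "\<dots> \<le> (\<integral>\<^sup>+ \<omega>. (\<Prod>j<n. g (W j \<omega>)) * S (W n \<omega>) \<partial>M)"
    by (intro nn_integral_mono mult_left_mono step) auto
  finally have "(\<Sum>k<n. \<integral>\<^sup>+ \<omega>. (\<Prod>j<k. g (W j \<omega>)) * \<phi> (W k \<omega>) \<partial>M)
      + ((\<integral>\<^sup>+ \<omega>. (\<Prod>j<n. g (W j \<omega>)) * \<phi> (W n \<omega>) \<partial>M)
      + (\<integral>\<^sup>+ \<omega>. (\<Prod>j<Suc n. g (W j \<omega>)) * S (W (Suc n) \<omega>) \<partial>M)) \<le> S x"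
    by (rule order_trans[OF add_left_mono Suc.IH])
  then show ?case unfolding sum.lessThan_Suc[of _ n] add.assoc .
qed

end

section \<open>Occupation times of a stable path\<close>

text \<open>For \<open>u \<ge> 0\<close> and positive \<open>h\<close>, times are rounded up to the
  grid so that right continuity of the paths recovers the value at \<open>u\<close>.\<close>

definition grid :: "real \<Rightarrow> real \<Rightarrow> real" where
  "grid h u = real (nat \<lceil>u / h\<rceil>) * h"

lemma grid_bounds:
  assumes "0 < h" "0 \<le> u"
  shows "u \<le> grid h u" "grid h u < u + h"
proof -
  have r: "real (nat \<lceil>u / h\<rceil>) = of_int \<lceil>u / h\<rceil>" using assms by simp
  have c: "u / h \<le> of_int \<lceil>u / h\<rceil>" "of_int \<lceil>u / h\<rceil> < u / h + 1" by linarith+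
  show "u \<le> grid h u" using mult_right_mono[OF c(1), of h] assms unfolding grid_def r by simp
  show "grid h u < u + h"
    using mult_strict_right_mono[OF c(2), of h] assms unfolding grid_def r by (simp add: distrib_right)
qed

lemma grid_tendsto:
  assumes t: "0 < t" and u: "0 \<le> u"
  shows "(\<lambda>n. grid (t / real (Suc n)) u) \<longlonglongrightarrow> u"
proof (rule tendsto_sandwich[of "\<lambda>_. u" _ _ "\<lambda>n. u + t / real (Suc n)"])
  have h: "0 < t / real (Suc n)" for n using t by simp
  show "\<forall>\<^sub>F n in sequentially. u \<le> grid (t / real (Suc n)) u"
    using grid_bounds(1)[OF h u] by simp
  show "\<forall>\<^sub>F n in sequentially. grid (t / real (Suc n)) u \<le> u + t / real (Suc n)"
    using grid_bounds(2)[OF h u] by (simp add: less_imp_le)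
  show "(\<lambda>n. u + t / real (Suc n)) \<longlonglongrightarrow> u"
    using tendsto_add[OF tendsto_const[of u] tendsto_mult[OF tendsto_const[of t] LIMSEQ_inverse_real_of_nat]]
    by (simp add: divide_inverse)
qed simp

lemma right_continuous_seq:
  fixes w :: "real \<Rightarrow> real"
  assumes w: "(w \<longlongrightarrow> w u) (at_right u)" and s: "s \<longlonglongrightarrow> u" "\<And>n. u \<le> s n"
  shows "(\<lambda>n. w (s n)) \<longlonglongrightarrow> w u"
proof (rule LIMSEQ_I)
  fix r :: real assume "0 < r"
  with w have "\<forall>\<^sub>F v in at_right u. dist (w v) (w u) < r" by (rule tendstoD)
  then obtain b where b: "b > u" "\<And>v. u < v \<Longrightarrow> v < b \<Longrightarrow> dist (w v) (w u) < r"
    unfolding eventually_at_right_field by blast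
  have "\<forall>\<^sub>F n in sequentially. s n < b" using s(1) b(1) by (rule order_tendstoD)
  then obtain N where N: "\<And>n. n \<ge> N \<Longrightarrow> s n < b" unfolding eventually_sequentially by blast
  have "norm (w (s n) - w u) < r" if "n \<ge> N" for n
    using b(2)[of "s n"] N[OF that] s(2)[of n] \<open>0 < r\<close>
    by (cases "s n = u") (auto simp: dist_real_def)
  then show "\<exists>N. \<forall>n\<ge>N. norm (w (s n) - w u) < r" by blast
qed

lemma right_continuous_measurable:
  fixes w :: "real \<Rightarrow> real"
  assumes "\<And>t. 0 \<le> t \<Longrightarrow> (w \<longlongrightarrow> w t) (at_right t)"
  shows "(\<lambda>u. if 0 \<le> u then w u else 0) \<in> borel_measurable borel"
proof (rule borel_measurable_LIMSEQ_real)
  let ?h = "\<lambda>n. 1 / real (Suc n)"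
  show "(\<lambda>u. if 0 \<le> u then w (grid (?h n) u) else 0) \<in> borel_measurable borel" for n
  proof -
    have "(\<lambda>u. nat \<lceil>u / ?h n\<rceil>) \<in> measurable borel (count_space UNIV)" by measurable
    from measurable_compose[OF this, of "\<lambda>k. w (real k * ?h n)" borel]
    have "(\<lambda>u. w (grid (?h n) u)) \<in> borel_measurable borel" unfolding grid_def by simp
    then show ?thesis by (rule measurable_If) simp_all
  qed
  show "(\<lambda>n. if 0 \<le> u then w (grid (?h n) u) else 0) \<longlonglongrightarrow> (if 0 \<le> u then w u else 0)" for u
  proof (cases "0 \<le> u")
    case True
    then have "(\<lambda>n. w (grid (?h n) u)) \<longlonglongrightarrow> w u"
      by (intro right_continuous_seq[OF assms[OF True]] grid_tendsto grid_bounds(1)) simp_all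
    then show ?thesis using True by simp
  qed simp
qed

lemma nn_integral_grid:
  assumes h: "0 < h"
  shows "(\<integral>\<^sup>+ u. F (nat \<lceil>u / h\<rceil>) * indicator {0<..real n * h} u \<partial>lborel) = (\<Sum>k<n. ennreal h * F (Suc k))"
proof (induction n)
  case (Suc n)
  have [measurable]: "(\<lambda>u. F (nat \<lceil>u / h\<rceil>)) \<in> borel_measurable borel"
    by (rule measurable_compose[of _ _ "count_space UNIV"]) measurable
  have nh: "0 \<le> real n * h" "real n * h \<le> real (Suc n) * h" using h by (auto simp: algebra_simps)
  have "indicator {0<..real (Suc n) * h} u = indicator {0<..real n * h} u + (indicator {real n * h<..real (Suc n) * h} u :: ennreal)" for u
    using nh by (auto simp: indicator_def)
  then have "(\<integral>\<^sup>+ u. F (nat \<lceil>u / h\<rceil>) * indicator {0<..real (Suc n) * h} u \<partial>lborel)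
      = (\<integral>\<^sup>+ u. F (nat \<lceil>u / h\<rceil>) * indicator {0<..real n * h} u \<partial>lborel)
      + (\<integral>\<^sup>+ u. F (nat \<lceil>u / h\<rceil>) * indicator {real n * h<..real (Suc n) * h} u \<partial>lborel)"
    by (simp add: distrib_left nn_integral_add)
  also have "(\<integral>\<^sup>+ u. F (nat \<lceil>u / h\<rceil>) * indicator {real n * h<..real (Suc n) * h} u \<partial>lborel)
      = (\<integral>\<^sup>+ u. F (Suc n) * indicator {real n * h<..real (Suc n) * h} u \<partial>lborel)"
  proof (intro nn_integral_cong)
    fix u
    have "nat \<lceil>u / h\<rceil> = Suc n" if "real n * h < u" "u \<le> real (Suc n) * h"
    proof -
      have "\<lceil>u / h\<rceil> = int (Suc n)"
        using that h by (intro ceiling_unique) (auto simp: field_simps)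
      then show ?thesis by simp
    qed
    then show "F (nat \<lceil>u / h\<rceil>) * indicator {real n * h<..real (Suc n) * h} u
        = F (Suc n) * indicator {real n * h<..real (Suc n) * h} u"
      by (auto simp: indicator_def)
  qed
  also have "\<dots> = ennreal h * F (Suc n)"
  proof -
    have "real (Suc n) * h - real n * h = h" by (simp add: algebra_simps)
    then show ?thesis using nh(2) by (simp add: nn_integral_cmult mult.commute)
  qed
  finally show ?case by (simp add: Suc.IH)
qed simp

text \<open>This is the origin of the factor 2 in all exponents \<open>2 * \<gamma>\<close>; it
  rests on \<open>(1 - y) * (1 + 2 * y) \<ge> 1\<close> for \<open>y \<le> 1 / 2\<close>.\<close>

lemma one_minus_ge_exp:
  fixes y :: real
  assumes "0 \<le> y" "y \<le> 1 / 2"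
  shows "exp (- 2 * y) \<le> 1 - y"
proof -
  have "0 \<le> y * (1 - 2 * y)" using assms by simp
  then have "1 \<le> (1 - y) * (1 + 2 * y)" by (simp add: algebra_simps)
  also have "\<dots> \<le> (1 - y) * exp (2 * y)" using assms by (intro mult_left_mono exp_ge_add_one_self) auto
  finally show ?thesis by (simp add: exp_minus field_simps)
qed

text \<open>Independence of the increments enters only as a supermartingale inequality along time grids.\<close>

locale stable_path = stable_family \<alpha> N + prob_space M
  for \<alpha> :: real and N :: "real \<Rightarrow> real measure" and M :: "'w measure" +
  fixes X :: "real \<Rightarrow> 'w \<Rightarrow> real" and x :: real
  assumes X_measurable: "\<And>t. X t \<in> borel_measurable M"
    and X_start: "\<And>\<omega>. \<omega> \<in> space M \<Longrightarrow> X 0 \<omega> = x"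
    and X_right: "\<And>\<omega> t. \<omega> \<in> space M \<Longrightarrow> 0 \<le> t \<Longrightarrow> ((\<lambda>s. X s \<omega>) \<longlongrightarrow> X t \<omega>) (at_right t)"
    and X_law: "\<And>t. 0 \<le> t \<Longrightarrow> distr M borel (\<lambda>\<omega>. X t \<omega> - x) = N t"
    and X_walk: "\<And>h n (S :: real \<Rightarrow> ennreal) \<phi> g. 0 < h \<Longrightarrow> S \<in> borel_measurable borel \<Longrightarrow>
      \<phi> \<in> borel_measurable borel \<Longrightarrow> g \<in> borel_measurable borel \<Longrightarrow>
      (\<And>y. \<phi> y + g y * (\<integral>\<^sup>+ z. S (y + z) \<partial>N h) \<le> S y) \<Longrightarrow>
      (\<Sum>k<n. \<integral>\<^sup>+ \<omega>. (\<Prod>j<k. g (X (real j * h) \<omega>)) * \<phi> (X (real k * h) \<omega>) \<partial>M)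
        + (\<integral>\<^sup>+ \<omega>. (\<Prod>j<n. g (X (real j * h) \<omega>)) * S (X (real n * h) \<omega>) \<partial>M) \<le> S x"
begin

lemma X_joint_measurable:
  "(\<lambda>(u, \<omega>). if 0 \<le> u then X u \<omega> else 0) \<in> borel_measurable (borel \<Otimes>\<^sub>M M)"
proof (rule borel_measurable_LIMSEQ_real)
  let ?h = "\<lambda>n. 1 / real (Suc n)"
  note [measurable] = X_measurable
  show "(\<lambda>w. if 0 \<le> fst w then X (grid (?h n) (fst w)) (snd w) else 0) \<in> borel_measurable (borel \<Otimes>\<^sub>M M)" for n
  proof -
    have "(\<lambda>w. X (real (nat \<lceil>fst w / ?h n\<rceil>) * ?h n) (snd w)) \<in> borel_measurable (borel \<Otimes>\<^sub>M M)"
      by (rule measurable_compose_countable[where f="\<lambda>k w. X (real k * ?h n) (snd w)" and g="\<lambda>w. nat \<lceil>fst w / ?h n\<rceil>"])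
        measurable
    then show ?thesis unfolding grid_def[symmetric] by (rule measurable_If) measurable
  qed
  show "(\<lambda>n. if 0 \<le> fst w then X (grid (?h n) (fst w)) (snd w) else 0) \<longlonglongrightarrow> (case w of (u, \<omega>) \<Rightarrow> if 0 \<le> u then X u \<omega> else 0)"
    if "w \<in> space (borel \<Otimes>\<^sub>M M)" for w
  proof (cases "0 \<le> fst w")
    case True
    have "snd w \<in> space M" using that by (auto simp: space_pair_measure)
    then have "(\<lambda>n. X (grid (?h n) (fst w)) (snd w)) \<longlonglongrightarrow> X (fst w) (snd w)"
      using True by (intro right_continuous_seq[OF X_right[OF _ True]] grid_tendsto grid_bounds(1)) simp_all
    then show ?thesis using True by (simp add: case_prod_beta')
  qed (simp add: case_prod_beta')
qed

text \<open>Stochastic continuity at time 0, read off from right continuity of the paths and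
  transferred to the laws \<open>N s\<close>.\<close>

lemma small_time:
  "((\<lambda>s. \<integral>\<^sup>+ z. ennreal (min 1 \<bar>z\<bar>) \<partial>N s) \<longlongrightarrow> 0) (at_right 0)"
proof (rule tendsto_at_right_sequentially[of 0 1])
  fix s :: "nat \<Rightarrow> real" assume s: "\<And>n. 0 < s n" "s \<longlonglongrightarrow> 0"
  note [measurable] = X_measurable
  have "(\<lambda>n. \<integral>\<^sup>+ \<omega>. ennreal (min 1 \<bar>X (s n) \<omega> - x\<bar>) \<partial>M) \<longlonglongrightarrow> (\<integral>\<^sup>+ \<omega>. 0 \<partial>M)"
  proof (rule nn_integral_dominated_convergence[where w="\<lambda>_. 1"])
    show "AE \<omega> in M. (\<lambda>n. ennreal (min 1 \<bar>X (s n) \<omega> - x\<bar>)) \<longlonglongrightarrow> 0"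
    proof (rule AE_I2)
      fix \<omega> assume \<omega>: "\<omega> \<in> space M"
      have "(\<lambda>n. X (s n) \<omega>) \<longlonglongrightarrow> X 0 \<omega>"
        by (rule right_continuous_seq[OF X_right[OF \<omega> order_refl] s(2) less_imp_le[OF s(1)]])
      then have "(\<lambda>n. X (s n) \<omega> - x) \<longlonglongrightarrow> 0"
        using X_start[OF \<omega>] by (simp add: LIM_zero)
      then have "(\<lambda>n. min 1 \<bar>X (s n) \<omega> - x\<bar>) \<longlonglongrightarrow> min 1 \<bar>0\<bar>"
        by (intro tendsto_min tendsto_rabs tendsto_const)
      then show "(\<lambda>n. ennreal (min 1 \<bar>X (s n) \<omega> - x\<bar>)) \<longlonglongrightarrow> 0"
        using tendsto_ennrealI[of "\<lambda>n. min 1 \<bar>X (s n) \<omega> - x\<bar>" 0] by simp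
    qed
    show "AE \<omega> in M. ennreal (min 1 \<bar>X (s n) \<omega> - x\<bar>) \<le> 1" for n
      by (intro AE_I2) (simp add: ennreal_le_1)
  qed (auto simp: emeasure_space_1)
  moreover have "(\<integral>\<^sup>+ \<omega>. ennreal (min 1 \<bar>X (s n) \<omega> - x\<bar>) \<partial>M) = (\<integral>\<^sup>+ z. ennreal (min 1 \<bar>z\<bar>) \<partial>N (s n))" for n
    using s(1)[of n] by (subst X_law[symmetric]) (auto simp: nn_integral_distr)
  ultimately show "(\<lambda>n. \<integral>\<^sup>+ z. ennreal (min 1 \<bar>z\<bar>) \<partial>N (s n)) \<longlonglongrightarrow> 0" by simp
qed simp

text \<open>The approximation \<open>h * f y\<close> is uniform in the starting point because the
  law of the increment does not depend on it and \<open>f\<close> has a uniform modulus of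
  continuity.\<close>

lemma occupation_uniform:
  assumes uc: "uniformly_continuous_on UNIV f" and f: "\<And>y. 0 \<le> f y" "\<And>y. f y \<le> C" and \<epsilon>: "0 < \<epsilon>"
  shows "\<forall>\<^sub>F h in at_right 0. \<forall>y. occupation h (\<lambda>y. ennreal (f y)) y \<le> ennreal (h * (f y + \<epsilon>))
    \<and> ennreal (h * f y) \<le> occupation h (\<lambda>y. ennreal (f y)) y + ennreal (h * \<epsilon>)"
proof -
  have [measurable]: "f \<in> borel_measurable borel"
    using uc by (intro borel_measurable_continuous_onI uniformly_continuous_imp_continuous)
  have C0: "0 \<le> C" using f(1)[of 0] f(2)[of 0] by simp
  obtain d where d: "d > 0" "\<And>y z. dist y z < d \<Longrightarrow> dist (f y) (f z) < \<epsilon> / 2"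
    using uc \<epsilon> unfolding uniformly_continuous_on_def by (metis UNIV_I half_gt_zero)
  \<comment> \<open>With this slope \<open>K * min 1 \<bar>z\<bar>\<close> is at least
    \<open>C\<close> for jumps of size \<open>d\<close> or more, where only boundedness of
    \<open>f\<close> helps.\<close>
  define K where "K = C / min 1 d"
  have K0: "0 \<le> K" using C0 d by (simp add: K_def)
  have diff: "f (y + z) \<le> f y + (\<epsilon> / 2 + K * min 1 \<bar>z\<bar>) \<and> f y \<le> f (y + z) + (\<epsilon> / 2 + K * min 1 \<bar>z\<bar>)" for y z
  proof (cases "\<bar>z\<bar> < d")
    case True
    then have "\<bar>f (y + z) - f y\<bar> < \<epsilon> / 2" using d(2)[of "y + z" y] by (simp add: dist_real_def)
    moreover have "0 \<le> K * min 1 \<bar>z\<bar>" using K0 by simp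
    ultimately show ?thesis by linarith
  next
    case False
    then have "min 1 d \<le> min 1 \<bar>z\<bar>" by simp
    then have "K * min 1 d \<le> K * min 1 \<bar>z\<bar>" using K0 by (intro mult_left_mono)
    then have "C \<le> K * min 1 \<bar>z\<bar>" using d(1) by (simp add: K_def split: if_splits)
    then show ?thesis using f(1)[of y] f(1)[of "y + z"] f(2)[of y] f(2)[of "y + z"] \<epsilon> by linarith
  qed
  define R where "R z = \<epsilon> / 2 + K * min 1 \<bar>z\<bar>" for z
  have R0: "0 \<le> R z" for z using \<epsilon> K0 by (simp add: R_def)
  have [measurable]: "R \<in> borel_measurable borel" unfolding R_def by measurable
  have diffE: "ennreal (f (y + z)) \<le> ennreal (f y) + ennreal (R z)"
    "ennreal (f y) \<le> ennreal (f (y + z)) + ennreal (R z)" for y z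
    using diff[of y z] f(1) R0[of z] by (auto simp: R_def[symmetric] ennreal_leI simp flip: ennreal_plus)
  have "((\<lambda>s. ennreal (\<epsilon> / 2) + ennreal K * (\<integral>\<^sup>+ z. ennreal (min 1 \<bar>z\<bar>) \<partial>N s)) \<longlongrightarrow> ennreal (\<epsilon> / 2) + ennreal K * 0) (at_right 0)"
    by (intro tendsto_add tendsto_const ennreal_tendsto_cmult small_time) simp
  moreover have "ennreal (\<epsilon> / 2) + ennreal K * 0 < ennreal \<epsilon>" using \<epsilon> by (simp add: ennreal_lessI)
  ultimately have "\<forall>\<^sub>F s in at_right 0. ennreal (\<epsilon> / 2) + ennreal K * (\<integral>\<^sup>+ z. ennreal (min 1 \<bar>z\<bar>) \<partial>N s) < ennreal \<epsilon>"
    by (rule order_tendstoD(2))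
  then obtain b where b: "b > 0"
    "\<And>s. 0 < s \<Longrightarrow> s < b \<Longrightarrow> ennreal (\<epsilon> / 2) + ennreal K * (\<integral>\<^sup>+ z. ennreal (min 1 \<bar>z\<bar>) \<partial>N s) < ennreal \<epsilon>"
    unfolding eventually_at_right_field by auto
  have step: "(\<integral>\<^sup>+ w. ennreal (f w) * ennreal (stable_density \<alpha> s (w - y)) \<partial>lborel) \<le> ennreal (f y + \<epsilon>)
      \<and> ennreal (f y) \<le> (\<integral>\<^sup>+ w. ennreal (f w) * ennreal (stable_density \<alpha> s (w - y)) \<partial>lborel) + ennreal \<epsilon>"
    if s: "0 < s" "s < b" for s y
  proof -
    interpret Ns: prob_space "N s" using s by (intro N_prob) simp
    note [measurable_cong] = sets_N[OF less_imp_le[OF s(1)]]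
    let ?r = "ennreal (\<epsilon> / 2) + ennreal K * (\<integral>\<^sup>+ z. ennreal (min 1 \<bar>z\<bar>) \<partial>N s)"
    have r: "(\<integral>\<^sup>+ z. ennreal (R z) \<partial>N s) = ?r"
      unfolding R_def using \<epsilon> K0 by (simp add: nn_integral_add nn_integral_cmult ennreal_mult Ns.emeasure_space_1)
    have "(\<integral>\<^sup>+ z. ennreal (f (y + z)) \<partial>N s) \<le> (\<integral>\<^sup>+ z. ennreal (f y) + ennreal (R z) \<partial>N s)"
      by (intro nn_integral_mono diffE)
    also have "\<dots> = ennreal (f y) + ?r"
      unfolding r[symmetric] by (subst nn_integral_add) (auto simp: Ns.emeasure_space_1)
    also have "\<dots> \<le> ennreal (f y) + ennreal \<epsilon>" using b(2)[OF s] by (intro add_left_mono) (rule less_imp_le)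
    finally have 1: "(\<integral>\<^sup>+ z. ennreal (f (y + z)) \<partial>N s) \<le> ennreal (f y + \<epsilon>)" using f(1) \<epsilon> by simp
    have "ennreal (f y) = (\<integral>\<^sup>+ z. ennreal (f y) \<partial>N s)" by (simp add: Ns.emeasure_space_1)
    also have "\<dots> \<le> (\<integral>\<^sup>+ z. ennreal (f (y + z)) + ennreal (R z) \<partial>N s)"
      by (intro nn_integral_mono diffE)
    also have "\<dots> = (\<integral>\<^sup>+ z. ennreal (f (y + z)) \<partial>N s) + ?r"
      unfolding r[symmetric] by (subst nn_integral_add) auto
    also have "\<dots> \<le> (\<integral>\<^sup>+ z. ennreal (f (y + z)) \<partial>N s) + ennreal \<epsilon>"
      using b(2)[OF s] by (intro add_left_mono) (rule less_imp_le)
    finally show ?thesis using 1 nn_integral_N[OF s(1), of "\<lambda>w. ennreal (f w)" y] by simp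
  qed
  have "occupation h (\<lambda>y. ennreal (f y)) y \<le> ennreal (h * (f y + \<epsilon>))
    \<and> ennreal (h * f y) \<le> occupation h (\<lambda>y. ennreal (f y)) y + ennreal (h * \<epsilon>)"
    if h: "0 < h" "h < b" for h y
  proof -
    let ?I = "\<lambda>s. \<integral>\<^sup>+ w. ennreal (f w) * ennreal (stable_density \<alpha> s (w - y)) \<partial>lborel"
    have "occupation h (\<lambda>y. ennreal (f y)) y \<le> (\<integral>\<^sup>+ s. ennreal (f y + \<epsilon>) * indicator {0..h} s \<partial>lborel)"
      unfolding occupation_def
    proof (rule nn_integral_mono_AE)
      show "AE s in lborel. ?I s * indicator {0..h} s \<le> ennreal (f y + \<epsilon>) * indicator {0..h} s"
        using AE_lborel_singleton[of 0]
        by eventually_elim (use step h in \<open>auto simp: indicator_def\<close>)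
    qed
    also have "\<dots> = ennreal (h * (f y + \<epsilon>))"
      using h f(1)[of y] \<epsilon> by (simp add: nn_integral_cmult ennreal_mult mult.commute del: ennreal_plus)
    finally have 1: "occupation h (\<lambda>y. ennreal (f y)) y \<le> ennreal (h * (f y + \<epsilon>))" .
    have "ennreal (h * f y) = (\<integral>\<^sup>+ s. ennreal (f y) * indicator {0..h} s \<partial>lborel)"
      using h f(1)[of y] by (simp add: nn_integral_cmult ennreal_mult mult.commute)
    also have "\<dots> \<le> (\<integral>\<^sup>+ s. ?I s * indicator {0..h} s + ennreal \<epsilon> * indicator {0..h} s \<partial>lborel)"
    proof (rule nn_integral_mono_AE)
      show "AE s in lborel. ennreal (f y) * indicator {0..h} s \<le> ?I s * indicator {0..h} s + ennreal \<epsilon> * indicator {0..h} s"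
        using AE_lborel_singleton[of 0]
        by eventually_elim (use step h in \<open>auto simp: indicator_def\<close>)
    qed
    also have "\<dots> = occupation h (\<lambda>y. ennreal (f y)) y + ennreal (h * \<epsilon>)"
      using h \<epsilon> by (simp add: occupation_def nn_integral_add nn_integral_cmult ennreal_mult mult.commute)
    finally show ?thesis using 1 by simp
  qed
  then show ?thesis using b(1) unfolding eventually_at_right_field by blast
qed

end

section \<open>Feynman-Kac weights along a path\<close>

lemma measurable_grid_fun:
  fixes h :: real and F :: "nat \<Rightarrow> 'b"
  assumes "\<And>k. F k \<in> space L"
  shows "(\<lambda>s. F (nat \<lceil>s / h\<rceil>)) \<in> measurable borel L"
proof -
  have 1: "(\<lambda>s. nat \<lceil>s / h\<rceil>) \<in> measurable borel (count_space UNIV)" by measurable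
  have 2: "F \<in> measurable (count_space UNIV) L" using assms by simp
  show ?thesis by (rule measurable_compose[OF 1 2])
qed

lemma uniformly_continuous_hat: "uniformly_continuous_on UNIV hat"
  unfolding uniformly_continuous_on_def dist_real_def
  using hat_lipschitz le_less_trans by blast

context stable_path
begin

definition hat_clock :: "real \<Rightarrow> 'w \<Rightarrow> real" where
  "hat_clock u \<omega> = enn2real (\<integral>\<^sup>+ s. ennreal (hat (X s \<omega>)) * indicator {0<..u} s \<partial>lborel)"

lemma X_path_measurable:
  assumes "\<omega> \<in> space M" and [measurable]: "f \<in> borel_measurable borel"
  shows "(\<lambda>s. f (X s \<omega>) * indicator {0<..u} s :: real) \<in> borel_measurable borel"
proof -
  have [measurable]: "(\<lambda>s. if 0 \<le> s then X s \<omega> else 0) \<in> borel_measurable borel"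
    using X_right[OF assms(1)] by (rule right_continuous_measurable)
  have "(\<lambda>s. f (if 0 \<le> s then X s \<omega> else 0) * indicator {0<..u} s :: real) \<in> borel_measurable borel"
    by measurable
  moreover have "f (if 0 \<le> s then X s \<omega> else 0) * indicator {0<..u} s = f (X s \<omega>) * indicator {0<..u} s" for s
    by (auto simp: indicator_def)
  ultimately show ?thesis by simp
qed

text \<open>Paths are controlled for nonnegative times only; with the value 0 before time 0 the
  process is jointly measurable on the whole line.\<close>

definition Xp :: "real \<Rightarrow> 'w \<Rightarrow> real" where
  "Xp u \<omega> = (if 0 \<le> u then X u \<omega> else 0)"

lemma Xp_measurable [measurable]: "(\<lambda>w. Xp (fst w) (snd w)) \<in> borel_measurable (borel \<Otimes>\<^sub>M M)"
  using X_joint_measurable by (simp add: Xp_def case_prod_beta')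

lemma Xp_indicator:
  "f (X u \<omega>) * indicator {0<..t} u = (f (Xp u \<omega>) * indicator {0<..t} u :: ennreal)"
  by (auto simp: Xp_def indicator_def)

lemma hat_integral_finite: "(\<integral>\<^sup>+ s. ennreal (hat (w s)) * indicator {0<..u} s \<partial>lborel) \<le> ennreal u"
proof -
  have "(\<integral>\<^sup>+ s. ennreal (hat (w s)) * indicator {0<..u} s \<partial>lborel) \<le> (\<integral>\<^sup>+ s. indicator {0<..u} s \<partial>lborel)"
    using hat_le_1 by (intro nn_integral_mono) (auto simp: indicator_def ennreal_le_1)
  also have "\<dots> \<le> ennreal u" by (cases "0 \<le> u") auto
  finally show ?thesis .
qed

lemma hat_clock_ennreal:
  "ennreal (hat_clock u \<omega>) = (\<integral>\<^sup>+ s. ennreal (hat (X s \<omega>)) * indicator {0<..u} s \<partial>lborel)"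
  unfolding hat_clock_def using hat_integral_finite[of "\<lambda>s. X s \<omega>" u]
  by (intro ennreal_enn2real) (auto intro: le_less_trans)

lemma hat_clock_nonneg: "0 \<le> hat_clock u \<omega>"
  by (simp add: hat_clock_def)

lemma hat_clock_measurable [measurable]:
  "(\<lambda>w. hat_clock (fst w) (snd w)) \<in> borel_measurable (borel \<Otimes>\<^sub>M M)"
proof -
  have [measurable]: "(\<lambda>w. Xp (snd w) (snd (fst w))) \<in> borel_measurable ((borel \<Otimes>\<^sub>M M) \<Otimes>\<^sub>M borel)"
    using measurable_compose[OF _ Xp_measurable, of "\<lambda>w. (snd w, snd (fst w))" "(borel \<Otimes>\<^sub>M M) \<Otimes>\<^sub>M borel"] by simp
  have [measurable]: "Measurable.pred ((borel \<Otimes>\<^sub>M M) \<Otimes>\<^sub>M borel) (\<lambda>w :: (real \<times> 'w) \<times> real. snd w \<in> {0<..fst (fst w)})"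
    unfolding greaterThanAtMost_iff by measurable
  show ?thesis
    unfolding hat_clock_def Xp_indicator[of "\<lambda>y. ennreal (hat y)"] by measurable
qed

text \<open>The product of weights runs over left endpoints, while \<open>grid\<close> evaluates at
  right endpoints. Shifting the index costs at most \<open>h\<close>, and the last cell overshoots
  \<open>u\<close> by at most another \<open>h\<close>.\<close>

lemma hat_sum_bound:
  assumes \<omega>: "\<omega> \<in> space M" and u: "0 < u" and h: "0 < h"
  shows "(\<Sum>j<nat \<lceil>u / h\<rceil>. h * hat (X (real j * h) \<omega>))
    \<le> enn2real (\<integral>\<^sup>+ s. ennreal (hat (X (grid h s) \<omega>)) * indicator {0<..u} s \<partial>lborel) + 2 * h"
proof -
  let ?k = "nat \<lceil>u / h\<rceil>" and ?H = "\<lambda>j. hat (X (real j * h) \<omega>)"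
  let ?I = "\<integral>\<^sup>+ s. ennreal (hat (X (grid h s) \<omega>)) * indicator {0<..u} s \<partial>lborel"
  have kh: "u \<le> real ?k * h" "real ?k * h < u + h"
    using grid_bounds[OF h less_imp_le[OF u]] by (auto simp: grid_def)
  have [measurable]: "(\<lambda>s. ennreal (hat (X (grid h s) \<omega>))) \<in> borel_measurable borel"
    unfolding grid_def by (rule measurable_grid_fun[of "\<lambda>k. ennreal (hat (X (real k * h) \<omega>))"]) simp
  have tele: "(\<Sum>j<k. h * ?H j) \<le> h + (\<Sum>j<k. h * ?H (Suc j))" for k
  proof -
    have "(\<Sum>j<k. h * ?H j) + h * ?H k = h * ?H 0 + (\<Sum>j<k. h * ?H (Suc j))"
      by (induction k) simp_all
    moreover have "0 \<le> h * ?H k" using h hat_nonneg by simp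
    moreover have "h * ?H 0 \<le> h" using h hat_le_1 mult_left_le[of "?H 0" h] by simp
    ultimately show ?thesis by linarith
  qed
  have "ennreal (\<Sum>j<?k. h * ?H (Suc j)) = (\<Sum>j<?k. ennreal h * ennreal (?H (Suc j)))"
    using h hat_nonneg by (simp add: ennreal_mult[symmetric] sum_ennreal)
  also have "\<dots> = (\<integral>\<^sup>+ s. ennreal (hat (X (grid h s) \<omega>)) * indicator {0<..real ?k * h} s \<partial>lborel)"
    using nn_integral_grid[OF h, of "\<lambda>k. ennreal (?H k)" ?k] by (simp add: grid_def)
  also have "\<dots> \<le> (\<integral>\<^sup>+ s. ennreal (hat (X (grid h s) \<omega>)) * indicator {0<..u} s + indicator {u<..real ?k * h} s \<partial>lborel)"
    using hat_le_1 by (intro nn_integral_mono) (auto simp: indicator_def ennreal_le_1)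
  also have "\<dots> = ?I + ennreal (real ?k * h - u)"
    using kh by (simp add: nn_integral_add)
  also have "\<dots> \<le> ?I + ennreal h" using kh by (intro add_left_mono ennreal_leI) simp
  also have "\<dots> = ennreal (enn2real ?I + h)"
  proof -
    have "?I < \<top>" using hat_integral_finite[of "\<lambda>s. X (grid h s) \<omega>" u] by (rule le_less_trans) simp
    then have "ennreal (enn2real ?I) = ?I" by (rule ennreal_enn2real)
    then show ?thesis using h by (simp add: ennreal_plus)
  qed
  finally have "(\<Sum>j<?k. h * ?H (Suc j)) \<le> enn2real ?I + h"
    using h by (subst (asm) ennreal_le_iff) auto
  then show ?thesis using tele[of ?k] by linarith
qed

lemma hat_clock_limit:
  assumes \<omega>: "\<omega> \<in> space M" and t: "0 < t"
  shows "(\<lambda>n. enn2real (\<integral>\<^sup>+ s. ennreal (hat (X (grid (t / real (Suc n)) s) \<omega>)) * indicator {0<..u} s \<partial>lborel))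
    \<longlonglongrightarrow> hat_clock u \<omega>"
proof -
  have h: "0 < t / real (Suc n)" for n using t by simp
  have [measurable]: "(\<lambda>s. ennreal (hat (X (grid h s) \<omega>))) \<in> borel_measurable borel" for h
    unfolding grid_def by (rule measurable_grid_fun[of "\<lambda>k. ennreal (hat (X (real k * h) \<omega>))"]) simp
  have [measurable]: "(\<lambda>s. hat (X s \<omega>) * indicator {0<..u} s) \<in> borel_measurable borel"
    by (rule X_path_measurable[OF \<omega>]) measurable
  have eq: "ennreal (hat (X s \<omega>)) * indicator {0<..u} s = ennreal (hat (X s \<omega>) * indicator {0<..u} s)" for s
    by (simp add: indicator_def)
  have "(\<lambda>n. \<integral>\<^sup>+ s. ennreal (hat (X (grid (t / real (Suc n)) s) \<omega>)) * indicator {0<..u} s \<partial>lborel)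
      \<longlonglongrightarrow> (\<integral>\<^sup>+ s. ennreal (hat (X s \<omega>)) * indicator {0<..u} s \<partial>lborel)"
  proof (rule nn_integral_dominated_convergence[where w="\<lambda>s. indicator {0<..u} s"])
    show "(\<integral>\<^sup>+ s. indicator {0<..u} s \<partial>lborel) < \<infinity>" by (cases "0 \<le> u") auto
    show "AE s in lborel. (\<lambda>n. ennreal (hat (X (grid (t / real (Suc n)) s) \<omega>)) * indicator {0<..u} s)
        \<longlonglongrightarrow> ennreal (hat (X s \<omega>)) * indicator {0<..u} s"
    proof (rule AE_I2)
      fix s :: real
      show "(\<lambda>n. ennreal (hat (X (grid (t / real (Suc n)) s) \<omega>)) * indicator {0<..u} s)
        \<longlonglongrightarrow> ennreal (hat (X s \<omega>)) * indicator {0<..u} s"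
      proof (cases "s \<in> {0<..u}")
        case True
        then have s: "0 \<le> s" by simp
        have "(\<lambda>n. X (grid (t / real (Suc n)) s) \<omega>) \<longlonglongrightarrow> X s \<omega>"
          by (rule right_continuous_seq[OF X_right[OF \<omega> s] grid_tendsto[OF t s] grid_bounds(1)[OF h s]])
        then have "(\<lambda>n. hat (X (grid (t / real (Suc n)) s) \<omega>)) \<longlonglongrightarrow> hat (X s \<omega>)"
          unfolding hat_def by (intro tendsto_intros)
        then show ?thesis using True by (simp add: tendsto_ennrealI)
      qed simp
    qed
    show "AE s in lborel. ennreal (hat (X (grid (t / real (Suc n)) s) \<omega>)) * indicator {0<..u} s \<le> indicator {0<..u} s" for n
      using hat_le_1 by (intro AE_I2) (auto simp: indicator_def ennreal_le_1)
  qed (auto simp: eq)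
  then show ?thesis unfolding hat_clock_def
    by (intro tendsto_enn2real) (auto simp: hat_clock_ennreal[symmetric])
qed

text \<open>Once \<open>h\<close> is small each factor subtracts at most
  \<open>\<gamma> * h * (hat + \<epsilon>) < 1 / 2\<close>, so \<open>one_minus_ge_exp\<close> turns
  the product into the exponential of a grid sum. \<open>hat_sum_bound\<close> and
  \<open>hat_clock_limit\<close> identify the limit of that bound for every path.\<close>

lemma prod_lower_bound:
  assumes \<omega>: "\<omega> \<in> space M" and u: "0 < u" and t: "0 < t" and \<gamma>: "0 < \<gamma>" and \<epsilon>: "0 < \<epsilon>"
  shows "\<exists>q. q \<longlonglongrightarrow> exp (- 2 * \<gamma> * (hat_clock u \<omega> + u * \<epsilon>)) \<and> (\<forall>n. 0 \<le> q n) \<and>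
    (\<forall>\<^sub>F n in sequentially. ennreal (q n) \<le> (\<Prod>j<nat \<lceil>u / (t / real (Suc n))\<rceil>.
      1 - ennreal \<gamma> * occupation (t / real (Suc n)) hatE (X (real j * (t / real (Suc n))) \<omega>)))"
proof -
  define h where "h n = t / real (Suc n)" for n
  have h: "0 < h n" for n using t by (simp add: h_def)
  have h0: "h \<longlonglongrightarrow> 0"
    using tendsto_mult[OF tendsto_const[of t] LIMSEQ_inverse_real_of_nat]
    by (simp add: h_def[abs_def] divide_inverse)
  define I where "I n = enn2real (\<integral>\<^sup>+ s. ennreal (hat (X (grid (h n) s) \<omega>)) * indicator {0<..u} s \<partial>lborel)" for n
  define q where "q n = exp (- 2 * \<gamma> * (I n + 2 * h n + (u + h n) * \<epsilon>))" for n
  have "I \<longlonglongrightarrow> hat_clock u \<omega>" unfolding I_def[abs_def] h_def by (rule hat_clock_limit[OF \<omega> t])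
  then have "q \<longlonglongrightarrow> exp (- 2 * \<gamma> * (hat_clock u \<omega> + 2 * 0 + (u + 0) * \<epsilon>))"
    unfolding q_def[abs_def] by (intro tendsto_intros h0)
  moreover have "\<forall>\<^sub>F n in sequentially. ennreal (q n) \<le> (\<Prod>j<nat \<lceil>u / h n\<rceil>.
      1 - ennreal \<gamma> * occupation (h n) hatE (X (real j * h n) \<omega>))"
  proof -
    have fl: "filterlim h (at_right 0) sequentially"
      using h0 h[THEN less_imp_neq] h by (auto simp: filterlim_at intro!: always_eventually)
    have "\<forall>\<^sub>F n in sequentially. \<forall>y. occupation (h n) hatE y \<le> ennreal (h n * (hat y + \<epsilon>))
        \<and> ennreal (h n * hat y) \<le> occupation (h n) hatE y + ennreal (h n * \<epsilon>)"
      using occupation_uniform[OF uniformly_continuous_hat hat_nonneg hat_le_1 \<epsilon>] fl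
      by (rule eventually_compose_filterlim)
    moreover have "\<forall>\<^sub>F n in sequentially. \<gamma> * (h n * (1 + \<epsilon>)) < 1 / 2"
    proof -
      have "(\<lambda>n. \<gamma> * (h n * (1 + \<epsilon>))) \<longlonglongrightarrow> \<gamma> * (0 * (1 + \<epsilon>))" by (intro tendsto_intros h0)
      then show ?thesis by (rule order_tendstoD) simp
    qed
    ultimately show ?thesis
    proof eventually_elim
      case (elim n)
      let ?k = "nat \<lceil>u / h n\<rceil>" and ?H = "\<lambda>j. hat (X (real j * h n) \<omega>)"
      have kh: "real ?k * h n < u + h n"
        using grid_bounds(2)[OF h less_imp_le[OF u], of n] by (simp add: grid_def)
      have le: "ennreal (exp (- 2 * (\<gamma> * (h n * (?H j + \<epsilon>)))))
          \<le> 1 - ennreal \<gamma> * occupation (h n) hatE (X (real j * h n) \<omega>)" for j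
      proof -
        let ?y = "\<gamma> * (h n * (?H j + \<epsilon>))"
        have y0: "0 \<le> ?y" using \<gamma> h[of n] \<epsilon> hat_nonneg by (intro mult_nonneg_nonneg add_nonneg_nonneg) (auto intro: less_imp_le)
        have "?y \<le> \<gamma> * (h n * (1 + \<epsilon>))"
          using \<gamma> h[of n] hat_le_1 by (intro mult_left_mono add_right_mono) (auto intro: less_imp_le)
        then have "exp (- 2 * ?y) \<le> 1 - ?y" using elim(2) y0 by (intro one_minus_ge_exp) auto
        then have "ennreal (exp (- 2 * ?y)) \<le> 1 - ennreal ?y"
          unfolding ennreal_1[symmetric] ennreal_minus[OF y0] by (rule ennreal_leI)
        also have "ennreal ?y = ennreal \<gamma> * ennreal (h n * (?H j + \<epsilon>))"
          using \<gamma> h[of n] \<epsilon> hat_nonneg by (intro ennreal_mult) (auto intro!: mult_nonneg_nonneg add_nonneg_nonneg less_imp_le)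
        also have "1 - \<dots> \<le> 1 - ennreal \<gamma> * occupation (h n) hatE (X (real j * h n) \<omega>)"
          using elim(1) by (intro ennreal_minus_mono mult_left_mono) auto
        finally show ?thesis .
      qed
      have "(\<Sum>j<?k. h n * (?H j + \<epsilon>)) = (\<Sum>j<?k. h n * ?H j) + real ?k * h n * \<epsilon>"
        by (simp add: distrib_left sum.distrib)
      also have "\<dots> \<le> (I n + 2 * h n) + (u + h n) * \<epsilon>"
        using kh \<epsilon> unfolding I_def by (intro add_mono hat_sum_bound[OF \<omega> u h] mult_right_mono) auto
      finally have "q n \<le> exp (- 2 * \<gamma> * (\<Sum>j<?k. h n * (?H j + \<epsilon>)))"
        unfolding q_def using \<gamma> by simp
      also have "\<dots> = (\<Prod>j<?k. exp (- 2 * (\<gamma> * (h n * (?H j + \<epsilon>)))))"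
        by (simp add: exp_sum[symmetric] sum_distrib_left mult.assoc)
      finally have "ennreal (q n) \<le> (\<Prod>j<?k. ennreal (exp (- 2 * (\<gamma> * (h n * (?H j + \<epsilon>))))))"
        by (simp add: prod_ennreal ennreal_leI)
      also have "\<dots> \<le> (\<Prod>j<?k. 1 - ennreal \<gamma> * occupation (h n) hatE (X (real j * h n) \<omega>))"
        by (intro prod_mono_ennreal le)
      finally show ?case .
    qed
  qed
  moreover have "\<forall>n. 0 \<le> q n" by (simp add: q_def)
  ultimately show ?thesis unfolding h_def by auto
qed

text \<open>Feynman--Kac bound: the limit of the discrete supermartingale inequality for the barrier.\<close>

theorem occupation_bound:
  assumes uc: "uniformly_continuous_on UNIV f" and f: "\<And>y. 0 \<le> f y" "\<And>y. f y \<le> C"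
    and fin: "weight (\<lambda>y. ennreal (f y)) < \<infinity>" and \<gamma>: "0 < \<gamma>" and t: "0 < t"
  shows "ennreal pot_const * (\<integral>\<^sup>+ \<omega>. \<integral>\<^sup>+ u. ennreal (exp (- 2 * \<gamma> * hat_clock u \<omega>) * f (X u \<omega>)) * indicator {0<..t} u \<partial>lborel \<partial>M)
    \<le> ennreal (2 + pot_const / \<gamma>) * weight (\<lambda>y. ennreal (f y))"
proof -
  let ?f = "\<lambda>y. ennreal (f y)"
  have [measurable]: "f \<in> borel_measurable borel"
    using uc by (intro borel_measurable_continuous_onI uniformly_continuous_imp_continuous)
  note [measurable] = X_measurable
  define h where "h n = t / real (Suc n)" for n
  have h: "0 < h n" for n using t by (simp add: h_def)
  have h0: "h \<longlonglongrightarrow> 0"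
    using tendsto_mult[OF tendsto_const[of t] LIMSEQ_inverse_real_of_nat]
    by (simp add: h_def[abs_def] divide_inverse)
  have fl: "filterlim h (at_right 0) sequentially"
    using h0 h[THEN less_imp_neq] h by (auto simp: filterlim_at intro!: always_eventually)
  define g where "g n y = 1 - ennreal \<gamma> * occupation (h n) hatE y" for n y
  have [measurable]: "g n \<in> borel_measurable borel" for n unfolding g_def[abs_def] by measurable
  define F where "F n k \<omega> = (\<Prod>j<k. g n (X (real j * h n) \<omega>)) * (ennreal pot_const * occupation (h n) ?f (X (real k * h n) \<omega>))" for n k \<omega>
  have F_meas[measurable]: "F n k \<in> borel_measurable M" for n k unfolding F_def[abs_def] by measurable
  \<comment> \<open>Division by the step length turns the sum over grid points into the integral of
    a step function over \<open>{0<..t}\<close>, to which Fatou applies.\<close>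
  define G where "G n k \<omega> = ennreal (1 / h n) * F n k \<omega>" for n k \<omega>
  define J where "J n \<omega> = (\<integral>\<^sup>+ u. G n (nat \<lceil>u / h n\<rceil>) \<omega> * indicator {0<..t} u \<partial>lborel)" for n \<omega>
  have J_eq: "J n \<omega> = (\<Sum>k<Suc n. F n (Suc k) \<omega>)" for n \<omega>
  proof -
    have "real (Suc n) * h n = t" by (simp add: h_def)
    then have 1: "J n \<omega> = (\<Sum>k<Suc n. ennreal (h n) * G n (Suc k) \<omega>)"
      unfolding J_def using nn_integral_grid[OF h, of "\<lambda>k. G n k \<omega>" n "Suc n"] by simp
    have "ennreal (h n) * ennreal (1 / h n) = 1" using h[of n] by (simp add: ennreal_mult[symmetric])
    then have "ennreal (h n) * G n k \<omega> = F n k \<omega>" for k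
      by (simp add: G_def mult.assoc[symmetric])
    then show ?thesis unfolding 1 by (intro sum.cong refl)
  qed
  have J_meas[measurable]: "J n \<in> borel_measurable M" for n unfolding J_eq[abs_def] by measurable
  let ?B = "ennreal (2 + pot_const / \<gamma>) * weight ?f"
  have J_bound: "\<forall>\<^sub>F n in sequentially. (\<integral>\<^sup>+ \<omega>. J n \<omega> \<partial>M) \<le> ?B"
  proof -
    have "\<forall>\<^sub>F n in sequentially. \<gamma> * h n < 1"
    proof -
      have "(\<lambda>n. \<gamma> * h n) \<longlonglongrightarrow> \<gamma> * 0" by (intro tendsto_intros h0)
      then show ?thesis by (rule order_tendstoD) simp
    qed
    then show ?thesis
    proof eventually_elim
      case (elim n)
      note bar = barrier[OF \<gamma> less_imp_le[OF h] less_imp_le[OF elim] _ fin, of "ennreal C"]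
      have b1: "ennreal pot_const * occupation (h n) ?f y + g n y * (\<integral>\<^sup>+ z. barrier \<gamma> ?f (y + z) \<partial>N (h n)) \<le> barrier \<gamma> ?f y" for y
        unfolding g_def using f by (intro bar(1)) (auto intro: ennreal_leI)
      have b2: "barrier \<gamma> ?f y \<le> ?B" for y
        using f by (intro bar(2)) (auto intro: ennreal_leI)
      \<comment> \<open>Rounding up makes \<open>J\<close> use the grid indices 1 to
        \<open>n + 1\<close>, so the inequality is taken one step further and its term at index 0 is
        discarded.\<close>
      have "(\<Sum>k<Suc (Suc n). \<integral>\<^sup>+ \<omega>. F n k \<omega> \<partial>M)
          + (\<integral>\<^sup>+ \<omega>. (\<Prod>j<Suc (Suc n). g n (X (real j * h n) \<omega>)) * barrier \<gamma> ?f (X (real (Suc (Suc n)) * h n) \<omega>) \<partial>M)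
          \<le> barrier \<gamma> ?f x"
        unfolding F_def by (rule X_walk[OF h]) (measurable, rule b1)
      then have "(\<Sum>k<Suc (Suc n). \<integral>\<^sup>+ \<omega>. F n k \<omega> \<partial>M) \<le> ?B"
        using b2[of x] by (meson le_iff_add order_trans)
      moreover have "(\<Sum>k<Suc (Suc n). \<integral>\<^sup>+ \<omega>. F n k \<omega> \<partial>M)
          = (\<integral>\<^sup>+ \<omega>. F n 0 \<omega> \<partial>M) + (\<Sum>k<Suc n. \<integral>\<^sup>+ \<omega>. F n (Suc k) \<omega> \<partial>M)"
        by (rule sum.lessThan_Suc_shift)
      moreover have "(\<integral>\<^sup>+ \<omega>. J n \<omega> \<partial>M) = (\<Sum>k<Suc n. \<integral>\<^sup>+ \<omega>. F n (Suc k) \<omega> \<partial>M)"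
        unfolding J_eq by (rule nn_integral_sum) measurable
      ultimately show ?case by (metis add.commute le_iff_add order_trans)
    qed
  qed
  have point: "ennreal pot_const * (ennreal (exp (- 2 * \<gamma> * hat_clock u \<omega>) * f (X u \<omega>)) * indicator {0<..t} u)
      \<le> liminf (\<lambda>n. G n (nat \<lceil>u / h n\<rceil>) \<omega> * indicator {0<..t} u)" if \<omega>: "\<omega> \<in> space M" for u \<omega>
  proof (cases "u \<in> {0<..t}")
    case True
    then have u: "0 < u" by simp
    let ?k = "\<lambda>n. nat \<lceil>u / h n\<rceil>"
    \<comment> \<open>\<open>\<epsilon>\<close> is the slack in the weights and in the one-step
      occupation of \<open>f\<close>; it is sent to 0 after the limit of fine grids.\<close>
    define E where "E \<epsilon> = pot_const * (exp (- 2 * \<gamma> * (hat_clock u \<omega> + u * \<epsilon>)) * max 0 (f (X u \<omega>) - \<epsilon>))" for \<epsilon>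
    have E_le: "ennreal (E \<epsilon>) \<le> liminf (\<lambda>n. G n (?k n) \<omega>)" if \<epsilon>: "0 < \<epsilon>" for \<epsilon>
    proof -
      obtain q where q: "q \<longlonglongrightarrow> exp (- 2 * \<gamma> * (hat_clock u \<omega> + u * \<epsilon>))" "\<And>n. 0 \<le> q n"
        "\<forall>\<^sub>F n in sequentially. ennreal (q n) \<le> (\<Prod>j<?k n. g n (X (real j * h n) \<omega>))"
        using prod_lower_bound[OF \<omega> u t \<gamma> \<epsilon>] unfolding h_def g_def by blast
      define r where "r n = pot_const * (q n * max 0 (f (X (grid (h n) u) \<omega>) - \<epsilon>))" for n
      have "(\<lambda>n. X (grid (h n) u) \<omega>) \<longlonglongrightarrow> X u \<omega>"
        using u t unfolding h_def
        by (intro right_continuous_seq[OF X_right[OF \<omega> less_imp_le[OF u]]] grid_tendsto grid_bounds(1)) auto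
      then have "(\<lambda>n. f (X (grid (h n) u) \<omega>)) \<longlonglongrightarrow> f (X u \<omega>)"
        using uniformly_continuous_imp_continuous[OF uc] by (intro continuous_on_tendsto_compose[of UNIV f]) auto
      then have "r \<longlonglongrightarrow> E \<epsilon>"
        unfolding r_def[abs_def] E_def by (intro tendsto_intros q(1))
      then have "(\<lambda>n. ennreal (r n)) \<longlonglongrightarrow> ennreal (E \<epsilon>)" by (rule tendsto_ennrealI)
      then have "ennreal (E \<epsilon>) = liminf (\<lambda>n. ennreal (r n))"
        by (rule lim_imp_Liminf[symmetric, rotated]) simp
      also have "\<dots> \<le> liminf (\<lambda>n. G n (?k n) \<omega>)"
      proof (rule Liminf_mono)
        have "\<forall>\<^sub>F n in sequentially. \<forall>y. occupation (h n) ?f y \<le> ennreal (h n * (f y + \<epsilon>))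
            \<and> ennreal (h n * f y) \<le> occupation (h n) ?f y + ennreal (h n * \<epsilon>)"
          using occupation_uniform[OF uc f \<epsilon>] fl by (rule eventually_compose_filterlim)
        then show "\<forall>\<^sub>F n in sequentially. ennreal (r n) \<le> G n (?k n) \<omega>"
          using q(3)
        proof eventually_elim
          case (elim n)
          let ?y = "X (grid (h n) u) \<omega>"
          have y: "?y = X (real (?k n) * h n) \<omega>" by (simp add: grid_def)
          have hp: "0 < h n" by (rule h)
          have "ennreal (h n * max 0 (f ?y - \<epsilon>)) \<le> occupation (h n) ?f ?y"
          proof (cases "\<epsilon> \<le> f ?y")
            case True
            then have "ennreal (h n * max 0 (f ?y - \<epsilon>)) + ennreal (h n * \<epsilon>) = ennreal (h n * f ?y)"
              using hp \<epsilon> by (subst ennreal_plus[symmetric]) (auto simp: algebra_simps)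
            also have "\<dots> \<le> occupation (h n) ?f ?y + ennreal (h n * \<epsilon>)" using elim(1) by blast
            finally show ?thesis by (rule ennreal_right_cancel_le) simp
          qed simp
          then have "ennreal (1 / h n) * ennreal (h n * max 0 (f ?y - \<epsilon>)) \<le> ennreal (1 / h n) * occupation (h n) ?f ?y"
            by (rule mult_left_mono) simp
          then have 1: "ennreal (max 0 (f ?y - \<epsilon>)) \<le> ennreal (1 / h n) * occupation (h n) ?f ?y"
            using hp by (simp add: ennreal_mult[symmetric])
          have "ennreal (r n) = ennreal pot_const * (ennreal (q n) * ennreal (max 0 (f ?y - \<epsilon>)))"
            using pot_const_pos q(2) by (simp add: r_def ennreal_mult)
          also have "\<dots> \<le> ennreal pot_const * ((\<Prod>j<?k n. g n (X (real j * h n) \<omega>)) * (ennreal (1 / h n) * occupation (h n) ?f ?y))"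
            by (intro mult_left_mono mult_mono elim(2) 1) auto
          also have "\<dots> = G n (?k n) \<omega>"
            by (simp add: G_def F_def y mult_ac)
          finally show ?case .
        qed
      qed
      finally show ?thesis .
    qed
    have "((\<lambda>\<epsilon>. ennreal (E \<epsilon>)) \<longlongrightarrow> ennreal (E 0)) (at_right 0)"
      unfolding E_def by (intro tendsto_ennrealI tendsto_intros)
    then have "ennreal (E 0) \<le> liminf (\<lambda>n. G n (?k n) \<omega>)"
      by (rule tendsto_upperbound) (auto simp: eventually_at_right_field intro!: exI[of _ 1] E_le)
    moreover have "ennreal (E 0) = ennreal pot_const * ennreal (exp (- 2 * \<gamma> * hat_clock u \<omega>) * f (X u \<omega>))"
      using f(1) pot_const_pos by (simp add: E_def ennreal_mult max_def)
    ultimately show ?thesis using True by simp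
  qed simp
  have "ennreal pot_const * (\<integral>\<^sup>+ \<omega>. \<integral>\<^sup>+ u. ennreal (exp (- 2 * \<gamma> * hat_clock u \<omega>) * f (X u \<omega>)) * indicator {0<..t} u \<partial>lborel \<partial>M)
      \<le> (\<integral>\<^sup>+ \<omega>. liminf (\<lambda>n. J n \<omega>) \<partial>M)"
  proof -
    let ?L = "\<lambda>u \<omega>. ennreal (exp (- 2 * \<gamma> * hat_clock u \<omega>) * f (X u \<omega>)) * indicator {0<..t} u"
    define L' where "L' u \<omega> = ennreal (exp (- 2 * \<gamma> * hat_clock u \<omega>) * f (Xp u \<omega>)) * indicator {0<..t} u" for u \<omega>
    have LL: "?L u \<omega> = L' u \<omega>" for u \<omega> by (auto simp: L'_def Xp_def indicator_def)
    have L'm: "(\<lambda>w. L' (snd w) (fst w)) \<in> borel_measurable (M \<Otimes>\<^sub>M lborel)"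
      using measurable_compose[OF measurable_pair_swap' Xp_measurable] measurable_compose[OF measurable_pair_swap' hat_clock_measurable]
      unfolding L'_def by (simp add: case_prod_beta')
    have [measurable]: "(\<lambda>\<omega>. \<integral>\<^sup>+ u. L' u \<omega> \<partial>lborel) \<in> borel_measurable M"
      using lborel.borel_measurable_nn_integral_fst[OF L'm] by simp
    have [measurable]: "(\<lambda>u. L' u \<omega>) \<in> borel_measurable lborel" if "\<omega> \<in> space M" for \<omega>
      using measurable_compose[OF measurable_Pair1'[OF that] L'm] by simp
    have "ennreal pot_const * (\<integral>\<^sup>+ \<omega>. \<integral>\<^sup>+ u. L' u \<omega> \<partial>lborel \<partial>M)
        = (\<integral>\<^sup>+ \<omega>. \<integral>\<^sup>+ u. ennreal pot_const * L' u \<omega> \<partial>lborel \<partial>M)"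
      by (subst nn_integral_cmult[symmetric]) (auto intro!: nn_integral_cong nn_integral_cmult[symmetric])
    also have "\<dots> \<le> (\<integral>\<^sup>+ \<omega>. liminf (\<lambda>n. J n \<omega>) \<partial>M)"
    proof (rule nn_integral_mono)
      fix \<omega> assume \<omega>: "\<omega> \<in> space M"
      have [measurable]: "(\<lambda>u. G n (nat \<lceil>u / h n\<rceil>) \<omega>) \<in> borel_measurable borel" for n
        by (rule measurable_grid_fun[of "\<lambda>k. G n k \<omega>"]) simp
      have "(\<integral>\<^sup>+ u. ennreal pot_const * L' u \<omega> \<partial>lborel)
          \<le> (\<integral>\<^sup>+ u. liminf (\<lambda>n. G n (nat \<lceil>u / h n\<rceil>) \<omega> * indicator {0<..t} u) \<partial>lborel)"
        using point[OF \<omega>] by (intro nn_integral_mono) (simp only: LL)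
      also have "\<dots> \<le> liminf (\<lambda>n. J n \<omega>)"
        unfolding J_def by (rule nn_integral_liminf) measurable
      finally show "(\<integral>\<^sup>+ u. ennreal pot_const * L' u \<omega> \<partial>lborel) \<le> liminf (\<lambda>n. J n \<omega>)" .
    qed
    finally show ?thesis by (simp only: LL)
  qed
  also have "\<dots> \<le> liminf (\<lambda>n. \<integral>\<^sup>+ \<omega>. J n \<omega> \<partial>M)" by (rule nn_integral_liminf) measurable
  also have "\<dots> \<le> liminf (\<lambda>n::nat. ?B)" by (rule Liminf_mono[OF J_bound])
  also have "\<dots> = ?B" by (simp add: Liminf_const)
  finally show ?thesis .
qed

end

section \<open>Divergence of the clock\<close>

lemma potential_hat_ge:
  assumes "stable_family \<alpha> N" and y: "1 \<le> \<bar>y\<bar>"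
  shows "ennreal ((\<bar>y\<bar> - 1) powr (\<alpha> - 1)) \<le> stable_family.potential \<alpha> (\<lambda>z. ennreal (hat z)) y"
proof -
  interpret stable_family \<alpha> N by fact
  have "ennreal ((\<bar>y\<bar> - 1) powr (\<alpha> - 1)) = (\<integral>\<^sup>+ z. hatE z * ennreal ((\<bar>y\<bar> - 1) powr (\<alpha> - 1)) \<partial>lborel)"
    by (subst nn_integral_multc) (simp_all add: nn_integral_hat)
  also have "\<dots> \<le> potential hatE y"
    unfolding potential_def
  proof (rule nn_integral_mono)
    fix z
    show "hatE z * ennreal ((\<bar>y\<bar> - 1) powr (\<alpha> - 1)) \<le> hatE z * ennreal (\<bar>y - z\<bar> powr (\<alpha> - 1))"
    proof (cases "hat z = 0")
      case False
      then have "\<bar>y\<bar> - 1 \<le> \<bar>y - z\<bar>" using hat_support[OF False] by linarith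
      then show ?thesis using y alpha by (intro mult_left_mono ennreal_leI powr_mono2) auto
    qed simp
  qed
  finally show ?thesis .
qed

context stable_path
begin

text \<open>Terminal term of the supermartingale inequality for \<open>lyapunov\<close> in the limit
  of fine grids: an unbounded function of the position keeps a bounded weighted expectation for all
  times.\<close>

lemma lyapunov_bound:
  assumes \<gamma>: "0 < \<gamma>" and t: "0 < t"
  shows "(\<integral>\<^sup>+ \<omega>. ennreal (exp (- 2 * \<gamma> * hat_clock t \<omega>)) * potential hatE (X t \<omega>) \<partial>M)
    \<le> ennreal (exp (2 * \<gamma>)) * (potential hatE x + ennreal (pot_const / \<gamma>))"
proof -
  note [measurable] = X_measurable
  define v where "v = (\<lambda>x. potential hatE x + ennreal (pot_const / \<gamma>))"
  have [measurable]: "v \<in> borel_measurable borel" unfolding v_def by measurable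
  define h where "h n = t / real (Suc n)" for n
  have h: "0 < h n" for n using t by (simp add: h_def)
  have h0: "h \<longlonglongrightarrow> 0"
    using tendsto_mult[OF tendsto_const[of t] LIMSEQ_inverse_real_of_nat]
    by (simp add: h_def[abs_def] divide_inverse)
  define g where "g n y = 1 - ennreal \<gamma> * occupation (h n) hatE y" for n y
  have [measurable]: "g n \<in> borel_measurable borel" for n unfolding g_def[abs_def] by measurable
  define F where "F n \<omega> = (\<Prod>j<Suc n. g n (X (real j * h n) \<omega>)) * v (X t \<omega>)" for n \<omega>
  have [measurable]: "F n \<in> borel_measurable M" for n unfolding F_def[abs_def] by measurable
  have F_bound: "\<forall>\<^sub>F n in sequentially. (\<integral>\<^sup>+ \<omega>. F n \<omega> \<partial>M) \<le> v x"
  proof -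
    have "\<forall>\<^sub>F n in sequentially. \<gamma> * h n < 1"
    proof -
      have "(\<lambda>n. \<gamma> * h n) \<longlonglongrightarrow> \<gamma> * 0" by (intro tendsto_intros h0)
      then show ?thesis by (rule order_tendstoD) simp
    qed
    then show ?thesis
    proof eventually_elim
      case (elim n)
      have "(\<Sum>k<Suc n. \<integral>\<^sup>+ \<omega>. (\<Prod>j<k. g n (X (real j * h n) \<omega>)) * (\<lambda>_. 0) (X (real k * h n) \<omega>) \<partial>M)
          + (\<integral>\<^sup>+ \<omega>. (\<Prod>j<Suc n. g n (X (real j * h n) \<omega>)) * v (X (real (Suc n) * h n) \<omega>) \<partial>M) \<le> v x"
      proof (rule X_walk[OF h])
        show "0 + g n y * (\<integral>\<^sup>+ z. v (y + z) \<partial>N (h n)) \<le> v y" for y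
          using lyapunov[OF \<gamma> less_imp_le[OF h] less_imp_le[OF elim], of y] by (simp add: g_def v_def)
      qed measurable
      moreover have "real (Suc n) * h n = t" by (simp add: h_def)
      ultimately show ?case by (simp add: F_def)
    qed
  qed
  have point: "ennreal (exp (- 2 * \<gamma> * (hat_clock t \<omega> + 1))) * v (X t \<omega>) \<le> liminf (\<lambda>n. F n \<omega>)"
    if \<omega>: "\<omega> \<in> space M" for \<omega>
  proof -
    \<comment> \<open>The slack \<open>1 / t\<close> enlarges the exponent over the whole interval
      by exactly 1, which costs the factor \<open>exp (2 * \<gamma>)\<close> of the
      statement.\<close>
    obtain q where q: "q \<longlonglongrightarrow> exp (- 2 * \<gamma> * (hat_clock t \<omega> + t * (1 / t)))"
      "\<forall>\<^sub>F n in sequentially. ennreal (q n) \<le> (\<Prod>j<nat \<lceil>t / h n\<rceil>. g n (X (real j * h n) \<omega>))"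
      using prod_lower_bound[OF \<omega> t t \<gamma>, of "1 / t"] t unfolding h_def g_def by auto
    have k: "nat \<lceil>t / h n\<rceil> = Suc n" for n
    proof -
      have "t / h n = real (Suc n)" using t by (simp add: h_def)
      then show ?thesis by (metis ceiling_of_nat nat_int)
    qed
    have "(\<lambda>n. ennreal (q n) * v (X t \<omega>)) \<longlonglongrightarrow> ennreal (exp (- 2 * \<gamma> * (hat_clock t \<omega> + 1))) * v (X t \<omega>)"
      using q(1) t potential_hat_finite[of "X t \<omega>"]
      by (intro tendsto_mult_ennreal tendsto_ennrealI tendsto_const) (auto simp: v_def)
    then have "ennreal (exp (- 2 * \<gamma> * (hat_clock t \<omega> + 1))) * v (X t \<omega>) = liminf (\<lambda>n. ennreal (q n) * v (X t \<omega>))"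
      by (rule lim_imp_Liminf[symmetric, rotated]) simp
    also have "\<dots> \<le> liminf (\<lambda>n. F n \<omega>)"
      using q(2) unfolding k F_def by (intro Liminf_mono) (auto elim!: eventually_mono intro: mult_right_mono)
    finally show ?thesis .
  qed
  have m: "(\<lambda>\<omega>. hat_clock t \<omega>) \<in> borel_measurable M"
    using measurable_compose[OF measurable_Pair1' hat_clock_measurable, of t] by simp
  note [measurable] = m
  have "(\<integral>\<^sup>+ \<omega>. ennreal (exp (- 2 * \<gamma> * hat_clock t \<omega>)) * potential hatE (X t \<omega>) \<partial>M)
      \<le> (\<integral>\<^sup>+ \<omega>. ennreal (exp (2 * \<gamma>)) * (ennreal (exp (- 2 * \<gamma> * (hat_clock t \<omega> + 1))) * v (X t \<omega>)) \<partial>M)"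
  proof (rule nn_integral_mono)
    fix \<omega>
    have "ennreal (exp (2 * \<gamma>)) * (ennreal (exp (- 2 * \<gamma> * (hat_clock t \<omega> + 1))) * v (X t \<omega>))
        = ennreal (exp (2 * \<gamma>) * exp (- 2 * \<gamma> * (hat_clock t \<omega> + 1))) * v (X t \<omega>)"
      by (subst ennreal_mult) (auto simp: mult.assoc)
    also have "exp (2 * \<gamma>) * exp (- 2 * \<gamma> * (hat_clock t \<omega> + 1)) = exp (- 2 * \<gamma> * hat_clock t \<omega>)"
      by (simp add: exp_add[symmetric] algebra_simps)
    finally show "ennreal (exp (- 2 * \<gamma> * hat_clock t \<omega>)) * potential hatE (X t \<omega>)
        \<le> ennreal (exp (2 * \<gamma>)) * (ennreal (exp (- 2 * \<gamma> * (hat_clock t \<omega> + 1))) * v (X t \<omega>))"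
      by (simp add: v_def mult_left_mono)
  qed
  also have "\<dots> = ennreal (exp (2 * \<gamma>)) * (\<integral>\<^sup>+ \<omega>. ennreal (exp (- 2 * \<gamma> * (hat_clock t \<omega> + 1))) * v (X t \<omega>) \<partial>M)"
    by (rule nn_integral_cmult) measurable
  also have "\<dots> \<le> ennreal (exp (2 * \<gamma>)) * v x"
  proof (rule mult_left_mono)
    have "(\<integral>\<^sup>+ \<omega>. ennreal (exp (- 2 * \<gamma> * (hat_clock t \<omega> + 1))) * v (X t \<omega>) \<partial>M) \<le> (\<integral>\<^sup>+ \<omega>. liminf (\<lambda>n. F n \<omega>) \<partial>M)"
      by (intro nn_integral_mono point)
    also have "\<dots> \<le> liminf (\<lambda>n. \<integral>\<^sup>+ \<omega>. F n \<omega> \<partial>M)" by (rule nn_integral_liminf) measurable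
    also have "\<dots> \<le> liminf (\<lambda>n::nat. v x)" by (rule Liminf_mono[OF F_bound])
    also have "\<dots> = v x" by (simp add: Liminf_const)
    finally show "(\<integral>\<^sup>+ \<omega>. ennreal (exp (- 2 * \<gamma> * (hat_clock t \<omega> + 1))) * v (X t \<omega>) \<partial>M) \<le> v x" .
  qed simp
  finally show ?thesis by (simp add: v_def)
qed

text \<open>The density at time \<open>t\<close> is bounded everywhere by the integral of its
  characteristic function over \<open>2 * pi\<close>, which tends to 0; so the probability of lying
  in a fixed bounded set does too.\<close>

lemma escape_probability:
  "(\<lambda>n. emeasure M {\<omega> \<in> space M. \<bar>X (real (Suc n)) \<omega>\<bar> \<le> R}) \<longlonglongrightarrow> 0"
proof -
  note [measurable] = X_measurable
  define I where "I n = (\<integral>\<theta>. exp (- real (Suc n) * \<bar>\<theta>\<bar> powr \<alpha>) \<partial>lborel)" for n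
  have "I \<longlonglongrightarrow> (\<integral>\<theta>. 0 \<partial>(lborel :: real measure))"
    unfolding I_def[abs_def]
  proof (rule integral_dominated_convergence)
    show "integrable lborel (\<lambda>\<theta>::real. exp (- 1 * \<bar>\<theta>\<bar> powr \<alpha>))" using alpha by (intro integrable_exp_powr) auto
    show "AE \<theta> in lborel. (\<lambda>n. exp (- real (Suc n) * \<bar>\<theta>\<bar> powr \<alpha>)) \<longlonglongrightarrow> 0"
      using AE_lborel_singleton[of 0]
    proof eventually_elim
      case (elim \<theta>)
      define r where "r = exp (- (\<bar>\<theta>\<bar> powr \<alpha>))"
      have "\<bar>r\<bar> < 1" using elim by (simp add: r_def)
      then have "(\<lambda>n. r ^ Suc n) \<longlonglongrightarrow> 0" using LIMSEQ_Suc[OF LIMSEQ_abs_realpow_zero2] by blast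
      moreover have "r ^ Suc n = exp (- real (Suc n) * \<bar>\<theta>\<bar> powr \<alpha>)" for n
        unfolding r_def exp_of_nat_mult[symmetric] by (simp add: algebra_simps)
      ultimately show ?case by simp
    qed
    show "AE \<theta> in lborel. norm (exp (- real (Suc n) * \<bar>\<theta>\<bar> powr \<alpha>)) \<le> exp (- 1 * \<bar>\<theta>\<bar> powr \<alpha>)" for n
      by (intro AE_I2) (simp add: left_diff_distrib)
  qed measurable
  then have I0: "I \<longlonglongrightarrow> 0" by simp
  define R' where "R' = \<bar>R\<bar>"
  have bound: "emeasure M {\<omega> \<in> space M. \<bar>X (real (Suc n)) \<omega>\<bar> \<le> R} \<le> ennreal (2 * R' * (1 / (2 * pi) * I n))" for n
  proof -
    let ?t = "real (Suc n)"
    have t: "0 < ?t" by simp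
    have sd: "stable_density \<alpha> ?t y \<le> 1 / (2 * pi) * I n" for y
    proof -
      have "(\<integral>\<theta>. cos (\<theta> * y) * exp (- ?t * \<bar>\<theta>\<bar> powr \<alpha>) \<partial>lborel) \<le> I n"
        unfolding I_def
      proof (rule integral_mono)
        show e: "integrable lborel (\<lambda>\<theta>::real. exp (- ?t * \<bar>\<theta>\<bar> powr \<alpha>))" using alpha t by (intro integrable_exp_powr) auto
        show "integrable lborel (\<lambda>\<theta>. cos (\<theta> * y) * exp (- ?t * \<bar>\<theta>\<bar> powr \<alpha>))"
          by (rule Bochner_Integration.integrable_bound[OF e]) (auto simp: abs_mult mult_left_le_one_le)
        show "cos (\<theta> * y) * exp (- ?t * \<bar>\<theta>\<bar> powr \<alpha>) \<le> exp (- ?t * \<bar>\<theta>\<bar> powr \<alpha>)" for \<theta>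
          using mult_right_mono[OF cos_le_one exp_ge_zero, of "\<theta> * y" "- ?t * \<bar>\<theta>\<bar> powr \<alpha>"] by simp
      qed
      then show ?thesis unfolding stable_density_def by (intro mult_left_mono) auto
    qed
    have "emeasure M {\<omega> \<in> space M. \<bar>X ?t \<omega>\<bar> \<le> R} \<le> emeasure M {\<omega> \<in> space M. x + (X ?t \<omega> - x) \<in> {- R'..R'}}"
      by (intro emeasure_mono) (auto simp: R'_def)
    also have "\<dots> = (\<integral>\<^sup>+ \<omega>. indicator {- R'..R'} (x + (X ?t \<omega> - x)) \<partial>M)"
    proof -
      have "{\<omega> \<in> space M. x + (X ?t \<omega> - x) \<in> {- R'..R'}} \<in> sets M" by measurable
      from nn_integral_indicator[OF this, symmetric] show ?thesis
        by (rule trans) (intro nn_integral_cong, auto simp: indicator_def)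
    qed
    also have "\<dots> = (\<integral>\<^sup>+ z. indicator {- R'..R'} (x + z) \<partial>N ?t)"
      using t by (subst X_law[symmetric]) (auto simp: nn_integral_distr)
    also have "\<dots> = (\<integral>\<^sup>+ y. indicator {- R'..R'} y * ennreal (stable_density \<alpha> ?t (y - x)) \<partial>lborel)"
      by (rule nn_integral_N[OF t]) measurable
    also have "\<dots> \<le> (\<integral>\<^sup>+ y. ennreal (1 / (2 * pi) * I n) * indicator {- R'..R'} y \<partial>lborel)"
      using sd by (intro nn_integral_mono) (auto simp: indicator_def intro!: ennreal_leI)
    also have "\<dots> = ennreal (1 / (2 * pi) * I n) * ennreal (2 * R')"
      by (subst nn_integral_cmult) (auto simp: R'_def)
    also have "\<dots> = ennreal (2 * R' * (1 / (2 * pi) * I n))"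
      by (subst mult.commute, subst ennreal_mult[symmetric]) (auto simp: R'_def I_def)
    finally show ?thesis .
  qed
  have "(\<lambda>n. ennreal (2 * R' * (1 / (2 * pi) * I n))) \<longlonglongrightarrow> ennreal (2 * R' * (1 / (2 * pi) * 0))"
    by (intro tendsto_ennrealI tendsto_intros I0)
  then have "(\<lambda>n. ennreal (2 * R' * (1 / (2 * pi) * I n))) \<longlonglongrightarrow> 0" by simp
  from tendsto_sandwich[OF _ _ tendsto_const this] bound show ?thesis by auto
qed

text \<open>On the event that the tent clock stays below \<open>a\<close> the weight is at least
  \<open>exp (- 2 * a)\<close>, with killing rate \<open>\<gamma> = 1\<close>. At late times the
  path is beyond \<open>R\<close> with probability close to 1, where the potential is at least
  \<open>(R - 1) powr (\<alpha> - 1)\<close>. The Lyapunov bound then makes the probability of the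
  event at most of the order of the inverse of this power, and \<open>R\<close> is
  arbitrary.\<close>

theorem hat_clock_unbounded: "AE \<omega> in M. \<forall>a. \<exists>n. a < hat_clock (real (Suc n)) \<omega>"
proof -
  note [measurable] = X_measurable
  have m[measurable]: "(\<lambda>\<omega>. hat_clock t \<omega>) \<in> borel_measurable M" for t
    using measurable_compose[OF measurable_Pair1' hat_clock_measurable, of t] by simp
  define Z where "Z a = {\<omega> \<in> space M. \<forall>n. hat_clock (real (Suc n)) \<omega> \<le> real a}" for a :: nat
  have Zm[measurable]: "Z a \<in> sets M" for a unfolding Z_def by measurable
  have Z0: "emeasure M (Z a) = 0" for a
  proof -
    define K where "K = enn2real (ennreal (exp (2 * 1)) * (potential hatE x + ennreal (pot_const / 1)))"
    have K: "ennreal K = ennreal (exp (2 * 1)) * (potential hatE x + ennreal (pot_const / 1))"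
      unfolding K_def using potential_hat_finite[of x]
      by (intro ennreal_enn2real) (auto simp: ennreal_mult_less_top)
    have K0: "0 \<le> K" by (simp add: K_def)
    let ?e = "exp (- 2 * 1 * real a)"
    have main: "ennreal ?e * emeasure M (Z a) \<le> ennreal (K / (R - 1) powr (\<alpha> - 1))" if R: "1 < R" for R
    proof -
      let ?A = "\<lambda>n. {\<omega> \<in> space M. \<bar>X (real (Suc n)) \<omega>\<bar> \<le> R}"
      have r: "0 < (R - 1) powr (\<alpha> - 1)" using R by simp
      have le: "ennreal ?e * emeasure M (Z a) \<le> emeasure M (?A n) + ennreal (K / (R - 1) powr (\<alpha> - 1))" for n
      proof -
        let ?t = "real (Suc n)"
        let ?E = "\<lambda>\<omega>. exp (- 2 * 1 * hat_clock ?t \<omega>)"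
        have "ennreal ?e * emeasure M (Z a) = (\<integral>\<^sup>+ \<omega>. ennreal ?e * indicator (Z a) \<omega> \<partial>M)"
          by (subst nn_integral_cmult) auto
        also have "\<dots> \<le> (\<integral>\<^sup>+ \<omega>. indicator (?A n) \<omega> + ennreal (1 / (R - 1) powr (\<alpha> - 1)) * (ennreal (?E \<omega>) * potential hatE (X ?t \<omega>)) \<partial>M)"
        proof (rule nn_integral_mono)
          fix \<omega> assume \<omega>: "\<omega> \<in> space M"
          show "ennreal ?e * indicator (Z a) \<omega> \<le> indicator (?A n) \<omega> + ennreal (1 / (R - 1) powr (\<alpha> - 1)) * (ennreal (?E \<omega>) * potential hatE (X ?t \<omega>))"
          proof (cases "\<omega> \<in> Z a \<and> \<omega> \<notin> ?A n")
            case True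
            then have "R < \<bar>X ?t \<omega>\<bar>" using \<omega> by auto
            then have "ennreal ((R - 1) powr (\<alpha> - 1)) \<le> ennreal ((\<bar>X ?t \<omega>\<bar> - 1) powr (\<alpha> - 1))"
              using R alpha by (intro ennreal_leI powr_mono2) auto
            also have "\<dots> \<le> potential hatE (X ?t \<omega>)"
              using \<open>R < \<bar>X ?t \<omega>\<bar>\<close> R by (intro potential_hat_ge[OF stable_family_axioms]) auto
            finally have p: "ennreal ((R - 1) powr (\<alpha> - 1)) \<le> potential hatE (X ?t \<omega>)" .
            have "ennreal ?e \<le> ennreal (?E \<omega>)" using True by (intro ennreal_leI) (auto simp: Z_def)
            then have "ennreal ?e * ennreal ((R - 1) powr (\<alpha> - 1)) \<le> ennreal (?E \<omega>) * potential hatE (X ?t \<omega>)"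
              using p by (intro mult_mono) auto
            then have "ennreal (1 / (R - 1) powr (\<alpha> - 1)) * (ennreal ?e * ennreal ((R - 1) powr (\<alpha> - 1)))
                \<le> ennreal (1 / (R - 1) powr (\<alpha> - 1)) * (ennreal (?E \<omega>) * potential hatE (X ?t \<omega>))"
              by (intro mult_left_mono) auto
            moreover have "ennreal (1 / (R - 1) powr (\<alpha> - 1)) * (ennreal ?e * ennreal ((R - 1) powr (\<alpha> - 1))) = ennreal ?e"
              using r by (simp add: ennreal_mult[symmetric])
            ultimately show ?thesis using True by simp
          next
            case False
            have "ennreal ?e \<le> 1" by (simp add: ennreal_le_1)
            then show ?thesis using False by (auto simp: indicator_def intro!: add_increasing2)
          qed
        qed
        also have "\<dots> = emeasure M (?A n) + ennreal (1 / (R - 1) powr (\<alpha> - 1)) * (\<integral>\<^sup>+ \<omega>. ennreal (?E \<omega>) * potential hatE (X ?t \<omega>) \<partial>M)"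
          by (simp add: nn_integral_add nn_integral_cmult)
        also have "\<dots> \<le> emeasure M (?A n) + ennreal (1 / (R - 1) powr (\<alpha> - 1)) * ennreal K"
          unfolding K by (intro add_left_mono mult_left_mono lyapunov_bound) auto
        also have "ennreal (1 / (R - 1) powr (\<alpha> - 1)) * ennreal K = ennreal (K / (R - 1) powr (\<alpha> - 1))"
          using K0 r by (simp add: ennreal_mult[symmetric])
        finally show ?thesis .
      qed
      have "(\<lambda>n. emeasure M (?A n) + ennreal (K / (R - 1) powr (\<alpha> - 1))) \<longlonglongrightarrow> 0 + ennreal (K / (R - 1) powr (\<alpha> - 1))"
        by (intro tendsto_add tendsto_const escape_probability)
      then show ?thesis using le by (intro LIMSEQ_le_const) (auto intro: exI[of _ 0])
    qed
    have "((\<lambda>R. ennreal (K / (R - 1) powr (\<alpha> - 1))) \<longlongrightarrow> ennreal (K * 0)) at_top"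
    proof (intro tendsto_ennrealI)
      have "filterlim (\<lambda>R::real. -1 + R) at_top at_top"
        by (rule filterlim_tendsto_add_at_top[OF tendsto_const filterlim_ident])
      then have "((\<lambda>R. (-1 + R) powr (- (\<alpha> - 1))) \<longlongrightarrow> 0) at_top"
        using alpha by (intro tendsto_neg_powr) auto
      from tendsto_mult[OF tendsto_const[of K] this]
      show "((\<lambda>R. K / (R - 1) powr (\<alpha> - 1)) \<longlongrightarrow> K * 0) at_top"
        by (simp only: powr_minus divide_inverse uminus_add_conv_diff)
    qed
    then have "ennreal ?e * emeasure M (Z a) \<le> ennreal (K * 0)"
      by (rule tendsto_lowerbound) (use main in \<open>auto intro: eventually_mono[OF eventually_gt_at_top[of 1]]\<close>)
    then show ?thesis by simp
  qed
  have "AE \<omega> in M. \<forall>a. \<omega> \<notin> Z a"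
    using Z0 by (subst AE_all_countable) (auto intro!: AE_not_in simp: null_sets_def)
  then show ?thesis
  proof (rule AE_mp, intro AE_I2 impI allI)
    fix \<omega> and b :: real assume \<omega>: "\<omega> \<in> space M" and Z: "\<forall>a. \<omega> \<notin> Z a"
    obtain a :: nat where "b \<le> real a" using real_arch_simple by blast
    moreover obtain n where "real a < hat_clock (real (Suc n)) \<omega>" using Z \<omega> by (auto simp: Z_def not_le)
    ultimately show "\<exists>n. b < hat_clock (real (Suc n)) \<omega>" by (intro exI[of _ n]) simp
  qed
qed

end

section \<open>Additive functionals and time change\<close>

text \<open>The pathwise part of the time change: \<open>p\<close> is one path, \<open>w\<close> the
  speed. A path bounded on compact time intervals sees only a compact range of positions, where
  \<open>w\<close> has positive lower and finite upper bounds; so the clock is continuous and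
  strictly increasing.\<close>

locale additive_clock =
  fixes p w :: "real \<Rightarrow> real"
  assumes p_right: "\<And>t. 0 \<le> t \<Longrightarrow> (p \<longlongrightarrow> p t) (at_right t)"
    and p_bdd: "\<And>t. 0 \<le> t \<Longrightarrow> \<exists>B. \<forall>s\<in>{0..t}. \<bar>p s\<bar> \<le> B"
    and w_cont: "continuous_on UNIV w" and w_pos: "\<And>y. 0 < w y"
    and p_meas: "(\<lambda>u. if 0 \<le> u then p u else 0) \<in> borel_measurable borel"
begin

definition clk :: "real \<Rightarrow> ennreal" where
  "clk s = (\<integral>\<^sup>+ u\<in>{0..s}. ennreal (w (p u)) \<partial>lborel)"

definition inv_clk :: "real \<Rightarrow> real" where
  "inv_clk t = Inf {s. s > 0 \<and> clk s > ennreal t}"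

lemma w_measurable [measurable]: "w \<in> borel_measurable borel"
  by (rule borel_measurable_continuous_onI[OF w_cont])

lemma wp_measurable [measurable]: "0 \<le> a \<Longrightarrow> (\<lambda>u. ennreal (w (p u)) * indicator {a<..b} u) \<in> borel_measurable borel"
proof -
  assume a: "0 \<le> a"
  note [measurable] = p_meas
  have "(\<lambda>u. ennreal (w (if 0 \<le> u then p u else 0)) * indicator {a<..b} u) \<in> borel_measurable borel"
    by measurable
  moreover have "ennreal (w (if 0 \<le> u then p u else 0)) * indicator {a<..b} u = ennreal (w (p u)) * indicator {a<..b} u" for u
    using a by (auto simp: indicator_def)
  ultimately show ?thesis by simp
qed

definition incr :: "real \<Rightarrow> real \<Rightarrow> ennreal" where
  "incr a b = (\<integral>\<^sup>+ u. ennreal (w (p u)) * indicator {a<..b} u \<partial>lborel)"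

lemma clk_eq: "clk s = incr 0 s"
proof -
  have "AE u in lborel. ennreal (w (p u)) * indicator {0..s} u = ennreal (w (p u)) * indicator {0<..s} u"
    using AE_lborel_singleton[of 0] by eventually_elim (auto simp: indicator_def)
  then show ?thesis unfolding clk_def incr_def by (rule nn_integral_cong_AE)
qed

lemma incr_add:
  assumes "0 \<le> a" "a \<le> b" "b \<le> c"
  shows "incr a c = incr a b + incr b c"
proof -
  have "incr a c = (\<integral>\<^sup>+ u. ennreal (w (p u)) * indicator {a<..b} u + ennreal (w (p u)) * indicator {b<..c} u \<partial>lborel)"
    unfolding incr_def using assms by (intro nn_integral_cong) (auto simp: indicator_def)
  also have "\<dots> = incr a b + incr b c"
    unfolding incr_def using assms by (intro nn_integral_add) auto
  finally show ?thesis .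
qed

lemma w_bounds:
  assumes "0 \<le> t"
  shows "\<exists>l L. 0 < l \<and> (\<forall>u\<in>{0..t}. l \<le> w (p u) \<and> w (p u) \<le> L)"
proof -
  obtain B where B: "\<And>s. s \<in> {0..t} \<Longrightarrow> \<bar>p s\<bar> \<le> B" using p_bdd[OF assms] by blast
  have B0: "0 \<le> B" using B[of 0] assms by fastforce
  have c: "continuous_on {- B..B} w" using w_cont by (rule continuous_on_subset) auto
  obtain m where m: "m \<in> {-B..B}" "\<And>y. y \<in> {-B..B} \<Longrightarrow> w m \<le> w y"
    using continuous_attains_inf[OF compact_Icc _ c] B0 by force
  obtain k where k: "k \<in> {-B..B}" "\<And>y. y \<in> {-B..B} \<Longrightarrow> w y \<le> w k"
    using continuous_attains_sup[OF compact_Icc _ c] B0 by force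
  have "p u \<in> {- B..B}" if "u \<in> {0..t}" for u using B[OF that] by (auto simp: abs_le_iff)
  then show ?thesis using m(2) k(2) w_pos[of m] by blast
qed

lemma incr_bounds:
  assumes "0 \<le> t"
  shows "\<exists>l L. 0 < l \<and> (\<forall>a b. 0 \<le> a \<longrightarrow> a \<le> b \<longrightarrow> b \<le> t \<longrightarrow>
    ennreal (l * (b - a)) \<le> incr a b \<and> incr a b \<le> ennreal (L * (b - a)))"
proof -
  obtain l L where l: "0 < l" and b: "\<And>u. u \<in> {0..t} \<Longrightarrow> l \<le> w (p u) \<and> w (p u) \<le> L"
    using w_bounds[OF assms] by blast
  have L: "0 \<le> L" using b[of 0] assms l by fastforce
  have "ennreal (l * (b - a)) \<le> incr a b \<and> incr a b \<le> ennreal (L * (b - a))"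
    if "0 \<le> a" "a \<le> b" "b \<le> t" for a b
  proof
    have "ennreal (l * (b - a)) = (\<integral>\<^sup>+ u. ennreal l * indicator {a<..b} u \<partial>lborel)"
      using l that by (simp add: nn_integral_cmult ennreal_mult)
    also have "\<dots> \<le> incr a b"
      unfolding incr_def using that \<open>\<And>u. u \<in> {0..t} \<Longrightarrow> l \<le> w (p u) \<and> w (p u) \<le> L\<close>
      by (intro nn_integral_mono) (auto simp: indicator_def intro!: ennreal_leI)
    finally show "ennreal (l * (b - a)) \<le> incr a b" .
    have "incr a b \<le> (\<integral>\<^sup>+ u. ennreal L * indicator {a<..b} u \<partial>lborel)"
      unfolding incr_def using that \<open>\<And>u. u \<in> {0..t} \<Longrightarrow> l \<le> w (p u) \<and> w (p u) \<le> L\<close>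
      by (intro nn_integral_mono) (auto simp: indicator_def intro!: ennreal_leI)
    also have "\<dots> = ennreal (L * (b - a))"
      using L that by (simp add: nn_integral_cmult ennreal_mult)
    finally show "incr a b \<le> ennreal (L * (b - a))" .
  qed
  then show ?thesis using l by blast
qed

definition rclk :: "real \<Rightarrow> real" where "rclk u = enn2real (clk u)"

lemma clk_rclk: "0 \<le> u \<Longrightarrow> clk u = ennreal (rclk u)"
  unfolding rclk_def clk_eq using incr_bounds[of u]
  by (metis diff_zero ennreal_enn2real ennreal_less_top le_less_trans order_refl)

lemma rclk_nonneg: "0 \<le> rclk u"
  by (simp add: rclk_def)

lemma rclk_0: "rclk 0 = 0"
  by (simp add: rclk_def clk_eq incr_def)

lemma incr_rclk:
  assumes "0 \<le> a" "a \<le> b"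
  shows "incr a b = ennreal (rclk b - rclk a)"
proof -
  have "ennreal (rclk b) = ennreal (rclk a) + incr a b"
    using incr_add[of 0 a b] assms by (simp add: clk_rclk[symmetric] clk_eq)
  then have "ennreal (rclk b) - ennreal (rclk a) = incr a b"
    by (simp add: ennreal_add_diff_cancel_left)
  then show ?thesis by (simp add: ennreal_minus rclk_nonneg)
qed

lemma rclk_strict_mono:
  assumes "0 \<le> a" "a < b"
  shows "rclk a < rclk b"
proof -
  obtain l L where "0 < l" "ennreal (l * (b - a)) \<le> incr a b"
    using incr_bounds[of b] assms by (meson less_imp_le order_refl order_trans)
  moreover have "0 < ennreal (l * (b - a))" using \<open>0 < l\<close> assms by simp
  ultimately have "0 < ennreal (rclk b - rclk a)"
    using assms incr_rclk[of a b] by (metis less_imp_le less_le_trans)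
  then show ?thesis by simp
qed

lemma rclk_mono: "0 \<le> a \<Longrightarrow> a \<le> b \<Longrightarrow> rclk a \<le> rclk b"
  using rclk_strict_mono[of a b] by (cases "a = b") auto

lemma rclk_continuous:
  assumes "0 \<le> t"
  shows "continuous_on {0..t} rclk"
proof -
  obtain l L where b: "\<And>a b. 0 \<le> a \<Longrightarrow> a \<le> b \<Longrightarrow> b \<le> t \<Longrightarrow> incr a b \<le> ennreal (L * (b - a))"
    using incr_bounds[OF assms] by blast
  have lip: "\<bar>rclk b - rclk a\<bar> \<le> \<bar>L\<bar> * \<bar>b - a\<bar>" if "a \<in> {0..t}" "b \<in> {0..t}" "a \<le> b" for a b
  proof -
    have "ennreal (rclk b - rclk a) \<le> ennreal (\<bar>L\<bar> * (b - a))"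
    proof -
      have "ennreal (rclk b - rclk a) \<le> ennreal (L * (b - a))"
        using b[of a b] incr_rclk[of a b] that by simp
      also have "\<dots> \<le> ennreal (\<bar>L\<bar> * (b - a))"
        using that by (intro ennreal_leI mult_right_mono) auto
      finally show ?thesis .
    qed
    then show ?thesis using rclk_mono[of a b] that by (simp add: ennreal_le_iff)
  qed
  have "(\<bar>L\<bar>)-lipschitz_on {0..t} rclk"
  proof (rule lipschitz_onI)
    fix a b assume "a \<in> {0..t}" "b \<in> {0..t}"
    then show "dist (rclk a) (rclk b) \<le> \<bar>L\<bar> * dist a b"
      using lip[of a b] lip[of b a] by (cases "a \<le> b") (auto simp: dist_real_def abs_minus_commute)
  qed simp
  then show ?thesis by (rule lipschitz_on_continuous_on)
qed

text \<open>Strict monotonicity makes the set of times with a larger clock reading the open ray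
  beyond \<open>u\<close>, whose infimum is \<open>u\<close>.\<close>

lemma inv_clk_rclk:
  assumes u: "0 \<le> u"
  shows "inv_clk (rclk u) = u"
proof -
  have "{s. s > 0 \<and> clk s > ennreal (rclk u)} = {u<..}"
  proof (intro set_eqI iffI)
    fix s assume "s \<in> {s. s > 0 \<and> clk s > ennreal (rclk u)}"
    then have "0 < s" "rclk u < rclk s" by (auto simp: clk_rclk ennreal_less_iff rclk_nonneg)
    then show "s \<in> {u<..}" using rclk_mono[of s u] by (cases "s \<le> u") auto
  next
    fix s assume "s \<in> {u<..}"
    then show "s \<in> {s. s > 0 \<and> clk s > ennreal (rclk u)}"
      using u rclk_strict_mono[of u s] by (auto simp: clk_rclk ennreal_less_iff rclk_nonneg)
  qed
  then show ?thesis by (simp add: inv_clk_def)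
qed

lemma inv_clk_nonneg_le:
  assumes "0 < s" "ennreal t < clk s"
  shows "0 \<le> inv_clk t" "inv_clk t \<le> s"
proof -
  show "0 \<le> inv_clk t" unfolding inv_clk_def using assms by (intro cInf_greatest) auto
  show "inv_clk t \<le> s" unfolding inv_clk_def using assms by (intro cInf_lower bdd_belowI[of _ 0]) auto
qed

lemma ex_rclk_eq:
  assumes s: "0 \<le> s" and u: "0 \<le> u" "s \<le> rclk u"
  shows "\<exists>v\<in>{0..u}. rclk v = s"
  using IVT'[of rclk 0 s u] s u rclk_0 rclk_continuous[OF u(1)] by auto

text \<open>The substitution of \<open>rclk u\<close> for \<open>s\<close> is carried out as an
  equality of measures: the image of Lebesgue measure on \<open>{0..<1}\<close> under
  \<open>inv_clk\<close> and the density \<open>w (p u)\<close> on \<open>{0<..T}\<close>, where the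
  clock reads 1 at \<open>T\<close>, agree on all rays.\<close>

theorem time_change_le:
  assumes unb: "0 < u1" "1 < clk u1" and [measurable]: "f \<in> borel_measurable borel"
  shows "(\<integral>\<^sup>+ s. f (p (inv_clk s)) * indicator {0..<1} s \<partial>lborel)
    \<le> (\<integral>\<^sup>+ u. f (p u) * ennreal (w (p u)) * indicator {u. 0 < u \<and> clk u < 1} u \<partial>lborel)"
proof -
  have "1 < rclk u1" using unb ennreal_less_iff[of 1 "rclk u1"] by (simp add: clk_rclk)
  \<comment> \<open>The reading exceeds 1 at \<open>u1\<close>, so the intermediate value theorem
    provides a time at which it equals 1.\<close>
  then obtain T where T: "0 \<le> T" "rclk T = 1"
    using ex_rclk_eq[of 1 u1] unb by auto
  have T0: "0 < T" using T rclk_0 by (cases "T = 0") auto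
  have inv: "\<exists>v. 0 \<le> v \<and> v < T \<and> rclk v = s \<and> inv_clk s = v" if s: "0 \<le> s" "s < 1" for s
  proof -
    obtain v where v: "v \<in> {0..T}" "rclk v = s" using ex_rclk_eq[of s T] s T by auto
    then have "v \<noteq> T" using T s by auto
    then show ?thesis using v inv_clk_rclk[of v] by (intro exI[of _ v]) auto
  qed
  have inv_mono: "mono_on {0..<1} inv_clk"
  proof (rule mono_onI)
    fix r s :: real assume rs: "r \<in> {0..<1}" "s \<in> {0..<1}" "r \<le> s"
    obtain a where a: "0 \<le> a" "rclk a = r" "inv_clk r = a" using inv[of r] rs by auto
    obtain b where b: "0 \<le> b" "rclk b = s" "inv_clk s = b" using inv[of s] rs by auto
    show "inv_clk r \<le> inv_clk s"
      using rclk_strict_mono[of b a] a b rs by (cases "a \<le> b") auto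
  qed
  have inv_meas[measurable]: "inv_clk \<in> borel_measurable (restrict_space lborel {0..<1})"
    using borel_measurable_mono_on_fnc[OF inv_mono] by (simp add: measurable_def space_restrict_space sets_restrict_space)
  define M1 where "M1 = distr (restrict_space lborel {0..<1}) borel inv_clk"
  define M2 where "M2 = density lborel (\<lambda>u. ennreal (w (p u)) * indicator {0<..T} u)"
  have wm: "(\<lambda>u. ennreal (w (p u)) * indicator {0<..T} u) \<in> borel_measurable borel" by (rule wp_measurable) simp
  have "M1 = M2"
  proof (rule measure_eqI_lessThan)
    show "sets M1 = sets borel" "sets M2 = sets borel" by (simp_all add: M1_def M2_def)
    have M2: "emeasure M2 {x<..} = incr (max 0 x) T" for x
    proof -
      have "emeasure M2 {x<..} = (\<integral>\<^sup>+ u. ennreal (w (p u)) * indicator {0<..T} u * indicator {x<..} u \<partial>lborel)"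
        unfolding M2_def using wm by (subst emeasure_density) auto
      also have "\<dots> = incr (max 0 x) T"
        unfolding incr_def by (intro nn_integral_cong) (auto simp: indicator_def)
      finally show ?thesis .
    qed
    have M1: "emeasure M1 {x<..} = emeasure lborel {s \<in> {0..<1}. x < inv_clk s}" for x
    proof -
      have "emeasure M1 {x<..} = emeasure (restrict_space lborel {0..<1}) (inv_clk -` {x<..} \<inter> space (restrict_space lborel {0..<1}))"
        unfolding M1_def by (rule emeasure_distr) auto
      also have "inv_clk -` {x<..} \<inter> space (restrict_space lborel {0..<1}) = {s \<in> {0..<1}. x < inv_clk s}"
        by (auto simp: space_restrict_space)
      also have "emeasure (restrict_space lborel {0..<1}) \<dots> = emeasure lborel \<dots>"
        by (rule emeasure_restrict_space) auto
      finally show ?thesis .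
    qed
    have eq: "emeasure lborel {s \<in> {0..<1}. x < inv_clk s} = incr (max 0 x) T" for x
    proof (cases "x < 0")
      case True
      have S: "{s \<in> {0..<1}. x < inv_clk s} = {0..<1}" using True inv by force
      show ?thesis unfolding S using True T incr_rclk[of 0 T] rclk_0 by (simp add: max_def)
    next
      case False
      then have x: "0 \<le> x" by simp
      have "{s \<in> {0..<1}. x < inv_clk s} = {rclk x<..<1}"
      proof (intro set_eqI iffI)
        fix s assume s: "s \<in> {s \<in> {0..<1}. x < inv_clk s}"
        then obtain v where v: "0 \<le> v" "rclk v = s" "inv_clk s = v" using inv[of s] by auto
        then show "s \<in> {rclk x<..<1}" using s x rclk_strict_mono[of x v] by auto
      next
        fix s assume s: "s \<in> {rclk x<..<1}"
        then have s': "0 \<le> s" "s < 1" using rclk_nonneg[of x] by auto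
        then obtain v where v: "0 \<le> v" "rclk v = s" "inv_clk s = v" using inv[of s] by auto
        then have "x < v" using s rclk_mono[of v x] by (cases "v \<le> x") auto
        then show "s \<in> {s \<in> {0..<1}. x < inv_clk s}" using s' v by auto
      qed
      moreover have "emeasure lborel {rclk x<..<1} = incr x T"
      proof (cases "x \<le> T")
        case True
        then show ?thesis using x incr_rclk[of x T] rclk_mono[of x T] T by simp
      next
        case False
        then have "1 \<le> rclk x" using rclk_mono[of T x] T by simp
        moreover have "incr x T = 0" unfolding incr_def using False by (simp add: indicator_def)
        ultimately show ?thesis by simp
      qed
      ultimately show ?thesis using x by simp
    qed
    show "emeasure M1 {x<..} = emeasure M2 {x<..}" for x by (simp only: M1 M2 eq)
    show "emeasure M1 {x<..} < \<infinity>" for x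
      unfolding M1 eq using incr_rclk[of "max 0 x" T] T(1)
      by (cases "max 0 x \<le> T") (auto simp: incr_def indicator_def)
  qed
  define P where "P u = (if 0 \<le> u then p u else 0)" for u
  have [measurable]: "P \<in> borel_measurable borel" unfolding P_def by (rule p_meas)
  have "(\<integral>\<^sup>+ s. f (p (inv_clk s)) * indicator {0..<1} s \<partial>lborel)
      = (\<integral>\<^sup>+ s. f (P (inv_clk s)) * indicator {0..<1} s \<partial>lborel)"
    using inv by (intro nn_integral_cong) (force simp: indicator_def P_def)
  also have "\<dots> = (\<integral>\<^sup>+ s. f (P (inv_clk s)) \<partial>restrict_space lborel {0..<1})"
    by (subst nn_integral_restrict_space) auto
  also have "\<dots> = (\<integral>\<^sup>+ u. f (P u) \<partial>M1)"
    unfolding M1_def by (subst nn_integral_distr) auto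
  also have "\<dots> = (\<integral>\<^sup>+ u. ennreal (w (p u)) * indicator {0<..T} u * f (P u) \<partial>lborel)"
    unfolding \<open>M1 = M2\<close> M2_def using wm by (subst nn_integral_density) auto
  also have "\<dots> \<le> (\<integral>\<^sup>+ u. f (p u) * ennreal (w (p u)) * indicator {u. 0 < u \<and> clk u < 1} u \<partial>lborel)"
  proof (rule nn_integral_mono_AE)
    show "AE u in lborel. ennreal (w (p u)) * indicator {0<..T} u * f (P u)
        \<le> f (p u) * ennreal (w (p u)) * indicator {u. 0 < u \<and> clk u < 1} u"
      using AE_lborel_singleton[of T]
    proof eventually_elim
      case (elim u)
      show ?case
      proof (cases "u \<in> {0<..T}")
        case True
        then have "rclk u < 1" using elim T rclk_strict_mono[of u T] by auto
        then have "clk u < 1" using True by (simp add: clk_rclk rclk_nonneg ennreal_less_one_iff)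
        then show ?thesis using True by (simp add: P_def mult_ac)
      qed simp
    qed
  qed
  finally show ?thesis .
qed

end

section \<open>Time spent far out by the time-changed path\<close>

lemma cadlag_bounded:
  assumes "cadlag p" "0 \<le> t"
  shows "\<exists>B. \<forall>s\<in>{0..t}. \<bar>p s\<bar> \<le> B"
proof -
  have loc: "\<exists>U. open U \<and> s \<in> U \<and> (\<exists>B. \<forall>u\<in>U \<inter> {0..t}. \<bar>p u\<bar> \<le> B)" if s: "s \<in> {0..t}" for s
  proof -
    have "(p \<longlongrightarrow> p s) (at_right s)" using assms(1) s by (auto simp: cadlag_def continuous_within)
    then have "\<forall>\<^sub>F u in at_right s. dist (p u) (p s) < 1" by (rule tendstoD) simp
    then obtain b where b: "s < b" "\<And>u. s < u \<Longrightarrow> u < b \<Longrightarrow> dist (p u) (p s) < 1"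
      unfolding eventually_at_right_field by blast
    obtain a L where a: "a < s" "\<And>u. a < u \<Longrightarrow> u < s \<Longrightarrow> 0 \<le> u \<Longrightarrow> \<bar>p u\<bar> \<le> L"
    proof (cases "s = 0")
      case True
      then show ?thesis by (intro that[of "-1" 0]) auto
    next
      case False
      then have "0 < s" using s by simp
      then obtain l where "(p \<longlongrightarrow> l) (at_left s)" using assms(1) unfolding cadlag_def by blast
      then have "\<forall>\<^sub>F u in at_left s. dist (p u) l < 1" by (rule tendstoD) simp
      then obtain a where "a < s" "\<And>u. a < u \<Longrightarrow> u < s \<Longrightarrow> dist (p u) l < 1"
        unfolding eventually_at_left_field by blast
      then show ?thesis by (intro that[of a "\<bar>l\<bar> + 1"]) (auto simp: dist_real_def intro!: less_imp_le, fastforce)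
    qed
    have bd: "\<bar>p u\<bar> \<le> max (\<bar>p s\<bar> + 1) L" if "u \<in> {a<..<b} \<inter> {0..t}" for u
    proof (cases u s rule: linorder_cases)
      case less then show ?thesis using a(2)[of u] that by auto
    next
      case equal then show ?thesis by auto
    next
      case greater then show ?thesis using b(2)[of u] that by (auto simp: dist_real_def)
    qed
    show ?thesis using a(1) b(1)
      by (intro exI[of _ "{a<..<b}"] conjI exI[of _ "max (\<bar>p s\<bar> + 1) L"] ballI bd) auto
  qed
  then obtain U where U: "\<And>s. s \<in> {0..t} \<Longrightarrow> open (U s) \<and> s \<in> U s \<and> (\<exists>B. \<forall>u\<in>U s \<inter> {0..t}. \<bar>p u\<bar> \<le> B)"
    by metis
  obtain D where D: "D \<subseteq> {0..t}" "finite D" "{0..t} \<subseteq> (\<Union>s\<in>D. U s)"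
    using compactE_image[OF compact_Icc[of 0 t], of "{0..t}" U] U by (metis UN_I subsetI)
  obtain B where B: "\<And>s u. s \<in> {0..t} \<Longrightarrow> u \<in> U s \<inter> {0..t} \<Longrightarrow> \<bar>p u\<bar> \<le> B s" using U by metis
  have "\<bar>p u\<bar> \<le> Max (B ` D)" if u: "u \<in> {0..t}" for u
  proof -
    obtain s where s: "s \<in> D" "u \<in> U s" using D u by auto
    then have "\<bar>p u\<bar> \<le> B s" using B[of s u] D u by auto
    also have "\<dots> \<le> Max (B ` D)" using s D by (intro Max_ge) auto
    finally show ?thesis .
  qed
  then show ?thesis by blast
qed

lemma uniformly_continuous_compact_support:
  fixes f :: "real \<Rightarrow> real"
  assumes c: "continuous_on UNIV f" and z: "\<And>y. n \<le> \<bar>y\<bar> \<Longrightarrow> f y = 0"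
  shows "uniformly_continuous_on UNIV f"
proof -
  let ?S = "{- \<bar>n\<bar> - 1..\<bar>n\<bar> + 1}"
  have uc: "uniformly_continuous_on ?S f"
    using c by (intro compact_uniformly_continuous continuous_on_subset[OF c]) auto
  show ?thesis
    unfolding uniformly_continuous_on_def
  proof (intro allI impI)
    fix e :: real assume e: "0 < e"
    then obtain d where d: "d > 0" "\<And>y z. y \<in> ?S \<Longrightarrow> z \<in> ?S \<Longrightarrow> dist z y < d \<Longrightarrow> dist (f z) (f y) < e"
      using uc unfolding uniformly_continuous_on_def by metis
    have "dist (f v) (f u) < e" if "dist v u < min d 1" for u v
    proof (cases "\<bar>u\<bar> < \<bar>n\<bar> \<or> \<bar>v\<bar> < \<bar>n\<bar>")
      case True
      then have "u \<in> ?S" "v \<in> ?S" using that by (auto simp: dist_real_def)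
      then show ?thesis using d(2) that by auto
    next
      case False
      then show ?thesis using z[of u] z[of v] e by auto
    qed
    then show "\<exists>d>0. \<forall>x\<in>UNIV. \<forall>x'\<in>UNIV. dist x' x < d \<longrightarrow> dist (f x') (f x) < e"
      using d(1) by (intro exI[of _ "min d 1"]) auto
  qed
qed

text \<open>The link between the two clocks is \<open>2 * \<gamma> * hat \<le> w\<close>: the weight
  exponent never exceeds the reading of the clock of \<open>w\<close>, and divergence of the tent
  clock carries over to that clock.\<close>

locale clocked_path = stable_path \<alpha> N M X x
  for \<alpha> :: real and N :: "real \<Rightarrow> real measure" and M :: "'w measure" and X x +
  fixes w :: "real \<Rightarrow> real" and \<gamma> :: real
  assumes w_cont: "continuous_on UNIV w" and w_pos: "\<And>y. 0 < w y"
    and X_bdd: "\<And>\<omega> t. \<omega> \<in> space M \<Longrightarrow> 0 \<le> t \<Longrightarrow> \<exists>B. \<forall>s\<in>{0..t}. \<bar>X s \<omega>\<bar> \<le> B"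
    and \<gamma>_pos: "0 < \<gamma>" and hat_le_w: "\<And>y. 2 * \<gamma> * hat y \<le> w y"
begin

lemma clock_path: "\<omega> \<in> space M \<Longrightarrow> additive_clock (\<lambda>u. X u \<omega>) w"
  using X_right X_bdd w_cont w_pos right_continuous_measurable[of "\<lambda>u. X u \<omega>"]
  by unfold_locales auto

abbreviation "clkX u \<omega> \<equiv> additive_clock.clk (\<lambda>u. X u \<omega>) w u"
abbreviation "invX s \<omega> \<equiv> additive_clock.inv_clk (\<lambda>u. X u \<omega>) w s"

lemma w_measurable [measurable]: "w \<in> borel_measurable borel"
  by (rule borel_measurable_continuous_onI[OF w_cont])

lemma clkX_eq: "\<omega> \<in> space M \<Longrightarrow> clkX u \<omega> = (\<integral>\<^sup>+ s. ennreal (w (Xp s \<omega>)) * indicator {0<..u} s \<partial>lborel)"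
  using additive_clock.clk_eq[OF clock_path, of \<omega> u]
  by (simp add: additive_clock.incr_def[OF clock_path] Xp_indicator[of "\<lambda>y. ennreal (w y)"])

lemma hat_clock_le_clkX:
  assumes "\<omega> \<in> space M"
  shows "ennreal (2 * \<gamma> * hat_clock u \<omega>) \<le> clkX u \<omega>"
proof -
  note [measurable] = measurable_compose[OF measurable_Pair2'[OF assms] Xp_measurable, simplified]
  have "ennreal (2 * \<gamma> * hat_clock u \<omega>) = ennreal (2 * \<gamma>) * (\<integral>\<^sup>+ s. ennreal (hat (Xp s \<omega>)) * indicator {0<..u} s \<partial>lborel)"
    using \<gamma>_pos by (simp add: ennreal_mult hat_clock_nonneg hat_clock_ennreal Xp_indicator[of "\<lambda>y. ennreal (hat y)"])
  also have "\<dots> = (\<integral>\<^sup>+ s. ennreal (2 * \<gamma> * hat (Xp s \<omega>)) * indicator {0<..u} s \<partial>lborel)"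
    using \<gamma>_pos by (subst nn_integral_cmult[symmetric]) (auto simp: ennreal_mult hat_nonneg mult.assoc)
  also have "\<dots> \<le> clkX u \<omega>"
    unfolding clkX_eq[OF assms] by (intro nn_integral_mono mult_right_mono ennreal_leI hat_le_w) auto
  finally show ?thesis .
qed

definition clock_passes_one :: "'w set" where
  "clock_passes_one = {\<omega> \<in> space M. \<exists>n. 1 < clkX (real (Suc n)) \<omega>}"

lemma clkX_measurable [measurable]:
  "(\<lambda>z. \<integral>\<^sup>+ s. ennreal (w (Xp s (snd z))) * indicator {0<..fst z} s \<partial>lborel) \<in> borel_measurable (borel \<Otimes>\<^sub>M M)"
proof -
  have [measurable]: "(\<lambda>z. Xp (snd z) (snd (fst z))) \<in> borel_measurable ((borel \<Otimes>\<^sub>M M) \<Otimes>\<^sub>M borel)"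
    using measurable_compose[OF _ Xp_measurable, of "\<lambda>w. (snd w, snd (fst w))" "(borel \<Otimes>\<^sub>M M) \<Otimes>\<^sub>M borel"] by simp
  have [measurable]: "Measurable.pred ((borel \<Otimes>\<^sub>M M) \<Otimes>\<^sub>M borel) (\<lambda>w :: (real \<times> 'w) \<times> real. snd w \<in> {0<..fst (fst w)})"
    unfolding greaterThanAtMost_iff by measurable
  show ?thesis by measurable
qed

lemma clkX_meas1: "(\<lambda>\<omega>. clkX u \<omega>) \<in> borel_measurable M"
  using measurable_compose[OF measurable_Pair1' clkX_measurable, of u]
  by (subst measurable_cong[OF clkX_eq]) simp_all

lemma clock_passes_one_measurable [measurable]: "clock_passes_one \<in> sets M"
  unfolding clock_passes_one_def using clkX_meas1 by measurable

lemma clock_passes_oneD: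
  assumes "\<omega> \<in> clock_passes_one"
  shows "\<omega> \<in> space M" "\<exists>n. 1 < clkX (real (Suc n)) \<omega>"
  using assms unfolding clock_passes_one_def by blast+

lemma AE_clock_passes_one: "AE \<omega> in M. \<omega> \<in> clock_passes_one"
  using hat_clock_unbounded AE_space
proof eventually_elim
  case (elim \<omega>)
  obtain n where "1 / (2 * \<gamma>) < hat_clock (real (Suc n)) \<omega>" using elim by blast
  then have "1 < 2 * \<gamma> * hat_clock (real (Suc n)) \<omega>" using \<gamma>_pos by (simp add: field_simps)
  then have "1 < ennreal (2 * \<gamma> * hat_clock (real (Suc n)) \<omega>)"
    by (simp add: ennreal_less_iff flip: ennreal_1)
  then have "1 < clkX (real (Suc n)) \<omega>"
    using hat_clock_le_clkX[OF elim(2), of "real (Suc n)"] by (rule less_le_trans)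
  then show ?case unfolding clock_passes_one_def using elim(2) by blast
qed

text \<open>The inverse clock is kept where the infimum is over a nonempty set; the default 0
  outside makes it jointly measurable in time and path.\<close>

definition inv_before_one :: "real \<Rightarrow> 'w \<Rightarrow> real" where
  "inv_before_one s \<omega> = (if 0 \<le> s \<and> s < 1 \<and> \<omega> \<in> clock_passes_one then invX s \<omega> else 0)"

text \<open>The inverse clock at \<open>s\<close> is below \<open>v\<close> exactly when the clock
  has passed \<open>s\<close> at some positive rational time before \<open>v\<close>, a countable
  condition.\<close>

lemma inv_before_one_measurable [measurable]: "(\<lambda>z. inv_before_one (fst z) (snd z)) \<in> borel_measurable (borel \<Otimes>\<^sub>M M)"
proof (rule borel_measurableI_less)
  fix v :: real
  let ?c = "\<lambda>q z. \<integral>\<^sup>+ s. ennreal (w (Xp s (snd z))) * indicator {0<..q} s \<partial>lborel"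
  have [measurable]: "?c q \<in> borel_measurable (borel \<Otimes>\<^sub>M M)" for q
    using measurable_compose[OF measurable_Pair clkX_measurable, of "\<lambda>_. q" "borel \<Otimes>\<^sub>M M" snd] by simp
  have eq: "inv_before_one s \<omega> < v \<longleftrightarrow> (if 0 \<le> s \<and> s < 1 \<and> \<omega> \<in> clock_passes_one
      then \<exists>q\<in>\<rat>. 0 < q \<and> q < v \<and> ennreal s < ?c q (s, \<omega>) else 0 < v)" if \<omega>: "\<omega> \<in> space M" for s \<omega>
  proof (cases "0 \<le> s \<and> s < 1 \<and> \<omega> \<in> clock_passes_one")
    case True
    interpret C: additive_clock "\<lambda>u. X u \<omega>" w by (rule clock_path[OF \<omega>])
    obtain n where n: "1 < C.clk (real (Suc n))" using clock_passes_oneD(2)[of \<omega>] True by blast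
    have "C.inv_clk s < v \<longleftrightarrow> (\<exists>q\<in>\<rat>. 0 < q \<and> q < v \<and> ennreal s < C.clk q)"
    proof
      have "ennreal s < 1" using True by (simp add: ennreal_less_one_iff)
      then have "real (Suc n) \<in> {u. u > 0 \<and> C.clk u > ennreal s}" using less_trans[OF _ n] by simp
      then have ne: "{u. u > 0 \<and> C.clk u > ennreal s} \<noteq> {}" by blast
      assume "C.inv_clk s < v"
      then obtain u where u: "u > 0" "C.clk u > ennreal s" "u < v"
        using cInf_less_iff[OF ne bdd_belowI[of _ 0], of v] by (auto simp: C.inv_clk_def)
      obtain q where q: "q \<in> \<rat>" "u < q" "q < v" using Rats_dense_in_real[OF u(3)] by blast
      have "C.clk u \<le> C.clk q"
        using C.rclk_mono[of u q] u q by (simp add: C.clk_rclk ennreal_leI)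
      then show "\<exists>q\<in>\<rat>. 0 < q \<and> q < v \<and> ennreal s < C.clk q"
        using u q by (intro bexI[of _ q]) auto
    next
      assume "\<exists>q\<in>\<rat>. 0 < q \<and> q < v \<and> ennreal s < C.clk q"
      then show "C.inv_clk s < v" using C.inv_clk_nonneg_le(2) by (meson le_less_trans)
    qed
    then show ?thesis using True by (simp add: inv_before_one_def clkX_eq[OF \<omega>])
  qed (auto simp: inv_before_one_def)
  have "{z \<in> space (borel \<Otimes>\<^sub>M M). inv_before_one (fst z) (snd z) < v}
      = {z \<in> space (borel \<Otimes>\<^sub>M M). if 0 \<le> fst z \<and> fst z < 1 \<and> snd z \<in> clock_passes_one
          then \<exists>q\<in>\<rat>. 0 < q \<and> q < v \<and> ennreal (fst z) < ?c q z else 0 < v}"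
  proof (intro Collect_cong conj_cong refl)
    fix z :: "real \<times> 'w" assume "z \<in> space (borel \<Otimes>\<^sub>M M)"
    then have "snd z \<in> space M" by (auto simp: space_pair_measure)
    from eq[OF this, of "fst z"]
    show "inv_before_one (fst z) (snd z) < v \<longleftrightarrow> (if 0 \<le> fst z \<and> fst z < 1 \<and> snd z \<in> clock_passes_one
          then \<exists>q\<in>\<rat>. 0 < q \<and> q < v \<and> ennreal (fst z) < ?c q z else 0 < v)" by simp
  qed
  also have "\<dots> \<in> sets (borel \<Otimes>\<^sub>M M)"
    using countable_rat by measurable
  finally show "{z \<in> space (borel \<Otimes>\<^sub>M M). inv_before_one (fst z) (snd z) < v} \<in> sets (borel \<Otimes>\<^sub>M M)" .
qed

text \<open>\<open>occupation_bound\<close> takes bounded uniformly continuous functions, so the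
  speed is multiplied by a ramp that rises between \<open>r\<close> and \<open>r + 1\<close> and by
  one that falls to 0 between \<open>n - 1\<close> and \<open>n\<close>. The first ramp explains
  \<open>r + 1\<close> on the left and \<open>r\<close> on the right; Fatou removes the outer cutoff
  and the time horizon \<open>n\<close> together.\<close>

lemma occupation_tail:
  assumes fin: "weight (\<lambda>y. ennreal (w y)) < \<infinity>"
  shows "(\<integral>\<^sup>+ \<omega>. \<integral>\<^sup>+ u. ennreal (exp (- 2 * \<gamma> * hat_clock u \<omega>) * w (X u \<omega>)) * indicator {y. r + 1 < \<bar>y\<bar>} (X u \<omega>) * indicator {0<..} u \<partial>lborel \<partial>M)
    \<le> ennreal ((2 + pot_const / \<gamma>) / pot_const) * weight (\<lambda>y. ennreal (w y) * indicator {y. r < \<bar>y\<bar>} y)"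
proof -
  let ?W = "weight (\<lambda>y. ennreal (w y) * indicator {y. r < \<bar>y\<bar>} y)"
  let ?K = "ennreal ((2 + pot_const / \<gamma>) / pot_const)"
  define f where "f n y = w y * (min 1 (max 0 (\<bar>y\<bar> - r)) * min 1 (max 0 (real n - \<bar>y\<bar>)))" for n y
  have f_cont: "continuous_on UNIV (f n)" for n
    unfolding f_def using w_cont by (intro continuous_intros) auto
  have f0: "0 \<le> f n y" for n y using w_pos[of y] by (simp add: f_def)
  have f_supp: "f n y = 0" if "real n \<le> \<bar>y\<bar>" for n y using that by (simp add: f_def)
  have uc: "uniformly_continuous_on UNIV (f n)" for n
    by (rule uniformly_continuous_compact_support[OF f_cont f_supp])
  have "\<exists>C. \<forall>y. f n y \<le> C" for n
  proof -
    obtain k where k: "\<And>y. y \<in> {- real n..real n} \<Longrightarrow> f n y \<le> f n k"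
      using continuous_attains_sup[OF compact_Icc, of "- real n" "real n" "f n"] continuous_on_subset[OF f_cont, of "{- real n..real n}"]
      by force
    have "f n y \<le> f n k" for y
    proof (cases "real n \<le> \<bar>y\<bar>")
      case False
      then have "y \<in> {- real n..real n}" by auto
      then show ?thesis by (rule k)
    qed (use f_supp[of n y] f0[of n k] in simp)
    then show ?thesis by blast
  qed
  then obtain C where C: "\<And>n y. f n y \<le> C n" by metis
  have f_le: "ennreal (f n y) \<le> ennreal (w y) * indicator {y. r < \<bar>y\<bar>} y" for n y
  proof (cases "r < \<bar>y\<bar>")
    case True
    have "f n y \<le> w y * (1 * 1)" unfolding f_def using w_pos[of y] by (intro mult_left_mono mult_mono) auto
    then show ?thesis using True by (simp add: ennreal_leI)
  qed (simp add: f_def)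
  have f_weight: "weight (\<lambda>y. ennreal (f n y)) \<le> ?W" for n
    unfolding weight_def by (intro nn_integral_mono mult_right_mono f_le) auto
  have "?W \<le> weight (\<lambda>y. ennreal (w y))"
    unfolding weight_def by (intro nn_integral_mono mult_right_mono) (auto simp: indicator_def)
  then have f_fin: "weight (\<lambda>y. ennreal (f n y)) < \<infinity>" for n
    using f_weight[of n] fin by (meson le_less_trans)
  have [measurable]: "f n \<in> borel_measurable borel" for n by (rule borel_measurable_continuous_onI[OF f_cont])
  define g where "g n z = ennreal (exp (- 2 * \<gamma> * hat_clock (snd z) (fst z)) * f n (Xp (snd z) (fst z))) * indicator {0<..real n} (snd z)" for n z
  have [measurable]: "(\<lambda>z. Xp (snd z) (fst z)) \<in> borel_measurable (M \<Otimes>\<^sub>M lborel)"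
    using measurable_compose[OF measurable_pair_swap' Xp_measurable] by (simp add: case_prod_beta')
  have [measurable]: "(\<lambda>z. hat_clock (snd z) (fst z)) \<in> borel_measurable (M \<Otimes>\<^sub>M lborel)"
    using measurable_compose[OF measurable_pair_swap' hat_clock_measurable] by (simp add: case_prod_beta')
  have gm[measurable]: "g n \<in> borel_measurable (M \<Otimes>\<^sub>M lborel)" for n unfolding g_def[abs_def] by measurable
  have g_int: "(\<integral>\<^sup>+ z. g n z \<partial>(M \<Otimes>\<^sub>M lborel)) \<le> ?K * ?W" if n: "0 < n" for n
  proof -
    have "(\<integral>\<^sup>+ z. g n z \<partial>(M \<Otimes>\<^sub>M lborel)) = (\<integral>\<^sup>+ \<omega>. \<integral>\<^sup>+ u. g n (\<omega>, u) \<partial>lborel \<partial>M)"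
      by (rule lborel.nn_integral_fst[symmetric]) (rule gm)
    also have "\<dots> = (\<integral>\<^sup>+ \<omega>. \<integral>\<^sup>+ u. ennreal (exp (- 2 * \<gamma> * hat_clock u \<omega>) * f n (X u \<omega>)) * indicator {0<..real n} u \<partial>lborel \<partial>M)"
      unfolding g_def by (intro nn_integral_cong) (auto simp: Xp_def indicator_def)
    finally have eq: "(\<integral>\<^sup>+ z. g n z \<partial>(M \<Otimes>\<^sub>M lborel)) = \<dots>" .
    have "ennreal pot_const * (\<integral>\<^sup>+ z. g n z \<partial>(M \<Otimes>\<^sub>M lborel)) \<le> ennreal (2 + pot_const / \<gamma>) * weight (\<lambda>y. ennreal (f n y))"
      unfolding eq using n by (intro occupation_bound[OF uc f0 C f_fin \<gamma>_pos]) simp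
    also have "\<dots> \<le> ennreal (2 + pot_const / \<gamma>) * ?W" by (intro mult_left_mono f_weight) simp
    finally have "ennreal (1 / pot_const) * (ennreal pot_const * (\<integral>\<^sup>+ z. g n z \<partial>(M \<Otimes>\<^sub>M lborel)))
        \<le> ennreal (1 / pot_const) * (ennreal (2 + pot_const / \<gamma>) * ?W)" by (rule mult_left_mono) simp
    moreover have "ennreal (1 / pot_const) * ennreal pot_const = 1"
      using pot_const_pos by (simp add: ennreal_mult[symmetric])
    moreover have "ennreal (1 / pot_const) * ennreal (2 + pot_const / \<gamma>) = ?K"
      using pot_const_pos \<gamma>_pos by (subst ennreal_mult[symmetric]) auto
    ultimately show ?thesis by (simp add: mult.assoc[symmetric])
  qed
  have "(\<integral>\<^sup>+ \<omega>. \<integral>\<^sup>+ u. ennreal (exp (- 2 * \<gamma> * hat_clock u \<omega>) * w (X u \<omega>)) * indicator {y. r + 1 < \<bar>y\<bar>} (X u \<omega>) * indicator {0<..} u \<partial>lborel \<partial>M)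
      \<le> (\<integral>\<^sup>+ \<omega>. \<integral>\<^sup>+ u. liminf (\<lambda>n. g n (\<omega>, u)) \<partial>lborel \<partial>M)"
  proof (intro nn_integral_mono)
    fix \<omega> u
    show "ennreal (exp (- 2 * \<gamma> * hat_clock u \<omega>) * w (X u \<omega>)) * indicator {y. r + 1 < \<bar>y\<bar>} (X u \<omega>) * indicator {0<..} u
        \<le> liminf (\<lambda>n. g n (\<omega>, u))"
    proof (cases "r + 1 < \<bar>X u \<omega>\<bar> \<and> 0 < u")
      case True
      obtain m :: nat where m: "max u (\<bar>X u \<omega>\<bar> + 1) \<le> real m" using real_arch_simple by blast
      have "\<forall>\<^sub>F n in sequentially. ennreal (exp (- 2 * \<gamma> * hat_clock u \<omega>) * w (X u \<omega>)) \<le> g n (\<omega>, u)"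
        using eventually_ge_at_top[of m]
      proof eventually_elim
        case (elim n)
        then have "max u (\<bar>X u \<omega>\<bar> + 1) \<le> real n" using m by (meson of_nat_le_iff order_trans)
        then have "u \<le> real n" "1 \<le> real n - \<bar>X u \<omega>\<bar>" by auto
        then have "f n (X u \<omega>) = w (X u \<omega>)" using True by (simp add: f_def)
        then show ?case using True \<open>u \<le> real n\<close> by (simp add: g_def Xp_def)
      qed
      then have "ennreal (exp (- 2 * \<gamma> * hat_clock u \<omega>) * w (X u \<omega>)) \<le> liminf (\<lambda>n. g n (\<omega>, u))"
        by (intro Liminf_bounded)
      then show ?thesis using True by simp
    qed auto
  qed
  also have "\<dots> = (\<integral>\<^sup>+ z. liminf (\<lambda>n. g n z) \<partial>(M \<Otimes>\<^sub>M lborel))"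
    by (rule lborel.nn_integral_fst) measurable
  also have "\<dots> \<le> liminf (\<lambda>n. \<integral>\<^sup>+ z. g n z \<partial>(M \<Otimes>\<^sub>M lborel))"
    by (rule nn_integral_liminf) measurable
  also have "\<dots> \<le> liminf (\<lambda>n::nat. ?K * ?W)"
    by (rule Liminf_mono, rule eventually_mono[OF eventually_gt_at_top[of 0]], rule g_int)
  also have "\<dots> = ?K * ?W" by (simp add: Liminf_const)
  finally show ?thesis .
qed

text \<open>The expected time that the changed path spends beyond \<open>r + 1\<close> during
  \<open>{0..<1}\<close> is turned into an occupation integral of \<open>X\<close> by the time
  change and bounded by \<open>occupation_tail\<close>. The conclusion names a measurable
  exceptional event, ready for an outer measure estimate.\<close>

theorem short_time_tail:
  assumes fin: "weight (\<lambda>y. ennreal (w y)) < \<infinity>"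
    and small: "ennreal (exp 1 * ((2 + pot_const / \<gamma>) / pot_const)) * weight (\<lambda>y. ennreal (w y) * indicator {y. r < \<bar>y\<bar>} y) < \<epsilon>"
  shows "\<exists>s. 0 < s \<and> s < 1 \<and> (\<exists>A\<in>sets M. emeasure M A \<le> \<epsilon> \<and>
    (AE \<omega> in M. \<omega> \<notin> A \<longrightarrow> 0 \<le> invX s \<omega> \<and> \<bar>X (invX s \<omega>) \<omega>\<bar> \<le> r + 1))"
proof -
  define \<Phi> where "\<Phi> s \<omega> = (indicator {y. r + 1 < \<bar>y\<bar>} (Xp (inv_before_one s \<omega>) \<omega>) * indicator clock_passes_one \<omega> * indicator {0..<1} s :: ennreal)" for s \<omega>
  have XJ[measurable]: "(\<lambda>z. Xp (inv_before_one (fst z) (snd z)) (snd z)) \<in> borel_measurable (borel \<Otimes>\<^sub>M M)"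
    using measurable_compose[OF measurable_Pair[OF inv_before_one_measurable measurable_snd] Xp_measurable] by simp
  have \<Phi>_meas: "(\<lambda>z. \<Phi> (fst z) (snd z)) \<in> borel_measurable (borel \<Otimes>\<^sub>M M)"
    unfolding \<Phi>_def by measurable
  have inv_nonneg: "0 \<le> invX s \<omega>" if g: "\<omega> \<in> clock_passes_one" and s: "0 \<le> s" "s < 1" for s \<omega>
  proof -
    interpret C: additive_clock "\<lambda>u. X u \<omega>" w by (rule clock_path[OF clock_passes_oneD(1)[OF g]])
    obtain n where n: "1 < C.clk (real (Suc n))" using clock_passes_oneD(2)[OF g] by blast
    have "ennreal s < 1" using s by (simp add: ennreal_less_one_iff)
    then have "ennreal s < C.clk (real (Suc n))" using n by (rule less_trans)
    then show ?thesis by (intro C.inv_clk_nonneg_le(1)[of "real (Suc n)"]) auto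
  qed
  have \<Phi>_good: "\<Phi> s \<omega> = indicator {y. r + 1 < \<bar>y\<bar>} (X (invX s \<omega>) \<omega>) * indicator {0..<1} s"
    if g: "\<omega> \<in> clock_passes_one" for s \<omega>
    using g inv_nonneg[OF g, of s] by (auto simp: \<Phi>_def inv_before_one_def Xp_def indicator_def)
  have inner: "(\<integral>\<^sup>+ s. \<Phi> s \<omega> \<partial>lborel)
      \<le> ennreal (exp 1) * (\<integral>\<^sup>+ u. ennreal (exp (- 2 * \<gamma> * hat_clock u \<omega>) * w (X u \<omega>)) * indicator {y. r + 1 < \<bar>y\<bar>} (X u \<omega>) * indicator {0<..} u \<partial>lborel)"
    if \<omega>: "\<omega> \<in> space M" for \<omega>
  proof (cases "\<omega> \<in> clock_passes_one")
    case True
    interpret C: additive_clock "\<lambda>u. X u \<omega>" w by (rule clock_path[OF \<omega>])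
    obtain n where n: "1 < C.clk (real (Suc n))" using clock_passes_oneD(2)[OF True] by blast
    have [measurable]: "(\<lambda>u. Xp u \<omega>) \<in> borel_measurable borel"
      using measurable_compose[OF measurable_Pair2'[OF \<omega>] Xp_measurable] by simp
    have [measurable]: "(\<lambda>u. hat_clock u \<omega>) \<in> borel_measurable borel"
      using measurable_compose[OF measurable_Pair2'[OF \<omega>] hat_clock_measurable] by simp
    let ?L = "\<lambda>Z u. ennreal (exp (- 2 * \<gamma> * hat_clock u \<omega>) * w (Z u \<omega>)) * indicator {y. r + 1 < \<bar>y\<bar>} (Z u \<omega>) * indicator {0<..} u"
    have LL: "?L X u = ?L Xp u" for u by (auto simp: Xp_def indicator_def)
    have "(\<integral>\<^sup>+ s. \<Phi> s \<omega> \<partial>lborel) = (\<integral>\<^sup>+ s. indicator {y. r + 1 < \<bar>y\<bar>} (X (C.inv_clk s) \<omega>) * indicator {0..<1} s \<partial>lborel)"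
      by (simp add: \<Phi>_good[OF True])
    also have "\<dots> \<le> (\<integral>\<^sup>+ u. indicator {y. r + 1 < \<bar>y\<bar>} (X u \<omega>) * ennreal (w (X u \<omega>)) * indicator {u. 0 < u \<and> C.clk u < 1} u \<partial>lborel)"
      using n by (intro C.time_change_le[of "real (Suc n)"]) auto
    also have "\<dots> \<le> (\<integral>\<^sup>+ u. ennreal (exp 1) * ?L X u \<partial>lborel)"
    proof (rule nn_integral_mono)
      fix u
      show "indicator {y. r + 1 < \<bar>y\<bar>} (X u \<omega>) * ennreal (w (X u \<omega>)) * indicator {u. 0 < u \<and> C.clk u < 1} u \<le> ennreal (exp 1) * ?L X u"
      proof (cases "0 < u \<and> C.clk u < 1")
        case True
        \<comment> \<open>Before the clock reads 1 the weight exponent is below 1, so inserting the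
          weight costs at most the factor \<open>exp 1\<close>.\<close>
        have "ennreal (2 * \<gamma> * hat_clock u \<omega>) < 1" using hat_clock_le_clkX[OF \<omega>, of u] conjunct2[OF True] by (rule le_less_trans)
        then have "2 * \<gamma> * hat_clock u \<omega> < 1"
          using \<gamma>_pos by (simp add: ennreal_less_one_iff hat_clock_nonneg)
        then have "1 \<le> exp 1 * exp (- 2 * \<gamma> * hat_clock u \<omega>)" by (simp add: exp_add[symmetric])
        then have "1 * w (X u \<omega>) \<le> (exp 1 * exp (- 2 * \<gamma> * hat_clock u \<omega>)) * w (X u \<omega>)"
          using w_pos[of "X u \<omega>"] by (intro mult_right_mono) auto
        then have "ennreal (w (X u \<omega>)) \<le> ennreal (exp 1 * (exp (- 2 * \<gamma> * hat_clock u \<omega>) * w (X u \<omega>)))"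
          by (intro ennreal_leI) (simp add: mult.assoc)
        also have "\<dots> = ennreal (exp 1) * ennreal (exp (- 2 * \<gamma> * hat_clock u \<omega>) * w (X u \<omega>))"
          using w_pos[of "X u \<omega>"] by (intro ennreal_mult) auto
        finally show ?thesis using True by (auto simp: indicator_def)
      qed simp
    qed
    also have "\<dots> = ennreal (exp 1) * (\<integral>\<^sup>+ u. ?L X u \<partial>lborel)"
      unfolding LL by (rule nn_integral_cmult) measurable
    finally show ?thesis .
  qed (simp add: \<Phi>_def)
  interpret P: pair_sigma_finite lborel M ..
  let ?L = "\<lambda>Z u \<omega>. ennreal (exp (- 2 * \<gamma> * hat_clock u \<omega>) * w (Z u \<omega>)) * indicator {y. r + 1 < \<bar>y\<bar>} (Z u \<omega>) * indicator {0<..} u"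
  have LL: "?L X u \<omega> = ?L Xp u \<omega>" for u \<omega> by (auto simp: Xp_def indicator_def)
  have [measurable]: "(\<lambda>z. Xp (snd z) (fst z)) \<in> borel_measurable (M \<Otimes>\<^sub>M lborel)"
    using measurable_compose[OF measurable_pair_swap' Xp_measurable] by (simp add: case_prod_beta')
  have [measurable]: "(\<lambda>z. hat_clock (snd z) (fst z)) \<in> borel_measurable (M \<Otimes>\<^sub>M lborel)"
    using measurable_compose[OF measurable_pair_swap' hat_clock_measurable] by (simp add: case_prod_beta')
  have Lm: "(\<lambda>z. ?L Xp (snd z) (fst z)) \<in> borel_measurable (M \<Otimes>\<^sub>M lborel)" by measurable
  have "(\<integral>\<^sup>+ s. \<integral>\<^sup>+ \<omega>. \<Phi> s \<omega> \<partial>M \<partial>lborel) = (\<integral>\<^sup>+ \<omega>. \<integral>\<^sup>+ s. \<Phi> s \<omega> \<partial>lborel \<partial>M)"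
    using P.Fubini'[of "\<lambda>s \<omega>. \<Phi> s \<omega>"] \<Phi>_meas by (simp add: case_prod_beta')
  also have "\<dots> \<le> (\<integral>\<^sup>+ \<omega>. ennreal (exp 1) * (\<integral>\<^sup>+ u. ?L X u \<omega> \<partial>lborel) \<partial>M)"
    by (intro nn_integral_mono inner)
  also have "\<dots> = ennreal (exp 1) * (\<integral>\<^sup>+ \<omega>. \<integral>\<^sup>+ u. ?L X u \<omega> \<partial>lborel \<partial>M)"
    unfolding LL by (rule nn_integral_cmult) (use lborel.borel_measurable_nn_integral_fst[OF Lm] in simp)
  also have "\<dots> \<le> ennreal (exp 1) * (ennreal ((2 + pot_const / \<gamma>) / pot_const) * weight (\<lambda>y. ennreal (w y) * indicator {y. r < \<bar>y\<bar>} y))"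
    by (intro mult_left_mono occupation_tail[OF fin]) simp
  also have "\<dots> < \<epsilon>"
  proof -
    have "ennreal (exp 1 * ((2 + pot_const / \<gamma>) / pot_const)) = ennreal (exp 1) * ennreal ((2 + pot_const / \<gamma>) / pot_const)"
      using pot_const_pos \<gamma>_pos by (intro ennreal_mult) auto
    then show ?thesis using small by (simp only: mult.assoc)
  qed
  finally have lt: "(\<integral>\<^sup>+ s. \<integral>\<^sup>+ \<omega>. \<Phi> s \<omega> \<partial>M \<partial>lborel) < \<epsilon>" .
  \<comment> \<open>Pigeonhole in time: probabilities above \<open>\<epsilon>\<close> throughout the
    unit interval would force the integral to be at least \<open>\<epsilon>\<close>.\<close>
  have "\<exists>s. 0 < s \<and> s < 1 \<and> (\<integral>\<^sup>+ \<omega>. \<Phi> s \<omega> \<partial>M) \<le> \<epsilon>"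
  proof (rule ccontr)
    assume "\<not> ?thesis"
    then have "\<epsilon> * indicator {0<..<1} s \<le> (\<integral>\<^sup>+ \<omega>. \<Phi> s \<omega> \<partial>M)" for s by (auto simp: indicator_def not_le)
    then have "(\<integral>\<^sup>+ s. \<epsilon> * indicator {0<..<1} s \<partial>(lborel :: real measure)) \<le> (\<integral>\<^sup>+ s. \<integral>\<^sup>+ \<omega>. \<Phi> s \<omega> \<partial>M \<partial>lborel)"
      by (intro nn_integral_mono)
    then have "\<epsilon> \<le> (\<integral>\<^sup>+ s. \<integral>\<^sup>+ \<omega>. \<Phi> s \<omega> \<partial>M \<partial>lborel)" by (simp add: nn_integral_cmult)
    then show False using lt by simp
  qed
  then obtain s where s: "0 < s" "s < 1" "(\<integral>\<^sup>+ \<omega>. \<Phi> s \<omega> \<partial>M) \<le> \<epsilon>" by blast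
  let ?A = "{\<omega> \<in> space M. r + 1 < \<bar>Xp (inv_before_one s \<omega>) \<omega>\<bar> \<and> \<omega> \<in> clock_passes_one}"
  have [measurable]: "(\<lambda>\<omega>. Xp (inv_before_one s \<omega>) \<omega>) \<in> borel_measurable M"
    using measurable_compose[OF measurable_Pair1' XJ, of s] by simp
  have A[measurable]: "?A \<in> sets M" by measurable
  have Am: "emeasure M ?A \<le> \<epsilon>"
  proof -
    have "emeasure M ?A = (\<integral>\<^sup>+ \<omega>. indicator ?A \<omega> \<partial>M)" by simp
    also have "\<dots> = (\<integral>\<^sup>+ \<omega>. \<Phi> s \<omega> \<partial>M)"
      using s by (intro nn_integral_cong) (auto simp: \<Phi>_def indicator_def)
    finally show ?thesis using s by simp
  qed
  have "AE \<omega> in M. \<omega> \<notin> ?A \<longrightarrow> 0 \<le> invX s \<omega> \<and> \<bar>X (invX s \<omega>) \<omega>\<bar> \<le> r + 1"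
    using AE_clock_passes_one
  proof eventually_elim
    case (elim \<omega>)
    have "r + 1 < \<bar>Xp (inv_before_one s \<omega>) \<omega>\<bar>" if "r + 1 < \<bar>X (invX s \<omega>) \<omega>\<bar>"
    proof -
      have "\<Phi> s \<omega> = 1" using \<Phi>_good[OF elim, of s] that s by simp
      then show ?thesis by (cases "r + 1 < \<bar>Xp (inv_before_one s \<omega>) \<omega>\<bar>") (auto simp: \<Phi>_def)
    qed
    moreover have "0 \<le> invX s \<omega>" using s by (intro inv_nonneg[OF elim]) auto
    ultimately show ?case using elim clock_passes_oneD(1)[OF elim] by (cases "r + 1 < \<bar>X (invX s \<omega>) \<omega>\<bar>") auto
  qed
  then show ?thesis using s A Am by blast
qed

end

section \<open>The time-changed process at small times\<close>

lemma outer_measure_of_le: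
  assumes A: "A \<in> sets M" and P: "AE \<omega> in M. \<omega> \<notin> A \<longrightarrow> \<not> P \<omega>"
  shows "outer_measure_of M {\<omega> \<in> space M. P \<omega>} \<le> emeasure M A"
proof -
  obtain N where N: "{\<omega> \<in> space M. \<not> (\<omega> \<notin> A \<longrightarrow> \<not> P \<omega>)} \<subseteq> N" "emeasure M N = 0" "N \<in> sets M"
    using P by (rule AE_E)
  have "outer_measure_of M {\<omega> \<in> space M. P \<omega>} \<le> outer_measure_of M (A \<union> N)"
    using N(1) by (intro outer_measure_of_mono) auto
  also have "\<dots> = emeasure M (A \<union> N)" using A N(3) by (intro outer_measure_of_eq) auto
  also have "\<dots> \<le> emeasure M A + emeasure M N" using A N(3) by (intro emeasure_subadditive)
  finally show ?thesis using N(2) by simp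
qed

context
  fixes \<alpha> x :: real and M :: "'w measure" and X :: "real \<Rightarrow> 'w \<Rightarrow> real"
  assumes X: "symmetric_stable_process \<alpha> x M X" and alpha: "1 < \<alpha>" "\<alpha> < 2"
begin

interpretation prob_space M using X by (simp add: symmetric_stable_process_def)

lemma process_measurable: "0 \<le> t \<Longrightarrow> X t \<in> borel_measurable M"
  using X by (simp add: symmetric_stable_process_def)

lemma process_char: "0 \<le> s \<Longrightarrow> s \<le> t \<Longrightarrow>
    char (distr M borel (\<lambda>\<omega>. X t \<omega> - X s \<omega>)) \<theta> = complex_of_real (exp (- (t - s) * \<bar>\<theta>\<bar> powr \<alpha>))"
  using X unfolding symmetric_stable_process_def by blast

lemma process_increment_distribution:
  "0 \<le> s \<Longrightarrow> s \<le> t \<Longrightarrow> real_distribution (distr M borel (\<lambda>\<omega>. X t \<omega> - X s \<omega>))"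
  by (intro real_distribution_distr borel_measurable_diff process_measurable) auto

lemma process_stable_family: "stable_family \<alpha> (\<lambda>t. distr M borel (\<lambda>\<omega>. X t \<omega> - X 0 \<omega>))"
proof (rule stable_family.intro)
  show "1 < \<alpha>" "\<alpha> < 2" by (fact alpha)+
  fix t :: real assume t: "0 \<le> t"
  show "real_distribution (distr M borel (\<lambda>\<omega>. X t \<omega> - X 0 \<omega>))"
    by (rule process_increment_distribution[OF order_refl t])
  show "char (distr M borel (\<lambda>\<omega>. X t \<omega> - X 0 \<omega>)) \<theta> = complex_of_real (exp (- t * \<bar>\<theta>\<bar> powr \<alpha>))" for \<theta>
    using process_char[OF order_refl t] by simp
qed

text \<open>Paths with a wrong start or without the cadlag property lie in a null set. There the
  path is frozen at \<open>x\<close>, so the path properties hold for every outcome, and all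
  expectations agree with those of the original process.\<close>

lemma process_path_version:
  assumes N: "stable_family \<alpha> N"
  shows "\<exists>X'. stable_path \<alpha> N M X' x \<and>
    (\<forall>\<omega>\<in>space M. \<forall>t\<ge>0. \<exists>B. \<forall>s\<in>{0..t}. \<bar>X' s \<omega>\<bar> \<le> B) \<and>
    (AE \<omega> in M. \<forall>t\<ge>0. X' t \<omega> = X t \<omega>)"
proof -
  interpret stable_family \<alpha> N by fact
  have "AE \<omega> in M. X 0 \<omega> = x" "AE \<omega> in M. cadlag (\<lambda>t. X t \<omega>)"
    using X by (simp_all add: symmetric_stable_process_def)
  then have "AE \<omega> in M. X 0 \<omega> = x \<and> cadlag (\<lambda>t. X t \<omega>)" by eventually_elim simp
  then obtain Z where Z: "{\<omega> \<in> space M. \<not> (X 0 \<omega> = x \<and> cadlag (\<lambda>t. X t \<omega>))} \<subseteq> Z" "emeasure M Z = 0" "Z \<in> sets M"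
    by (rule AE_E)
  define X' where "X' t \<omega> = (if \<omega> \<in> space M - Z \<and> 0 \<le> t then X t \<omega> else x)" for t \<omega>
  have notZ: "AE \<omega> in M. \<omega> \<notin> Z" using Z(2,3) by (intro AE_not_in) (auto simp: null_sets_def)
  have eq: "AE \<omega> in M. \<forall>t\<ge>0. X' t \<omega> = X t \<omega>"
    using notZ AE_space by eventually_elim (simp add: X'_def)
  have [measurable]: "X' t \<in> borel_measurable M" for t
  proof (cases "0 \<le> t")
    case True
    have [measurable]: "X t \<in> borel_measurable M" by (rule process_measurable[OF True])
    have "(\<lambda>\<omega>. if \<omega> \<in> Z then x else X t \<omega>) \<in> borel_measurable M" using Z(3) by measurable
    then show ?thesis by (rule measurable_cong[THEN iffD1, rotated]) (auto simp: X'_def True)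
  qed (simp add: X'_def[abs_def])
  have cad: "cadlag (\<lambda>t. X' t \<omega>)" if \<omega>: "\<omega> \<in> space M" for \<omega>
  proof (cases "\<omega> \<in> Z")
    case True
    then show ?thesis by (auto simp: X'_def cadlag_def)
  next
    case False
    then have c: "cadlag (\<lambda>t. X t \<omega>)" using Z(1) \<omega> by auto
    have X'eq: "X' t \<omega> = X t \<omega>" if "0 \<le> t" for t using False \<omega> that by (simp add: X'_def)
    show ?thesis
      unfolding cadlag_def
    proof (intro conjI allI impI)
      fix t :: real assume t: "0 \<le> t"
      have "((\<lambda>t. X t \<omega>) \<longlongrightarrow> X t \<omega>) (at_right t)" using c t by (auto simp: cadlag_def continuous_within)
      then have "((\<lambda>t. X' t \<omega>) \<longlongrightarrow> X t \<omega>) (at_right t)"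
        by (rule Lim_transform_eventually)
          (use t in \<open>auto simp: eventually_at_right_field X'eq intro!: exI[of _ "t + 1"]\<close>)
      then show "continuous (at_right t) (\<lambda>t. X' t \<omega>)" using X'eq[OF t] by (simp add: continuous_within)
    next
      fix t :: real assume t: "0 < t"
      obtain l where "((\<lambda>t. X t \<omega>) \<longlongrightarrow> l) (at_left t)" using c t by (auto simp: cadlag_def)
      then have "((\<lambda>t. X' t \<omega>) \<longlongrightarrow> l) (at_left t)"
        by (rule Lim_transform_eventually)
          (use t in \<open>auto simp: eventually_at_left_field X'eq intro!: exI[of _ 0]\<close>)
      then show "\<exists>l. ((\<lambda>t. X' t \<omega>) \<longlongrightarrow> l) (at_left t)" by blast
    qed
  qed
  have start: "X' 0 \<omega> = x" if "\<omega> \<in> space M" for \<omega>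
    using Z(1) that by (auto simp: X'_def)
  \<comment> \<open>The characteristic function identifies the law of an increment with a member of
    the given family, even if that family was built from another starting point.\<close>
  have law: "distr M borel (\<lambda>\<omega>. X t \<omega> - X s \<omega>) = N (t - s)" if "0 \<le> s" "s \<le> t" for s t
  proof (rule Levy_uniqueness)
    show "real_distribution (distr M borel (\<lambda>\<omega>. X t \<omega> - X s \<omega>))"
      using that by (rule process_increment_distribution)
    show "real_distribution (N (t - s))" using that by (intro N_dist) simp
    show "char (distr M borel (\<lambda>\<omega>. X t \<omega> - X s \<omega>)) = char (N (t - s))"
      using that by (intro ext) (simp add: process_char N_char)
  qed
  have "stable_path \<alpha> N M X' x"
  proof (unfold_locales)
    show "X' t \<in> borel_measurable M" for t by measurable
    show "X' 0 \<omega> = x" if "\<omega> \<in> space M" for \<omega> by (rule start[OF that])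
    show "((\<lambda>s. X' s \<omega>) \<longlongrightarrow> X' t \<omega>) (at_right t)" if "\<omega> \<in> space M" "0 \<le> t" for \<omega> t
      using cad[OF that(1)] that(2) by (auto simp: cadlag_def continuous_within)
    show "distr M borel (\<lambda>\<omega>. X' t \<omega> - x) = N t" if t: "0 \<le> t" for t
    proof -
      have "distr M borel (\<lambda>\<omega>. X' t \<omega> - x) = distr M borel (\<lambda>\<omega>. X t \<omega> - X 0 \<omega>)"
      proof (rule distr_cong_AE)
        show "AE \<omega> in M. X' t \<omega> - x = X t \<omega> - X 0 \<omega>"
          using eq AE_space by eventually_elim (use t start in \<open>simp, metis order_refl\<close>)
      qed (auto intro!: borel_measurable_diff process_measurable t)
      then show ?thesis using law[of 0 t] t by simp
    qed
  next
    fix h :: real and n and S \<phi> g :: "real \<Rightarrow> ennreal"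
    assume h: "0 < h" and [measurable]: "S \<in> borel_measurable borel" "\<phi> \<in> borel_measurable borel" "g \<in> borel_measurable borel"
      and step: "\<And>y. \<phi> y + g y * (\<integral>\<^sup>+ z. S (y + z) \<partial>N h) \<le> S y"
    define \<xi> where "\<xi> i \<omega> = X (real (Suc i) * h) \<omega> - X (real i * h) \<omega>" for i \<omega>
    define W where "W k \<omega> = x + (\<Sum>i<k. \<xi> i \<omega>)" for k \<omega>
    have ind: "indep_vars (\<lambda>_. borel) \<xi> {..<m}" for m
    proof -
      have "strict_mono (\<lambda>i::nat. real i * h)" using h by (auto simp: strict_mono_def)
      moreover have "0 \<le> real 0 * h" by simp
      ultimately have "indep_vars (\<lambda>_. borel) (\<lambda>i \<omega>. X (real (Suc i) * h) \<omega> - X (real i * h) \<omega>) {..<m}"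
        using X unfolding symmetric_stable_process_def by fast
      then show ?thesis by (simp add: \<xi>_def[abs_def])
    qed
    have law\<xi>: "distr M borel (\<xi> i) = N h" for i
    proof -
      have "real (Suc i) * h - real i * h = h" by (simp add: algebra_simps)
      then show ?thesis unfolding \<xi>_def using law[of "real i * h" "real (Suc i) * h"] h by simp
    qed
    have WX: "AE \<omega> in M. \<forall>k. W k \<omega> = X' (real k * h) \<omega>"
      using eq AE_space
    proof eventually_elim
      case (elim \<omega>)
      have "W k \<omega> = x + (X (real k * h) \<omega> - X (real 0 * h) \<omega>)" for k
        unfolding W_def \<xi>_def by (subst sum_lessThan_telescope) simp
      moreover have "X 0 \<omega> = x" using elim start by (metis order_refl)
      ultimately show ?case using elim h by simp
    qed
    have "(\<Sum>k<n. \<integral>\<^sup>+ \<omega>. (\<Prod>j<k. g (W j \<omega>)) * \<phi> (W k \<omega>) \<partial>M)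
        + (\<integral>\<^sup>+ \<omega>. (\<Prod>j<n. g (W j \<omega>)) * S (W n \<omega>) \<partial>M) \<le> S x"
      unfolding W_def by (rule walk_supermartingale[OF ind law\<xi> _ _ _ step]) measurable
    moreover have "(\<integral>\<^sup>+ \<omega>. (\<Prod>j<k. g (W j \<omega>)) * F (W k \<omega>) \<partial>M)
        = (\<integral>\<^sup>+ \<omega>. (\<Prod>j<k. g (X' (real j * h) \<omega>)) * F (X' (real k * h) \<omega>) \<partial>M)" for F k
      using WX by (intro nn_integral_cong_AE) (auto elim!: eventually_mono)
    ultimately show "(\<Sum>k<n. \<integral>\<^sup>+ \<omega>. (\<Prod>j<k. g (X' (real j * h) \<omega>)) * \<phi> (X' (real k * h) \<omega>) \<partial>M)
        + (\<integral>\<^sup>+ \<omega>. (\<Prod>j<n. g (X' (real j * h) \<omega>)) * S (X' (real n * h) \<omega>) \<partial>M) \<le> S x"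
      by simp
  qed
  moreover have "\<exists>B. \<forall>s\<in>{0..t}. \<bar>X' s \<omega>\<bar> \<le> B" if "\<omega> \<in> space M" "0 \<le> t" for \<omega> t
    by (rule cadlag_bounded[OF cad[OF that(1)] that(2)])
  ultimately show ?thesis using eq by blast
qed

context
  fixes \<sigma> :: "real \<Rightarrow> real"
  assumes sigma: "continuous_on UNIV \<sigma>" "\<And>x. 0 < \<sigma> x"
begin

abbreviation (input) "speed y \<equiv> \<sigma> y powr (- \<alpha>)"

lemma speed_continuous: "continuous_on UNIV speed"
  using sigma by (intro continuous_on_powr continuous_intros) (auto simp: less_le)

lemma speed_pos: "0 < speed y"
  using sigma(2)[of y] by simp

text \<open>Surviving restricts the event, so it suffices to bound the probability that
  \<open>Y\<close> lies in \<open>B\<close>. Outside a null set the modified path has the same clock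
  and hence the same inverse clock as \<open>X\<close>.\<close>

lemma killed_tail:
  assumes N: "stable_family \<alpha> N" and \<gamma>: "0 < \<gamma>" "\<And>y. 2 * \<gamma> * hat y \<le> speed y"
    and fin: "stable_family.weight \<alpha> (\<lambda>y. ennreal (speed y)) < \<infinity>"
    and small: "ennreal (exp 1 * ((2 + stable_family.pot_const \<alpha> / \<gamma>) / stable_family.pot_const \<alpha>))
      * stable_family.weight \<alpha> (\<lambda>y. ennreal (speed y) * indicator {y. r < \<bar>y\<bar>} y) < \<epsilon>"
    and B: "B \<subseteq> {y. r + 1 < \<bar>y\<bar>}"
  shows "\<exists>s. 0 < s \<and> s < 1 \<and> killed_prob M (time_changed \<sigma> \<alpha> X) s B \<le> \<epsilon>"
proof -
  obtain X' where X': "stable_path \<alpha> N M X' x"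
    "\<And>\<omega> t. \<omega> \<in> space M \<Longrightarrow> 0 \<le> t \<Longrightarrow> \<exists>B. \<forall>s\<in>{0..t}. \<bar>X' s \<omega>\<bar> \<le> B"
    "AE \<omega> in M. \<forall>t\<ge>0. X' t \<omega> = X t \<omega>"
    using process_path_version[OF N] by blast
  interpret P: clocked_path \<alpha> N M X' x speed \<gamma>
    using X'(1,2) speed_continuous speed_pos \<gamma>
    by (intro clocked_path.intro clocked_path_axioms.intro) auto
  obtain s A where s: "0 < s" "s < 1" and A: "A \<in> sets M" "emeasure M A \<le> \<epsilon>"
    "AE \<omega> in M. \<omega> \<notin> A \<longrightarrow> 0 \<le> P.invX s \<omega> \<and> \<bar>X' (P.invX s \<omega>) \<omega>\<bar> \<le> r + 1"
    using P.short_time_tail[OF fin small] by blast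
  have "killed_prob M (time_changed \<sigma> \<alpha> X) s B \<le> outer_measure_of M {\<omega> \<in> space M. time_changed \<sigma> \<alpha> X s \<omega> \<in> B}"
    unfolding killed_prob_def by (rule outer_measure_of_mono) auto
  also have "\<dots> \<le> emeasure M A"
  proof (rule outer_measure_of_le[OF A(1)])
    show "AE \<omega> in M. \<omega> \<notin> A \<longrightarrow> time_changed \<sigma> \<alpha> X s \<omega> \<notin> B"
      using A(3) X'(3) AE_space
    proof eventually_elim
      case (elim \<omega>)
      interpret C: additive_clock "\<lambda>u. X' u \<omega>" speed by (rule P.clock_path[OF elim(3)])
      have "C.clk u = clock \<sigma> \<alpha> X u \<omega>" for u
        unfolding C.clk_def clock_def using elim(2) by (intro nn_integral_cong) (auto simp: indicator_def)
      then have "C.inv_clk s = inverse_clock \<sigma> \<alpha> X s \<omega>"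
        by (simp add: C.inv_clk_def inverse_clock_def)
      then show ?case using elim(1,2) B by (auto simp: time_changed_def)
    qed
  qed
  finally show ?thesis using s A(2) by (blast intro: order_trans)
qed

text \<open>Right continuity keeps \<open>X\<close> for a short time in a neighbourhood of
  \<open>x\<close> that avoids 0 and where the speed is at least half its value at \<open>x\<close>.
  The clock then runs at least at that rate, so small clock times have small inverse clock times and
  \<open>Y\<close> stays in the neighbourhood as well.\<close>

lemma short_time_path:
  assumes "open U" "x \<in> U" "x \<noteq> 0"
  shows "AE \<omega> in M. time_changed \<sigma> \<alpha> X 0 \<omega> = x \<and> (\<exists>\<delta>>0. \<forall>t. 0 \<le> t \<longrightarrow> t < \<delta> \<longrightarrow>
    time_changed \<sigma> \<alpha> X t \<omega> \<in> U \<and> ereal t < hitting_time_0 (time_changed \<sigma> \<alpha> X) \<omega>)"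
proof -
  let ?Y = "time_changed \<sigma> \<alpha> X"
  have "AE \<omega> in M. X 0 \<omega> = x" "AE \<omega> in M. cadlag (\<lambda>t. X t \<omega>)"
    using X by (simp_all add: symmetric_stable_process_def)
  then show ?thesis
  proof eventually_elim
    case (elim \<omega>)
    define V where "V = U \<inter> (- {0}) \<inter> {y. speed x / 2 < speed y}"
    have "open {y. speed x / 2 < speed y}"
      by (rule open_Collect_less[OF continuous_on_const speed_continuous])
    then have V: "open V" "x \<in> V"
      using assms speed_pos[of x] by (auto simp: V_def)
    have "((\<lambda>t. X t \<omega>) \<longlongrightarrow> X 0 \<omega>) (at_right 0)" using elim(2) by (auto simp: cadlag_def continuous_within)
    then have "\<forall>\<^sub>F s in at_right 0. X s \<omega> \<in> V" using V elim(1) by (intro topological_tendstoD) auto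
    then obtain b where b: "0 < b" "\<And>s. 0 < s \<Longrightarrow> s < b \<Longrightarrow> X s \<omega> \<in> V"
      unfolding eventually_at_right_field by auto
    have XV: "X s \<omega> \<in> V" if "0 \<le> s" "s < b" for s
      using b(2)[of s] that elim(1) V(2) by (cases "s = 0") auto
    have clock_ge: "ennreal (speed x / 2 * s) \<le> clock \<sigma> \<alpha> X s \<omega>" if s: "0 < s" "s < b" for s
    proof -
      have "ennreal (speed x / 2 * s) = (\<integral>\<^sup>+ u\<in>{0..s}. ennreal (speed x / 2) \<partial>lborel)"
        using s speed_pos[of x] by (simp add: nn_integral_cmult flip: ennreal_mult)
      also have "\<dots> \<le> clock \<sigma> \<alpha> X s \<omega>"
        unfolding clock_def
      proof (rule nn_integral_mono)
        fix u
        show "ennreal (speed x / 2) * indicator {0..s} u \<le> ennreal (speed (X u \<omega>)) * indicator {0..s} u"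
          using XV[of u] s by (auto simp: indicator_def V_def intro!: ennreal_leI)
      qed
      finally show ?thesis .
    qed
    have inv: "0 \<le> inverse_clock \<sigma> \<alpha> X t \<omega> \<and> inverse_clock \<sigma> \<alpha> X t \<omega> \<le> s"
      if t: "0 \<le> t" "t < speed x / 2 * s" and s: "0 < s" "s < b" for t s
    proof -
      have "ennreal t < ennreal (speed x / 2 * s)" using t by (simp add: ennreal_less_iff)
      also note clock_ge[OF s]
      finally have mem: "s \<in> {s. s > 0 \<and> clock \<sigma> \<alpha> X s \<omega> > ennreal t}" using s by simp
      have "0 \<le> inverse_clock \<sigma> \<alpha> X t \<omega>"
        unfolding inverse_clock_def using mem by (intro cInf_greatest) auto
      moreover have "inverse_clock \<sigma> \<alpha> X t \<omega> \<le> s"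
        unfolding inverse_clock_def by (rule cInf_lower[OF mem]) (auto intro!: bdd_belowI[of _ 0])
      ultimately show ?thesis by simp
    qed
    have "inverse_clock \<sigma> \<alpha> X 0 \<omega> = 0"
    proof (rule antisym)
      show "0 \<le> inverse_clock \<sigma> \<alpha> X 0 \<omega>" using inv[of 0 "b/2"] b(1) speed_pos[of x] by simp
      show "inverse_clock \<sigma> \<alpha> X 0 \<omega> \<le> 0"
      proof (rule field_le_epsilon)
        fix e :: real assume "0 < e"
        then have "inverse_clock \<sigma> \<alpha> X 0 \<omega> \<le> min e (b/2)"
          using inv[of 0 "min e (b/2)"] b(1) speed_pos[of x] by auto
        then show "inverse_clock \<sigma> \<alpha> X 0 \<omega> \<le> 0 + e" by simp
      qed
    qed
    then have Y0: "?Y 0 \<omega> = x" using elim(1) by (simp add: time_changed_def)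
    define \<delta> where "\<delta> = speed x / 2 * (b / 2)"
    have \<delta>: "0 < \<delta>" using b(1) speed_pos[of x] by (simp add: \<delta>_def)
    have YV: "?Y t \<omega> \<in> V" if "0 \<le> t" "t < \<delta>" for t
      unfolding time_changed_def using inv[of t "b / 2"] that b(1) by (intro XV) (auto simp: \<delta>_def)
    have "ereal \<delta> \<le> hitting_time_0 ?Y \<omega>"
      unfolding hitting_time_0_def
    proof (rule Inf_greatest)
      fix z assume "z \<in> {ereal t |t. 0 < t \<and> ?Y t \<omega> = 0}"
      then obtain t where t: "z = ereal t" "0 < t" "?Y t \<omega> = 0" by blast
      then have "\<not> t < \<delta>" using YV[of t] by (auto simp: V_def)
      then show "ereal \<delta> \<le> z" using t by simp
    qed
    then have "ereal t < hitting_time_0 ?Y \<omega>" if "t < \<delta>" for t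
      by (rule less_le_trans[rotated]) (simp add: that)
    then have "\<forall>t. 0 \<le> t \<longrightarrow> t < \<delta> \<longrightarrow> ?Y t \<omega> \<in> U \<and> ereal t < hitting_time_0 ?Y \<omega>"
      using YV unfolding V_def by blast
    then show ?case using Y0 \<delta> by blast
  qed
qed

text \<open>The events \<open>E n\<close> need not be measurable. Outer measure is continuous along
  increasing sequences, and a measurable hull of their union has probability 1.\<close>

lemma killed_prob_short_time:
  assumes U: "open U" "x \<in> U" "x \<noteq> 0" and c: "c < 1"
  shows "\<exists>\<delta>>0. \<forall>t. 0 \<le> t \<longrightarrow> t < \<delta> \<longrightarrow> c < killed_prob M (time_changed \<sigma> \<alpha> X) t U"
proof -
  let ?Y = "time_changed \<sigma> \<alpha> X"
  define E where "E n = {\<omega> \<in> space M. \<forall>t. 0 \<le> t \<longrightarrow> t < 1 / real (Suc n) \<longrightarrow> ?Y t \<omega> \<in> U \<and> ereal t < hitting_time_0 ?Y \<omega>}" for n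
  have dec: "1 / real (Suc (Suc n)) \<le> 1 / real (Suc n)" for n by (simp add: frac_le)
  have inc: "incseq E"
    unfolding E_def by (rule incseq_SucI) (use dec in \<open>fastforce intro: less_le_trans\<close>)
  have "(SUP n. outer_measure_of M (E n)) = outer_measure_of M (\<Union>n. E n)"
    by (rule SUP_outer_measure_of_incseq[OF _ inc]) (auto simp: E_def)
  moreover have "1 \<le> outer_measure_of M (\<Union>n. E n)"
  proof -
    obtain F where F: "F \<in> sets M" "(\<Union>n. E n) \<subseteq> F" "outer_measure_of M (\<Union>n. E n) = emeasure M F"
      using outer_measure_of_attain[of "\<Union>n. E n" M] by (auto simp: E_def)
    have "AE \<omega> in M. \<omega> \<in> F"
      using short_time_path[OF U] AE_space
    proof eventually_elim
      case (elim \<omega>)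
      then obtain \<delta> where \<delta>: "\<delta> > 0" "\<And>t. 0 \<le> t \<Longrightarrow> t < \<delta> \<Longrightarrow> ?Y t \<omega> \<in> U \<and> ereal t < hitting_time_0 ?Y \<omega>" by blast
      obtain n :: nat where "1 / real (Suc n) < \<delta>" using \<delta>(1) by (rule nat_approx_posE)
      then have "\<omega> \<in> E n" using elim \<delta>(2) by (auto simp: E_def)
      then show ?case using F(2) by blast
    qed
    then have "emeasure M F = 1" by (rule emeasure_eq_1_AE[OF F(1)])
    then show ?thesis using F(3) by simp
  qed
  ultimately have "c < (SUP n. outer_measure_of M (E n))" using c by (simp add: less_le_trans)
  then obtain n where n: "c < outer_measure_of M (E n)" by (auto simp: less_SUP_iff)
  have "c < killed_prob M ?Y t U" if "0 \<le> t" "t < 1 / real (Suc n)" for t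
  proof -
    have "outer_measure_of M (E n) \<le> killed_prob M ?Y t U"
      unfolding killed_prob_def using that by (intro outer_measure_of_mono) (auto simp: E_def)
    then show ?thesis using n by (rule less_le_trans[rotated])
  qed
  then show ?thesis by (intro exI[of _ "1 / real (Suc n)"]) auto
qed

text \<open>The density describes positive times; time 0 is settled by the paths, which almost
  surely start at \<open>x\<close> and avoid 0 for a while. It supplies the case
  \<open>t = 0\<close> of the rate.\<close>

lemma killed_prob_0:
  assumes "x \<noteq> 0"
  shows "killed_prob M (time_changed \<sigma> \<alpha> X) 0 A = indicator A x"
proof -
  let ?Y = "time_changed \<sigma> \<alpha> X"
  have AE: "AE \<omega> in M. ?Y 0 \<omega> = x \<and> ereal 0 < hitting_time_0 ?Y \<omega>"
    using short_time_path[OF open_UNIV UNIV_I assms]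
  proof eventually_elim
    case (elim \<omega>)
    then obtain \<delta> where "0 < \<delta>" and \<delta>: "\<forall>t. 0 \<le> t \<longrightarrow> t < \<delta> \<longrightarrow> ?Y t \<omega> \<in> UNIV \<and> ereal t < hitting_time_0 ?Y \<omega>" by blast
    have "ereal 0 < hitting_time_0 ?Y \<omega>" using \<delta>[rule_format, OF order_refl \<open>0 < \<delta>\<close>] by (rule conjunct2)
    then show ?case by (rule conjI[OF conjunct1[OF elim]])
  qed
  show ?thesis
  proof (cases "x \<in> A")
    case True
    obtain F where F: "F \<in> sets M" "{\<omega> \<in> space M. ?Y 0 \<omega> \<in> A \<and> ereal 0 < hitting_time_0 ?Y \<omega>} \<subseteq> F"
      "killed_prob M ?Y 0 A = emeasure M F"
      unfolding killed_prob_def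
      using outer_measure_of_attain[of "{\<omega> \<in> space M. ?Y 0 \<omega> \<in> A \<and> ereal 0 < hitting_time_0 ?Y \<omega>}" M] by blast
    have "AE \<omega> in M. \<omega> \<in> F" using AE AE_space
    proof eventually_elim
      case (elim \<omega>)
      then have "\<omega> \<in> {\<omega> \<in> space M. ?Y 0 \<omega> \<in> A \<and> ereal 0 < hitting_time_0 ?Y \<omega>}" using True by simp
      then show ?case by (rule subsetD[OF F(2)])
    qed
    then have "emeasure M F = 1" by (rule emeasure_eq_1_AE[OF F(1)])
    then show ?thesis using True F(3) by simp
  next
    case False
    have "killed_prob M ?Y 0 A \<le> emeasure M {}"
      unfolding killed_prob_def
    proof (rule outer_measure_of_le)
      show "AE \<omega> in M. \<omega> \<notin> {} \<longrightarrow> \<not> (?Y 0 \<omega> \<in> A \<and> ereal 0 < hitting_time_0 ?Y \<omega>)"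
        using AE
      proof eventually_elim
        case (elim \<omega>)
        then have "?Y 0 \<omega> = x" by (rule conjunct1)
        then show ?case using False by metis
      qed
    qed simp
    then show ?thesis using False by simp
  qed
qed

lemma killed_prob_le_1: "killed_prob M (time_changed \<sigma> \<alpha> X) t A \<le> 1"
proof -
  have "killed_prob M (time_changed \<sigma> \<alpha> X) t A \<le> outer_measure_of M (space M)"
    unfolding killed_prob_def by (rule outer_measure_of_mono) auto
  then show ?thesis by (simp add: outer_measure_of_eq emeasure_space_1)
qed

end

end

section \<open>Conditional laws expressed by the kernel\<close>

context symmetric_kernel
begin

lemma nn_integral_kernel_indicator:
  assumes t: "t > 0" and \<eta>: "prob_space \<eta>" "sets \<eta> = sets M" and A: "A \<in> sets M"
  shows "(\<integral>\<^sup>+ x. (\<integral>\<^sup>+ y\<in>A. ennreal (p t x y) \<partial>M) \<partial>\<eta>) = ennreal (\<integral>x. Pt t (indicator A) x \<partial>\<eta>)"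
proof -
  interpret \<eta>: prob_space \<eta> by fact
  have sp: "space \<eta> = space M" by (rule sets_eq_imp_space_eq[OF \<eta>(2)])
  have AL: "indicator A \<in> L2_fun M"
    by (rule L2_fun_bounded[OF finite_measure_axioms, where B=1]) (use A in \<open>auto simp: indicator_def\<close>)
  have kernel: "(\<integral>\<^sup>+ y\<in>A. ennreal (p t x y) \<partial>M) = ennreal (Pt t (indicator A) x)" if x: "x \<in> space M" for x
  proof -
    have "(\<integral>\<^sup>+ y\<in>A. ennreal (p t x y) \<partial>M) = (\<integral>\<^sup>+ y. ennreal (p t x y * indicator A y) \<partial>M)"
      by (intro nn_integral_cong) (auto simp: indicator_def)
    also have "\<dots> = ennreal (Pt t (indicator A) x)"
      unfolding Pt_def
      by (intro nn_integral_eq_integral L2_fun_mult_integrable kernel_L2 AL t x AE_I2 mult_nonneg_nonneg p_nonneg) auto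
    finally show ?thesis .
  qed
  have m: "Pt t (indicator A) \<in> borel_measurable \<eta>"
    using Pt_measurable[OF t AL] measurable_cong_sets[OF \<eta>(2) refl] by blast
  have "(\<integral>\<^sup>+ x. (\<integral>\<^sup>+ y\<in>A. ennreal (p t x y) \<partial>M) \<partial>\<eta>) = (\<integral>\<^sup>+ x. ennreal (Pt t (indicator A) x) \<partial>\<eta>)"
    by (intro nn_integral_cong) (simp add: kernel sp)
  also have "\<dots> = ennreal (\<integral>x. Pt t (indicator A) x \<partial>\<eta>)"
  proof (rule nn_integral_eq_integral)
    show "integrable \<eta> (Pt t (indicator A))"
      by (rule \<eta>.integrable_const_bound[where B=1])
        (use A t sp in \<open>auto intro!: m AE_I2 Pt_bounded simp: indicator_def\<close>)
    show "AE x in \<eta>. 0 \<le> Pt t (indicator A) x"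
      using t sp by (intro AE_I2 Pt_nonneg) auto
  qed
  finally show ?thesis .
qed

text \<open>\<open>cond_law_survival\<close> is built by \<open>measure_of\<close> from a set
  function; to integrate against it, a genuine measure with these values is needed. It is the second
  marginal of the joint law with density \<open>p t x y / D\<close> on the product of
  \<open>\<eta>\<close> and the reference measure.\<close>

lemma exists_conditional_law:
  assumes t: "t > 0" and \<eta>: "prob_space \<eta>" "sets \<eta> = sets M" and D: "0 < D"
  shows "\<exists>L. sets L = sets M \<and>
    (\<forall>A\<in>sets M. emeasure L A = (\<integral>\<^sup>+ x. (\<integral>\<^sup>+ y\<in>A. ennreal (p t x y) \<partial>M) \<partial>\<eta>) / ennreal D) \<and>
    (\<forall>f\<in>borel_measurable M. (\<forall>x\<in>space M. \<bar>f x\<bar> \<le> 1) \<longrightarrow> (\<integral>x. f x \<partial>L) = (\<integral>x. Pt t f x \<partial>\<eta>) / D)"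
proof -
  interpret \<eta>: prob_space \<eta> by fact
  interpret \<eta>M: pair_sigma_finite \<eta> M ..
  have sp: "space \<eta> = space M" by (rule sets_eq_imp_space_eq[OF \<eta>(2)])
  have pm[measurable]: "(\<lambda>z. p t (fst z) (snd z)) \<in> borel_measurable (\<eta> \<Otimes>\<^sub>M M)"
    using kernel_joint_measurable[OF t] by (simp add: split_beta' measurable_cong_sets[OF sets_pair_measure_cong[OF \<eta>(2) refl] refl])
  define R where "R = density (\<eta> \<Otimes>\<^sub>M M) (\<lambda>z. ennreal (p t (fst z) (snd z) / D))"
  have [measurable_cong]: "sets R = sets (\<eta> \<Otimes>\<^sub>M M)" by (simp add: R_def)
  define L where "L = distr R M snd"
  have em: "emeasure L A = (\<integral>\<^sup>+ x. (\<integral>\<^sup>+ y\<in>A. ennreal (p t x y) \<partial>M) \<partial>\<eta>) / ennreal D" if A[measurable]: "A \<in> sets M" for A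
  proof -
    have "emeasure L A = emeasure R (snd -` A \<inter> space R)"
      unfolding L_def by (rule emeasure_distr) measurable
    also have "\<dots> = (\<integral>\<^sup>+ z. ennreal (p t (fst z) (snd z) / D) * indicator (snd -` A \<inter> space (\<eta> \<Otimes>\<^sub>M M)) z \<partial>(\<eta> \<Otimes>\<^sub>M M))"
      unfolding R_def by (subst emeasure_density) auto
    also have "\<dots> = (\<integral>\<^sup>+ z. ennreal (p t (fst z) (snd z)) * indicator A (snd z) / ennreal D \<partial>(\<eta> \<Otimes>\<^sub>M M))"
      using D t sp by (intro nn_integral_cong)
        (auto simp: indicator_def space_pair_measure divide_ennreal p_nonneg)
    also have "\<dots> = (\<integral>\<^sup>+ z. ennreal (p t (fst z) (snd z)) * indicator A (snd z) \<partial>(\<eta> \<Otimes>\<^sub>M M)) / ennreal D"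
      by (rule nn_integral_divide) measurable
    also have "\<dots> = (\<integral>\<^sup>+ x. (\<integral>\<^sup>+ y\<in>A. ennreal (p t x y) \<partial>M) \<partial>\<eta>) / ennreal D"
      by (subst nn_integral_fst[symmetric]) simp_all
    finally show ?thesis .
  qed
  have int: "(\<integral>x. f x \<partial>L) = (\<integral>x. Pt t f x \<partial>\<eta>) / D"
    if f[measurable]: "f \<in> borel_measurable M" and f1: "\<And>x. x \<in> space M \<Longrightarrow> \<bar>f x\<bar> \<le> 1" for f
  proof -
    have pos: "AE z in \<eta> \<Otimes>\<^sub>M M. 0 \<le> p t (fst z) (snd z) / D"
      using D t sp by (intro AE_I2) (auto simp: space_pair_measure p_nonneg)
    have bound: "\<bar>p t x y * f y\<bar> \<le> p t x y" if "x \<in> space M" "y \<in> space M" for x y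
      using mult_left_mono[OF f1[OF that(2)] p_nonneg[OF t that]] p_nonneg[OF t that] by (simp add: abs_mult)
    have i: "integrable (\<eta> \<Otimes>\<^sub>M M) (\<lambda>z. p t (fst z) (snd z) * f (snd z))"
    proof (rule integrableI_bounded)
      have "(\<integral>\<^sup>+ z. ennreal (norm (p t (fst z) (snd z) * f (snd z))) \<partial>(\<eta> \<Otimes>\<^sub>M M))
          \<le> (\<integral>\<^sup>+ z. ennreal (p t (fst z) (snd z)) \<partial>(\<eta> \<Otimes>\<^sub>M M))"
        using sp bound by (intro nn_integral_mono) (auto simp: space_pair_measure intro!: ennreal_leI)
      also have "\<dots> = (\<integral>\<^sup>+ x. (\<integral>\<^sup>+ y. ennreal (p t x y) \<partial>M) \<partial>\<eta>)"
        by (subst nn_integral_fst[symmetric]) simp_all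
      also have "\<dots> \<le> (\<integral>\<^sup>+ x. 1 \<partial>\<eta>)"
        using sp t by (intro nn_integral_mono p_submarkov) auto
      also have "\<dots> < \<infinity>" by (simp add: \<eta>.emeasure_space_1)
      finally show "(\<integral>\<^sup>+ z. ennreal (norm (p t (fst z) (snd z) * f (snd z))) \<partial>(\<eta> \<Otimes>\<^sub>M M)) < \<infinity>" .
    qed measurable
    have "(\<integral>x. f x \<partial>L) = (\<integral>z. f (snd z) \<partial>R)"
      unfolding L_def by (rule integral_distr) measurable
    also have "\<dots> = (\<integral>z. (p t (fst z) (snd z) / D) *\<^sub>R f (snd z) \<partial>(\<eta> \<Otimes>\<^sub>M M))"
      unfolding R_def by (rule integral_density) (use pos in measurable)
    also have "\<dots> = (\<integral>z. p t (fst z) (snd z) * f (snd z) \<partial>(\<eta> \<Otimes>\<^sub>M M)) / D"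
      by simp
    also have "\<dots> = (\<integral>x. Pt t f x \<partial>\<eta>) / D"
      using \<eta>M.integral_fst'[OF i] by (simp add: Pt_def)
    finally show ?thesis .
  qed
  have "sets L = sets M" by (simp add: L_def)
  moreover have "\<forall>A\<in>sets M. emeasure L A = (\<integral>\<^sup>+ x. (\<integral>\<^sup>+ y\<in>A. ennreal (p t x y) \<partial>M) \<partial>\<eta>) / ennreal D"
    by (rule ballI) (rule em)
  moreover have "\<forall>f\<in>borel_measurable M. (\<forall>x\<in>space M. \<bar>f x\<bar> \<le> 1) \<longrightarrow> (\<integral>x. f x \<partial>L) = (\<integral>x. Pt t f x \<partial>\<eta>) / D"
    by (intro ballI impI int) (simp_all only: Ball_def)
  ultimately show ?thesis by (intro exI[of _ L] conjI)
qed

end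

section \<open>Attraction to the normalised ground state\<close>

lemma killed_prob_UNIV:
  assumes "0 < t"
  shows "killed_prob M Y t UNIV = killed_prob M Y t (- {0})"
proof -
  have "Y t \<omega> \<noteq> 0" if "ereal t < hitting_time_0 Y \<omega>" for \<omega>
  proof
    assume "Y t \<omega> = 0"
    then have "hitting_time_0 Y \<omega> \<le> ereal t"
      unfolding hitting_time_0_def using assms by (intro Inf_lower) blast
    then show False using that by simp
  qed
  then have "{\<omega> \<in> space M. Y t \<omega> \<in> UNIV \<and> ereal t < hitting_time_0 Y \<omega>}
      = {\<omega> \<in> space M. Y t \<omega> \<in> - {0} \<and> ereal t < hitting_time_0 Y \<omega>}" by blast
  then show ?thesis by (simp only: killed_prob_def)
qed

lemma SUP_ennreal_bound:
  assumes "(SUP x\<in>S. ennreal (F x)) < \<infinity>"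
  shows "\<exists>B. \<forall>x\<in>S. F x \<le> B"
proof (intro exI ballI)
  fix x assume "x \<in> S"
  then have "ennreal (F x) \<le> (SUP x\<in>S. ennreal (F x))" by (rule SUP_upper)
  also have "\<dots> = ennreal (enn2real (SUP x\<in>S. ennreal (F x)))" using assms by simp
  finally show "F x \<le> enn2real (SUP x\<in>S. ennreal (F x))" by (simp add: ennreal_le_iff)
qed

lemma (in prob_space) abs_expectation_le:
  fixes f :: "'a \<Rightarrow> real"
  assumes f: "f \<in> borel_measurable M" and c: "\<And>x. x \<in> space M \<Longrightarrow> \<bar>f x\<bar> \<le> c"
  shows "\<bar>expectation f\<bar> \<le> c"
proof -
  have "integrable M f" using f c by (intro integrable_const_bound[where B=c]) auto
  moreover have "AE x in M. f x \<le> c" "AE x in M. - c \<le> f x" using c by (auto simp: abs_le_iff minus_le_iff)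
  ultimately show ?thesis
    using integral_le_const[of f c] integral_ge_const[of f "- c"] by (simp add: abs_le_iff)
qed

locale killed_stable =
  fixes \<alpha> :: real and \<sigma> :: "real \<Rightarrow> real" and P :: "real \<Rightarrow> 'w measure" and X :: "real \<Rightarrow> 'w \<Rightarrow> real"
    and \<mu>0 :: "real measure" and p :: "real \<Rightarrow> real \<Rightarrow> real \<Rightarrow> real" and \<psi> :: "nat \<Rightarrow> real \<Rightarrow> real" and lam :: "nat \<Rightarrow> real"
  assumes alpha: "1 < \<alpha>" "\<alpha> < 2"
    and sigma: "continuous_on UNIV \<sigma>" "\<And>x. 0 < \<sigma> x"
    and mu: "prob_space (speed_measure \<sigma> \<alpha>)"
    and mu0: "\<mu>0 = restrict_space (speed_measure \<sigma> \<alpha>) (- {0})"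
    and X: "\<And>x. symmetric_stable_process \<alpha> x (P x) X"
    and I_finite: "(\<integral>\<^sup>+ x. ennreal (\<sigma> x powr (- \<alpha>) * \<bar>x\<bar> powr (\<alpha> - 1)) \<partial>lborel) < \<infinity>"
    and p_nonneg: "\<And>t x y. t > 0 \<Longrightarrow> x \<noteq> 0 \<Longrightarrow> y \<noteq> 0 \<Longrightarrow> 0 \<le> p t x y"
    and p_measurable: "\<And>t x. t > 0 \<Longrightarrow> x \<noteq> 0 \<Longrightarrow> p t x \<in> borel_measurable \<mu>0"
    and p_density: "\<And>t x A. t > 0 \<Longrightarrow> x \<noteq> 0 \<Longrightarrow> A \<in> sets borel_R0 \<Longrightarrow>
          killed_prob (P x) (time_changed \<sigma> \<alpha> X) t A = (\<integral>\<^sup>+ y\<in>A. ennreal (p t x y) \<partial>\<mu>0)"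
    and p_symmetric: "\<And>t x y. t > 0 \<Longrightarrow> x \<noteq> 0 \<Longrightarrow> y \<noteq> 0 \<Longrightarrow> p t x y = p t y x"
    and p_Chapman_Kolmogorov:
        "\<And>s t x y. s > 0 \<Longrightarrow> t > 0 \<Longrightarrow> x \<noteq> 0 \<Longrightarrow> y \<noteq> 0 \<Longrightarrow>
          ennreal (p (s + t) x y) = (\<integral>\<^sup>+ z. ennreal (p s x z * p t z y) \<partial>\<mu>0)"
    and psi_basis: "complete_orthonormal \<mu>0 \<psi>"
    and psi_eigen: "\<And>n t. t \<ge> 0 \<Longrightarrow>
          AE x in \<mu>0. (\<integral>y. \<psi> n y \<partial>killed_transition (P x) (time_changed \<sigma> \<alpha> X) t) = exp (- lam n * t) * \<psi> n x"
    and lam: "0 < lam 0" "lam 0 < lam 1" "mono lam"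
    and ground_state: "\<And>x. x \<noteq> 0 \<Longrightarrow> 0 < \<psi> 0 x" "continuous_on (- {0}) (\<psi> 0)"
begin

abbreviation "Y \<equiv> time_changed \<sigma> \<alpha> X"

lemma sets_borel_R0: "A \<in> sets borel_R0 \<longleftrightarrow> A \<in> sets borel \<and> A \<subseteq> - {0}"
  unfolding borel_R0_def by (subst sets_restrict_space_iff) (simp_all add: conj_commute)

lemma sets_mu0: "sets \<mu>0 = sets borel_R0"
  by (simp add: mu0 borel_R0_def sets_restrict_space speed_measure_def)

lemma space_borel_R0: "space borel_R0 = - {0}"
  by (simp add: borel_R0_def space_restrict_space)

lemma space_mu0: "space \<mu>0 = - {0}"
  using sets_eq_imp_space_eq[OF sets_mu0] by (simp add: space_borel_R0)

lemma speed_measurable [measurable]: "(\<lambda>y. \<sigma> y powr (- \<alpha>)) \<in> borel_measurable borel"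
  by (intro borel_measurable_continuous_onI speed_continuous[OF X alpha sigma])

lemma prob_mu0: "prob_space \<mu>0"
proof -
  interpret mu: prob_space "speed_measure \<sigma> \<alpha>" by (rule mu)
  have "AE x in speed_measure \<sigma> \<alpha>. x \<in> - {0}"
    unfolding speed_measure_def using AE_lborel_singleton[of 0] by (subst AE_density) auto
  moreover have "- {0} \<in> sets (speed_measure \<sigma> \<alpha>)" by (simp add: speed_measure_def)
  ultimately show ?thesis
    unfolding mu0 by (intro prob_space_restrict_space mu.emeasure_eq_1_AE)
qed

text \<open>\<open>measure_of\<close> depends only on the values on the sigma-algebra, and there
  they are those of a density; so integrals against \<open>killed_transition\<close> are kernel
  integrals.\<close>

lemma killed_transition_eq:
  assumes "t > 0" "x \<noteq> 0"
  shows "killed_transition (P x) Y t = density \<mu>0 (\<lambda>y. ennreal (p t x y))" (is "_ = ?R")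
proof -
  note [measurable] = p_measurable[OF assms]
  have sets_R: "sets ?R = sets borel_R0" by (simp add: sets_mu0)
  have "killed_prob (P x) Y t A = emeasure ?R A" if "A \<in> sets borel_R0" for A
    using that assms by (subst emeasure_density) (auto simp: p_density sets_mu0)
  then have "killed_transition (P x) Y t = measure_of (- {0}) (sets borel_R0) (emeasure ?R)"
    unfolding killed_transition_def using sets.space_closed[of borel_R0] sets.sigma_sets_eq[of borel_R0]
    by (intro measure_of_eq) (simp_all add: space_borel_R0)
  also have "\<dots> = measure_of (space ?R) (sets ?R) (emeasure ?R)"
    by (simp only: sets_R) (simp add: space_mu0)
  also have "\<dots> = ?R" by (rule measure_of_of_measure)
  finally show ?thesis .
qed

sublocale K: symmetric_kernel \<mu>0 p \<psi> lam
proof (intro symmetric_kernel.intro symmetric_kernel_axioms.intro)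
  show "prob_space \<mu>0" by (rule prob_mu0)
  show "complete_orthonormal \<mu>0 \<psi>" "mono lam" "0 < lam 0" by (fact psi_basis lam)+
  fix t :: real assume t: "0 < t"
  show "0 \<le> p t x y" if "x \<in> space \<mu>0" "y \<in> space \<mu>0" for x y
    using that t by (intro p_nonneg) (auto simp: space_mu0)
  show "p t x \<in> borel_measurable \<mu>0" if "x \<in> space \<mu>0" for x
    using that t by (intro p_measurable) (auto simp: space_mu0)
  show "p t x y = p t y x" if "x \<in> space \<mu>0" "y \<in> space \<mu>0" for x y
    using that t by (intro p_symmetric) (auto simp: space_mu0)
  show "ennreal (p (s + t) x y) = (\<integral>\<^sup>+ z. ennreal (p s x z * p t z y) \<partial>\<mu>0)"
    if "0 < s" "x \<in> space \<mu>0" "y \<in> space \<mu>0" for s x y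
    using that t by (intro p_Chapman_Kolmogorov) (auto simp: space_mu0)
  show "(\<integral>\<^sup>+ y. ennreal (p t x y) \<partial>\<mu>0) \<le> 1" if "x \<in> space \<mu>0" for x
  proof -
    have x: "x \<noteq> 0" using that by (simp add: space_mu0)
    have "(\<integral>\<^sup>+ y. ennreal (p t x y) \<partial>\<mu>0) = (\<integral>\<^sup>+ y\<in>- {0}. ennreal (p t x y) \<partial>\<mu>0)"
      by (intro nn_integral_cong) (simp add: space_mu0)
    also have "\<dots> = killed_prob (P x) Y t (- {0})"
      using t x by (subst p_density) (auto simp: sets_borel_R0)
    also have "\<dots> \<le> 1" by (rule killed_prob_le_1[OF X alpha sigma])
    finally show ?thesis .
  qed
  show "AE x in \<mu>0. (\<integral>y. p t x y * \<psi> n y \<partial>\<mu>0) = exp (- lam n * t) * \<psi> n x" for n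
    using psi_eigen[of t n, OF less_imp_le[OF t]] AE_space
  proof eventually_elim
    case (elim x)
    then have x: "x \<noteq> 0" by (simp add: space_mu0)
    have "(\<integral>y. \<psi> n y \<partial>killed_transition (P x) Y t) = (\<integral>y. p t x y *\<^sub>R \<psi> n y \<partial>\<mu>0)"
      unfolding killed_transition_eq[OF t x]
    proof (rule integral_density)
      show "\<psi> n \<in> borel_measurable \<mu>0" using psi_basis by (simp add: complete_orthonormal_def L2_fun_def)
      show "AE y in \<mu>0. 0 \<le> p t x y" using t x by (intro AE_I2 p_nonneg) (auto simp: space_mu0)
    qed (rule p_measurable[OF t x])
    then show ?case using elim(1) by simp
  qed
qed

lemma Pt_indicator:
  assumes t: "0 < t" and x: "x \<noteq> 0" and A: "A \<in> sets \<mu>0"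
  shows "killed_prob (P x) Y t A = ennreal (K.Pt t (indicator A) x)"
proof -
  have "killed_prob (P x) Y t A = (\<integral>\<^sup>+ y. ennreal (p t x y * indicator A y) \<partial>\<mu>0)"
    using assms by (subst p_density) (auto simp: sets_mu0 indicator_def intro!: nn_integral_cong)
  also have "\<dots> = ennreal (K.Pt t (indicator A) x)"
    unfolding K.Pt_def
  proof (rule nn_integral_eq_integral)
    show "AE y in \<mu>0. 0 \<le> p t x y * indicator A y"
      using t x by (intro AE_I2 mult_nonneg_nonneg p_nonneg) (auto simp: space_mu0)
    have "x \<in> space \<mu>0" using x by (simp add: space_mu0)
    then have "integrable \<mu>0 (p t x)" using t by (intro K.kernel_integral_le_1)
    then show "integrable \<mu>0 (\<lambda>y. p t x y * indicator A y)" using A by (rule integrable_real_mult_indicator[rotated])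
  qed
  finally show ?thesis .
qed

text \<open>Near \<open>x\<close> the continuous \<open>\<psi> 0\<close> exceeds any
  \<open>a < \<psi> 0 x\<close>, and for short times the killed process remains near
  \<open>x\<close> with probability close to 1. Hence \<open>Pt t (\<psi> 0) x\<close> is nearly at
  least \<open>a\<close>, while it equals \<open>exp (- lam 0 * t) * ground x\<close>; then
  \<open>t\<close> tends to 0. This carries strict positivity from \<open>\<psi> 0\<close> to the
  pointwise version.\<close>

lemma psi0_le_ground:
  assumes x: "x \<noteq> 0"
  shows "\<psi> 0 x \<le> K.ground x"
proof (rule field_le_epsilon)
  fix e :: real assume e: "0 < e"
  have xs: "x \<in> space \<mu>0" using x by (simp add: space_mu0)
  \<comment> \<open>Half of \<open>e\<close> keeps \<open>a\<close> strictly below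
    \<open>\<psi> 0 x\<close>; truncation at 0 makes \<open>a * indicator U\<close> a nonnegative
    minorant of \<open>\<psi> 0\<close> on the whole space.\<close>
  define a where "a = max 0 (\<psi> 0 x - e / 2)"
  have a: "0 \<le> a" "a < \<psi> 0 x" using e ground_state(1)[OF x] by (auto simp: a_def)
  define U where "U = {y \<in> - {0}. a < \<psi> 0 y}"
  have U: "open U" "x \<in> U"
  proof -
    have "open (\<psi> 0 -` {a<..} \<inter> - {0})"
      using continuous_on_open_vimage[OF open_Compl[OF closed_singleton], THEN iffD1, OF ground_state(2)]
      by (simp del: vimage_Int)
    moreover have "\<psi> 0 -` {a<..} \<inter> - {0} = U" by (auto simp: U_def)
    ultimately show "open U" by simp
    show "x \<in> U" using x a by (simp add: U_def)
  qed
  have U_sets: "U \<in> sets \<mu>0" using U(1) by (auto simp: sets_mu0 sets_borel_R0 U_def)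
  have UL: "(\<lambda>y. a * indicator U y) \<in> L2_fun \<mu>0"
    by (intro L2_fun_scale L2_fun_bounded[OF K.finite_measure_axioms, where B=1]) (use U_sets in \<open>auto simp: indicator_def\<close>)
  have "a * c \<le> K.ground x" if c: "0 \<le> c" "c < 1" for c
  proof -
    have "ennreal c < 1" using c by (simp add: ennreal_less_one_iff)
    then obtain d where d: "0 < d" "\<And>t. 0 \<le> t \<Longrightarrow> t < d \<Longrightarrow> ennreal c < killed_prob (P x) Y t U"
      using killed_prob_short_time[OF X alpha sigma U(1) U(2) x] by metis
    have bound: "a * c \<le> exp (- lam 0 * t) * K.ground x" if t: "0 < t" "t < d" for t
    proof -
      have "ennreal c < ennreal (K.Pt t (indicator U) x)"
        using d(2)[of t] t by (simp add: Pt_indicator[OF t(1) x U_sets])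
      then have "c \<le> K.Pt t (indicator U) x" using c by (simp add: ennreal_less_iff)
      then have "a * c \<le> a * K.Pt t (indicator U) x" using a(1) by (rule mult_left_mono)
      also have "\<dots> = K.Pt t (\<lambda>y. a * indicator U y) x" by (simp add: K.Pt_scale)
      also have "\<dots> \<le> K.Pt t (\<psi> 0) x"
        by (rule K.Pt_mono[OF t(1) xs UL K.psi_L2])
          (auto simp: indicator_def U_def space_mu0 less_imp_le[OF ground_state(1)])
      also have "\<dots> = exp (- lam 0 * t) * K.ground x" by (rule K.Pt_psi0[OF t(1) xs])
      finally show ?thesis .
    qed
    have "((\<lambda>t. exp (- lam 0 * t) * K.ground x) \<longlongrightarrow> exp (- lam 0 * 0) * K.ground x) (at_right 0)"
      by (intro tendsto_intros)
    moreover have "\<forall>\<^sub>F t in at_right 0. a * c \<le> exp (- lam 0 * t) * K.ground x"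
      unfolding eventually_at_right_field using d(1) bound by blast
    ultimately have "a * c \<le> exp (- lam 0 * 0) * K.ground x"
      by (intro tendsto_lowerbound) auto
    then show ?thesis by simp
  qed
  then have "c * a \<le> K.ground x" if "0 < c" "c < 1" for c
    using that by (subst mult.commute) auto
  then have "a \<le> K.ground x" by (rule field_le_mult_one_interval)
  then show "\<psi> 0 x \<le> K.ground x + e" using e by (simp add: a_def)
qed

lemma speed_ge_hat: "\<exists>\<gamma>>0. \<forall>y. 2 * \<gamma> * hat y \<le> \<sigma> y powr (- \<alpha>)"
proof -
  obtain m where m: "m \<in> {- 1..1::real}" "\<And>y. y \<in> {- 1..1} \<Longrightarrow> \<sigma> m powr (- \<alpha>) \<le> \<sigma> y powr (- \<alpha>)"
    using continuous_attains_inf[of "{- 1..1::real}" "\<lambda>y. \<sigma> y powr (- \<alpha>)"]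
      continuous_on_subset[OF speed_continuous[OF X alpha sigma] subset_UNIV] by auto
  define \<gamma> where "\<gamma> = \<sigma> m powr (- \<alpha>) / 2"
  have pos: "0 < \<sigma> m powr (- \<alpha>)" by (rule speed_pos[OF X alpha sigma])
  have "2 * \<gamma> * hat y \<le> \<sigma> y powr (- \<alpha>)" for y
  proof (cases "\<bar>y\<bar> \<le> 1")
    case True
    have "\<sigma> m powr (- \<alpha>) * hat y \<le> \<sigma> m powr (- \<alpha>) * 1" using pos by (intro mult_left_mono hat_le_1) simp
    also have "\<dots> \<le> \<sigma> y powr (- \<alpha>)" using m(2)[of y] True by (simp add: abs_le_iff)
    finally show ?thesis by (simp add: \<gamma>_def)
  next
    case False
    then have "hat y = 0" using hat_support by blast
    then show ?thesis by simp
  qed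
  moreover have "0 < \<gamma>" using pos by (simp add: \<gamma>_def)
  ultimately show ?thesis by blast
qed

text \<open>The weight of the speed density is 1 plus the integral \<open>I\<close>, hence finite,
  so the weight of its tail vanishes by dominated convergence. Neither the tail nor the constants
  involve the starting point, which gives one \<open>r\<close> for all \<open>x\<close>; the time
  \<open>s\<close> may vary with \<open>x\<close>.\<close>

lemma short_time_escape:
  assumes "0 < \<epsilon>"
  shows "\<exists>r>0. \<forall>x. \<exists>s. 0 < s \<and> s < 1 \<and> killed_prob (P x) Y s {y. r < \<bar>y\<bar>} \<le> ennreal \<epsilon>"
proof -
  define N where "N t = distr (P 0) borel (\<lambda>\<omega>. X t \<omega> - X 0 \<omega>)" for t
  have N: "stable_family \<alpha> N"
    unfolding N_def by (rule process_stable_family[OF X alpha])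
  interpret S: stable_family \<alpha> N by (rule N)
  obtain \<gamma> where \<gamma>: "0 < \<gamma>" "\<And>y. 2 * \<gamma> * hat y \<le> \<sigma> y powr (- \<alpha>)" using speed_ge_hat by blast
  let ?w = "\<lambda>y. ennreal (\<sigma> y powr (- \<alpha>))"
  let ?h = "\<lambda>y. ?w y * ennreal (1 + \<bar>y\<bar> powr (\<alpha> - 1))"
  interpret mu: prob_space "speed_measure \<sigma> \<alpha>" by (rule mu)
  have "S.weight ?w = (\<integral>\<^sup>+ y. ?w y + ennreal (\<sigma> y powr (- \<alpha>) * \<bar>y\<bar> powr (\<alpha> - 1)) \<partial>lborel)"
    unfolding S.weight_def by (intro nn_integral_cong) (simp add: distrib_left flip: ennreal_mult ennreal_plus)
  also have "\<dots> = (\<integral>\<^sup>+ y. ?w y \<partial>lborel) + (\<integral>\<^sup>+ y. ennreal (\<sigma> y powr (- \<alpha>) * \<bar>y\<bar> powr (\<alpha> - 1)) \<partial>lborel)"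
    by (rule nn_integral_add) measurable
  also have "(\<integral>\<^sup>+ y. ?w y \<partial>lborel) = 1"
    using mu.emeasure_space_1 by (simp add: speed_measure_def emeasure_density)
  finally have fin: "S.weight ?w < \<infinity>" using I_finite by (simp add: less_top[symmetric])
  define c where "c = ennreal (exp 1 * ((2 + S.pot_const / \<gamma>) / S.pot_const))"
  have "(\<lambda>n. S.weight (\<lambda>y. ?w y * indicator {y. real n < \<bar>y\<bar>} y)) \<longlonglongrightarrow> (\<integral>\<^sup>+ y. 0 \<partial>(lborel :: real measure))"
    unfolding S.weight_def
  proof (rule nn_integral_dominated_convergence[where w = ?h])
    show "(\<integral>\<^sup>+ y. ?h y \<partial>lborel) < \<infinity>" using fin by (simp add: S.weight_def)
    show "AE y in lborel. ?w y * indicator {y. real n < \<bar>y\<bar>} y * ennreal (1 + \<bar>y\<bar> powr (\<alpha> - 1)) \<le> ?h y" for n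
      by (intro AE_I2) (simp add: indicator_def)
    show "AE y in lborel. (\<lambda>n. ?w y * indicator {y. real n < \<bar>y\<bar>} y * ennreal (1 + \<bar>y\<bar> powr (\<alpha> - 1))) \<longlonglongrightarrow> 0"
    proof (intro AE_I2 tendsto_eventually)
      fix y :: real
      obtain m :: nat where "\<bar>y\<bar> \<le> real m" using real_arch_simple by blast
      then have "indicator {y. real n < \<bar>y\<bar>} y = (0::ennreal)" if "m \<le> n" for n
        using that by (simp add: indicator_def)
      then show "\<forall>\<^sub>F n in sequentially. ?w y * indicator {y. real n < \<bar>y\<bar>} y * ennreal (1 + \<bar>y\<bar> powr (\<alpha> - 1)) = 0"
        unfolding eventually_sequentially by (intro exI[of _ m]) simp
    qed
  qed measurable
  then have "(\<lambda>n. c * S.weight (\<lambda>y. ?w y * indicator {y. real n < \<bar>y\<bar>} y)) \<longlonglongrightarrow> c * 0"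
    by (intro ennreal_tendsto_cmult) (simp_all add: c_def)
  then have "\<forall>\<^sub>F n in sequentially. c * S.weight (\<lambda>y. ?w y * indicator {y. real n < \<bar>y\<bar>} y) < ennreal \<epsilon>"
    by (rule order_tendstoD) (use assms in simp)
  then obtain n where n: "c * S.weight (\<lambda>y. ?w y * indicator {y. real n < \<bar>y\<bar>} y) < ennreal \<epsilon>"
    using eventually_happens trivial_limit_sequentially by blast
  have "\<exists>s. 0 < s \<and> s < 1 \<and> killed_prob (P x) Y s {y. real n + 1 < \<bar>y\<bar>} \<le> ennreal \<epsilon>" for x
    by (rule killed_tail[OF X alpha sigma N \<gamma> fin n[unfolded c_def] order_refl])
  then show ?thesis by (intro exI[of _ "real n + 1"]) simp
qed

lemma tail:
  assumes bdd: "\<And>r. 0 < r \<Longrightarrow> \<exists>B. \<forall>x\<in>{- r..r} - {0}. p 2 x x \<le> B" and \<epsilon>: "0 < \<epsilon>"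
  shows "\<exists>K B. K \<in> sets \<mu>0 \<and> (\<forall>x\<in>K. p 2 x x \<le> B) \<and>
    (\<forall>x\<in>space \<mu>0. \<exists>s. 0 < s \<and> s < 1 \<and> K.Pt s (indicator (space \<mu>0 - K)) x \<le> \<epsilon>)"
proof -
  obtain r where r: "0 < r" and s: "\<And>x. \<exists>s. 0 < s \<and> s < 1 \<and> killed_prob (P x) Y s {y. r < \<bar>y\<bar>} \<le> ennreal \<epsilon>"
    using short_time_escape[OF \<epsilon>] by blast
  obtain B where B: "\<forall>x\<in>{- r..r} - {0}. p 2 x x \<le> B" using bdd[OF r] by blast
  have K: "{- r..r} - {0} \<in> sets \<mu>0" by (auto simp: sets_mu0 sets_borel_R0)
  have compl: "space \<mu>0 - ({- r..r} - {0}) = {y. r < \<bar>y\<bar>}" using r by (auto simp: space_mu0)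
  have "\<exists>s. 0 < s \<and> s < 1 \<and> K.Pt s (indicator (space \<mu>0 - ({- r..r} - {0}))) x \<le> \<epsilon>" if "x \<in> space \<mu>0" for x
  proof -
    obtain u where u: "0 < u" "u < 1" "killed_prob (P x) Y u {y. r < \<bar>y\<bar>} \<le> ennreal \<epsilon>" using s[of x] by blast
    have "x \<noteq> 0" using that by (simp add: space_mu0)
    moreover have "{y. r < \<bar>y\<bar>} \<in> sets \<mu>0" using sets.compl_sets[OF K] by (simp only: compl)
    ultimately have "ennreal (K.Pt u (indicator {y. r < \<bar>y\<bar>}) x) \<le> ennreal \<epsilon>"
      using u(1,3) by (simp add: Pt_indicator)
    then have "K.Pt u (indicator {y. r < \<bar>y\<bar>}) x \<le> \<epsilon>" using \<epsilon> by (simp add: ennreal_le_iff)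
    then show ?thesis unfolding compl using u by blast
  qed
  then show ?thesis using K B by blast
qed

abbreviation "Z \<equiv> \<integral>x. \<psi> 0 x \<partial>\<mu>0"

lemma psi0_pos: "x \<in> space \<mu>0 \<Longrightarrow> 0 < \<psi> 0 x"
  by (rule ground_state) (simp add: space_mu0)

lemma psi0_ground: "x \<in> space \<mu>0 \<Longrightarrow> \<psi> 0 x \<le> K.ground x"
  by (rule psi0_le_ground) (simp add: space_mu0)

lemma Z_pos: "0 < Z"
  by (rule K.psi0_integral_pos[OF psi0_pos])

lemma normalized_psi0:
  shows "prob_space (normalized_density \<mu>0 (\<psi> 0))"
    and "sets (normalized_density \<mu>0 (\<psi> 0)) = sets borel_R0"
    and "f \<in> borel_measurable \<mu>0 \<Longrightarrow>
      (\<integral>x. f x \<partial>normalized_density \<mu>0 (\<psi> 0)) = inner_L2 \<mu>0 f (\<psi> 0) / Z"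
proof -
  have m: "(\<lambda>x. \<psi> 0 x / Z) \<in> borel_measurable \<mu>0"
    by (intro borel_measurable_divide borel_measurable_const L2_fun_measurable[OF K.psi_L2])
  have nonneg: "AE x in \<mu>0. 0 \<le> \<psi> 0 x / Z"
    using Z_pos psi0_pos by (intro AE_I2 divide_nonneg_pos) (auto intro: less_imp_le)
  have "(\<integral>\<^sup>+ x. ennreal (\<psi> 0 x / Z) \<partial>\<mu>0) = ennreal (\<integral>x. \<psi> 0 x / Z \<partial>\<mu>0)"
    by (intro nn_integral_eq_integral nonneg integrable_divide_zero L2_fun_integrable[OF K.finite_measure_axioms K.psi_L2])
  also have "\<dots> = 1" using Z_pos by simp
  finally show "prob_space (normalized_density \<mu>0 (\<psi> 0))"
    using m by (intro prob_spaceI) (simp add: normalized_density_def emeasure_density cong: nn_integral_cong)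
  show "sets (normalized_density \<mu>0 (\<psi> 0)) = sets borel_R0"
    by (simp add: normalized_density_def sets_mu0)
  assume "f \<in> borel_measurable \<mu>0"
  then have "(\<integral>x. f x \<partial>normalized_density \<mu>0 (\<psi> 0)) = (\<integral>x. (\<psi> 0 x / Z) *\<^sub>R f x \<partial>\<mu>0)"
    unfolding normalized_density_def by (intro integral_density nonneg m)
  also have "\<dots> = (\<integral>x. f x * \<psi> 0 x / Z \<partial>\<mu>0)"
    by (intro Bochner_Integration.integral_cong) simp_all
  finally show "(\<integral>x. f x \<partial>normalized_density \<mu>0 (\<psi> 0)) = inner_L2 \<mu>0 f (\<psi> 0) / Z"
    by (simp add: inner_L2_def)
qed

lemma nn_integral_killed_prob:
  assumes t: "0 < t" and \<eta>: "prob_measure_R0 \<eta>" and A: "A \<in> sets borel_R0"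
  shows "(\<integral>\<^sup>+ x. killed_prob (P x) Y t A \<partial>\<eta>) = (\<integral>\<^sup>+ x. (\<integral>\<^sup>+ y\<in>A. ennreal (p t x y) \<partial>\<mu>0) \<partial>\<eta>)"
proof (rule nn_integral_cong)
  fix x assume "x \<in> space \<eta>"
  then have "x \<noteq> 0" using \<eta> sets_eq_imp_space_eq[of \<eta> borel_R0] by (auto simp: prob_measure_R0_def space_borel_R0)
  then show "killed_prob (P x) Y t A = (\<integral>\<^sup>+ y\<in>A. ennreal (p t x y) \<partial>\<mu>0)"
    by (rule p_density[OF t _ A])
qed

lemma prob_measure_R0_D:
  assumes "prob_measure_R0 \<eta>"
  shows "prob_space \<eta>" "sets \<eta> = sets \<mu>0" "space \<eta> = - {0}"
  using assms sets_eq_imp_space_eq[of \<eta> borel_R0] by (auto simp: prob_measure_R0_def sets_mu0 space_borel_R0)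

lemma cond_prob_survival_kernel:
  assumes t: "0 < t" and \<eta>: "prob_measure_R0 \<eta>" and A: "A \<in> sets borel_R0"
  shows "cond_prob_survival P Y \<eta> t A =
    (\<integral>\<^sup>+ x. (\<integral>\<^sup>+ y\<in>A. ennreal (p t x y) \<partial>\<mu>0) \<partial>\<eta>) / ennreal (\<integral>x. K.Pt t (\<lambda>_. 1) x \<partial>\<eta>)"
proof -
  note \<eta>' = prob_measure_R0_D[OF \<eta>]
  have 0: "- {0} \<in> sets borel_R0" by (simp add: sets_borel_R0)
  have Pt1: "K.Pt t (indicator (- {0})) x = K.Pt t (\<lambda>_. 1) x" for x
    unfolding K.Pt_def by (intro Bochner_Integration.integral_cong) (auto simp: space_mu0)
  have "(\<integral>\<^sup>+ x. killed_prob (P x) Y t UNIV \<partial>\<eta>) = ennreal (\<integral>x. K.Pt t (indicator (- {0})) x \<partial>\<eta>)"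
    using K.nn_integral_kernel_indicator[OF t \<eta>'(1,2), of "- {0}"] 0
    by (simp add: killed_prob_UNIV[OF t] nn_integral_killed_prob[OF t \<eta> 0] sets_mu0)
  then show ?thesis
    unfolding cond_prob_survival_def nn_integral_killed_prob[OF assms] Pt1 by simp
qed

theorem attraction:
  assumes bdd: "\<And>r. 0 < r \<Longrightarrow> \<exists>B. \<forall>x\<in>{- r..r} - {0}. p 2 x x \<le> B"
    and \<eta>: "prob_measure_R0 \<eta>" and A: "A \<in> sets borel_R0"
  shows "((\<lambda>t. cond_prob_survival P Y \<eta> t A) \<longlongrightarrow> emeasure (normalized_density \<mu>0 (\<psi> 0)) A) at_top"
proof -
  let ?\<nu> = "normalized_density \<mu>0 (\<psi> 0)"
  let ?D = "\<lambda>t. \<integral>x. K.Pt t (\<lambda>_. 1) x \<partial>\<eta>"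
  note \<eta>' = prob_measure_R0_D[OF \<eta>]
  have A': "A \<in> sets \<mu>0" using A by (simp add: sets_mu0)
  then have ind: "indicator A \<in> borel_measurable \<mu>0" "\<And>x. \<bar>indicator A x\<bar> \<le> (1::real)" by (auto simp: indicator_def)
  have limit: "((\<lambda>t. (\<integral>x. K.Pt t (indicator A) x \<partial>\<eta>) / ?D t) \<longlongrightarrow> inner_L2 \<mu>0 (indicator A) (\<psi> 0) / Z) at_top"
    "\<forall>\<^sub>F t in at_top. 0 < ?D t"
    by (rule K.conditional_limit[OF tail[OF bdd] psi0_pos psi0_ground lam(2) \<eta>'(1,2) ind]; assumption)+
  interpret \<nu>: prob_space ?\<nu> by (rule normalized_psi0(1))
  have "emeasure ?\<nu> A = ennreal (inner_L2 \<mu>0 (indicator A) (\<psi> 0) / Z)"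
    using A normalized_psi0(3)[OF ind(1)] normalized_psi0(2) by (simp add: \<nu>.emeasure_eq_measure)
  moreover have "((\<lambda>t. ennreal ((\<integral>x. K.Pt t (indicator A) x \<partial>\<eta>) / ?D t)) \<longlongrightarrow>
      ennreal (inner_L2 \<mu>0 (indicator A) (\<psi> 0) / Z)) at_top"
    by (intro tendsto_ennrealI limit(1))
  \<comment> \<open>\<open>cond_prob_survival\<close> is a quotient in \<open>ennreal\<close>; it
    agrees with the real quotient once the time and the survival probability are positive.\<close>
  moreover have "\<forall>\<^sub>F t in at_top. ennreal ((\<integral>x. K.Pt t (indicator A) x \<partial>\<eta>) / ?D t) = cond_prob_survival P Y \<eta> t A"
    using limit(2) eventually_gt_at_top[of 0]
  proof eventually_elim
    case (elim t)
    have "0 \<le> (\<integral>x. K.Pt t (indicator A) x \<partial>\<eta>)"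
      using elim(2) by (intro integral_nonneg_AE AE_I2 K.Pt_nonneg) (auto simp: \<eta>'(3) space_mu0)
    then show ?case
      using elim by (simp add: cond_prob_survival_kernel[OF elim(2) \<eta> A] divide_ennreal
        K.nn_integral_kernel_indicator[OF elim(2) \<eta>'(1,2) A'])
  qed
  ultimately show ?thesis by (auto elim: Lim_transform_eventually)
qed

lemma cond_law_survival_0:
  assumes \<eta>: "prob_measure_R0 \<eta>"
  shows "cond_law_survival P Y \<eta> 0 = \<eta>"
proof -
  note \<eta>' = prob_measure_R0_D[OF \<eta>]
  interpret \<eta>: prob_space \<eta> by (rule \<eta>'(1))
  have k: "(\<integral>\<^sup>+ x. killed_prob (P x) Y 0 A \<partial>\<eta>) = (\<integral>\<^sup>+ x. indicator A x \<partial>\<eta>)" for A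
    by (intro nn_integral_cong killed_prob_0[OF X alpha sigma]) (simp add: \<eta>'(3))
  have "cond_prob_survival P Y \<eta> 0 A = emeasure \<eta> A" if "A \<in> sets \<eta>" for A
    using that \<eta>.emeasure_space_1 by (simp add: cond_prob_survival_def k divide_ennreal_def)
  then have "cond_law_survival P Y \<eta> 0 = measure_of (- {0}) (sets borel_R0) (emeasure \<eta>)"
    unfolding cond_law_survival_def using sets.space_closed[of borel_R0] sets.sigma_sets_eq[of borel_R0]
    by (intro measure_of_eq) (simp_all add: space_borel_R0 \<eta>'(2) sets_mu0)
  also have "\<dots> = measure_of (space \<eta>) (sets \<eta>) (emeasure \<eta>)" by (simp add: \<eta>' sets_mu0)
  also have "\<dots> = \<eta>" by (rule measure_of_of_measure)
  finally show ?thesis .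
qed

lemma integral_cond_law_survival:
  assumes t: "0 < t" and \<eta>: "prob_measure_R0 \<eta>" and D: "0 < (\<integral>x. K.Pt t (\<lambda>_. 1) x \<partial>\<eta>)"
    and f: "f \<in> borel_measurable \<mu>0" "\<And>x. x \<in> space \<mu>0 \<Longrightarrow> \<bar>f x\<bar> \<le> 1"
  shows "(\<integral>x. f x \<partial>cond_law_survival P Y \<eta> t) = (\<integral>x. K.Pt t f x \<partial>\<eta>) / (\<integral>x. K.Pt t (\<lambda>_. 1) x \<partial>\<eta>)"
proof -
  note \<eta>' = prob_measure_R0_D[OF \<eta>]
  from K.exists_conditional_law[OF t \<eta>'(1,2) D] obtain L where L1: "sets L = sets \<mu>0"
    and L2: "\<forall>A\<in>sets \<mu>0. emeasure L A =
      (\<integral>\<^sup>+ x. (\<integral>\<^sup>+ y\<in>A. ennreal (p t x y) \<partial>\<mu>0) \<partial>\<eta>) / ennreal (\<integral>x. K.Pt t (\<lambda>_. 1) x \<partial>\<eta>)"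
    and L3: "\<forall>f\<in>borel_measurable \<mu>0. (\<forall>x\<in>space \<mu>0. \<bar>f x\<bar> \<le> 1) \<longrightarrow>
      (\<integral>x. f x \<partial>L) = (\<integral>x. K.Pt t f x \<partial>\<eta>) / (\<integral>x. K.Pt t (\<lambda>_. 1) x \<partial>\<eta>)"
    by (elim exE conjE)
  have "cond_prob_survival P Y \<eta> t A = emeasure L A" if "A \<in> sets borel_R0" for A

    using that L2[rule_format, of A] by (simp add: cond_prob_survival_kernel[OF t \<eta>] sets_mu0)
  then have "cond_law_survival P Y \<eta> t = measure_of (- {0}) (sets borel_R0) (emeasure L)"
    unfolding cond_law_survival_def using sets.space_closed[of borel_R0] sets.sigma_sets_eq[of borel_R0]
    by (intro measure_of_eq) (simp_all add: space_borel_R0)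
  also have "\<dots> = measure_of (space L) (sets L) (emeasure L)"
    using sets_eq_imp_space_eq[OF L1] by (simp add: L1 sets_mu0 space_mu0)
  also have "\<dots> = L" by (rule measure_of_of_measure)
  finally show ?thesis using L3[rule_format, OF f] by simp
qed

text \<open>Admissible test functions give differences of at most 2, so the real supremum is taken
  over a nonempty bounded set and is a least upper bound.\<close>

lemma tv_norm_diff_bounds:
  assumes \<eta>1: "prob_measure_R0 \<eta>1" and \<eta>2: "prob_measure_R0 \<eta>2"
  shows "0 \<le> tv_norm_diff \<eta>1 \<eta>2"
    and "f \<in> borel_measurable borel_R0 \<Longrightarrow> (\<And>x. x \<in> - {0} \<Longrightarrow> \<bar>f x\<bar> \<le> 1) \<Longrightarrow>
      \<bar>(\<integral>x. f x \<partial>\<eta>1) - (\<integral>x. f x \<partial>\<eta>2)\<bar> \<le> tv_norm_diff \<eta>1 \<eta>2"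
proof -
  interpret \<eta>1: prob_space \<eta>1 by (rule prob_measure_R0_D[OF \<eta>1])
  interpret \<eta>2: prob_space \<eta>2 by (rule prob_measure_R0_D[OF \<eta>2])
  let ?S = "{f \<in> borel_measurable borel_R0. \<forall>x\<in>- {0}. \<bar>f x\<bar> \<le> (1::real)}"
  have bound: "\<bar>(\<integral>x. f x \<partial>\<eta>)\<bar> \<le> 1" if "prob_measure_R0 \<eta>" "f \<in> ?S" for f \<eta>
  proof (rule prob_space.abs_expectation_le)
    note \<eta> = prob_measure_R0_D[OF that(1)]
    show "prob_space \<eta>" by (rule \<eta>(1))
    show "f \<in> borel_measurable \<eta>"
      using that(2) measurable_cong_sets[OF trans[OF \<eta>(2) sets_mu0] refl] by blast
    show "\<bar>f x\<bar> \<le> 1" if "x \<in> space \<eta>" for x using that \<open>f \<in> ?S\<close> \<eta>(3) by simp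
  qed
  have "bdd_above ((\<lambda>f. \<bar>(\<integral>x. f x \<partial>\<eta>1) - (\<integral>x. f x \<partial>\<eta>2)\<bar>) ` ?S)"
  proof (rule bdd_aboveI2)
    fix f assume f: "f \<in> ?S"
    show "\<bar>(\<integral>x. f x \<partial>\<eta>1) - (\<integral>x. f x \<partial>\<eta>2)\<bar> \<le> 2"
      using bound[OF \<eta>1 f] bound[OF \<eta>2 f] by linarith
  qed
  then have upper: "\<bar>(\<integral>x. f x \<partial>\<eta>1) - (\<integral>x. f x \<partial>\<eta>2)\<bar> \<le> tv_norm_diff \<eta>1 \<eta>2" if "f \<in> ?S" for f
    unfolding tv_norm_diff_def using that by (rule cSUP_upper[rotated])
  show "0 \<le> tv_norm_diff \<eta>1 \<eta>2" using upper[of "\<lambda>_. 0"] by simp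
  assume "f \<in> borel_measurable borel_R0" "\<And>x. x \<in> - {0} \<Longrightarrow> \<bar>f x\<bar> \<le> 1"
  then show "\<bar>(\<integral>x. f x \<partial>\<eta>1) - (\<integral>x. f x \<partial>\<eta>2)\<bar> \<le> tv_norm_diff \<eta>1 \<eta>2"
    by (intro upper) simp
qed

theorem attraction_rate:
  assumes B: "\<forall>x\<in>- {0}. p 2 x x \<le> B"
  shows "\<exists>C. \<forall>\<eta>. prob_measure_R0 \<eta> \<longrightarrow> (\<forall>t\<ge>0.
    tv_norm_diff (cond_law_survival P Y \<eta> t) (normalized_density \<mu>0 (\<psi> 0))
      \<le> C * exp (- (lam 1 - lam 0) * t) * tv_norm_diff \<eta> (normalized_density \<mu>0 (\<psi> 0)) / (\<integral>x. \<psi> 0 x \<partial>\<eta>))"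
proof -
  let ?\<nu> = "normalized_density \<mu>0 (\<psi> 0)"
  have \<nu>: "prob_measure_R0 ?\<nu>" using normalized_psi0(1,2) by (simp add: prob_measure_R0_def)
  have B': "p 2 x x \<le> B" if "x \<in> space \<mu>0" for x using that B by (simp add: space_mu0)
  have meas: "borel_measurable \<mu>0 = borel_measurable borel_R0"
    by (rule measurable_cong_sets[OF sets_mu0 refl])
  have "\<exists>L C. 0 \<le> C \<and> (\<forall>x\<in>space \<mu>0. \<psi> 0 x \<le> L) \<and> (\<forall>\<eta> T t f. prob_space \<eta> \<longrightarrow> sets \<eta> = sets \<mu>0 \<longrightarrow>
        (\<forall>g\<in>borel_measurable \<mu>0. (\<forall>x\<in>space \<mu>0. \<bar>g x\<bar> \<le> 1) \<longrightarrow>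
          \<bar>(\<integral>x. g x \<partial>\<eta>) - inner_L2 \<mu>0 g (\<psi> 0) / Z\<bar> \<le> T) \<longrightarrow>
        0 < t \<longrightarrow> f \<in> borel_measurable \<mu>0 \<longrightarrow> (\<forall>x\<in>space \<mu>0. \<bar>f x\<bar> \<le> 1) \<longrightarrow>
        0 < (\<integral>x. K.Pt t (\<lambda>_. 1) x \<partial>\<eta>) \<and>
        \<bar>(\<integral>x. K.Pt t f x \<partial>\<eta>) / (\<integral>x. K.Pt t (\<lambda>_. 1) x \<partial>\<eta>) - inner_L2 \<mu>0 f (\<psi> 0) / Z\<bar>
          \<le> C * exp (- (lam 1 - lam 0) * t) * T / (\<integral>x. \<psi> 0 x \<partial>\<eta>))"
    by (rule K.conditional_rate[OF B' psi0_pos psi0_ground lam(2)])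
  then obtain L C where C0: "0 \<le> C" and L: "\<forall>x\<in>space \<mu>0. \<psi> 0 x \<le> L"
    and rate: "\<forall>\<eta> T t f. prob_space \<eta> \<longrightarrow> sets \<eta> = sets \<mu>0 \<longrightarrow>
      (\<forall>g\<in>borel_measurable \<mu>0. (\<forall>x\<in>space \<mu>0. \<bar>g x\<bar> \<le> 1) \<longrightarrow>
        \<bar>(\<integral>x. g x \<partial>\<eta>) - inner_L2 \<mu>0 g (\<psi> 0) / Z\<bar> \<le> T) \<longrightarrow>
      0 < t \<longrightarrow> f \<in> borel_measurable \<mu>0 \<longrightarrow> (\<forall>x\<in>space \<mu>0. \<bar>f x\<bar> \<le> 1) \<longrightarrow>
      0 < (\<integral>x. K.Pt t (\<lambda>_. 1) x \<partial>\<eta>) \<and>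
      \<bar>(\<integral>x. K.Pt t f x \<partial>\<eta>) / (\<integral>x. K.Pt t (\<lambda>_. 1) x \<partial>\<eta>) - inner_L2 \<mu>0 f (\<psi> 0) / Z\<bar>
        \<le> C * exp (- (lam 1 - lam 0) * t) * T / (\<integral>x. \<psi> 0 x \<partial>\<eta>)"
    by (elim exE conjE)
  \<comment> \<open>Two constants are merged: \<open>C\<close> serves positive times, and at time 0,
    where the conditional law is \<open>\<eta>\<close> itself, the claim amounts to the integral of
    \<open>\<psi> 0\<close> under \<open>\<eta>\<close> being at most \<open>L\<close>.\<close>
  have "tv_norm_diff (cond_law_survival P Y \<eta> t) ?\<nu>
      \<le> max C L * exp (- (lam 1 - lam 0) * t) * tv_norm_diff \<eta> ?\<nu> / (\<integral>x. \<psi> 0 x \<partial>\<eta>)"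
    if \<eta>: "prob_measure_R0 \<eta>" and t: "0 \<le> t" for \<eta> t
  proof -
    note \<eta>' = prob_measure_R0_D[OF \<eta>]
    interpret \<eta>: prob_space \<eta> by (rule \<eta>'(1))
    let ?T = "tv_norm_diff \<eta> ?\<nu>"
    note T0 = tv_norm_diff_bounds(1)[OF \<eta> \<nu>]
    have psi_abs: "\<bar>\<psi> 0 x\<bar> \<le> L" if "x \<in> space \<eta>" for x
      using that L psi0_pos[of x] by (simp add: \<eta>'(3) space_mu0)
    have psi_meas: "\<psi> 0 \<in> borel_measurable \<eta>"
      using L2_fun_measurable[OF K.psi_L2[of 0]] measurable_cong_sets[OF \<eta>'(2) refl] by blast
    have "\<bar>\<eta>.expectation (\<psi> 0)\<bar> \<le> L" by (rule \<eta>.abs_expectation_le[OF psi_meas psi_abs])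
    then have psi_le: "\<eta>.expectation (\<psi> 0) \<le> L" by simp
    have "integrable \<eta> (\<psi> 0)"
      by (rule \<eta>.integrable_const_bound[OF _ psi_meas, where B=L]) (use psi_abs in auto)
    then have psi_int: "0 < \<eta>.expectation (\<psi> 0)"
      by (rule \<eta>.integral_pos) (simp add: \<eta>'(3) ground_state(1))
    show ?thesis
    proof (cases "t = 0")
      case True
      have "?T * \<eta>.expectation (\<psi> 0) \<le> ?T * max C L"
        using T0 psi_le by (intro mult_left_mono) auto
      then show ?thesis
        using True psi_int by (simp add: cond_law_survival_0[OF \<eta>] le_divide_eq mult.commute)
    next
      case False
      then have t: "0 < t" using that(2) by simp
      have T: "\<forall>g\<in>borel_measurable \<mu>0. (\<forall>x\<in>space \<mu>0. \<bar>g x\<bar> \<le> 1) \<longrightarrow>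
          \<bar>(\<integral>x. g x \<partial>\<eta>) - inner_L2 \<mu>0 g (\<psi> 0) / Z\<bar> \<le> ?T"
      proof (intro ballI impI)
        fix g :: "real \<Rightarrow> real" assume g: "g \<in> borel_measurable \<mu>0" "\<forall>x\<in>space \<mu>0. \<bar>g x\<bar> \<le> 1"
        have "\<bar>(\<integral>x. g x \<partial>\<eta>) - (\<integral>x. g x \<partial>?\<nu>)\<bar> \<le> ?T"
          using g by (intro tv_norm_diff_bounds(2)[OF \<eta> \<nu>]) (simp_all add: meas space_mu0)
        then show "\<bar>(\<integral>x. g x \<partial>\<eta>) - inner_L2 \<mu>0 g (\<psi> 0) / Z\<bar> \<le> ?T"
          by (simp only: normalized_psi0(3)[OF g(1)])
      qed
      have "tv_norm_diff (cond_law_survival P Y \<eta> t) ?\<nu>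
          \<le> C * exp (- (lam 1 - lam 0) * t) * ?T / \<eta>.expectation (\<psi> 0)"
        unfolding tv_norm_diff_def[of "cond_law_survival P Y \<eta> t"]
      proof (rule cSUP_least)
        have "(\<lambda>_. 0) \<in> {f \<in> borel_measurable borel_R0. \<forall>x\<in>- {0}. \<bar>f x\<bar> \<le> (1::real)}" by simp
        then show "{f \<in> borel_measurable borel_R0. \<forall>x\<in>- {0}. \<bar>f x\<bar> \<le> (1::real)} \<noteq> {}" by blast
        fix f :: "real \<Rightarrow> real" assume "f \<in> {f \<in> borel_measurable borel_R0. \<forall>x\<in>- {0}. \<bar>f x\<bar> \<le> 1}"
        then have f: "f \<in> borel_measurable \<mu>0" "\<forall>x\<in>space \<mu>0. \<bar>f x\<bar> \<le> 1" by (simp_all add: meas space_mu0)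
        note r = rate[rule_format, OF \<eta>'(1,2) T[rule_format] t f(1) f(2)[rule_format]]
        show "\<bar>(\<integral>x. f x \<partial>cond_law_survival P Y \<eta> t) - (\<integral>x. f x \<partial>?\<nu>)\<bar>
            \<le> C * exp (- (lam 1 - lam 0) * t) * ?T / \<eta>.expectation (\<psi> 0)"
          using r by (simp only: integral_cond_law_survival[OF t \<eta> conjunct1[OF r] f(1) f(2)[rule_format]]
            normalized_psi0(3)[OF f(1)])
      qed
      also have "\<dots> \<le> max C L * exp (- (lam 1 - lam 0) * t) * ?T / \<eta>.expectation (\<psi> 0)"
        using T0 psi_int by (intro divide_right_mono mult_right_mono) auto
      finally show ?thesis .
    qed
  qed
  then show ?thesis by blast
qed

end

theorem theorem1p3:
  fixes \<alpha> :: real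
    and \<sigma> :: "real \<Rightarrow> real"
    and P :: "real \<Rightarrow> 'w measure"
    and X Y :: "real \<Rightarrow> 'w \<Rightarrow> real"
    and \<mu> \<mu>0 \<nu> :: "real measure"
    and p :: "real \<Rightarrow> real \<Rightarrow> real \<Rightarrow> real"
    and \<psi> :: "nat \<Rightarrow> real \<Rightarrow> real"
    and lam :: "nat \<Rightarrow> real"
  assumes alpha: "1 < \<alpha>" "\<alpha> < 2"
    and sigma: "continuous_on UNIV \<sigma>" "\<And>x. 0 < \<sigma> x"
    and mu: "\<mu> = speed_measure \<sigma> \<alpha>" "prob_space \<mu>"
    and mu0: "\<mu>0 = restrict_space \<mu> (- {0})"
    and X: "\<And>x. symmetric_stable_process \<alpha> x (P x) X"
    and Y: "Y = time_changed \<sigma> \<alpha> X"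
    and I_finite: "(\<integral>\<^sup>+ x. ennreal (\<sigma> x powr (- \<alpha>) * \<bar>x\<bar> powr (\<alpha> - 1)) \<partial>lborel) < \<infinity>"
    and p_nonneg: "\<And>t x y. t > 0 \<Longrightarrow> x \<noteq> 0 \<Longrightarrow> y \<noteq> 0 \<Longrightarrow> 0 \<le> p t x y"
    and p_measurable: "\<And>t x. t > 0 \<Longrightarrow> x \<noteq> 0 \<Longrightarrow> p t x \<in> borel_measurable \<mu>0"
    and p_density: "\<And>t x A. t > 0 \<Longrightarrow> x \<noteq> 0 \<Longrightarrow> A \<in> sets borel_R0 \<Longrightarrow>
          killed_prob (P x) Y t A = (\<integral>\<^sup>+ y\<in>A. ennreal (p t x y) \<partial>\<mu>0)"
    and p_symmetric: "\<And>t x y. t > 0 \<Longrightarrow> x \<noteq> 0 \<Longrightarrow> y \<noteq> 0 \<Longrightarrow> p t x y = p t y x"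
    and p_Chapman_Kolmogorov:
        "\<And>s t x y. s > 0 \<Longrightarrow> t > 0 \<Longrightarrow> x \<noteq> 0 \<Longrightarrow> y \<noteq> 0 \<Longrightarrow>
          ennreal (p (s + t) x y) = (\<integral>\<^sup>+ z. ennreal (p s x z * p t z y) \<partial>\<mu>0)"
    and psi_basis: "complete_orthonormal \<mu>0 \<psi>"
    and psi_eigen: "\<And>n t. t \<ge> 0 \<Longrightarrow>
          AE x in \<mu>0. (\<integral>y. \<psi> n y \<partial>killed_transition (P x) Y t) = exp (- lam n * t) * \<psi> n x"
    and lam: "0 < lam 0" "lam 0 < lam 1" "mono lam" "filterlim lam at_top sequentially"
    and ground_state: "\<And>x. x \<noteq> 0 \<Longrightarrow> 0 < \<psi> 0 x" "continuous_on (- {0}) (\<psi> 0)"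
    and nu: "\<nu> = normalized_density \<mu>0 (\<psi> 0)"
  shows "((\<forall>r0>0. (SUP x\<in>{- r0..r0} - {0}. ennreal (p 2 x x)) < \<infinity>) \<longrightarrow>
            (\<forall>\<eta>. prob_measure_R0 \<eta> \<longrightarrow>
              (\<forall>A\<in>sets borel_R0.
                ((\<lambda>t. cond_prob_survival P Y \<eta> t A) \<longlongrightarrow> emeasure \<nu> A) at_top))) \<and>
         ((SUP x\<in>- {0}. ennreal (p 2 x x)) < \<infinity> \<longrightarrow>
            (\<exists>C. \<forall>\<eta>. prob_measure_R0 \<eta> \<longrightarrow>
              (\<forall>t\<ge>0.
                tv_norm_diff (cond_law_survival P Y \<eta> t) \<nu>
                  \<le> C * exp (- (lam 1 - lam 0) * t) * tv_norm_diff \<eta> \<nu> / (\<integral>x. \<psi> 0 x \<partial>\<eta>))))"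
proof -
  interpret S: killed_stable \<alpha> \<sigma> P X \<mu>0 p \<psi> lam
    by (rule killed_stable.intro; fact alpha sigma mu0[unfolded mu(1)] mu(2)[unfolded mu(1)] X I_finite p_nonneg
      p_measurable p_density[unfolded Y] p_symmetric p_Chapman_Kolmogorov psi_basis psi_eigen[unfolded Y] lam(1-3) ground_state)
  show ?thesis
    unfolding Y nu
  proof (intro conjI impI allI ballI)
    fix \<eta> A assume "\<forall>r0>0. (SUP x\<in>{- r0..r0} - {0}. ennreal (p 2 x x)) < \<infinity>" "prob_measure_R0 \<eta>" "A \<in> sets borel_R0"
    then show "((\<lambda>t. cond_prob_survival P S.Y \<eta> t A) \<longlongrightarrow> emeasure (normalized_density \<mu>0 (\<psi> 0)) A) at_top"
      by (intro S.attraction SUP_ennreal_bound) auto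
  next
    assume "(SUP x\<in>- {0}. ennreal (p 2 x x)) < \<infinity>"
    then obtain B where "\<forall>x\<in>- {0}. p 2 x x \<le> B" using SUP_ennreal_bound[of "\<lambda>x. p 2 x x"] by blast
    then show "\<exists>C. \<forall>\<eta>. prob_measure_R0 \<eta> \<longrightarrow> (\<forall>t\<ge>0.
        tv_norm_diff (cond_law_survival P S.Y \<eta> t) (normalized_density \<mu>0 (\<psi> 0))
          \<le> C * exp (- (lam 1 - lam 0) * t) * tv_norm_diff \<eta> (normalized_density \<mu>0 (\<psi> 0)) / (\<integral>x. \<psi> 0 x \<partial>\<eta>))"
      by (rule S.attraction_rate)
  qed
qed

end
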